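(* Let $F_1\subset F_2$ be closed subsets of $\mathbb{R}^d$ and let $P\in\mathbb{C}[\xi_1,\ldots,\xi_d]$ be a non-constant polynomial. Consider the following conditions. (i) $(F_1,F_2)$ is a $P$-Runge pair for smooth Whitney jets. (ii) $F_2$ does not contain a bounded connected component of $\mathbb{R}^d\setminus F_1$. Then (i) implies (ii). Additionally, if $P$ is elliptic, (ii) also implies (i).
   Context: Smooth Whitney jets. For a compact set $K\subset\mathbb{R}^d$, $\mathscr{E}(K)$ is the space of families $f=(f^{(\alpha)})_{\alpha\in\mathbb{N}_0^d}$ of continuous complex-valued functions on $K$ such that, with $T^n_xf(y)=\sum_{|\alpha|\le n}\frac{f^{(\alpha)}(x)}{\alpha!}(y-x)^\alpha$ and $$q_{K,n,t}(f)=\sup\Big\{\tfrac{|f^{(\alpha)}(y)-\partial^\alpha T^n_xf(y)|}{|x-y|^{n-|\alpha|}}: |\alpha|\le n,\ x,y\in K,\ 0<|x-y|<t\Big\},$$ one has $\lim_{t\to0}q_{K,n,t}(f)=0$ for all $n\in\mathbb{N}_0$. It is a Fréchet space with the seminorms $\|f\|_{n,K}=\sup\{|f^{(\alpha)}(x)|:x\in K,|\alpha|\le n\}+\sup_{t>0}q_{K,n,t}(f)$. For a closed set $F\subset\mathbb{R}^d$, $\mathscr{E}(F)$ is the projective limit of the spaces $\mathscr{E}(K_l)$ along a compact exhaustion $(K_l)_l$ of $F$, i.e. the space of families $(f^{(\alpha)})_\alpha$ of continuous functions on $F$ whose restriction to every compact $K\subset F$ lies in $\mathscr{E}(K)$,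 with the topology given by the seminorms $f\mapsto\|f|_K\|_{n,K}$. Operators. For $P(\xi)=\sum_{|\alpha|\le m}c_\alpha\xi^\alpha$ of degree $m$, $P(D)$ acts on $\mathscr{E}(F)$ by $P(D)f=\sum_{|\alpha|\le m}c_\alpha D_1^{\alpha_1}\cdots D_d^{\alpha_d}f$, where $D_jf=-i(f^{(\alpha+e_j)})_{\alpha}$. Put $\mathscr{E}_P(F)=\{f\in\mathscr{E}(F):P(D)f=0\}$. $P$-Runge pair. For closed $F_1\subset F_2$, $(F_1,F_2)$ is a $P$-Runge pair (for smooth Whitney jets) if the image of $\mathscr{E}_P(F_2)$ under the restriction map $f\mapsto(f^{(\alpha)}|_{F_1})_\alpha$ is dense in $\mathscr{E}_P(F_1)$ (with the topology of $\mathscr{E}(F_1)$). Ellipticity. $P$ of degree $m$ with principal part $P_m(\xi)=\sum_{|\alpha|=m}c_\alpha\xi^\alpha$ is elliptic if $P_m(\xi)\ne0$ for all $\xi\in\mathbb{R}^d\setminus\{0\}$. *)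

theory Defs
  imports "HOL-Analysis.Analysis" "HOL-Library.Poly_Mapping"
begin

section \<open>Multi-indices and polynomials\<close>

type_synonym 'd multi_index = "nat ^ 'd"

text \<open>A polynomial in the variables \<open>\<xi>\<^sub>j\<close>, \<open>j :: 'd\<close>, is its finitely supported coefficient family.\<close>

type_synonym 'd mpoly = "'d multi_index \<Rightarrow>\<^sub>0 complex"

definition mi_size :: "('d::finite) multi_index \<Rightarrow> nat" where
  "mi_size \<alpha> = (\<Sum>j\<in>UNIV. \<alpha> $ j)"

definition mi_fact :: "('d::finite) multi_index \<Rightarrow> real" where
  "mi_fact \<alpha> = (\<Prod>j\<in>UNIV. fact (\<alpha> $ j))"

definition mi_power :: "real ^ 'd \<Rightarrow> ('d::finite) multi_index \<Rightarrow> real" where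
  "mi_power v \<alpha> = (\<Prod>j\<in>UNIV. (v $ j) ^ (\<alpha> $ j))"

text \<open>Sums over the following sets occur below; they are not junk sums over infinite sets.\<close>

lemma finite_mi_size_le: "finite {\<alpha> :: ('d::finite) multi_index. mi_size \<alpha> \<le> n}"
proof -
  have "\<alpha> $ j \<le> mi_size \<alpha>" for \<alpha> :: "'d multi_index" and j
    unfolding mi_size_def by (rule member_le_sum) auto
  then have "\<alpha> \<in> vec_lambda ` (UNIV \<rightarrow>\<^sub>E {..n})" if "mi_size \<alpha> \<le> n" for \<alpha> :: "'d multi_index"
    using that by (intro image_eqI[where x = "vec_nth \<alpha>"]) (auto intro: order_trans)
  then have "{\<alpha> :: 'd multi_index. mi_size \<alpha> \<le> n} \<subseteq> vec_lambda ` (UNIV \<rightarrow>\<^sub>E {..n})"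
    by blast
  then show ?thesis
    by (rule finite_subset) (intro finite_imageI finite_PiE, auto)
qed

definition mpoly_degree :: "('d::finite) mpoly \<Rightarrow> nat" where
  "mpoly_degree P = Max (insert 0 (mi_size ` Poly_Mapping.keys P))"

definition principal_part :: "('d::finite) mpoly \<Rightarrow> real ^ 'd \<Rightarrow> complex" where
  "principal_part P \<xi> =
     (\<Sum>\<alpha> | \<alpha> \<in> Poly_Mapping.keys P \<and> mi_size \<alpha> = mpoly_degree P.
        Poly_Mapping.lookup P \<alpha> * of_real (mi_power \<xi> \<alpha>))"

definition elliptic :: "('d::finite) mpoly \<Rightarrow> bool" where
  "elliptic P \<longleftrightarrow> (\<forall>\<xi>. \<xi> \<noteq> 0 \<longrightarrow> principal_part P \<xi> \<noteq> 0)"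

text \<open>
  \<open>A\<^sub>1\<^bsup>\<alpha>\<^sub>1\<^esup> \<dots> A\<^sub>d\<^bsup>\<alpha>\<^sub>d\<^esup>\<close> for operators indexed by the coordinates. As \<open>'d\<close> carries no order,
  an enumeration of the coordinates is chosen. The choice does not matter in the two uses
  below, partial derivatives of polynomials and shifts of jets, since these commute.
\<close>

definition coord_list :: "('d::finite) list" where
  "coord_list = (SOME js. distinct js \<and> set js = UNIV)"

definition mi_iterate :: "('d \<Rightarrow> 'a \<Rightarrow> 'a) \<Rightarrow> ('d::finite) multi_index \<Rightarrow> 'a \<Rightarrow> 'a" where
  "mi_iterate A \<alpha> = foldr (\<lambda>j. (\<circ>) (A j ^^ (\<alpha> $ j))) coord_list id"

definition partial_deriv :: "'d \<Rightarrow> (real ^ 'd \<Rightarrow> complex) \<Rightarrow> real ^ ('d::finite) \<Rightarrow> complex" where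
  "partial_deriv j g y = vector_derivative (\<lambda>t::real. g (y + t *\<^sub>R axis j 1)) (at 0)"


section \<open>Smooth Whitney jets\<close>

text \<open>
  A family of functions on \<open>F\<close> is represented by total functions that vanish outside \<open>F\<close>,
  so that equality of jets on \<open>F\<close> is equality in HOL.
\<close>

type_synonym 'd jet = "'d multi_index \<Rightarrow> real ^ 'd \<Rightarrow> complex"

definition jet_restrict :: "(real ^ 'd) set \<Rightarrow> ('d::finite) jet \<Rightarrow> 'd jet" where
  "jet_restrict F f = (\<lambda>\<alpha> x. if x \<in> F then f \<alpha> x else 0)"

definition continuous_jets :: "(real ^ 'd) set \<Rightarrow> ('d::finite) jet set" where
  "continuous_jets F = {f. \<forall>\<alpha>. continuous_on F (f \<alpha>) \<and> (\<forall>x. x \<notin> F \<longrightarrow> f \<alpha> x = 0)}"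

definition taylor :: "nat \<Rightarrow> real ^ 'd \<Rightarrow> ('d::finite) jet \<Rightarrow> real ^ 'd \<Rightarrow> complex" where
  "taylor n x f y =
     (\<Sum>\<alpha> | mi_size \<alpha> \<le> n. f \<alpha> x / of_real (mi_fact \<alpha>) * of_real (mi_power (y - x) \<alpha>))"

text \<open>
  The suprema are taken in \<open>[0,\<infinity>]\<close>: they may be infinite for arbitrary families, and the
  supremum over the empty set is 0.
\<close>

definition whitney_q :: "(real ^ 'd) set \<Rightarrow> nat \<Rightarrow> real \<Rightarrow> ('d::finite) jet \<Rightarrow> ennreal" where
  "whitney_q K n t f =
     Sup {ennreal (cmod (f \<alpha> y - mi_iterate partial_deriv \<alpha> (taylor n x f) y)
                     / norm (x - y) ^ (n - mi_size \<alpha>)) | \<alpha> x y.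
            mi_size \<alpha> \<le> n \<and> x \<in> K \<and> y \<in> K \<and> 0 < norm (x - y) \<and> norm (x - y) < t}"

definition whitney_norm :: "(real ^ 'd) set \<Rightarrow> nat \<Rightarrow> ('d::finite) jet \<Rightarrow> ennreal" where
  "whitney_norm K n f =
     Sup {ennreal (cmod (f \<alpha> x)) | \<alpha> x. x \<in> K \<and> mi_size \<alpha> \<le> n} + (SUP t\<in>{0<..}. whitney_q K n t f)"

definition whitney_jets_compact :: "(real ^ 'd) set \<Rightarrow> ('d::finite) jet set" where
  "whitney_jets_compact K =
     {f \<in> continuous_jets K. \<forall>n. ((\<lambda>t. whitney_q K n t f) \<longlongrightarrow> 0) (at_right 0)}"

definition whitney_jets :: "(real ^ 'd) set \<Rightarrow> ('d::finite) jet set" where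
  "whitney_jets F =
     {f \<in> continuous_jets F. \<forall>K. compact K \<and> K \<subseteq> F \<longrightarrow> jet_restrict K f \<in> whitney_jets_compact K}"

definition whitney_topology :: "(real ^ 'd) set \<Rightarrow> ('d::finite) jet topology" where
  "whitney_topology F = topology_generated_by
     {{g \<in> whitney_jets F. whitney_norm K n (jet_restrict K (g - f)) < ennreal \<epsilon>} | K n f \<epsilon>.
        compact K \<and> K \<subseteq> F \<and> f \<in> whitney_jets F \<and> 0 < \<epsilon>}"


section \<open>Differential operators on jets and Runge pairs\<close>

definition jet_D :: "'d \<Rightarrow> ('d::finite) jet \<Rightarrow> 'd jet" where
  "jet_D j f = (\<lambda>\<alpha> x. - \<i> * f (\<alpha> + axis j 1) x)"

definition jet_op :: "('d::finite) mpoly \<Rightarrow> 'd jet \<Rightarrow> 'd jet" where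
  "jet_op P f = (\<lambda>\<beta> x. \<Sum>\<alpha>\<in>Poly_Mapping.keys P.
                   Poly_Mapping.lookup P \<alpha> * mi_iterate jet_D \<alpha> f \<beta> x)"

definition jet_kernel :: "('d::finite) mpoly \<Rightarrow> (real ^ 'd) set \<Rightarrow> 'd jet set" where
  "jet_kernel P F = {f \<in> whitney_jets F. jet_op P f = (\<lambda>\<alpha> x. 0)}"

definition runge_pair ::
  "('d::finite) mpoly \<Rightarrow> (real ^ 'd) set \<Rightarrow> (real ^ 'd) set \<Rightarrow> bool" where
  "runge_pair P F1 F2 \<longleftrightarrow>
     subtopology (whitney_topology F1) (jet_kernel P F1)
       closure_of (jet_restrict F1 ` jet_kernel P F2) = jet_kernel P F1"

end

theory Submission
  imports Defs "HOL-Probability.Probability" "HOL-Real_Asymp.Real_Asymp"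
    "HOL-Computational_Algebra.Fundamental_Theorem_Algebra"
begin

text \<open>
  Smooth functions are treated together with all their derivatives. Gluing the Taylor polynomials of
  a Whitney jet by a partition of unity on a grid of mesh \<open>\<delta>\<close> gives a smooth function that agrees with the
  jet up to high powers of \<open>\<delta>\<close>; this replaces Whitney's extension theorem, and no duality is used.

  Sufficiency. Let \<open>s\<close> be such a smoothing of \<open>f\<close> with \<open>P(D)f = 0\<close> on \<open>F\<^sub>1\<close>. Then \<open>P(D)s\<close> is small near
  \<open>F\<^sub>1\<close>. Subtracting a solution \<open>u\<close> of \<open>P(D)u = \<theta> P(D)s\<close>, with a cutoff \<open>\<theta>\<close>, removes it there, so
  that \<open>v = s - u\<close> is close to \<open>f\<close> and \<open>P(D)v\<close> vanishes near the part of \<open>F\<^sub>1\<close> under consideration. Cut \<open>v\<close>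
  into pieces with sources in small balls. Solutions of elliptic equations are real analytic with
  uniform radii, so translating a piece by its Taylor polynomials moves its ball a little and changes
  it arbitrarily little away from the ball. In finitely many steps the ball leaves \<open>F\<^sub>2\<close>, or runs to infinity.

  Necessity. Let \<open>C \<subseteq> F\<^sub>2\<close> be a bounded component of the complement of \<open>F\<^sub>1\<close>, \<open>P(\<zeta>) = 0\<close>, and \<open>\<phi>\<close> a test
  function in \<open>C\<close> whose Fourier transform does not vanish at \<open>\<zeta>\<close>. Solve \<open>P(D)u = \<phi>\<close> and let \<open>g\<close> be a solution on
  \<open>F\<^sub>2\<close> close to \<open>u\<close> on \<open>F\<^sub>1\<close>. The jet of \<open>w = g - u\<close> on the boundary of \<open>C\<close> has a small extension \<open>e\<close>, and
  cutting off \<open>w - e\<close> near the boundary gives a test function \<open>z\<close> with \<open>P(D)z\<close> close to \<open>- \<phi>\<close>.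
  As the transform of \<open>P(D)z\<close> vanishes at \<open>\<zeta>\<close>, so does that of \<open>\<phi>\<close>.
\<close>

section \<open>Multi-indices\<close>

text \<open>Two questions of order shape the estimates. In the necessity part the width of the
  cutoff can be chosen only after the solution \<open>g\<close>, because it depends on how fast the
  Taylor remainders of \<open>g\<close> decay at the boundary, whereas the final bound must not
  depend on that width. So the extension is estimated uniformly in its finest scale, at the price of
  one extra order (\<open>Suc m\<close> for \<open>m\<close>). In the sufficiency part only finitely
  many derivatives are controlled at a time: the smoothing has order \<open>m + k\<close>, with
  \<open>k\<close> so large that the powers of the mesh pay for everything lost afterwards, namely
  the derivatives of the cutoffs, the two derivatives per variable lost by the solution operator
  (they make Fourier transforms integrable), and the division by small distances in the Whitney
  seminorms.

  A ball of radius \<open>r\<close> can be moved by a fixed fraction of \<open>r\<close> while it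
  stays \<open>3 r\<close> away from the set where the solution is to be kept. The fraction does not
  depend on the solution, which is why a path is covered by finitely many moves.\<close>

lemma mi_size_0 [simp]: "mi_size 0 = 0"
  by (simp add: mi_size_def)

lemma mi_size_add: "mi_size (a + b) = mi_size a + mi_size b"
  by (simp add: mi_size_def sum.distrib)

text \<open>Unit multi-indices are written with \<open>Suc 0\<close> here and below because the
  simplifier rewrites \<open>1 :: nat\<close> to it.\<close>

lemma mi_size_axis [simp]: "mi_size (axis j (Suc 0)) = 1"
  by (simp add: mi_size_def axis_def)

lemma mi_size_add_axis [simp]: "mi_size (a + axis j (Suc 0)) = Suc (mi_size a)"
  by (simp add: mi_size_add)

lemma mi_component_le_size: "a $ j \<le> mi_size (a :: 'd::finite multi_index)"
  unfolding mi_size_def by (rule member_le_sum) auto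

lemma mi_size_eq_0_iff [simp]: "mi_size a = 0 \<longleftrightarrow> a = 0"
  by (simp add: mi_size_def vec_eq_iff)

lemma mi_split_axis:
  fixes a :: "'d::finite multi_index"
  assumes "mi_size a = Suc n"
  obtains b j where "a = b + axis j (Suc 0)" "mi_size b = n"
proof -
  have "a \<noteq> 0" using assms by auto
  then obtain j where j: "a $ j \<noteq> 0" by (auto simp: vec_eq_iff)
  define b :: "'d multi_index" where "b = (\<chi> i. a $ i - (axis j (Suc 0)) $ i)"
  have "a = b + axis j (Suc 0)"
    using j by (auto simp: vec_eq_iff b_def axis_def)
  with assms show ?thesis by (auto intro!: that)
qed

lemma multi_index_induct [case_names zero add]:
  fixes a :: "'d::finite multi_index"
  assumes "P 0" and "\<And>a j. P a ==> P (a + axis j (Suc 0))"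
  shows "P a"
proof (induction "mi_size a" arbitrary: a)
  case 0
  then show ?case using assms(1) by (metis mi_size_eq_0_iff)
next
  case (Suc n)
  then show ?case using assms(2) by (metis mi_split_axis)
qed

lemma coord_list: "distinct (coord_list :: 'd::finite list)" "set (coord_list :: 'd list) = UNIV"
proof -
  have "\<exists>js :: 'd list. distinct js \<and> set js = UNIV"
    using finite_distinct_list[of "UNIV :: 'd set"] by auto
  from someI_ex[OF this]
  show "distinct (coord_list :: 'd::finite list)" "set (coord_list :: 'd list) = UNIV"
    unfolding coord_list_def by auto
qed

lemma mi_iterate_0 [simp]:
  fixes A :: "'d::finite => 'a => 'a"
  shows "mi_iterate A 0 = id"
proof -
  have "foldr (\<lambda>j. (\<circ>) (A j ^^ ((0 :: 'd multi_index) $ j))) js id = id" for js :: "'d list"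
    by (induction js) auto
  then show ?thesis by (simp add: mi_iterate_def)
qed

text \<open>Commutation lets the additional factor \<open>A j\<close> be pulled to the front from
  whatever place the chosen enumeration gives to \<open>j\<close>.\<close>

lemma mi_iterate_add_axis:
  fixes A :: "'d::finite => 'a => 'a"
  assumes comm: "\<And>i j x. A i (A j x) = A j (A i x)"
  shows "mi_iterate A (a + axis j (Suc 0)) x = A j (mi_iterate A a x)"
proof -
  have pow: "(A i ^^ n) (A j x) = A j ((A i ^^ n) x)" for i j n x
    by (induction n) (simp_all add: comm[of _ j])
  define G where "G = (\<lambda>a js. foldr (\<lambda>i. (\<circ>) (A i ^^ (a $ i))) js id)"
  have G_Nil: "G a [] = id" for a :: "'d multi_index" by (simp add: G_def)
  have G_Cons: "G a (i # js) x = (A i ^^ (a $ i)) (G a js x)" for a :: "'d multi_index" and i js x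
    by (simp add: G_def)
  \<comment> \<open>Stated for an arbitrary list without repetitions so that induction applies: the
    extra factor appears once \<open>j\<close> has been met.\<close>
  have "G (a + axis j (Suc 0)) js x = (if j \<in> set js then A j (G a js x) else G a js x)"
    if "distinct js" for js
    using that
  proof (induction js)
    case Nil
    then show ?case by (simp add: G_Nil)
  next
    case (Cons i js)
    show ?case
    proof (cases "i = j")
      case True
      with Cons show ?thesis by (simp add: axis_def G_Cons)
    next
      case False
      with Cons show ?thesis by (auto simp add: axis_def pow G_Cons)
    qed
  qed
  from this[OF coord_list(1)] show ?thesis
    by (simp add: mi_iterate_def coord_list(2) G_def)
qed

text \<open>Partial derivatives do not commute on arbitrary functions. Along a family on which each
  operator acts as an index shift they do, and this is the form used for partial derivatives of
  smooth functions and for \<open>jet_D\<close>.\<close>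

lemma mi_iterate_family:
  fixes A :: "'d::finite => 'a => 'a" and f :: "'d multi_index => 'a"
  assumes step: "\<And>j b. A j (f b) = f (b + axis j (Suc 0))"
  shows "mi_iterate A a (f b) = f (b + a)"
proof -
  have pow: "(A j ^^ n) (f b) = f (b + (\<chi> i. if i = j then n else 0))" for j n b
  proof (induction n)
    case 0
    have "(\<chi> i. if i = j then 0 else 0) = (0 :: 'd multi_index)" by (simp add: vec_eq_iff)
    then show ?case by simp
  next
    case (Suc n)
    have "b + (\<chi> i. if i = j then n else 0) + axis j (Suc 0) = b + (\<chi> i. if i = j then Suc n else 0)"
      by (simp add: vec_eq_iff axis_def)
    with Suc step show ?case by simp
  qed
  have "foldr (\<lambda>j. (\<circ>) (A j ^^ (a $ j))) js id (f b) = f (b + (\<chi> i. if i \<in> set js then a $ i else 0))"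
    if "distinct js" for js
    using that
  proof (induction js)
    case Nil
    have "(\<chi> i. 0) = (0 :: 'd multi_index)" by (simp add: vec_eq_iff)
    then show ?case by simp
  next
    case (Cons j js)
    have "b + (\<chi> i. if i \<in> set js then a $ i else 0) + (\<chi> i. if i = j then a $ j else 0)
        = b + (\<chi> i. if i \<in> set (j # js) then a $ i else 0)"
      using Cons.prems by (auto simp: vec_eq_iff)
    with Cons show ?case by (simp add: pow)
  qed
  from this[OF coord_list(1)] show ?thesis
    by (simp add: mi_iterate_def coord_list(2))
qed


section \<open>Smooth functions as families of derivatives\<close>

text \<open>
  A smooth function is represented by the family of all its partial derivatives, so that
  Whitney jets and smooth functions live in the same type.
\<close>

definition smooth_on :: "(real ^ 'd) set => ('d::finite) jet => bool" where
  "smooth_on S f \<longleftrightarrow> (\<forall>a. \<forall>x\<in>S.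
     (f a has_derivative (\<lambda>h. \<Sum>j\<in>UNIV. (h $ j) *\<^sub>R f (a + axis j (Suc 0)) x)) (at x))"

lemma smooth_onD:
  "smooth_on S f ==> x \<in> S ==>
     (f a has_derivative (\<lambda>h. \<Sum>j\<in>UNIV. (h $ j) *\<^sub>R f (a + axis j (Suc 0)) x)) (at x)"
  by (simp add: smooth_on_def)

lemma smooth_on_subset: "smooth_on S f ==> T \<subseteq> S ==> smooth_on T f"
  by (auto simp: smooth_on_def)

lemma smooth_on_continuous_on: "smooth_on S f ==> continuous_on S (f a)"
  by (meson continuous_at_imp_continuous_on has_derivative_continuous smooth_onD)

lemma smooth_on_cong_open:
  assumes "smooth_on S f" "open S" "\<And>a x. x \<in> S ==> g a x = f a x"
  shows "smooth_on S g"
  unfolding smooth_on_def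
proof (intro allI ballI)
  fix a x assume x: "x \<in> S"
  have "(g a has_derivative (\<lambda>h. \<Sum>j\<in>UNIV. (h $ j) *\<^sub>R f (a + axis j (Suc 0)) x)) (at x)"
    by (rule has_derivative_transform_within_open[OF smooth_onD[OF assms(1) x] assms(2) x])
       (use assms(3) in auto)
  then show "(g a has_derivative (\<lambda>h. \<Sum>j\<in>UNIV. (h $ j) *\<^sub>R g (a + axis j (Suc 0)) x)) (at x)"
    using assms(3)[OF x] by simp
qed

lemma smooth_on_Un: "smooth_on S f ==> smooth_on T f ==> smooth_on (S \<union> T) f"
  by (auto simp: smooth_on_def)

lemma sum_axis_scaleR [simp]: "(\<Sum>i\<in>UNIV. (axis j (1::real) $ i) *\<^sub>R (F i :: complex)) = F j"
proof -
  have "(\<Sum>i\<in>UNIV. (axis j (1::real) $ i) *\<^sub>R (F i :: complex)) = (\<Sum>i\<in>UNIV. if i = j then F i else 0)"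
    by (rule sum.cong) (auto simp: axis_def)
  then show ?thesis by simp
qed

text \<open>The first-order entries are the values of the total derivative at unit vectors, hence
  determined by the entry itself on an open set. Identities between all derivatives thus follow from
  order 0; this serves for the partition of unity and for polynomials that vanish
  identically.\<close>

lemma smooth_on_unique:
  assumes f: "smooth_on S f" and g: "smooth_on S g" and "open S"
    and eq: "\<And>x. x \<in> S ==> f 0 x = g 0 x"
  shows "x \<in> S ==> f a x = g a x"
proof (induction a arbitrary: x rule: multi_index_induct)
  case zero
  then show ?case using eq by simp
next
  case (add a j)
  have "(g a has_derivative (\<lambda>h. \<Sum>j\<in>UNIV. (h $ j) *\<^sub>R f (a + axis j (Suc 0)) x)) (at x)"
    by (rule has_derivative_transform_within_open[OF smooth_onD[OF f add.prems] \<open>open S\<close> add.prems])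
       (use add.IH in auto)
  from has_derivative_unique[OF this smooth_onD[OF g add.prems]]
  have "(\<lambda>h. \<Sum>j\<in>UNIV. (h $ j) *\<^sub>R f (a + axis j (Suc 0)) x) (axis j 1) =
        (\<lambda>h. \<Sum>j\<in>UNIV. (h $ j) *\<^sub>R g (a + axis j (Suc 0)) x) (axis j 1)"
    by metis
  then show ?case by simp
qed

lemma partial_deriv_smooth:
  fixes f :: "'d::finite jet"
  assumes "smooth_on UNIV f"
  shows "partial_deriv j (f a) = f (a + axis j (Suc 0))"
proof
  fix y :: "real ^ 'd"
  have "((\<lambda>t::real. y + t *\<^sub>R axis j 1) has_derivative (\<lambda>t. t *\<^sub>R axis j 1)) (at 0)"
    by (auto intro!: derivative_eq_intros)
  moreover have "(f a has_derivative (\<lambda>h. \<Sum>j\<in>UNIV. (h $ j) *\<^sub>R f (a + axis j (Suc 0)) y))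
      (at ((\<lambda>t::real. y + t *\<^sub>R axis j 1) 0))"
    using smooth_onD[OF assms, of y a] by simp
  ultimately have "((\<lambda>t. f a (y + t *\<^sub>R axis j 1)) has_derivative
     (\<lambda>t. \<Sum>i\<in>UNIV. ((t *\<^sub>R axis j 1) $ i) *\<^sub>R f (a + axis i (Suc 0)) y)) (at 0)"
    by (rule diff_chain_at[unfolded o_def])
  moreover have "(\<Sum>i\<in>UNIV. ((t *\<^sub>R axis j 1) $ i) *\<^sub>R f (a + axis i (Suc 0)) y) =
     t *\<^sub>R f (a + axis j (Suc 0)) y" for t :: real
  proof -
    have "(\<Sum>i\<in>UNIV. ((t *\<^sub>R axis j 1) $ i) *\<^sub>R f (a + axis i (Suc 0)) y) =
       t *\<^sub>R (\<Sum>i\<in>UNIV. (axis j (1::real) $ i) *\<^sub>R f (a + axis i (Suc 0)) y)"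
      unfolding scaleR_sum_right by (rule sum.cong) auto
    then show ?thesis by simp
  qed
  ultimately have "((\<lambda>t. f a (y + t *\<^sub>R axis j 1)) has_vector_derivative
     f (a + axis j (Suc 0)) y) (at 0)"
    by (simp add: has_vector_derivative_def)
  then show "partial_deriv j (f a) y = f (a + axis j (Suc 0)) y"
    by (simp add: partial_deriv_def vector_derivative_at)
qed

lemma mi_iterate_partial_deriv_smooth:
  assumes "smooth_on UNIV f"
  shows "mi_iterate partial_deriv a (f 0) = f a"
  using mi_iterate_family[of partial_deriv f a 0] partial_deriv_smooth[OF assms] by simp


subsection \<open>Linear operations\<close>

lemma smooth_on_zero: "smooth_on S (\<lambda>a x. 0)"
  by (simp add: smooth_on_def)

lemma smooth_on_add:
  assumes "smooth_on S f" "smooth_on S g"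
  shows "smooth_on S (\<lambda>a x. f a x + g a x)"
  unfolding smooth_on_def
proof (intro allI ballI)
  fix a x assume x: "x \<in> S"
  show "((\<lambda>x. f a x + g a x) has_derivative
     (\<lambda>h. \<Sum>j\<in>UNIV. (h $ j) *\<^sub>R (f (a + axis j (Suc 0)) x + g (a + axis j (Suc 0)) x))) (at x)"
    using has_derivative_add[OF smooth_onD[OF assms(1) x] smooth_onD[OF assms(2) x], of a a]
    by (simp add: scaleR_add_right sum.distrib)
qed

lemma smooth_on_cmult:
  assumes "smooth_on S f"
  shows "smooth_on S (\<lambda>a x. c * f a x)"
  unfolding smooth_on_def
proof (intro allI ballI)
  fix a x assume x: "x \<in> S"
  show "((\<lambda>x. c * f a x) has_derivative
     (\<lambda>h. \<Sum>j\<in>UNIV. (h $ j) *\<^sub>R (c * f (a + axis j (Suc 0)) x))) (at x)"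
    using has_derivative_mult_right[OF smooth_onD[OF assms(1) x], of c a]
    by (simp add: sum_distrib_left)
qed

lemma smooth_on_sum:
  assumes "\<And>i. i \<in> I ==> smooth_on S (f i)"
  shows "smooth_on S (\<lambda>a x. \<Sum>i\<in>I. f i a x)"
  using assms
  by (induction I rule: infinite_finite_induct) (auto intro: smooth_on_zero smooth_on_add)

lemma smooth_on_diff:
  assumes "smooth_on S f" "smooth_on S g"
  shows "smooth_on S (\<lambda>a x. f a x - g a x)"
  using smooth_on_add[OF assms(1) smooth_on_cmult[OF assms(2), of "-1"]] by simp

lemma smooth_on_shift:
  assumes "smooth_on S f"
  shows "smooth_on S (\<lambda>a. f (a + b))"
  using assms by (auto simp: smooth_on_def add.assoc add.commute[of _ b]) (simp add: add.assoc[symmetric])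

lemma smooth_on_affine:
  assumes "smooth_on S f"
  shows "smooth_on {x. a + \<delta> *\<^sub>R x \<in> S} (\<lambda>i x. of_real (\<delta> ^ mi_size i) * f i (a + \<delta> *\<^sub>R x))"
  unfolding smooth_on_def
proof (intro allI ballI)
  fix i x assume x: "x \<in> {x. a + \<delta> *\<^sub>R x \<in> S}"
  have "((\<lambda>x. a + \<delta> *\<^sub>R x) has_derivative (\<lambda>h. \<delta> *\<^sub>R h)) (at x)"
    by (auto intro!: derivative_eq_intros)
  from diff_chain_at[OF this smooth_onD[OF assms, of _ i]] x
  have "((\<lambda>x. f i (a + \<delta> *\<^sub>R x)) has_derivative
    (\<lambda>h. \<Sum>j\<in>UNIV. ((\<delta> *\<^sub>R h) $ j) *\<^sub>R f (i + axis j (Suc 0)) (a + \<delta> *\<^sub>R x))) (at x)"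
    by (simp add: o_def)
  from has_derivative_mult_right[OF this, of "of_real (\<delta> ^ mi_size i)"]
  show "((\<lambda>x. of_real (\<delta> ^ mi_size i) * f i (a + \<delta> *\<^sub>R x)) has_derivative
     (\<lambda>h. \<Sum>j\<in>UNIV. h $ j *\<^sub>R (of_real (\<delta> ^ mi_size (i + axis j (Suc 0))) *
                 f (i + axis j (Suc 0)) (a + \<delta> *\<^sub>R x)))) (at x)"
    by (simp add: sum_distrib_left scaleR_conv_of_real[where 'a=complex] mult_ac)
qed

lemma smooth_on_translate:
  assumes "smooth_on UNIV f"
  shows "smooth_on UNIV (\<lambda>i x. f i (x + a))"
  using smooth_on_affine[OF assms, of a 1] by (simp add: add.commute)

definition jet_const :: "complex => ('d::finite) jet" where
  "jet_const c = (\<lambda>a x. if a = 0 then c else 0)"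

lemma add_axis_neq_0 [simp]: "a + axis j (Suc 0) \<noteq> (0 :: 'd::finite multi_index)"
proof
  assume "a + axis j (Suc 0) = 0"
  then have "mi_size (a + axis j (Suc 0)) = 0" by simp
  then show False unfolding mi_size_add_axis by simp
qed

lemma smooth_on_const: "smooth_on S (jet_const c)"
  by (auto simp: smooth_on_def jet_const_def)


subsection \<open>Products\<close>

definition prod_step :: "'d => ('d multi_index => 'd multi_index => complex) =>
    ('d::finite) multi_index => 'd multi_index => complex" where
  "prod_step j \<Phi> = (\<lambda>b \<gamma>. \<Phi> (b + axis j (Suc 0)) \<gamma> + \<Phi> b (\<gamma> + axis j (Suc 0)))"

text \<open>
  The Leibniz rule is encoded by letting the operators \<open>\<partial>\<^sub>j \<otimes> 1 + 1 \<otimes> \<partial>\<^sub>j\<close> act on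
  families indexed by pairs of multi-indices; this avoids multi-index binomial coefficients.
\<close>

definition jet_mult :: "('d::finite) jet => 'd jet => 'd jet" where
  "jet_mult f g = (\<lambda>a x. mi_iterate prod_step a (\<lambda>b \<gamma>. f b x * g \<gamma> x) 0 0)"

lemma prod_step_commute: "prod_step i (prod_step j \<Phi>) = prod_step j (prod_step i \<Phi>)"
  by (simp add: prod_step_def fun_eq_iff add_ac)

lemma prod_step_iterate:
  "mi_iterate prod_step (a + axis j (Suc 0)) \<Phi> = prod_step j (mi_iterate prod_step a \<Phi>)"
  by (rule mi_iterate_add_axis) (rule prod_step_commute)

lemma jet_mult_0 [simp]: "jet_mult f g 0 x = f 0 x * g 0 x"
  by (simp add: jet_mult_def)

lemma smooth_on_mult:
  assumes f: "smooth_on S f" and g: "smooth_on S g"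
  shows "smooth_on S (jet_mult f g)"
proof -
  \<comment> \<open>Generalised from the entry \<open>0 0\<close> to all pairs of indices, because
    \<open>prod_step\<close> shifts both of them.\<close>
  have "((\<lambda>x. mi_iterate prod_step a (\<lambda>b \<gamma>. f b x * g \<gamma> x) b \<gamma>) has_derivative
     (\<lambda>h. \<Sum>j\<in>UNIV. (h $ j) *\<^sub>R prod_step j (mi_iterate prod_step a (\<lambda>b \<gamma>. f b x * g \<gamma> x)) b \<gamma>)) (at x)"
    if x: "x \<in> S" for a b \<gamma> x
  proof (induction a arbitrary: b \<gamma> rule: multi_index_induct)
    case zero
    have "((\<lambda>x. f b x * g \<gamma> x) has_derivative
       (\<lambda>h. f b x * (\<Sum>j\<in>UNIV. (h $ j) *\<^sub>R g (\<gamma> + axis j (Suc 0)) x)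
          + (\<Sum>j\<in>UNIV. (h $ j) *\<^sub>R f (b + axis j (Suc 0)) x) * g \<gamma> x)) (at x)"
      by (rule has_derivative_mult[OF smooth_onD[OF f x] smooth_onD[OF g x]])
    then show ?case
      by (simp add: prod_step_def sum.distrib scaleR_add_right sum_distrib_left sum_distrib_right add.commute)
  next
    case (add a i)
    from has_derivative_add[OF add.IH[of "b + axis i (Suc 0)" \<gamma>] add.IH[of b "\<gamma> + axis i (Suc 0)"]]
    show ?case
      unfolding prod_step_iterate prod_step_commute[of _ i]
      unfolding prod_step_def[of i] by (simp add: sum.distrib scaleR_add_right)
  qed
  from this[of _ _ 0 0] show ?thesis
    by (simp add: smooth_on_def jet_mult_def prod_step_iterate)
qed

lemma mi_iterate_prod_step_eq_0:
  assumes "\<And>b \<gamma>. \<Phi> b \<gamma> = 0"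
  shows "mi_iterate prod_step a \<Phi> b \<gamma> = 0"
  by (induction a arbitrary: b \<gamma> rule: multi_index_induct) (auto simp: assms prod_step_iterate prod_step_def)

lemma jet_mult_zero_left: "(\<And>b. f b x = 0) ==> jet_mult f g a x = 0"
  and jet_mult_zero_right: "(\<And>b. g b x = 0) ==> jet_mult f g a x = 0"
  unfolding jet_mult_def by (rule mi_iterate_prod_step_eq_0; simp)+

lemma jet_mult_one_left:
  assumes "\<And>b. f b x = (if b = 0 then 1 else 0)"
  shows "jet_mult f g a x = g a x"
proof -
  have "mi_iterate prod_step a (\<lambda>b \<gamma>. f b x * g \<gamma> x) b \<gamma> = (if b = 0 then g (\<gamma> + a) x else 0)" for b \<gamma>
    by (induction a arbitrary: b \<gamma> rule: multi_index_induct)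
       (auto simp: assms prod_step_iterate prod_step_def add_ac)
  then show ?thesis by (simp add: jet_mult_def)
qed

lemma mi_iterate_prod_step_sum:
  "mi_iterate prod_step a (\<lambda>b \<gamma>. \<Sum>i\<in>I. \<Phi> i b \<gamma>) b \<gamma> = (\<Sum>i\<in>I. mi_iterate prod_step a (\<Phi> i) b \<gamma>)"
  by (induction a arbitrary: b \<gamma> rule: multi_index_induct) (auto simp: prod_step_iterate prod_step_def sum.distrib)

lemma jet_mult_sum_left: "jet_mult (\<lambda>b x. \<Sum>i\<in>I. f i b x) g a x = (\<Sum>i\<in>I. jet_mult (f i) g a x)"
  unfolding jet_mult_def sum_distrib_right by (rule mi_iterate_prod_step_sum)

lemma mi_iterate_prod_step_diff:
  "mi_iterate prod_step a (\<lambda>b \<gamma>. \<Phi> b \<gamma> - \<Psi> b \<gamma>) b \<gamma>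
    = mi_iterate prod_step a \<Phi> b \<gamma> - mi_iterate prod_step a \<Psi> b \<gamma>"
  by (induction a arbitrary: b \<gamma> rule: multi_index_induct) (auto simp: prod_step_iterate prod_step_def)

lemma jet_mult_diff_right: "jet_mult f (\<lambda>b x. g b x - h b x) a x = jet_mult f g a x - jet_mult f h a x"
  unfolding jet_mult_def right_diff_distrib by (rule mi_iterate_prod_step_diff)

text \<open>Weighting the order-\<open>k\<close> derivatives by \<open>\<delta>^k\<close> makes bounds at scale \<open>\<delta>\<close> multiplicative.\<close>

definition jet_bound :: "real => nat => (real ^ 'd) set => ('d::finite) jet => real => bool" where
  "jet_bound \<delta> M X f A \<longleftrightarrow> (\<forall>x\<in>X. \<forall>a. mi_size a \<le> M --> \<delta> ^ mi_size a * cmod (f a x) \<le> A)"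

lemma jet_boundD: "jet_bound \<delta> M X f A ==> x \<in> X ==> mi_size a \<le> M ==> \<delta> ^ mi_size a * cmod (f a x) \<le> A"
  by (simp add: jet_bound_def)

lemma jet_bound_mono:
  "jet_bound \<delta> M X f A ==> M' \<le> M ==> X' \<subseteq> X ==> A \<le> A' ==> jet_bound \<delta> M' X' f A'"
  unfolding jet_bound_def by (meson order_trans subsetD)

text \<open>Each \<open>prod_step\<close> replaces one term by two whose total weight is the same,
  so an entry of order at most \<open>M\<close> is a sum of at most \<open>2 ^ M\<close> products,
  each bounded by \<open>A * B\<close>.\<close>

lemma jet_bound_mult:
  fixes f g :: "'d::finite jet"
  assumes f: "jet_bound \<delta> M X f A" and g: "jet_bound \<delta> M X g B" and "\<delta> \<ge> 0" "A \<ge> 0"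
  shows "jet_bound \<delta> M X (jet_mult f g) (2 ^ M * (A * B))"
  unfolding jet_bound_def
proof (intro ballI allI impI)
  fix x and a :: "'d multi_index" assume x: "x \<in> X" and a: "mi_size a \<le> M"
  have B: "B \<ge> 0"
    using jet_boundD[OF g x, of 0] by simp (meson norm_ge_zero order_trans)
  define \<Phi> where "\<Phi> = (\<lambda>b \<gamma>. f b x * g \<gamma> x)"
  have "\<delta> ^ (mi_size a + mi_size b + mi_size \<gamma>) * cmod (mi_iterate prod_step a \<Phi> b \<gamma>) \<le> 2 ^ mi_size a * (A * B)"
    if "mi_size a + mi_size b + mi_size \<gamma> \<le> M" for b \<gamma>
    using that
  proof (induction a arbitrary: b \<gamma> rule: multi_index_induct)
    case zero
    have "(\<delta> ^ mi_size b * cmod (f b x)) * (\<delta> ^ mi_size \<gamma> * cmod (g \<gamma> x)) \<le> A * B"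
      using zero \<open>\<delta> \<ge> 0\<close> \<open>A \<ge> 0\<close> by (intro mult_mono jet_boundD[OF f x] jet_boundD[OF g x]) auto
    then show ?case by (simp add: \<Phi>_def norm_mult power_add mult_ac)
  next
    case (add a j)
    let ?M = "mi_iterate prod_step a \<Phi>"
    let ?n = "Suc (mi_size a) + mi_size b + mi_size \<gamma>"
    have "\<delta> ^ ?n * cmod (?M (b + axis j (Suc 0)) \<gamma> + ?M b (\<gamma> + axis j (Suc 0)))
      \<le> \<delta> ^ ?n * cmod (?M (b + axis j (Suc 0)) \<gamma>) + \<delta> ^ ?n * cmod (?M b (\<gamma> + axis j (Suc 0)))"
      unfolding distrib_left[symmetric] using \<open>\<delta> \<ge> 0\<close> by (intro mult_left_mono norm_triangle_ineq) auto
    also have "\<dots> \<le> 2 ^ mi_size a * (A * B) + 2 ^ mi_size a * (A * B)"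
      using add.IH[of "b + axis j (Suc 0)" \<gamma>] add.IH[of b "\<gamma> + axis j (Suc 0)"] add.prems
      by (intro add_mono) auto
    finally show ?case unfolding prod_step_iterate by (simp add: prod_step_def[of j] mult_ac)
  qed
  from this[of 0 0] a have "\<delta> ^ mi_size a * cmod (jet_mult f g a x) \<le> 2 ^ mi_size a * (A * B)"
    by (simp add: jet_mult_def \<Phi>_def)
  also have "\<dots> \<le> 2 ^ M * (A * B)"
    using a \<open>A \<ge> 0\<close> B by (intro mult_right_mono power_increasing) auto
  finally show "\<delta> ^ mi_size a * cmod (jet_mult f g a x) \<le> 2 ^ M * (A * B)" .
qed


subsection \<open>Constant coefficient operators\<close>

text \<open>The coefficients are a plain function that has absorbed the powers of
  \<open>- \<i>\<close> (\<open>op_coeff\<close>). The interior estimate has to hold uniformly over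
  rescaled operators, whose coefficients vary while the order stays fixed.\<close>

definition const_op :: "nat => ('d::finite multi_index => complex) => 'd jet => 'd jet" where
  "const_op m c f = (\<lambda>b x. \<Sum>a | mi_size a \<le> m. c a * f (b + a) x)"

definition op_coeff :: "('d::finite) mpoly => 'd multi_index => complex" where
  "op_coeff P a = (- \<i>) ^ mi_size a * Poly_Mapping.lookup P a"

lemma mi_iterate_jet_D: "mi_iterate jet_D a f b x = (- \<i>) ^ mi_size a * f (b + a) x"
proof -
  have "mi_iterate jet_D a ((\<lambda>\<gamma> b x. (- \<i>) ^ mi_size \<gamma> * f (b + \<gamma>) x) 0) =
      (\<lambda>\<gamma> b x. (- \<i>) ^ mi_size \<gamma> * f (b + \<gamma>) x) (0 + a)"
    by (rule mi_iterate_family) (simp add: jet_D_def fun_eq_iff add_ac)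
  then show ?thesis by (simp add: fun_eq_iff)
qed

lemma mi_size_le_degree: "a \<in> Poly_Mapping.keys P ==> mi_size a \<le> mpoly_degree P"
  unfolding mpoly_degree_def by (intro Max_ge) auto

lemma jet_op_eq_const_op: "jet_op P = const_op (mpoly_degree P) (op_coeff P)"
proof (intro ext)
  fix f b x
  show "jet_op P f b x = const_op (mpoly_degree P) (op_coeff P) f b x"
    unfolding jet_op_def const_op_def
    by (rule sum.mono_neutral_cong_left)
       (auto simp: finite_mi_size_le mi_size_le_degree mi_iterate_jet_D op_coeff_def in_keys_iff)
qed

lemma smooth_on_const_op: "smooth_on S f ==> smooth_on S (const_op m c f)"
  unfolding const_op_def by (intro smooth_on_sum smooth_on_cmult smooth_on_shift)

lemma const_op_add: "const_op m c (\<lambda>i x. f i x + g i x) b x = const_op m c f b x + const_op m c g b x"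
  and const_op_diff: "const_op m c (\<lambda>i x. f i x - g i x) b x = const_op m c f b x - const_op m c g b x"
  and const_op_cmult: "const_op m c (\<lambda>i x. a * f i x) b x = a * const_op m c f b x"
  by (simp_all add: const_op_def sum.distrib sum_subtractf algebra_simps sum_distrib_left)

lemma const_op_sum: "const_op m c (\<lambda>a x. \<Sum>i\<in>I. f i a x) b x = (\<Sum>i\<in>I. const_op m c (f i) b x)"
  unfolding const_op_def sum_distrib_left by (rule sum.swap)

lemma const_op_cong: "(\<And>a. f a x = g a x) ==> const_op m c f b x = const_op m c g b x"
  by (simp add: const_op_def)

lemma const_op_eq_0: "(\<And>a. f a x = 0) ==> const_op m c f b x = 0"
  by (simp add: const_op_def)

section \<open>Taylor expansion\<close>

lemma norm_sum_scaleR_le: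
  fixes h :: "real ^ 'd::finite"
  assumes "\<And>j. cmod (F j) \<le> B"
  shows "cmod (\<Sum>j\<in>UNIV. (h $ j) *\<^sub>R F j) \<le> real CARD('d) * B * norm h"
proof -
  have "cmod (\<Sum>j\<in>UNIV. (h $ j) *\<^sub>R F j) \<le> (\<Sum>j\<in>(UNIV :: 'd set). norm h * B)"
    using assms component_le_norm_cart[of h] by (intro sum_norm_le) (auto intro!: mult_mono)
  then show ?thesis by (simp add: mult_ac)
qed

text \<open>Downward induction on the order: an entry that vanishes at \<open>x\<close> is recovered
  along the segment from \<open>x\<close> by the mean value inequality, and each step gains a factor
  \<open>d * norm (y - x)\<close>. All Taylor estimates of the development are instances.\<close>

lemma taylor_vanish:
  fixes r :: "'d::finite jet"
  assumes r: "smooth_on S r" and "convex S" and x: "x \<in> S"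
    and zero: "\<And>b. mi_size b \<le> k ==> r b x = 0"
    and M: "\<And>b y. y \<in> S ==> mi_size b = Suc k ==> cmod (r b y) \<le> M"
  shows "y \<in> S ==> mi_size a \<le> Suc k ==>
    cmod (r a y) \<le> M * (real CARD('d) * norm (y - x)) ^ (Suc k - mi_size a)"
proof (induction "Suc k - mi_size a" arbitrary: a y)
  case 0
  then show ?case using M by (auto simp: le_antisym)
next
  case (Suc n)
  have M0: "M \<ge> 0"
  proof -
    have "\<exists>b :: 'd multi_index. mi_size b = l" for l
    proof (induction l)
      case (Suc l)
      then show ?case by (metis mi_size_add_axis)
    qed (auto intro: exI[of _ 0])
    then obtain b :: "'d multi_index" where "mi_size b = Suc k" by blast
    from M[OF x this] show ?thesis by (rule order_trans[OF norm_ge_zero])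
  qed
  have ak: "mi_size a \<le> k" and n: "k - mi_size a = n" "Suc k - mi_size a = Suc n"
    using Suc.hyps(2) by linarith+
  let ?d = "real CARD('d)"
  let ?B = "M * (?d * norm (y - x)) ^ n"
  have sub: "closed_segment x y \<subseteq> S"
    using \<open>convex S\<close> x Suc.prems(1) by (simp add: closed_segment_subset)
  have der: "(r a has_derivative (\<lambda>h. \<Sum>j\<in>UNIV. (h $ j) *\<^sub>R r (a + axis j (Suc 0)) z)) (at z within closed_segment x y)"
    if z: "z \<in> closed_segment x y" for z
    by (rule has_derivative_at_withinI) (rule smooth_onD[OF r subsetD[OF sub z]])
  have ons: "onorm (\<lambda>h. \<Sum>j\<in>UNIV. (h $ j) *\<^sub>R r (a + axis j (Suc 0)) z) \<le> ?d * ?B"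
    if z: "z \<in> closed_segment x y" for z
  proof -
    have "cmod (r (a + axis j (Suc 0)) z) \<le> ?B" for j
    proof -
      have n': "n = Suc k - mi_size (a + axis j (Suc 0))" using n(1) by simp
      have "cmod (r (a + axis j (Suc 0)) z) \<le> M * (?d * norm (z - x)) ^ n"
        unfolding n' using ak by (intro Suc.hyps(1)[OF n'] subsetD[OF sub z]) simp
      also have "M * (?d * norm (z - x)) ^ n \<le> ?B"
        using segment_bound(1)[OF z] M0 by (intro mult_left_mono power_mono) auto
      finally show ?thesis .
    qed
    then show ?thesis
      by (intro onorm_le norm_sum_scaleR_le[where F = "\<lambda>j. r (a + axis j (Suc 0)) z"]) blast
  qed
  have "norm (r a y - r a x) \<le> (?d * ?B) * norm (y - x)"
    by (rule differentiable_bound[OF convex_closed_segment der ons]) auto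
  also have "r a x = 0" by (rule zero[OF ak])
  finally show ?case by (simp add: n(2) mult_ac)
qed


subsection \<open>Tensor products of functions of one variable\<close>

definition smooth1 :: "(nat => real => real) => bool" where
  "smooth1 p \<longleftrightarrow> (\<forall>k t. (p k has_real_derivative p (Suc k) t) (at t))"

definition jet_tensor :: "('d => nat => real => real) => ('d::finite) jet" where
  "jet_tensor p = (\<lambda>a x. of_real (\<Prod>j\<in>UNIV. p j (a $ j) (x $ j)))"

lemma smooth_on_tensor:
  fixes p :: "'d::finite => nat => real => real"
  assumes "\<And>j. smooth1 (p j)"
  shows "smooth_on S (jet_tensor p)"
  unfolding smooth_on_def
proof (intro allI ballI)
  fix a and x :: "real ^ 'd" assume "x \<in> S"
  have "((\<lambda>x. p j (a $ j) (x $ j)) has_derivative (\<lambda>h. p j (Suc (a $ j)) (x $ j) * (h $ j))) (at x)" for j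
  proof -
    have "(p j (a $ j) has_derivative (*) (p j (Suc (a $ j)) (x $ j))) (at (x $ j))"
      using assms[of j] by (auto simp: smooth1_def has_field_derivative_def)
    from diff_chain_at[OF bounded_linear_imp_has_derivative[OF bounded_linear_vec_nth] this]
    show ?thesis by (simp add: o_def)
  qed
  then have "((\<lambda>x. \<Prod>j\<in>UNIV. p j (a $ j) (x $ j)) has_derivative
     (\<lambda>h. \<Sum>i\<in>UNIV. (p i (Suc (a $ i)) (x $ i) * (h $ i)) * (\<Prod>j\<in>UNIV - {i}. p j (a $ j) (x $ j)))) (at x)"
    by (intro has_derivative_prod) auto
  from has_derivative_of_real[OF this]
  have "(jet_tensor p a has_derivative (\<lambda>h. of_real (\<Sum>i\<in>UNIV. (p i (Suc (a $ i)) (x $ i) * (h $ i))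
     * (\<Prod>j\<in>UNIV - {i}. p j (a $ j) (x $ j))))) (at x)"
    unfolding jet_tensor_def by (simp del: of_real_prod of_real_sum of_real_mult)
  moreover have "of_real (\<Sum>i\<in>UNIV. (p i (Suc (a $ i)) (x $ i) * (h $ i)) * (\<Prod>j\<in>UNIV - {i}. p j (a $ j) (x $ j)))
     = (\<Sum>i\<in>UNIV. (h $ i) *\<^sub>R jet_tensor p (a + axis i (Suc 0)) x)" for h :: "real ^ 'd"
  proof -
    have "(\<Prod>j\<in>UNIV. p j ((a + axis i (Suc 0)) $ j) (x $ j))
       = p i (Suc (a $ i)) (x $ i) * (\<Prod>j\<in>UNIV - {i}. p j (a $ j) (x $ j))" for i
    proof -
      have "(\<Prod>j\<in>UNIV. p j ((a + axis i (Suc 0)) $ j) (x $ j)) =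
        p i ((a + axis i (Suc 0)) $ i) (x $ i) * (\<Prod>j\<in>UNIV - {i}. p j ((a + axis i (Suc 0)) $ j) (x $ j))"
        by (rule prod.remove) auto
      also have "(\<Prod>j\<in>UNIV - {i}. p j ((a + axis i (Suc 0)) $ j) (x $ j)) = (\<Prod>j\<in>UNIV - {i}. p j (a $ j) (x $ j))"
        by (rule prod.cong) (auto simp: axis_def)
      finally show ?thesis by (simp add: axis_def)
    qed
    then show ?thesis unfolding of_real_sum jet_tensor_def
      by (intro sum.cong refl) (simp add: scaleR_conv_of_real mult_ac)
  qed
  ultimately show "(jet_tensor p a has_derivative (\<lambda>h. \<Sum>j\<in>UNIV. h $ j *\<^sub>R jet_tensor p (a + axis j (Suc 0)) x)) (at x)"
    by simp
qed

definition power_family :: "nat => nat => real => real" where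
  "power_family n k t = (if k \<le> n then t ^ (n - k) / fact (n - k) else 0)"

lemma smooth1_power_family: "smooth1 (power_family n)"
  unfolding smooth1_def
proof (intro allI)
  fix k and t :: real
  show "(power_family n k has_real_derivative power_family n (Suc k) t) (at t)"
  proof (cases "k < n")
    case True
    then obtain l where l: "n - k = Suc l" by (metis Suc_diff_Suc)
    then have l': "n - Suc k = l" by simp
    have "((\<lambda>t. t ^ Suc l / fact (Suc l)) has_real_derivative (real (Suc l) * t ^ l / fact (Suc l))) (at t)"
      using DERIV_cdivide[OF DERIV_pow[of "Suc l" t], of "fact (Suc l)"]
      by (simp del: fact_Suc of_nat_Suc power_Suc)
    moreover have "real (Suc l) * t ^ l / fact (Suc l) = t ^ l / fact l"
      unfolding fact_Suc by (simp del: of_nat_Suc)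
    ultimately show ?thesis using True
      unfolding power_family_def[abs_def] l l' by simp
  next
    case False
    then show ?thesis
      by (cases "k = n") (auto simp: power_family_def[abs_def])
  qed
qed

text \<open>The monomial \<open>x ^ \<gamma> / \<gamma>!\<close> with all its derivatives; the
  factorial makes its jet at 0 the unit jet with entry 1 at \<open>\<gamma>\<close>, so Taylor
  polynomials need no further factorials.\<close>

definition mono_jet :: "('d::finite) multi_index => 'd jet" where
  "mono_jet \<gamma> = jet_tensor (\<lambda>j. power_family (\<gamma> $ j))"

lemma smooth_on_mono_jet: "smooth_on S (mono_jet \<gamma>)"
  unfolding mono_jet_def by (intro smooth_on_tensor smooth1_power_family)

lemma mono_jet_at_0: "mono_jet \<gamma> a 0 = (if a = \<gamma> then 1 else 0)"
proof (cases "a = \<gamma>")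
  case True
  then show ?thesis by (simp add: mono_jet_def jet_tensor_def power_family_def)
next
  case False
  then obtain j where j: "a $ j \<noteq> \<gamma> $ j" by (auto simp: vec_eq_iff)
  then have "power_family (\<gamma> $ j) (a $ j) 0 = 0" by (auto simp: power_family_def)
  then have "(\<Prod>j\<in>UNIV. power_family (\<gamma> $ j) (a $ j) 0) = 0"
    by (intro prod_zero) auto
  with False show ?thesis unfolding mono_jet_def jet_tensor_def by simp
qed

lemma mono_jet_eq_0:
  assumes "mi_size \<gamma> < mi_size a"
  shows "mono_jet \<gamma> a v = 0"
proof -
  have "\<exists>j. \<not> a $ j \<le> \<gamma> $ j"
    using assms by (metis mi_size_def not_le sum_mono)
  then obtain j where "\<not> a $ j \<le> \<gamma> $ j" by blast
  then have "power_family (\<gamma> $ j) (a $ j) (v $ j) = 0" by (auto simp: power_family_def)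
  then have "(\<Prod>j\<in>UNIV. power_family (\<gamma> $ j) (a $ j) (v $ j)) = 0"
    by (intro prod_zero) auto
  then show ?thesis unfolding mono_jet_def jet_tensor_def by simp
qed

lemma mono_jet_bound:
  fixes a \<gamma> :: "'d::finite multi_index"
  assumes "\<delta> > 0" "c \<ge> 1" "norm v \<le> c * \<delta>"
  shows "\<delta> ^ mi_size a * cmod (mono_jet \<gamma> a v) \<le> (c * \<delta>) ^ mi_size \<gamma>"
proof -
  have *: "\<delta> ^ (a $ j) * \<bar>power_family (\<gamma> $ j) (a $ j) (v $ j)\<bar> \<le> (c * \<delta>) ^ (\<gamma> $ j)" for j
  proof (cases "a $ j \<le> \<gamma> $ j")
    case True
    define k where "k = \<gamma> $ j - a $ j"
    have vj: "\<bar>v $ j\<bar> \<le> c * \<delta>" using component_le_norm_cart[of v j] assms by linarith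
    have "\<bar>(v $ j) ^ k / fact k\<bar> \<le> \<bar>v $ j\<bar> ^ k"
      using mult_left_mono[OF fact_ge_1[of k, where 'a = real], of "\<bar>v $ j\<bar> ^ k"]
      by (simp add: power_abs divide_le_eq)
    also have "\<dots> \<le> (c * \<delta>) ^ k" using vj by (intro power_mono) auto
    finally have "\<delta> ^ (a $ j) * \<bar>(v $ j) ^ k / fact k\<bar> \<le> (c * \<delta>) ^ (a $ j) * (c * \<delta>) ^ k"
      using assms by (intro mult_mono power_mono) auto
    also have "\<dots> = (c * \<delta>) ^ (\<gamma> $ j)"
      using True by (simp add: k_def power_add[symmetric])
    finally show ?thesis using True by (simp add: power_family_def k_def)
  next
    case False
    with assms show ?thesis by (simp add: power_family_def)
  qed
  have "\<delta> ^ mi_size a * cmod (mono_jet \<gamma> a v)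
      = (\<Prod>j\<in>UNIV. \<delta> ^ (a $ j) * \<bar>power_family (\<gamma> $ j) (a $ j) (v $ j)\<bar>)"
    by (simp add: mono_jet_def jet_tensor_def mi_size_def power_sum prod.distrib abs_prod del: of_real_prod)
  also have "\<dots> \<le> (\<Prod>j\<in>UNIV. (c * \<delta>) ^ (\<gamma> $ j))"
    using * assms by (intro prod_mono) auto
  finally show ?thesis by (simp add: mi_size_def power_sum)
qed

definition taylor_jet :: "nat => real ^ 'd => ('d::finite) jet => 'd jet" where
  "taylor_jet n x f = (\<lambda>a y. \<Sum>\<gamma> | mi_size \<gamma> \<le> n. f \<gamma> x * mono_jet \<gamma> a (y - x))"

lemma smooth_on_taylor_jet: "smooth_on UNIV (taylor_jet n x f)"
  unfolding taylor_jet_def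
  using smooth_on_translate[OF smooth_on_mono_jet, where a = "- x"]
  by (intro smooth_on_sum smooth_on_cmult) simp

lemma taylor_jet_0: "taylor_jet n x f 0 = taylor n x f"
proof
  fix y
  have "mono_jet \<gamma> 0 v = of_real (mi_power v \<gamma> / mi_fact \<gamma>)" for \<gamma> :: "'a multi_index" and v
    by (simp add: mono_jet_def jet_tensor_def power_family_def mi_power_def mi_fact_def prod_dividef del: of_real_prod)
  then show "taylor_jet n x f 0 y = taylor n x f y"
    unfolding taylor_jet_def taylor_def by (intro sum.cong) auto
qed

text \<open>This removes iterated partial derivatives from the Whitney seminorms: everything later
  works with the explicit finite sums in \<open>taylor_jet\<close>.\<close>

lemma mi_iterate_partial_deriv_taylor: "mi_iterate partial_deriv a (taylor n x f) = taylor_jet n x f a"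
  using mi_iterate_partial_deriv_smooth[OF smooth_on_taylor_jet] by (simp add: taylor_jet_0[symmetric])

lemma taylor_jet_at: "taylor_jet n x f a x = (if mi_size a \<le> n then f a x else 0)"
proof -
  have "taylor_jet n x f a x = (\<Sum>\<gamma> | mi_size \<gamma> \<le> n. if \<gamma> = a then f \<gamma> x else 0)"
    unfolding taylor_jet_def by (intro sum.cong) (auto simp: mono_jet_at_0)
  then show ?thesis by (simp add: finite_mi_size_le)
qed

lemma taylor_jet_eq_0: "n < mi_size a ==> taylor_jet n x f a y = 0"
  unfolding taylor_jet_def by (intro sum.neutral) (auto simp: mono_jet_eq_0)

lemma taylor_jet_diff: "taylor_jet n x (\<lambda>a x. f a x - g a x) a y = taylor_jet n x f a y - taylor_jet n x g a y"
  unfolding taylor_jet_def by (simp add: left_diff_distrib sum_subtractf)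

lemma taylor_jet_add: "taylor_jet n x (\<lambda>a x. f a x + g a x) a y = taylor_jet n x f a y + taylor_jet n x g a y"
  unfolding taylor_jet_def by (simp add: distrib_right sum.distrib)

lemma taylor_jet_cong: "(\<And>\<gamma>. mi_size \<gamma> \<le> n ==> f \<gamma> x = g \<gamma> x) ==> taylor_jet n x f a y = taylor_jet n x g a y"
  unfolding taylor_jet_def by (intro sum.cong) auto

lemma taylor_jet_bound:
  fixes f :: "'d::finite jet"
  assumes "\<delta> > 0" "c \<ge> 1" "norm (y - x) \<le> c * \<delta>" and f: "jet_bound \<delta> n {x} f B"
  shows "\<delta> ^ mi_size a * cmod (taylor_jet n x f a y) \<le> real (card {\<gamma> :: 'd multi_index. mi_size \<gamma> \<le> n}) * (c ^ n * B)"
proof -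
  have B: "B \<ge> 0"
    using jet_boundD[OF f, of x 0] by simp (meson norm_ge_zero order_trans)
  have "\<delta> ^ mi_size a * cmod (taylor_jet n x f a y)
      \<le> (\<Sum>\<gamma> | mi_size \<gamma> \<le> n. \<delta> ^ mi_size a * cmod (f \<gamma> x * mono_jet \<gamma> a (y - x)))"
    unfolding taylor_jet_def sum_distrib_left[symmetric] using assms
    by (intro mult_left_mono norm_sum) auto
  also have "\<dots> \<le> (\<Sum>\<gamma> | mi_size (\<gamma> :: 'd multi_index) \<le> n. c ^ n * B)"
  proof (rule sum_mono)
    fix \<gamma> :: "'d multi_index" assume "\<gamma> \<in> {\<gamma>. mi_size \<gamma> \<le> n}"
    then have n: "mi_size \<gamma> \<le> n" by simp
    have "\<delta> ^ mi_size a * cmod (f \<gamma> x * mono_jet \<gamma> a (y - x))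
        = cmod (f \<gamma> x) * (\<delta> ^ mi_size a * cmod (mono_jet \<gamma> a (y - x)))"
      by (simp add: norm_mult)
    also have "\<dots> \<le> cmod (f \<gamma> x) * (c * \<delta>) ^ mi_size \<gamma>"
      using assms by (intro mult_left_mono mono_jet_bound) auto
    also have "\<dots> = c ^ mi_size \<gamma> * (\<delta> ^ mi_size \<gamma> * cmod (f \<gamma> x))"
      by (simp add: power_mult_distrib)
    also have "\<dots> \<le> c ^ n * B"
      using assms n B by (intro mult_mono power_increasing jet_boundD[OF f]) auto
    finally show "\<delta> ^ mi_size a * cmod (f \<gamma> x * mono_jet \<gamma> a (y - x)) \<le> c ^ n * B" .
  qed
  finally show ?thesis by simp
qed

text \<open>The remainder vanishes to order \<open>n\<close> at \<open>x\<close> and its derivatives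
  of order \<open>Suc n\<close> are zero, so \<open>taylor_vanish\<close> applies with
  \<open>M = 0\<close>. It serves to re-expand a difference of Taylor polynomials around another
  point.\<close>

lemma taylor_jet_polynomial:
  fixes q :: "'d::finite jet"
  assumes q: "smooth_on UNIV q" and deg: "\<And>a y. n < mi_size a ==> q a y = 0"
  shows "taylor_jet n x q a y = q a y"
proof (cases "mi_size a \<le> n")
  case True
  let ?r = "\<lambda>a y. q a y - taylor_jet n x q a y"
  have "cmod (?r a y) \<le> 0 * (real CARD('d) * norm (y - x)) ^ (Suc n - mi_size a)"
    using True
    by (intro taylor_vanish[where S = UNIV] smooth_on_diff q smooth_on_taylor_jet)
       (auto simp: taylor_jet_at deg taylor_jet_eq_0)
  then show ?thesis by simp
next
  case False
  then show ?thesis by (simp add: taylor_jet_eq_0 deg)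
qed

lemma taylor_remainder:
  fixes w :: "'d::finite jet"
  assumes w: "smooth_on S w" "convex S" "x \<in> S" "y \<in> S" "mi_size a \<le> n"
    and M: "\<And>b z. z \<in> S ==> mi_size b = Suc n ==> cmod (w b z) \<le> M"
  shows "cmod (w a y - taylor_jet n x w a y) \<le> M * (real CARD('d) * norm (y - x)) ^ (Suc n - mi_size a)"
proof -
  have "cmod ((\<lambda>a y. w a y - taylor_jet n x w a y) a y) \<le> M * (real CARD('d) * norm (y - x)) ^ (Suc n - mi_size a)"
    using w smooth_on_subset[OF smooth_on_taylor_jet, of S]
    by (intro taylor_vanish[where S = S] smooth_on_diff) (auto simp: taylor_jet_at M taylor_jet_eq_0)
  then show ?thesis by simp
qed

section \<open>Smooth partitions of unity on a grid\<close>

lemma tendsto_poly_exp_neg: "((\<lambda>s. s ^ n * poly p s * exp (- s)) \<longlongrightarrow> 0) (at_top :: real filter)"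
proof (induction p arbitrary: n)
  case 0
  then show ?case by simp
next
  case (pCons a p)
  have "((\<lambda>s::real. s ^ n / exp s) \<longlongrightarrow> 0) at_top" by (rule tendsto_power_div_exp_0)
  from tendsto_add[OF tendsto_mult_right_zero[OF this, of a] pCons.IH[of "Suc n"]]
  show ?case by (simp add: exp_minus field_simps)
qed

text \<open>With \<open>s = 1 / t\<close> one has \<open>ds / dt = - s ^ 2\<close>, so the
  derivative of \<open>p(s) exp (- s)\<close> in \<open>t\<close> is
  \<open>s ^ 2 (p(s) - p'(s)) exp (- s)\<close>. The polynomials are those occurring in the
  derivatives of \<open>exp (- 1 / t)\<close>.\<close>

fun bump_poly :: "nat => real poly" where
  "bump_poly 0 = 1"
| "bump_poly (Suc k) = [:0, 0, 1:] * (bump_poly k - pderiv (bump_poly k))"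

definition exp_flat :: "nat => real => real" where
  "exp_flat k t = (if t > 0 then poly (bump_poly k) (inverse t) * exp (- inverse t) else 0)"

lemma smooth1_exp_flat: "smooth1 exp_flat"
  unfolding smooth1_def
proof (intro allI)
  fix k and t :: real
  consider "t > 0" | "t < 0" | "t = 0" by linarith
  then show "(exp_flat k has_real_derivative exp_flat (Suc k) t) (at t)"
  proof cases
    case 1
    have "((\<lambda>t. poly (bump_poly k) (inverse t) * exp (- inverse t)) has_real_derivative exp_flat (Suc k) t) (at t)"
      using 1
      by (auto intro!: derivative_eq_intros poly_DERIV[THEN DERIV_chain2] simp: exp_flat_def field_simps power2_eq_square)
    then show ?thesis
      by (rule has_field_derivative_transform_within_open[where S = "{0<..}"])
         (use 1 in \<open>auto simp: exp_flat_def\<close>)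
  next
    case 2
    have "((\<lambda>t. 0) has_real_derivative exp_flat (Suc k) t) (at t)" using 2 by (simp add: exp_flat_def)
    then show ?thesis
      by (rule has_field_derivative_transform_within_open[where S = "{..<0}"])
         (use 2 in \<open>auto simp: exp_flat_def\<close>)
  next
    case 3
    have "((\<lambda>y. exp_flat k y / y) \<longlongrightarrow> 0) (at_left 0)"
      by (rule tendsto_eventually) (auto simp: exp_flat_def eventually_at_filter)
    moreover have "((\<lambda>y. exp_flat k y / y) \<longlongrightarrow> 0) (at_right 0)"
      unfolding filterlim_at_right_to_top
    proof (rule Lim_transform_eventually[OF tendsto_poly_exp_neg[of 1 "bump_poly k"]])
      show "\<forall>\<^sub>F s in at_top. s ^ 1 * poly (bump_poly k) s * exp (- s) = exp_flat k (inverse s) / inverse s"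
        using eventually_gt_at_top[of "0::real"] by eventually_elim (auto simp: exp_flat_def field_simps)
    qed
    ultimately have "((\<lambda>y. exp_flat k y / y) \<longlongrightarrow> 0) (at 0)"
      by (simp add: filterlim_at_split)
    then show ?thesis using 3 by (simp add: has_field_derivative_iff exp_flat_def)
  qed
qed

text \<open>The operator form of the Leibniz rule from \<open>jet_mult\<close>, in one
  variable.\<close>

lemma smooth1_mult:
  assumes p: "smooth1 p" and q: "smooth1 q"
  shows "smooth1 (\<lambda>k t. ((\<lambda>\<Phi> i j. \<Phi> (Suc i) j + \<Phi> i (Suc j)) ^^ k) (\<lambda>i j. p i t * q j t) 0 0)"
proof -
  let ?A = "\<lambda>\<Phi> i j. \<Phi> (Suc i) j + (\<Phi> i (Suc j) :: real)"
  have "((\<lambda>t. (?A ^^ k) (\<lambda>i j. p i t * q j t) i j) has_real_derivative (?A ^^ Suc k) (\<lambda>i j. p i t * q j t) i j) (at t)"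
    for k t i j
  proof (induction k arbitrary: i j)
    case 0
    have "((\<lambda>t. p i t * q j t) has_real_derivative (p i t * q (Suc j) t + p (Suc i) t * q j t)) (at t)"
      using p q unfolding smooth1_def by (intro DERIV_mult') auto
    then show ?case by (simp add: add.commute)
  next
    case (Suc k)
    from DERIV_add[OF Suc.IH[of "Suc i" j] Suc.IH[of i "Suc j"]] show ?case by simp
  qed
  then show ?thesis by (simp add: smooth1_def)
qed

lemma smooth1_affine:
  assumes "smooth1 p"
  shows "smooth1 (\<lambda>k t. c ^ k * p k (c * t + b))"
  unfolding smooth1_def
proof (intro allI)
  fix k t
  have "((\<lambda>t. c * t + b) has_real_derivative c) (at t)" by (auto intro!: derivative_eq_intros)
  from DERIV_chain2[OF _ this, of "p k"] assms
  have "((\<lambda>t. p k (c * t + b)) has_real_derivative p (Suc k) (c * t + b) * c) (at t)"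
    by (simp add: smooth1_def)
  from DERIV_cmult[OF this, of "c ^ k"]
  show "((\<lambda>t. c ^ k * p k (c * t + b)) has_real_derivative c ^ Suc k * p (Suc k) (c * t + b)) (at t)"
    by (simp add: mult_ac)
qed

text \<open>The step is the normalised primitive of the bump \<open>b\<close>, the product of
  \<open>exp (- 1 / t)\<close> with its reflection at 1/2, which lives on the unit interval; the
  derivatives of the step are those of \<open>b\<close>, shifted by one.\<close>

lemma exists_smooth_step:
  "\<exists>s. smooth1 s \<and> (\<forall>k. \<forall>t\<le>0. s k t = 0) \<and> (\<forall>k. \<forall>t\<ge>1. s k t = (if k = 0 then 1 else 0)) \<and>
       (\<forall>t. 0 \<le> s 0 t \<and> s 0 t \<le> 1)"
proof -
  define q where "q = (\<lambda>k t. (-1) ^ k * exp_flat k ((-1) * t + 1))"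
  define b where "b = (\<lambda>k t. ((\<lambda>\<Phi> i j. \<Phi> (Suc i) j + \<Phi> i (Suc j)) ^^ k) (\<lambda>i j. exp_flat i t * q j t) 0 0)"
  have b: "smooth1 b"
    unfolding b_def q_def by (intro smooth1_mult smooth1_exp_flat smooth1_affine)
  have iter0: "((\<lambda>\<Phi> i j. \<Phi> (Suc i) j + \<Phi> i (Suc j)) ^^ k) (\<lambda>i j. 0) i j = (0::real)" for k i j
    by (induction k arbitrary: i j) auto
  have b0: "b k t = 0" if "t \<le> 0 \<or> t \<ge> 1" for k t
  proof -
    have "(\<lambda>i j. exp_flat i t * q j t) = (\<lambda>i j. 0)"
      using that by (auto simp: exp_flat_def q_def fun_eq_iff)
    then show ?thesis by (simp add: b_def iter0)
  qed
  have bval: "b 0 t = exp_flat 0 t * exp_flat 0 (1 - t)" for t by (simp add: b_def q_def)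
  have b_nonneg: "b 0 t \<ge> 0" for t by (simp add: bval exp_flat_def)
  have b_pos: "b 0 t > 0" if "0 < t" "t < 1" for t using that by (simp add: bval exp_flat_def)
  have cont: "continuous_on S (b 0)" for S
    using b unfolding smooth1_def by (meson DERIV_continuous_on has_field_derivative_at_within)
  \<comment> \<open>The integral starts at -1 and not at 0, so that every \<open>t \<ge> 0\<close>
    is interior to the interval used for differentiation.\<close>
  define F where "F = (\<lambda>t. integral {-1..t} (b 0))"
  have F0: "F t = 0" if "t \<le> 0" for t
  proof -
    have "integral {-1..t} (b 0) = integral {-1..t} (\<lambda>t. 0)"
      using that by (intro integral_cong) (auto intro: b0)
    then show ?thesis by (simp add: F_def)
  qed
  have F: "(F has_real_derivative b 0 t) (at t)" for t
  proof (cases "t < 0")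
    case True
    have "((\<lambda>t. 0) has_real_derivative b 0 t) (at t)" using True by (simp add: b0)
    then show ?thesis
      by (rule has_field_derivative_transform_within_open[where S = "{..<0}"])
         (use True F0 in auto)
  next
    case False
    have "(F has_real_derivative b 0 t) (at t within {-1..t+1})"
      unfolding F_def using False by (intro integral_has_real_derivative cont) auto
    then show ?thesis using False at_within_Icc_at[of "-1" t "t + 1"] by simp
  qed
  have contF: "continuous_on S F" for S
    by (intro continuous_at_imp_continuous_on ballI DERIV_isCont[OF F])
  define c where "c = F 1"
  have mono: "F s \<le> F t" if "s \<le> t" for s t
    by (rule DERIV_nonneg_imp_nondecreasing[OF that]) (use F b_nonneg in blast)
  have c: "c > 0"
  proof -
    have "F 0 < F 1"
    proof (rule DERIV_pos_imp_increasing_open[of 0 1 F])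
      fix x :: real assume "0 < x" "x < 1"
      then show "\<exists>y. DERIV F x :> y \<and> y > 0" using F b_pos by blast
    qed (auto intro: contF)
    then show ?thesis by (simp add: c_def F0)
  qed
  have F1: "F t = c" if "t \<ge> 1" for t
  proof (cases "t = 1")
    case False
    have "F t = F 1"
    proof (rule DERIV_isconst2[of 1 t])
      show "continuous_on {1..t} F" by (rule contF)
      show "(F has_real_derivative 0) (at x)" if "1 < x" "x < t" for x
        using F[of x] that by (simp add: b0)
    qed (use that False in auto)
    then show ?thesis by (simp add: c_def)
  qed (simp add: c_def)
  define s where "s = (\<lambda>k t. (case k of 0 => F t | Suc k => b k t) / c)"
  have "smooth1 s"
    unfolding smooth1_def
  proof (intro allI)
    fix k t
    show "(s k has_real_derivative s (Suc k) t) (at t)"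
      using DERIV_cdivide[OF F, where c = c] DERIV_cdivide[of "b (k - 1)" "b k t" t UNIV c] b
      unfolding smooth1_def s_def by (cases k) auto
  qed
  moreover have "0 \<le> s 0 t \<and> s 0 t \<le> 1" for t
  proof -
    have "0 \<le> F t" "F t \<le> c"
      using mono[of "min t 0" t] mono[of t "max t 1"] F0[of "min t 0"] F1[of "max t 1"] by auto
    with c show ?thesis by (simp add: s_def)
  qed
  ultimately show ?thesis
    using c by (intro exI[of _ s]) (auto simp: s_def F0 F1 b0 split: nat.splits)
qed

section \<open>Differences of a smooth step and the partition of unity on a grid\<close>

definition smooth_step :: "nat => real => real" where
  "smooth_step = (SOME s. smooth1 s \<and> (\<forall>k. \<forall>t\<le>0. s k t = 0) \<and>
     (\<forall>k. \<forall>t\<ge>1. s k t = (if k = 0 then 1 else 0)) \<and> (\<forall>t. 0 \<le> s 0 t \<and> s 0 t \<le> 1))"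

lemma smooth_step:
  shows smooth1_step: "smooth1 smooth_step"
    and smooth_step_0: "t \<le> 0 ==> smooth_step k t = 0"
    and smooth_step_1: "t \<ge> 1 ==> smooth_step k t = (if k = 0 then 1 else 0)"
    and smooth_step_ge: "0 \<le> smooth_step 0 t" and smooth_step_le: "smooth_step 0 t \<le> 1"
  using someI_ex[OF exists_smooth_step] unfolding smooth_step_def[symmetric] by auto

text \<open>The integer translates of \<open>hat\<close> telescope to 1.\<close>

definition hat :: "nat => real => real" where
  "hat k t = smooth_step k (t + 1) - smooth_step k t"

lemma smooth1_hat: "smooth1 hat"
proof -
  have "smooth1 (\<lambda>k t. smooth_step k (t + 1))"
    using smooth1_affine[OF smooth1_step, of 1 1] by simp
  then show ?thesis using smooth1_step unfolding smooth1_def hat_def by (auto intro!: DERIV_diff)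
qed

lemma hat_eq_0: "\<bar>t\<bar> \<ge> 1 ==> hat k t = 0"
  by (cases "t \<ge> 0") (auto simp: hat_def smooth_step_0 smooth_step_1 abs_if split: if_splits)

lemma hat_nonneg: "hat 0 t \<ge> 0"
  by (cases "t \<ge> 0") (auto simp: hat_def smooth_step_0 smooth_step_1 smooth_step_ge smooth_step_le)

lemma hat_at_0: "hat 0 0 = 1"
  by (simp add: hat_def smooth_step_0 smooth_step_1)

lemma hat_bounded: "\<exists>B\<ge>1. \<forall>k\<le>n. \<forall>t. \<bar>hat k t\<bar> \<le> B"
proof -
  have "\<exists>B. \<forall>t. \<bar>hat k t\<bar> \<le> B" for k
  proof -
    have "continuous_on {-1..1} (hat k)"
      using smooth1_hat unfolding smooth1_def by (meson DERIV_continuous_on has_field_derivative_at_within)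
    then have "bounded (hat k ` {-1..1})"
      by (intro compact_imp_bounded compact_continuous_image) auto
    then obtain B where "\<forall>x\<in>hat k ` {-1..1}. norm x \<le> B"
      unfolding bounded_iff by blast
    then have B: "\<And>t. t \<in> {-1..1} ==> \<bar>hat k t\<bar> \<le> B" by simp
    have "\<bar>hat k t\<bar> \<le> \<bar>B\<bar>" for t
      using B[of t] hat_eq_0[of t k] by (cases "\<bar>t\<bar> \<ge> 1") (simp, force simp: abs_less_iff not_le)
    then show ?thesis by blast
  qed
  then obtain B where B: "\<And>k t. \<bar>hat k t\<bar> \<le> B k" by metis
  have B0: "B k \<ge> 0" for k using B[of k 0] by linarith
  have "\<bar>hat k t\<bar> \<le> 1 + sum B {..n}" if "k \<le> n" for k t
    using member_le_sum[of k "{..n}" B] B[of k t] B0 that by fastforce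
  moreover have "1 + sum B {..n} \<ge> 1" using B0 by (simp add: sum_nonneg)
  ultimately show ?thesis by blast
qed

definition grid_fun :: "real => ('d => int) => ('d::finite) jet" where
  "grid_fun \<delta> \<kappa> = jet_tensor (\<lambda>j k t. (1 / \<delta>) ^ k * hat k ((1 / \<delta>) * t + - real_of_int (\<kappa> j)))"

definition grid_pt :: "real => ('d => int) => real ^ 'd::finite" where
  "grid_pt \<delta> \<kappa> = (\<chi> j. \<delta> * real_of_int (\<kappa> j))"

text \<open>At \<open>x\<close> the grid functions with other indices vanish together with all
  derivatives, so sums over the grid are local and have a bounded number of terms.\<close>

definition grid_active :: "real => real ^ 'd => ('d::finite => int) set" where
  "grid_active \<delta> x = {\<kappa>. \<forall>j. \<bar>x $ j / \<delta> - real_of_int (\<kappa> j)\<bar> < 1}"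

lemma smooth_on_grid_fun: "smooth_on S (grid_fun \<delta> \<kappa>)"
  unfolding grid_fun_def by (intro smooth_on_tensor smooth1_affine smooth1_hat)

lemma grid_fun_eq_0:
  assumes "\<kappa> \<notin> grid_active \<delta> x"
  shows "grid_fun \<delta> \<kappa> a x = 0"
proof -
  obtain j where "\<bar>x $ j / \<delta> - real_of_int (\<kappa> j)\<bar> \<ge> 1"
    using assms by (auto simp: grid_active_def not_less)
  then have "hat (a $ j) ((1 / \<delta>) * x $ j + - real_of_int (\<kappa> j)) = 0" by (intro hat_eq_0) simp
  then have "(\<Prod>j\<in>UNIV. (1 / \<delta>) ^ (a $ j) * hat (a $ j) ((1 / \<delta>) * x $ j + - real_of_int (\<kappa> j))) = 0"
    by (intro prod_zero) auto
  then show ?thesis unfolding grid_fun_def jet_tensor_def by (simp del: of_real_prod)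
qed

lemma grid_active_dist:
  fixes x :: "real ^ 'd::finite"
  assumes "\<kappa> \<in> grid_active \<delta> x" "\<delta> > 0"
  shows "norm (x - grid_pt \<delta> \<kappa>) \<le> real CARD('d) * \<delta>"
proof -
  have *: "\<bar>x $ j - \<delta> * real_of_int (\<kappa> j)\<bar> \<le> \<delta>" for j
  proof -
    have "\<bar>x $ j / \<delta> - real_of_int (\<kappa> j)\<bar> < 1" using assms(1) by (simp add: grid_active_def)
    then have "\<delta> * \<bar>x $ j / \<delta> - real_of_int (\<kappa> j)\<bar> \<le> \<delta>" using assms(2) by simp
    moreover have "\<delta> * \<bar>x $ j / \<delta> - real_of_int (\<kappa> j)\<bar> = \<bar>\<delta> * (x $ j / \<delta> - real_of_int (\<kappa> j))\<bar>"
      using assms(2) by (simp add: abs_mult)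
    ultimately show ?thesis using assms(2) by (simp add: right_diff_distrib)
  qed
  have "norm (x - grid_pt \<delta> \<kappa>) \<le> (\<Sum>j\<in>UNIV. \<bar>(x - grid_pt \<delta> \<kappa>) $ j\<bar>)" by (rule norm_le_l1_cart)
  also have "\<dots> \<le> (\<Sum>j\<in>(UNIV :: 'd set). \<delta>)"
    using * by (intro sum_mono) (simp add: grid_pt_def)
  finally show ?thesis by simp
qed

lemma grid_active_card:
  fixes x :: "real ^ 'd::finite"
  shows "finite (grid_active \<delta> x)" "card (grid_active \<delta> x) \<le> 3 ^ CARD('d)"
proof -
  let ?B = "PiE (UNIV :: 'd set) (\<lambda>j. {\<lfloor>x $ j / \<delta>\<rfloor> - 1 .. \<lfloor>x $ j / \<delta>\<rfloor> + 1})"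
  have sub: "grid_active \<delta> x \<subseteq> ?B"
  proof
    fix \<kappa> assume \<kappa>: "\<kappa> \<in> grid_active \<delta> x"
    have "\<kappa> j \<in> {\<lfloor>x $ j / \<delta>\<rfloor> - 1 .. \<lfloor>x $ j / \<delta>\<rfloor> + 1}" for j
    proof -
      have "\<bar>x $ j / \<delta> - real_of_int (\<kappa> j)\<bar> < 1" using \<kappa> by (simp add: grid_active_def)
      then show ?thesis by (simp add: abs_less_iff) linarith
    qed
    then show "\<kappa> \<in> ?B" by (simp add: PiE_def)
  qed
  have fin: "finite ?B" by (intro finite_PiE) auto
  then show "finite (grid_active \<delta> x)" using sub by (rule finite_subset[rotated])
  have "card (grid_active \<delta> x) \<le> card ?B" by (rule card_mono[OF fin sub])
  also have "card ?B = 3 ^ CARD('d)" by (simp add: card_PiE)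
  finally show "card (grid_active \<delta> x) \<le> 3 ^ CARD('d)" .
qed

text \<open>The weights in \<open>jet_bound\<close> cancel the powers of \<open>1 / \<delta>\<close>
  that come from scaling, and what is left are values of \<open>hat\<close>; hence one constant for
  all meshes and all grid points.\<close>

lemma grid_fun_bound:
  "\<exists>B\<ge>1. \<forall>\<delta>>0. \<forall>\<kappa>. jet_bound \<delta> n UNIV (grid_fun \<delta> \<kappa> :: 'd::finite jet) B"
proof -
  obtain B where B: "B \<ge> 1" "\<And>k t. k \<le> n ==> \<bar>hat k t\<bar> \<le> B"
    using hat_bounded[of n] by blast
  have "\<delta> ^ mi_size a * cmod (grid_fun \<delta> \<kappa> a x) \<le> B ^ CARD('d)"
    if \<delta>: "\<delta> > 0" and a: "mi_size a \<le> n" for \<delta> \<kappa> a and x :: "real ^ 'd"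
  proof -
    have le: "a $ j \<le> n" for j using mi_component_le_size[of a j] a by simp
    have "\<delta> ^ mi_size a * cmod (grid_fun \<delta> \<kappa> a x) =
       (\<Prod>j\<in>UNIV. \<delta> ^ (a $ j) * \<bar>(1 / \<delta>) ^ (a $ j) * hat (a $ j) ((1 / \<delta>) * x $ j + - real_of_int (\<kappa> j))\<bar>)"
      unfolding grid_fun_def jet_tensor_def norm_of_real abs_prod mi_size_def power_sum prod.distrib[symmetric] by simp
    also have "\<dots> = (\<Prod>j\<in>UNIV. \<bar>hat (a $ j) ((1 / \<delta>) * x $ j + - real_of_int (\<kappa> j))\<bar>)"
      using \<delta> by (intro prod.cong) (auto simp: abs_mult power_one_over power_abs)
    also have "\<dots> \<le> (\<Prod>j\<in>(UNIV :: 'd set). B)"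
      using B le by (intro prod_mono) auto
    finally show ?thesis by simp
  qed
  with B(1) show ?thesis
    by (intro exI[of _ "B ^ CARD('d)"]) (auto simp: jet_bound_def one_le_power)
qed

lemma sum_hat_eq_1:
  assumes "\<bar>t\<bar> \<le> real_of_int M"
  shows "(\<Sum>k\<in>{-M-1..M+1}. hat 0 (t + - real_of_int k)) = 1"
proof -
  have "M \<ge> 0" using assms by (metis abs_ge_zero of_int_0_le_iff order_trans)
  then obtain m where m: "M = int m" by (metis nonneg_int_cases)
  have tele: "(\<Sum>k\<in>{- int m .. int m}. hat 0 (t + - real_of_int k)) = smooth_step 0 (t + real m + 1) - smooth_step 0 (t - real m)" for m
  proof (induction m)
    case 0
    then show ?case by (simp add: hat_def)
  next
    case (Suc m)
    have eq: "{- int (Suc m)..int (Suc m)} = insert (- int (Suc m)) (insert (int (Suc m)) {- int m..int m})" by auto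
    then have "(\<Sum>k\<in>{- int (Suc m) .. int (Suc m)}. hat 0 (t + - real_of_int k)) =
        hat 0 (t + real (Suc m)) + (hat 0 (t - real (Suc m)) + (\<Sum>k\<in>{- int m .. int m}. hat 0 (t + - real_of_int k)))"
    proof -
      have "t + - real_of_int (- int (Suc m)) = t + real (Suc m)" "t + - real_of_int (int (Suc m)) = t - real (Suc m)"
        by simp_all
      moreover have "- int (Suc m) \<notin> insert (int (Suc m)) {- int m..int m}" "int (Suc m) \<notin> {- int m..int m}" by auto
      ultimately show ?thesis unfolding eq by (simp only: sum.insert finite_insert finite_atLeastAtMost_int not_False_eq_True)
    qed
    also have "\<dots> = smooth_step 0 (t + real (Suc m) + 1) - smooth_step 0 (t - real (Suc m))"
      unfolding Suc.IH by (simp add: hat_def algebra_simps)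
    finally show ?case .
  qed
  have "{-M-1..M+1} = {- int (Suc m) .. int (Suc m)}" by (simp add: m)
  then have "(\<Sum>k\<in>{-M-1..M+1}. hat 0 (t + - real_of_int k)) = smooth_step 0 (t + real (Suc m) + 1) - smooth_step 0 (t - real (Suc m))"
    by (metis tele)
  also have "\<dots> = 1" using assms by (simp add: m smooth_step_0 smooth_step_1)
  finally show ?thesis .
qed

lemma jet_const_at_0: "jet_const c 0 x = c"
  by (simp add: jet_const_def)

lemma grid_partition:
  fixes x :: "real ^ 'd::finite"
  assumes "\<delta> > 0" "finite I" "grid_active \<delta> x \<subseteq> I"
  shows "(\<Sum>\<kappa>\<in>I. grid_fun \<delta> \<kappa> a x) = (if a = 0 then 1 else 0)"
proof -
  \<comment> \<open>The index box is large enough for a whole ball around the origin with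
    \<open>x\<close> in its interior. On this open set the order 0 identity is a product of
    telescoping sums, and \<open>smooth_on_unique\<close> then yields the identities for the
    derivatives at \<open>x\<close>.\<close>
  define M where "M = \<lceil>(norm x + 1) / \<delta>\<rceil>"
  define J where "J = PiE (UNIV :: 'd set) (\<lambda>j. {-M-1..M+1})"
  have M: "(norm x + 1) / \<delta> \<le> real_of_int M" by (simp add: M_def)
  have bd: "\<bar>y $ j / \<delta>\<bar> \<le> real_of_int M" if "y \<in> ball 0 (norm x + 1)" for y j
  proof -
    have "\<bar>y $ j / \<delta>\<bar> \<le> (norm x + 1) / \<delta>"
      using that component_le_norm_cart[of y j] assms(1) by (auto simp: abs_divide intro!: divide_right_mono)
    with M show ?thesis by linarith
  qed
  have one: "(\<Sum>\<kappa>\<in>J. grid_fun \<delta> \<kappa> 0 y) = 1" if "y \<in> ball 0 (norm x + 1)" for y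
  proof -
    have "(\<Sum>\<kappa>\<in>J. \<Prod>j\<in>UNIV. hat 0 (y $ j / \<delta> + - real_of_int (\<kappa> j))) =
       (\<Prod>j\<in>UNIV. \<Sum>k\<in>{-M-1..M+1}. hat 0 (y $ j / \<delta> + - real_of_int k))"
      unfolding J_def by (rule prod_sum_PiE[symmetric]) auto
    also have "\<dots> = 1" by (intro prod.neutral ballI sum_hat_eq_1 bd[OF that])
    finally show ?thesis
      by (simp add: grid_fun_def jet_tensor_def of_real_sum[symmetric] del: of_real_sum of_real_prod)
  qed
  have "(\<lambda>a y. \<Sum>\<kappa>\<in>J. grid_fun \<delta> \<kappa> a y) a x = jet_const 1 a x"
    by (rule smooth_on_unique[where S = "ball 0 (norm x + 1)"])
       (auto intro!: smooth_on_sum smooth_on_grid_fun smooth_on_const simp: one jet_const_at_0)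
  moreover have "(\<Sum>\<kappa>\<in>J. grid_fun \<delta> \<kappa> a x) = (\<Sum>\<kappa>\<in>grid_active \<delta> x. grid_fun \<delta> \<kappa> a x)"
  proof (rule sum.mono_neutral_right)
    show "finite J" unfolding J_def by (intro finite_PiE) auto
    show "grid_active \<delta> x \<subseteq> J"
    proof
      fix \<kappa> assume \<kappa>: "\<kappa> \<in> grid_active \<delta> x"
      have "\<kappa> j \<in> {-M-1..M+1}" for j
      proof -
        have "\<bar>x $ j / \<delta> - real_of_int (\<kappa> j)\<bar> < 1" using \<kappa> by (simp add: grid_active_def)
        moreover have "\<bar>x $ j / \<delta>\<bar> \<le> real_of_int M" using bd[of x j] by simp
        ultimately have "real_of_int (\<kappa> j) < real_of_int M + 1" "real_of_int (\<kappa> j) > - real_of_int M - 1" by linarith+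
        then show ?thesis by simp
      qed
      then show "\<kappa> \<in> J" by (simp add: J_def PiE_def)
    qed
  qed (auto simp: grid_fun_eq_0)
  moreover have "(\<Sum>\<kappa>\<in>I. grid_fun \<delta> \<kappa> a x) = (\<Sum>\<kappa>\<in>grid_active \<delta> x. grid_fun \<delta> \<kappa> a x)"
    using assms by (intro sum.mono_neutral_right) (auto simp: grid_fun_eq_0)
  ultimately show ?thesis by (simp add: jet_const_def)
qed

section \<open>The Fourier transform at complex frequencies\<close>

text \<open>Bilinear, without conjugation, so that differentiation corresponds to multiplication by
  \<open>\<i> * \<zeta> $ j\<close> at complex frequencies as well.\<close>

definition dotc :: "complex ^ 'd => real ^ 'd::finite => complex" where
  "dotc \<zeta> x = (\<Sum>j\<in>UNIV. \<zeta> $ j * of_real (x $ j))"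

definition cvec :: "real ^ 'd => complex ^ 'd::finite" where
  "cvec \<xi> = (\<chi> j. of_real (\<xi> $ j))"

definition fourier :: "(real ^ 'd => complex) => complex ^ 'd::finite => complex" where
  "fourier w \<zeta> = (LINT x|lborel. w x * exp (- \<i> * dotc \<zeta> x))"

definition cont_supp :: "real => (real ^ 'd::finite => complex) => bool" where
  "cont_supp R w \<longleftrightarrow> continuous_on UNIV w \<and> (\<forall>x. R < norm x --> w x = 0)"

lemma dotc_add: "dotc \<zeta> (x + y) = dotc \<zeta> x + dotc \<zeta> y"
  and dotc_diff: "dotc \<zeta> (x - y) = dotc \<zeta> x - dotc \<zeta> y"
  and dotc_scaleR: "dotc \<zeta> (c *\<^sub>R x) = of_real c * dotc \<zeta> x"
  by (simp_all add: dotc_def sum.distrib sum_subtractf algebra_simps sum_distrib_left)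

lemma dotc_cvec: "dotc (cvec \<xi>) x = of_real (\<xi> \<bullet> x)"
  by (simp add: dotc_def cvec_def inner_vec_def)

lemma dotc_axis: "dotc \<zeta> (axis j 1) = \<zeta> $ j"
proof -
  have "dotc \<zeta> (axis j 1) = (\<Sum>i\<in>UNIV. if i = j then \<zeta> $ i else 0)"
    unfolding dotc_def by (intro sum.cong) (auto simp: axis_def)
  then show ?thesis by simp
qed

lemma continuous_on_dotc [continuous_intros]: "continuous_on S f ==> continuous_on S (\<lambda>x. dotc \<zeta> (f x))"
  unfolding dotc_def by (intro continuous_intros)

lemma cont_suppD: "cont_supp R w ==> continuous_on S w" "cont_supp R w ==> R < norm x ==> w x = 0"
  unfolding cont_supp_def using continuous_on_subset by auto

lemma cont_supp_mult: "cont_supp R w ==> continuous_on UNIV g ==> cont_supp R (\<lambda>x. w x * g x)"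
  by (auto simp: cont_supp_def intro: continuous_on_mult)

lemma cont_supp_integrable:
  assumes "cont_supp R (w :: real ^ 'd::finite => complex)"
  shows "integrable lborel w"
proof -
  have "integrable lborel (\<lambda>x. indicator (cball 0 R) x *\<^sub>R w x)"
    by (intro borel_integrable_compact compact_cball cont_suppD(1)[OF assms])
  moreover have "(\<lambda>x. indicator (cball 0 R) x *\<^sub>R w x) = w"
    using cont_suppD(2)[OF assms] by (auto simp: fun_eq_iff indicator_def)
  ultimately show ?thesis by simp
qed

lemma integrable_indicator_cball: "integrable lborel (\<lambda>x :: real ^ 'd::finite. indicator (cball 0 R) x * (B::real))"
  by (intro integrable_mult_left integrable_real_indicator) (auto simp: emeasure_bounded_finite[simplified])

lemma cont_supp_integral_bound:
  fixes w :: "real ^ 'd::finite => complex"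
  assumes "cont_supp R w" "\<And>x. norm x \<le> R ==> cmod (w x) \<le> B"
  shows "cmod (LINT x|lborel. w x) \<le> B * measure lborel (cball (0 :: real ^ 'd) R)"
proof -
  have "cmod (LINT x|lborel. w x) \<le> (LINT x|lborel. cmod (w x))" by (rule integral_norm_bound)
  also have "\<dots> \<le> (LINT x|lborel. indicator (cball (0 :: real ^ 'd) R) x * B)"
    using cont_supp_integrable[OF assms(1)] cont_suppD(2)[OF assms(1)] assms(2)
    by (intro integral_mono integrable_norm integrable_indicator_cball)
       (auto simp: indicator_def not_le)
  also have "\<dots> = B * measure lborel (cball (0 :: real ^ 'd) R)" by simp
  finally show ?thesis .
qed

lemma measurable_cont: "continuous_on UNIV (w :: real ^ 'd::finite => 'b::{real_normed_vector}) ==> w \<in> borel_measurable borel"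
  by (rule borel_measurable_continuous_onI)

lemma lborel_integral_translate:
  fixes f :: "real ^ 'd::finite => complex"
  assumes "f \<in> borel_measurable borel"
  shows "(LINT x|lborel. f (a + x)) = (LINT x|lborel. f x)"
proof -
  have "(LINT x|lborel. f x) = (LINT x|distr lborel borel ((+) a). f x)" by (simp add: lborel_distr_plus)
  also have "\<dots> = (LINT x|lborel. f (a + x))" using assms by (subst integral_distr) auto
  finally show ?thesis by simp
qed

lemma lborel_integral_affine:
  fixes f :: "real ^ 'd::finite => complex"
  assumes [measurable]: "f \<in> borel_measurable borel" and "c > 0"
  shows "(LINT x|lborel. f x) = of_real (c ^ CARD('d)) * (LINT x|lborel. f (a + c *\<^sub>R x))"
proof -
  have "(LINT x|lborel. f x) = (LINT x|density (distr lborel borel (\<lambda>x. a + c *\<^sub>R x)) (\<lambda>_. ennreal (\<bar>c\<bar> ^ DIM(real ^ 'd))). f x)"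
    using lborel_affine[of c a] assms(2) by simp
  also have "\<dots> = (LINT x|distr lborel borel (\<lambda>x. a + c *\<^sub>R x). (\<bar>c\<bar> ^ DIM(real ^ 'd)) *\<^sub>R f x)"
    by (rule integral_density) auto
  also have "\<dots> = (LINT x|lborel. (\<bar>c\<bar> ^ DIM(real ^ 'd)) *\<^sub>R f (a + c *\<^sub>R x))"
    by (rule integral_distr) auto
  finally show ?thesis using assms(2) by (simp add: scaleR_conv_of_real)
qed

text \<open>Integration by parts without boundary terms. The difference quotients \<open>D n\<close>
  have integral 0 by translation invariance; since their steps have length at most 1, they live in
  the ball of radius \<open>R + 1\<close> and are bounded there, so dominated convergence carries
  this over to the derivative.\<close>

lemma integral_directional_derivative_0:
  fixes g g' :: "real ^ 'd::finite => complex"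
  assumes der: "\<And>x. ((\<lambda>t. g (x + t *\<^sub>R e)) has_vector_derivative g' x) (at 0)"
    and g: "cont_supp R g" and g': "cont_supp R g'" and e: "norm e \<le> 1"
  shows "(LINT x|lborel. g' x) = 0"
proof -
  have "bounded (g' ` cball 0 R)"
    by (intro compact_imp_bounded compact_continuous_image cont_suppD(1)[OF g']) auto
  then obtain B0 where B0: "\<forall>z\<in>g' ` cball 0 R. cmod z \<le> B0" unfolding bounded_iff by blast
  define B where "B = max B0 0"
  have B: "cmod (g' x) \<le> B" for x
    using B0 cont_suppD(2)[OF g', of x] by (cases "norm x \<le> R") (auto simp: B_def le_max_iff_disj)
  define D where "D = (\<lambda>n x. of_real (real (Suc n)) * (g (x + (1 / real (Suc n)) *\<^sub>R e) - g x))"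
  have der': "((\<lambda>t. g (x + t *\<^sub>R e)) has_vector_derivative g' (x + t *\<^sub>R e)) (at t)" for x t
  proof -
    have "((\<lambda>s. s - t) has_real_derivative 1) (at t)" by (auto intro!: derivative_eq_intros)
    from vector_diff_chain_at[OF this[unfolded has_real_derivative_iff_has_vector_derivative], of "\<lambda>s. g ((x + t *\<^sub>R e) + s *\<^sub>R e)"]
      der[of "x + t *\<^sub>R e"]
    have "(((\<lambda>s. g ((x + t *\<^sub>R e) + s *\<^sub>R e)) \<circ> (\<lambda>s. s - t)) has_vector_derivative (1 *\<^sub>R g' (x + t *\<^sub>R e))) (at t)" by simp
    moreover have "((\<lambda>s. g ((x + t *\<^sub>R e) + s *\<^sub>R e)) \<circ> (\<lambda>s. s - t)) = (\<lambda>t. g (x + t *\<^sub>R e))"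
      by (auto simp: fun_eq_iff algebra_simps)
    ultimately show ?thesis by simp
  qed
  have lip: "cmod (g (x + s *\<^sub>R e) - g x) \<le> B * s" if "s \<ge> 0" for x s
  proof -
    have "norm (g (x + s *\<^sub>R e) - g (x + 0 *\<^sub>R e)) \<le> B * norm (s - 0)"
    proof (rule differentiable_bound[where S = "{0..s}" and f = "\<lambda>t. g (x + t *\<^sub>R e)" and f' = "\<lambda>t h. h *\<^sub>R g' (x + t *\<^sub>R e)"])
      show "((\<lambda>t. g (x + t *\<^sub>R e)) has_derivative (\<lambda>h. h *\<^sub>R g' (x + t *\<^sub>R e))) (at t within {0..s})" for t
        using der'[of x t] unfolding has_vector_derivative_def by (rule has_derivative_at_withinI)
      show "onorm (\<lambda>h. h *\<^sub>R g' (x + t *\<^sub>R e)) \<le> B" for t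
      proof (rule onorm_le)
        fix h :: real
        show "norm (h *\<^sub>R g' (x + t *\<^sub>R e)) \<le> B * norm h"
          using mult_left_mono[OF B[of "x + t *\<^sub>R e"] abs_ge_zero[of h]] by (simp add: mult.commute)
      qed
    qed (use that in auto)
    then show ?thesis using that by simp
  qed
  have contg: "continuous_on UNIV g" and contg': "continuous_on UNIV g'" using cont_suppD(1) g g' by auto
  have "(\<lambda>n. LINT x|lborel. D n x) \<longlonglongrightarrow> (LINT x|lborel. g' x)"
  proof (rule integral_dominated_convergence[where w = "\<lambda>x. indicator (cball 0 (R + 1)) x * B"])
    show "g' \<in> borel_measurable lborel" using measurable_cont[OF contg'] by simp
    show "D n \<in> borel_measurable lborel" for n
      unfolding D_def measurable_lborel2
      by (intro measurable_cont continuous_intros continuous_on_compose2[OF contg] contg) auto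
    show "integrable lborel (\<lambda>x :: real ^ 'd. indicator (cball 0 (R + 1)) x * B)" by (rule integrable_indicator_cball)
    show "AE x in lborel. (\<lambda>n. D n x) \<longlonglongrightarrow> g' x"
    proof (rule AE_I2)
      fix x
      have "((\<lambda>t. cmod (g (x + t *\<^sub>R e) - g x - t *\<^sub>R g' x) / \<bar>t\<bar>) \<longlongrightarrow> 0) (at 0)"
        using der[of x] by (simp add: has_vector_derivative_def has_derivative_iff_norm)
      moreover have "\<forall>\<^sub>F t in at 0. cmod (g (x + t *\<^sub>R e) - g x - t *\<^sub>R g' x) / \<bar>t\<bar> = cmod ((g (x + t *\<^sub>R e) - g x) /\<^sub>R t - g' x)"
      proof (rule eventually_at_filter[THEN iffD2], rule always_eventually, intro allI impI)
        fix t :: real assume t: "t \<noteq> 0"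
        have "(g (x + t *\<^sub>R e) - g x) /\<^sub>R t - g' x = (g (x + t *\<^sub>R e) - g x - t *\<^sub>R g' x) /\<^sub>R t"
          using t by (simp add: scaleR_diff_right)
        then show "cmod (g (x + t *\<^sub>R e) - g x - t *\<^sub>R g' x) / \<bar>t\<bar> = cmod ((g (x + t *\<^sub>R e) - g x) /\<^sub>R t - g' x)"
          by (simp add: divide_inverse mult.commute)
      qed
      ultimately have "((\<lambda>t. cmod ((g (x + t *\<^sub>R e) - g x) /\<^sub>R t - g' x)) \<longlongrightarrow> 0) (at 0)"
        by (rule Lim_transform_eventually)
      then have "((\<lambda>t. (g (x + t *\<^sub>R e) - g x) /\<^sub>R t) \<longlongrightarrow> g' x) (at 0)"
        by (simp add: tendsto_norm_zero_iff LIM_zero_iff)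
      then have "(\<lambda>n. (g (x + (1 / real (Suc n)) *\<^sub>R e) - g x) /\<^sub>R (1 / real (Suc n))) \<longlonglongrightarrow> g' x"
        by (rule filterlim_compose[of _ _ "at 0"])
           (use LIMSEQ_Suc[OF lim_1_over_n] in \<open>auto simp: filterlim_at\<close>)
      then show "(\<lambda>n. D n x) \<longlonglongrightarrow> g' x" by (simp add: D_def scaleR_conv_of_real)
    qed
    show "AE x in lborel. norm (D n x) \<le> indicator (cball 0 (R + 1)) x * B" for n
    proof (rule AE_I2)
      fix x
      have D: "norm (D n x) \<le> B"
      proof -
        have "norm (D n x) = real (Suc n) * cmod (g (x + (1 / real (Suc n)) *\<^sub>R e) - g x)"
          by (simp only: D_def norm_mult norm_of_real abs_of_nat)
        also have "\<dots> \<le> real (Suc n) * (B * (1 / real (Suc n)))"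
          by (intro mult_left_mono lip) auto
        finally show ?thesis by simp
      qed
      have "D n x = 0" if "norm x > R + 1"
      proof -
        have "norm x \<le> norm (x + (1 / real (Suc n)) *\<^sub>R e) + norm ((1 / real (Suc n)) *\<^sub>R e)"
          by (metis add_diff_cancel norm_triangle_ineq4)
        moreover have "norm ((1 / real (Suc n)) *\<^sub>R e) \<le> 1"
        proof -
          have "norm ((1 / real (Suc n)) *\<^sub>R e) = (1 / real (Suc n)) * norm e" by simp
          also have "\<dots> \<le> 1 * 1" using e by (intro mult_mono) auto
          finally show ?thesis by simp
        qed
        ultimately have "norm (x + (1 / real (Suc n)) *\<^sub>R e) > R" using that by linarith
        then show ?thesis using that by (simp add: D_def cont_suppD(2)[OF g])
      qed
      with D show "norm (D n x) \<le> indicator (cball 0 (R + 1)) x * B"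
        by (auto simp: indicator_def not_le)
    qed
  qed
  moreover have "(LINT x|lborel. D n x) = 0" for n
  proof -
    have mg: "g \<in> borel_measurable borel" by (rule measurable_cont[OF contg])
    have "integrable lborel (\<lambda>x. g (x + a))" for a :: "real ^ 'd"
    proof (rule cont_supp_integrable[where R = "R + norm a"])
      show "cont_supp (R + norm a) (\<lambda>x. g (x + a))"
        unfolding cont_supp_def
      proof (intro conjI allI impI)
        show "continuous_on UNIV (\<lambda>x. g (x + a))"
          by (intro continuous_on_compose2[OF contg] continuous_intros) auto
        fix x :: "real ^ 'd" assume "R + norm a < norm x"
        moreover have "norm x \<le> norm (x + a) + norm a" by (metis add_diff_cancel norm_triangle_ineq4)
        ultimately show "g (x + a) = 0" by (intro cont_suppD(2)[OF g]) linarith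
      qed
    qed
    moreover have "(LINT x|lborel. g (x + a)) = (LINT x|lborel. g x)" for a :: "real ^ 'd"
      using lborel_integral_translate[OF mg, of a] by (simp add: add.commute)
    ultimately show ?thesis unfolding D_def
      using cont_supp_integrable[OF g] by simp
  qed
  ultimately show ?thesis by (simp add: LIMSEQ_const_iff)
qed

text \<open>The derivative of \<open>w a\<close> times the exponential kernel has integral 0, and by
  the product rule this integral is the difference of the two sides.\<close>

lemma fourier_deriv:
  assumes w: "smooth_on UNIV w" and supp: "\<And>a x. R < norm x ==> w a x = 0"
  shows "fourier (w (a + axis j (Suc 0))) \<zeta> = \<i> * \<zeta> $ j * fourier (w a) \<zeta>"
proof -
  define k where "k = (\<lambda>x. exp (- \<i> * dotc \<zeta> x))"
  have contk: "continuous_on UNIV k" unfolding k_def by (intro continuous_intros)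
  have cs: "cont_supp R (w b)" for b
    using supp smooth_on_continuous_on[OF w] by (auto simp: cont_supp_def)
  have "(LINT x|lborel. w (a + axis j (Suc 0)) x * k x + w a x * ((- \<i> * \<zeta> $ j) * k x)) = 0"
  proof (rule integral_directional_derivative_0[where e = "axis j 1" and R = R and g = "\<lambda>x. w a x * k x"])
    fix x
    have "((\<lambda>t. w a (x + t *\<^sub>R axis j 1)) has_vector_derivative w (a + axis j (Suc 0)) x) (at 0)"
    proof -
      have "((\<lambda>t::real. x + t *\<^sub>R axis j 1) has_derivative (\<lambda>t. t *\<^sub>R axis j 1)) (at 0)"
        by (auto intro!: derivative_eq_intros)
      moreover have "(w a has_derivative (\<lambda>h. \<Sum>i\<in>UNIV. (h $ i) *\<^sub>R w (a + axis i (Suc 0)) x)) (at (x + 0 *\<^sub>R axis j 1))"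
        using smooth_onD[OF w, of x a] by simp
      ultimately have "((\<lambda>t. w a (x + t *\<^sub>R axis j 1)) has_derivative
          (\<lambda>t. \<Sum>i\<in>UNIV. ((t *\<^sub>R axis j 1) $ i) *\<^sub>R w (a + axis i (Suc 0)) x)) (at 0)"
        by (rule diff_chain_at[unfolded o_def])
      moreover have "(\<Sum>i\<in>UNIV. ((t *\<^sub>R axis j 1) $ i) *\<^sub>R w (a + axis i (Suc 0)) x) = t *\<^sub>R w (a + axis j (Suc 0)) x" for t :: real
      proof -
        have "(\<Sum>i\<in>UNIV. ((t *\<^sub>R axis j 1) $ i) *\<^sub>R w (a + axis i (Suc 0)) x) =
          t *\<^sub>R (\<Sum>i\<in>UNIV. (axis j (1::real) $ i) *\<^sub>R w (a + axis i (Suc 0)) x)"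
          unfolding scaleR_sum_right by (rule sum.cong) auto
        then show ?thesis by simp
      qed
      ultimately show ?thesis by (simp add: has_vector_derivative_def)
    qed
    moreover have "((\<lambda>t. k (x + t *\<^sub>R axis j 1)) has_vector_derivative ((- \<i> * \<zeta> $ j) * k x)) (at 0)"
    proof -
      have "((\<lambda>t. of_real t :: complex) has_vector_derivative 1) (at 0)"
        using has_vector_derivative_of_real[OF DERIV_ident[of "at (0::real)"]] by simp
      then have "((\<lambda>t. - \<i> * (dotc \<zeta> x + of_real t * \<zeta> $ j)) has_vector_derivative (- \<i> * (0 + 1 * \<zeta> $ j))) (at 0)"
        by (intro has_vector_derivative_mult_right has_vector_derivative_add has_vector_derivative_mult_left has_vector_derivative_const)
      from field_vector_diff_chain_at[OF this DERIV_exp]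
      have "((\<lambda>t. exp (- \<i> * (dotc \<zeta> x + of_real t * \<zeta> $ j))) has_vector_derivative ((- \<i> * \<zeta> $ j) * k x)) (at 0)"
        by (simp add: o_def k_def mult_ac)
      then show ?thesis by (simp add: k_def dotc_add dotc_scaleR dotc_axis)
    qed
    ultimately have "((\<lambda>t. w a (x + t *\<^sub>R axis j 1) * k (x + t *\<^sub>R axis j 1)) has_vector_derivative
         (w a (x + 0 *\<^sub>R axis j 1) * ((- \<i> * \<zeta> $ j) * k x) + w (a + axis j (Suc 0)) x * k (x + 0 *\<^sub>R axis j 1))) (at 0)"
      by (rule has_vector_derivative_mult)
    then show "((\<lambda>t. w a (x + t *\<^sub>R axis j 1) * k (x + t *\<^sub>R axis j 1)) has_vector_derivative
         (w (a + axis j (Suc 0)) x * k x + w a x * ((- \<i> * \<zeta> $ j) * k x))) (at 0)"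
      by (simp add: add.commute)
  next
    show "cont_supp R (\<lambda>x. w a x * k x)" by (rule cont_supp_mult[OF cs contk])
    have "continuous_on UNIV (\<lambda>x. w (a + axis j (Suc 0)) x * k x + w a x * ((- \<i> * \<zeta> $ j) * k x))"
      by (intro continuous_intros contk cont_suppD(1)[OF cs])
    then show "cont_supp R (\<lambda>x. w (a + axis j (Suc 0)) x * k x + w a x * ((- \<i> * \<zeta> $ j) * k x))"
      using supp by (simp add: cont_supp_def)
  qed auto
  moreover have int: "integrable lborel (\<lambda>x. w b x * k x)" for b
    by (rule cont_supp_integrable[OF cont_supp_mult[OF cs contk]])
  moreover have "(\<lambda>x. w a x * ((- \<i> * \<zeta> $ j) * k x)) = (\<lambda>x. (- \<i> * \<zeta> $ j) * (w a x * k x))"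
    by (simp add: mult_ac)
  moreover have "(LINT x|lborel. w (a + axis j (Suc 0)) x * k x + (- \<i> * \<zeta> $ j) * (w a x * k x))
     = (LINT x|lborel. w (a + axis j (Suc 0)) x * k x) + (LINT x|lborel. (- \<i> * \<zeta> $ j) * (w a x * k x))"
    by (rule Bochner_Integration.integral_add[OF int integrable_mult_right[OF int]])
  ultimately have "(LINT x|lborel. w (a + axis j (Suc 0)) x * k x) + (- \<i> * \<zeta> $ j) * (LINT x|lborel. w a x * k x) = 0"
    unfolding integral_mult_right_zero by (simp only: fun_eq_iff)
  then show ?thesis by (simp add: fourier_def k_def)
qed

lemma fourier_mono:
  assumes w: "smooth_on UNIV w" and supp: "\<And>a x. R < norm x ==> w a x = 0"
  shows "fourier (w (b + a)) \<zeta> = (\<Prod>j\<in>UNIV. (\<i> * \<zeta> $ j) ^ (a $ j)) * fourier (w b) \<zeta>"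
proof (induction a rule: multi_index_induct)
  case zero
  then show ?case by simp
next
  case (add a j)
  have "(\<Prod>i\<in>UNIV. (\<i> * \<zeta> $ i) ^ ((a + axis j (Suc 0)) $ i)) = (\<Prod>i\<in>UNIV. (\<i> * \<zeta> $ i) ^ (a $ i) * (if i = j then \<i> * \<zeta> $ i else 1))"
    by (intro prod.cong) (auto simp: axis_def)
  also have "\<dots> = (\<Prod>i\<in>UNIV. (\<i> * \<zeta> $ i) ^ (a $ i)) * (\<i> * \<zeta> $ j)" by (simp add: prod.distrib)
  finally show ?case
    using fourier_deriv[OF w supp, where a = "b + a" and j = j and \<zeta> = \<zeta>] add.IH by (simp add: add.assoc)
qed


subsection \<open>Fourier inversion\<close>

text \<open>Lebesgue measure on vectors is the image of a product measure indexed by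
  \<open>Basis\<close>. The bijection \<open>ax\<close> from coordinates to basis vectors makes the
  theorem on integrals of finite products applicable.\<close>

lemma lborel_prod_integral:
  fixes f :: "'d::finite => real => complex"
  assumes int: "\<And>j. integrable lborel (f j)"
  shows "integrable lborel (\<lambda>x :: real ^ 'd. \<Prod>j\<in>UNIV. f j (x $ j))"
    and "(LINT x|lborel. (\<Prod>j\<in>UNIV. f j ((x :: real ^ 'd) $ j))) = (\<Prod>j\<in>UNIV. LINT t|lborel. f j t)"
proof -
  interpret product_sigma_finite "\<lambda>_ :: real ^ 'd. lborel :: real measure" by standard
  define ax where "ax = (\<lambda>j :: 'd. axis j (1::real))"
  have inj: "inj ax" by (auto simp: inj_on_def ax_def axis_eq_axis)
  have Basis: "(Basis :: (real ^ 'd) set) = range ax" by (auto simp: Basis_vec_def ax_def)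
  define h :: "(real ^ 'd => real) => real ^ 'd" where "h = (\<lambda>f. \<Sum>b\<in>Basis. f b *\<^sub>R b)"
  define F where "F = (\<lambda>b. f (inv ax b))"
  have h: "h u $ j = u (ax j)" for u j
  proof -
    have "h u $ j = h u \<bullet> ax j" by (simp add: ax_def inner_axis)
    also have "\<dots> = u (ax j)" unfolding h_def using Basis by (subst inner_sum_left_Basis) auto
    finally show ?thesis .
  qed
  have prod: "(\<Prod>j\<in>UNIV. f j (h u $ j)) = (\<Prod>b\<in>Basis. F b (u b))" for u
    unfolding h Basis by (subst prod.reindex[OF inj]) (simp add: F_def inv_f_f[OF inj])
  have intF: "integrable lborel (F b)" for b by (simp add: F_def int)
  have lb: "lborel = distr (\<Pi>\<^sub>M b\<in>Basis. lborel) borel h" unfolding h_def by (rule lborel_eq)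
  have mh: "h \<in> measurable (\<Pi>\<^sub>M b\<in>Basis. lborel) borel" unfolding h_def by measurable
  have mf: "(\<lambda>x :: real ^ 'd. \<Prod>j\<in>UNIV. f j (x $ j)) \<in> borel_measurable borel"
  proof (intro borel_measurable_prod)
    fix j :: 'd
    have "(\<lambda>x :: real ^ 'd. x $ j) \<in> borel_measurable borel" by (intro measurable_cont continuous_intros)
    moreover have "f j \<in> borel_measurable borel" using int[of j] by simp
    ultimately show "(\<lambda>x :: real ^ 'd. f j (x $ j)) \<in> borel_measurable borel" by (rule measurable_compose)
  qed
  have "integrable (\<Pi>\<^sub>M b\<in>Basis. lborel) (\<lambda>u. \<Prod>j\<in>UNIV. f j (h u $ j))"
    unfolding prod by (rule product_integrable_prod) (auto intro: intF)
  then show "integrable lborel (\<lambda>x :: real ^ 'd. \<Prod>j\<in>UNIV. f j (x $ j))"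
    unfolding lb by (subst integrable_distr_eq[OF mh mf])
  have "(LINT x|lborel. (\<Prod>j\<in>UNIV. f j ((x :: real ^ 'd) $ j))) = (LINT u|(\<Pi>\<^sub>M b\<in>Basis. lborel). (\<Prod>j\<in>UNIV. f j (h u $ j)))"
    unfolding lb by (rule integral_distr[OF mh mf])
  also have "\<dots> = (\<Prod>b\<in>Basis. LINT t|lborel. F b t)"
    unfolding prod by (rule product_integral_prod) (auto intro: intF)
  also have "\<dots> = (\<Prod>j\<in>UNIV. LINT t|lborel. f j t)"
    unfolding Basis by (subst prod.reindex[OF inj]) (simp add: F_def inv_f_f[OF inj])
  finally show "(LINT x|lborel. (\<Prod>j\<in>UNIV. f j ((x :: real ^ 'd) $ j))) = (\<Prod>j\<in>UNIV. LINT t|lborel. f j t)" .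
qed

definition gauss :: "real ^ 'd::finite => complex" where
  "gauss \<xi> = (\<Prod>j\<in>UNIV. of_real (exp (- ((\<xi> $ j)\<^sup>2) / 2)))"

text \<open>Up to the factor \<open>sqrt (2 * pi)\<close> this is the characteristic function of the
  standard normal distribution.\<close>

lemma gauss_1d:
  "integrable lborel (\<lambda>t. exp (- \<i> * of_real (z * t)) * of_real (exp (- t\<^sup>2 / 2)))"
  "(LINT t|lborel. exp (- \<i> * of_real (z * t)) * of_real (exp (- t\<^sup>2 / 2))) = of_real (sqrt (2 * pi) * exp (- z\<^sup>2 / 2))"
proof -
  have eq: "exp (- \<i> * of_real (z * t)) * of_real (exp (- t\<^sup>2 / 2)) = sqrt (2 * pi) *\<^sub>R (std_normal_density t *\<^sub>R iexp (- z * t))" for t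
    by (simp add: std_normal_density_def scaleR_conv_of_real)
  have int: "integrable lborel (\<lambda>t. std_normal_density t *\<^sub>R iexp (- z * t))"
  proof (rule Bochner_Integration.integrable_bound[of _ std_normal_density])
    show "AE x in lborel. norm (std_normal_density x *\<^sub>R iexp (- z * x)) \<le> norm (std_normal_density x)"
      by (auto simp: norm_mult)
  qed (auto simp: std_normal_density_def integrable_std_normal_moment[of 0, simplified])
  have "char std_normal_distribution (- z) = (LINT t|lborel. std_normal_density t *\<^sub>R iexp (- z * t))"
    unfolding char_def by (subst integral_density) auto
  then have "(LINT t|lborel. std_normal_density t *\<^sub>R iexp (- z * t)) = of_real (exp (- z\<^sup>2 / 2))"
    by (simp add: char_std_normal_distribution)
  then show "(LINT t|lborel. exp (- \<i> * of_real (z * t)) * of_real (exp (- t\<^sup>2 / 2))) = of_real (sqrt (2 * pi) * exp (- z\<^sup>2 / 2))"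
    unfolding eq by (simp add: scaleR_conv_of_real)
  show "integrable lborel (\<lambda>t. exp (- \<i> * of_real (z * t)) * of_real (exp (- t\<^sup>2 / 2)))"
    unfolding eq using int by (rule integrable_scaleR_right)
qed

lemma gauss_fourier:
  fixes z :: "real ^ 'd::finite"
  shows "integrable lborel (\<lambda>\<eta>. exp (- \<i> * of_real (z \<bullet> \<eta>)) * gauss \<eta>)"
    and "(LINT \<eta>|lborel. exp (- \<i> * of_real (z \<bullet> \<eta>)) * gauss \<eta>) = of_real (sqrt (2 * pi) ^ CARD('d)) * gauss z"
proof -
  have eq: "exp (- \<i> * of_real (z \<bullet> \<eta>)) * gauss \<eta> = (\<Prod>j\<in>UNIV. exp (- \<i> * of_real (z $ j * \<eta> $ j)) * of_real (exp (- (\<eta> $ j)\<^sup>2 / 2)))" for \<eta>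
    by (simp add: gauss_def inner_vec_def prod.distrib exp_sum[symmetric] sum_distrib_left sum_negf)
  show "integrable lborel (\<lambda>\<eta>. exp (- \<i> * of_real (z \<bullet> \<eta>)) * gauss \<eta>)"
    unfolding eq by (intro lborel_prod_integral(1)[of "\<lambda>j t. exp (- \<i> * of_real (z $ j * t)) * of_real (exp (- t\<^sup>2 / 2))"] gauss_1d)
  have "(LINT \<eta>|lborel. exp (- \<i> * of_real (z \<bullet> \<eta>)) * gauss \<eta>) = (\<Prod>j\<in>UNIV. of_real (sqrt (2 * pi) * exp (- (z $ j)\<^sup>2 / 2)))"
    unfolding eq
    by (subst lborel_prod_integral(2)[of "\<lambda>j t. exp (- \<i> * of_real (z $ j * t)) * of_real (exp (- t\<^sup>2 / 2))"])
       (rule gauss_1d(1), simp only: gauss_1d(2))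
  then show "(LINT \<eta>|lborel. exp (- \<i> * of_real (z \<bullet> \<eta>)) * gauss \<eta>) = of_real (sqrt (2 * pi) ^ CARD('d)) * gauss z"
    by (simp add: gauss_def prod.distrib)
qed

lemma gauss_at_0: "gauss 0 = 1"
  by (simp add: gauss_def)

lemma gauss_integral:
  "integrable lborel (gauss :: real ^ 'd::finite => complex)"
  "(LINT \<eta>|lborel. gauss (\<eta> :: real ^ 'd)) = of_real (sqrt (2 * pi) ^ CARD('d))"
  using gauss_fourier[of "0 :: real ^ 'd"] by (simp_all add: gauss_at_0)

lemma continuous_on_gauss [continuous_intros]: "continuous_on S f ==> continuous_on S (\<lambda>x. gauss (f x))"
  unfolding gauss_def by (intro continuous_intros) auto

lemma norm_gauss_le: "cmod (gauss \<xi>) \<le> 1"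
  unfolding gauss_def prod_norm[symmetric] by (intro prod_le_1) auto

text \<open>The integral \<open>I n\<close> contains the additional factor
  \<open>gauss (\<epsilon> n *\<^sub>R \<xi>)\<close>. By dominated convergence it tends to the
  left-hand side. By Fubini it equals an average of \<open>g\<close> against a Gaussian concentrated
  near \<open>x\<close>, which tends to the right-hand side.\<close>

theorem fourier_inversion:
  fixes g :: "real ^ 'd::finite => complex"
  assumes g: "cont_supp R g" and int: "integrable lborel (\<lambda>\<xi>. fourier g (cvec \<xi>))"
  shows "(LINT \<xi>|lborel. fourier g (cvec \<xi>) * exp (\<i> * of_real (\<xi> \<bullet> x))) = of_real ((2 * pi) ^ CARD('d)) * g x"
proof -
  define G where "G = (\<lambda>\<xi>. fourier g (cvec \<xi>))"
  define \<epsilon> where "\<epsilon> = (\<lambda>n. 1 / real (Suc n))"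
  have \<epsilon>: "\<epsilon> n > 0" for n by (simp add: \<epsilon>_def)
  have \<epsilon>0: "\<epsilon> \<longlonglongrightarrow> 0" unfolding \<epsilon>_def using LIMSEQ_Suc[OF lim_1_over_n] by simp
  define I where "I = (\<lambda>n. LINT \<xi>|lborel. G \<xi> * exp (\<i> * of_real (\<xi> \<bullet> x)) * gauss (\<epsilon> n *\<^sub>R \<xi>))"
  have contg: "continuous_on UNIV g" by (rule cont_suppD(1)[OF g])
  have mg: "g \<in> borel_measurable borel" by (rule measurable_cont[OF contg])
  have mG: "G \<in> borel_measurable borel" using int by (simp add: G_def)
  have me: "(\<lambda>\<xi>. exp (\<i> * of_real (\<xi> \<bullet> x))) \<in> borel_measurable borel" for x :: "real ^ 'd"
    by (intro measurable_cont continuous_intros)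
  have mgauss: "(\<lambda>\<xi> :: real ^ 'd. gauss (c *\<^sub>R \<xi>)) \<in> borel_measurable borel" for c
    by (intro measurable_cont continuous_intros)
  have lim1: "I \<longlonglongrightarrow> (LINT \<xi>|lborel. G \<xi> * exp (\<i> * of_real (\<xi> \<bullet> x)))"
    unfolding I_def
  proof (rule integral_dominated_convergence[where w = "\<lambda>\<xi>. cmod (G \<xi>)"])
    show "(\<lambda>\<xi>. G \<xi> * exp (\<i> * of_real (\<xi> \<bullet> x))) \<in> borel_measurable lborel"
      using mG me by simp
    show "(\<lambda>\<xi>. G \<xi> * exp (\<i> * of_real (\<xi> \<bullet> x)) * gauss (\<epsilon> n *\<^sub>R \<xi>)) \<in> borel_measurable lborel" for n
      using mG me mgauss by simp
    show "integrable lborel (\<lambda>\<xi>. cmod (G \<xi>))" using int by (simp add: G_def)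
    show "AE \<xi> in lborel. (\<lambda>n. G \<xi> * exp (\<i> * of_real (\<xi> \<bullet> x)) * gauss (\<epsilon> n *\<^sub>R \<xi>)) \<longlonglongrightarrow> G \<xi> * exp (\<i> * of_real (\<xi> \<bullet> x))"
    proof (rule AE_I2)
      fix \<xi> :: "real ^ 'd"
      have "(\<lambda>n. \<epsilon> n *\<^sub>R \<xi>) \<longlonglongrightarrow> 0 *\<^sub>R \<xi>" by (intro tendsto_intros \<epsilon>0)
      from continuous_on_tendsto_compose[OF continuous_on_gauss[where S = UNIV, OF continuous_on_id] this]
      have "(\<lambda>n. gauss (\<epsilon> n *\<^sub>R \<xi>)) \<longlonglongrightarrow> gauss (0 *\<^sub>R \<xi>)" by simp
      from tendsto_mult_left[OF this, of "G \<xi> * exp (\<i> * of_real (\<xi> \<bullet> x))"]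
      show "(\<lambda>n. G \<xi> * exp (\<i> * of_real (\<xi> \<bullet> x)) * gauss (\<epsilon> n *\<^sub>R \<xi>)) \<longlonglongrightarrow> G \<xi> * exp (\<i> * of_real (\<xi> \<bullet> x))"
        by (simp add: gauss_at_0)
    qed
    show "AE \<xi> in lborel. norm (G \<xi> * exp (\<i> * of_real (\<xi> \<bullet> x)) * gauss (\<epsilon> n *\<^sub>R \<xi>)) \<le> cmod (G \<xi>)" for n
      by (intro AE_I2) (simp add: norm_mult mult_left_le norm_gauss_le)
  qed
  have I: "I n = of_real (sqrt (2 * pi) ^ CARD('d)) * (LINT z|lborel. g (x + \<epsilon> n *\<^sub>R z) * gauss z)" for n
  proof -
    define f where "f = (\<lambda>z \<eta> :: real ^ 'd. g (x + \<epsilon> n *\<^sub>R z) * (exp (- \<i> * of_real (z \<bullet> \<eta>)) * gauss \<eta>))"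
    \<comment> \<open>The substitutions are \<open>\<xi> = \<eta> / \<epsilon>\<close> for the
      frequency and \<open>y = x + \<epsilon> z\<close> for the point. The phase turns into
      \<open>z \<bullet> \<eta>\<close> alone, and the two Jacobians will cancel.\<close>
    have inner: "G ((1 / \<epsilon> n) *\<^sub>R \<eta>) * exp (\<i> * of_real (((1 / \<epsilon> n) *\<^sub>R \<eta>) \<bullet> x)) * gauss (\<epsilon> n *\<^sub>R (1 / \<epsilon> n) *\<^sub>R \<eta>)
        = of_real (\<epsilon> n ^ CARD('d)) * (LINT z|lborel. f z \<eta>)" for \<eta>
    proof -
      have "G ((1 / \<epsilon> n) *\<^sub>R \<eta>) = (LINT y|lborel. g y * exp (- \<i> * of_real (((1 / \<epsilon> n) *\<^sub>R \<eta>) \<bullet> y)))"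
        by (simp add: G_def fourier_def dotc_cvec)
      also have "\<dots> = of_real (\<epsilon> n ^ CARD('d)) *
          (LINT z|lborel. g (x + \<epsilon> n *\<^sub>R z) * exp (- \<i> * of_real (((1 / \<epsilon> n) *\<^sub>R \<eta>) \<bullet> (x + \<epsilon> n *\<^sub>R z))))"
        by (intro lborel_integral_affine \<epsilon> measurable_cont continuous_intros contg)
      finally have "G ((1 / \<epsilon> n) *\<^sub>R \<eta>) * exp (\<i> * of_real (((1 / \<epsilon> n) *\<^sub>R \<eta>) \<bullet> x)) * gauss \<eta> = of_real (\<epsilon> n ^ CARD('d)) *
          ((LINT z|lborel. g (x + \<epsilon> n *\<^sub>R z) * exp (- \<i> * of_real (((1 / \<epsilon> n) *\<^sub>R \<eta>) \<bullet> (x + \<epsilon> n *\<^sub>R z))))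
            * (exp (\<i> * of_real (((1 / \<epsilon> n) *\<^sub>R \<eta>) \<bullet> x)) * gauss \<eta>))"
        by (simp add: mult_ac)
      also have "\<dots> = of_real (\<epsilon> n ^ CARD('d)) *
          (LINT z|lborel. g (x + \<epsilon> n *\<^sub>R z) * exp (- \<i> * of_real (((1 / \<epsilon> n) *\<^sub>R \<eta>) \<bullet> (x + \<epsilon> n *\<^sub>R z)))
            * (exp (\<i> * of_real (((1 / \<epsilon> n) *\<^sub>R \<eta>) \<bullet> x)) * gauss \<eta>))"
        by (simp only: integral_mult_left_zero)
      also have "(\<lambda>z. g (x + \<epsilon> n *\<^sub>R z) * exp (- \<i> * of_real (((1 / \<epsilon> n) *\<^sub>R \<eta>) \<bullet> (x + \<epsilon> n *\<^sub>R z)))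
            * (exp (\<i> * of_real (((1 / \<epsilon> n) *\<^sub>R \<eta>) \<bullet> x)) * gauss \<eta>)) = (\<lambda>z. f z \<eta>)"
      proof
        fix z
        have "exp (- \<i> * of_real (((1 / \<epsilon> n) *\<^sub>R \<eta>) \<bullet> (x + \<epsilon> n *\<^sub>R z))) * exp (\<i> * of_real (((1 / \<epsilon> n) *\<^sub>R \<eta>) \<bullet> x))
          = exp (- \<i> * of_real (z \<bullet> \<eta>))"
          using \<epsilon>[of n] unfolding exp_add[symmetric]
          by (intro arg_cong[where f = exp]) (simp add: inner_add_right distrib_left inner_commute)
        then show "g (x + \<epsilon> n *\<^sub>R z) * exp (- \<i> * of_real (((1 / \<epsilon> n) *\<^sub>R \<eta>) \<bullet> (x + \<epsilon> n *\<^sub>R z)))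
            * (exp (\<i> * of_real (((1 / \<epsilon> n) *\<^sub>R \<eta>) \<bullet> x)) * gauss \<eta>) = f z \<eta>"
          unfolding f_def by (metis mult.assoc)
      qed
      finally show ?thesis using \<epsilon>[of n] by simp
    qed
    have "I n = of_real ((1 / \<epsilon> n) ^ CARD('d)) *
       (LINT \<eta>|lborel. G (0 + (1 / \<epsilon> n) *\<^sub>R \<eta>) * exp (\<i> * of_real ((0 + (1 / \<epsilon> n) *\<^sub>R \<eta>) \<bullet> x)) * gauss (\<epsilon> n *\<^sub>R (0 + (1 / \<epsilon> n) *\<^sub>R \<eta>)))"
      unfolding I_def using \<epsilon>[of n] mG me mgauss by (intro lborel_integral_affine) auto
    also have "\<dots> = of_real ((1 / \<epsilon> n) ^ CARD('d)) * (LINT \<eta>|lborel. of_real (\<epsilon> n ^ CARD('d)) * (LINT z|lborel. f z \<eta>))"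
      by (simp only: add_0 inner)
    also have "\<dots> = of_real ((1 / \<epsilon> n) ^ CARD('d) * \<epsilon> n ^ CARD('d)) * (LINT \<eta>|lborel. (LINT z|lborel. f z \<eta>))"
      by (simp only: integral_mult_right_zero of_real_mult mult.assoc)
    also have "(1 / \<epsilon> n) ^ CARD('d) * \<epsilon> n ^ CARD('d) = 1" using \<epsilon>[of n] by (simp add: power_mult_distrib[symmetric])
    \<comment> \<open>Absolute integrability comes from the Gaussian in \<open>\<eta>\<close> and
      from the compact support of \<open>g\<close> in \<open>z\<close>; without the regularising
      factor the interchange would be unjustified.\<close>
    also have "(LINT \<eta>|lborel. (LINT z|lborel. f z \<eta>)) = (LINT z|lborel. (LINT \<eta>|lborel. f z \<eta>))"
    proof (rule lborel_pair.Fubini_integral)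
      have cg: "cont_supp ((R + norm x) / \<epsilon> n) (\<lambda>z. g (x + \<epsilon> n *\<^sub>R z))"
        unfolding cont_supp_def
      proof (intro conjI allI impI)
        show "continuous_on UNIV (\<lambda>z. g (x + \<epsilon> n *\<^sub>R z))"
          by (intro continuous_on_compose2[OF contg] continuous_intros) auto
        fix z :: "real ^ 'd" assume "(R + norm x) / \<epsilon> n < norm z"
        then have "R + norm x < norm (\<epsilon> n *\<^sub>R z)" using \<epsilon>[of n] by (simp add: field_simps)
        moreover have "norm (\<epsilon> n *\<^sub>R z) \<le> norm (x + \<epsilon> n *\<^sub>R z) + norm x"
          by (metis add_diff_cancel_left' norm_triangle_ineq4)
        ultimately show "g (x + \<epsilon> n *\<^sub>R z) = 0" by (intro cont_suppD(2)[OF g]) linarith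
      qed
      show "integrable (lborel \<Otimes>\<^sub>M lborel) (\<lambda>(z, \<eta>). f z \<eta>)"
      proof (rule lborel_pair.Fubini_integrable)
        have "continuous_on UNIV (\<lambda>p. f (fst p) (snd p))"
          unfolding f_def by (intro continuous_intros continuous_on_compose2[OF contg]) auto
        then have "(\<lambda>p. f (fst p) (snd p)) \<in> borel_measurable borel"
          by (rule borel_measurable_continuous_onI)
        then show "(\<lambda>(z, \<eta>). f z \<eta>) \<in> borel_measurable (lborel \<Otimes>\<^sub>M lborel)"
          by (simp add: lborel_prod case_prod_beta')
        have "(LINT \<eta>|lborel. norm (case (z, \<eta>) of (z, \<eta>) => f z \<eta>)) = cmod (g (x + \<epsilon> n *\<^sub>R z)) * (LINT \<eta>|lborel. cmod (gauss (\<eta> :: real ^ 'd)))" for z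
          by (simp add: f_def norm_mult)
        then show "integrable lborel (\<lambda>z. LINT \<eta>|lborel. norm (case (z, \<eta>) of (z, \<eta>) => f z \<eta>))"
          using cont_supp_integrable[OF cg] by simp
        show "AE z in lborel. integrable lborel (\<lambda>\<eta>. case (z, \<eta>) of (z, \<eta>) => f z \<eta>)"
          unfolding f_def by (intro AE_I2) (simp only: prod.case, intro integrable_mult_right gauss_fourier(1))
      qed
    qed
    also have "(LINT z|lborel. (LINT \<eta>|lborel. f z \<eta>)) = (LINT z|lborel. of_real (sqrt (2 * pi) ^ CARD('d)) * (g (x + \<epsilon> n *\<^sub>R z) * gauss z))"
    proof -
      have "(LINT \<eta>|lborel. f z \<eta>) = of_real (sqrt (2 * pi) ^ CARD('d)) * (g (x + \<epsilon> n *\<^sub>R z) * gauss z)" for z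
        unfolding f_def integral_mult_right_zero gauss_fourier(2) by (simp only: mult_ac)
      then show ?thesis by (simp only:)
    qed
    finally show ?thesis by (simp only: integral_mult_right_zero of_real_1 mult_1)
  qed
  have "(\<lambda>n. LINT z|lborel. g (x + \<epsilon> n *\<^sub>R z) * gauss z) \<longlonglongrightarrow> (LINT z|lborel. g x * gauss (z :: real ^ 'd))"
  proof -
    have "bounded (g ` cball 0 R)"
      by (intro compact_imp_bounded compact_continuous_image cont_suppD(1)[OF g]) auto
    then obtain B0 where B0: "\<forall>z\<in>g ` cball 0 R. cmod z \<le> B0" unfolding bounded_iff by blast
    define B where "B = max B0 0"
    have B: "cmod (g x) \<le> B" for x
      using B0 cont_suppD(2)[OF g, of x] by (cases "norm x \<le> R") (auto simp: B_def le_max_iff_disj)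
    have mgauss1: "(gauss :: real ^ 'd => complex) \<in> borel_measurable borel"
      using mgauss[of 1] by simp
    show ?thesis
    proof (rule integral_dominated_convergence[where w = "\<lambda>z :: real ^ 'd. B * cmod (gauss z)"])
      show "(\<lambda>z :: real ^ 'd. g x * gauss z) \<in> borel_measurable lborel"
        unfolding measurable_lborel2 by (intro borel_measurable_times borel_measurable_const mgauss1)
      show "(\<lambda>z. g (x + \<epsilon> n *\<^sub>R z) * gauss z) \<in> borel_measurable lborel" for n
        unfolding measurable_lborel2
        by (intro measurable_cont continuous_intros continuous_on_compose2[OF contg]) auto
      show "integrable lborel (\<lambda>z :: real ^ 'd. B * cmod (gauss z))"
        by (intro integrable_mult_right integrable_norm gauss_integral)
      show "AE z in lborel. (\<lambda>n. g (x + \<epsilon> n *\<^sub>R z) * gauss z) \<longlonglongrightarrow> g x * gauss z"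
      proof (rule AE_I2)
        fix z
        have "(\<lambda>n. x + \<epsilon> n *\<^sub>R z) \<longlonglongrightarrow> x + 0 *\<^sub>R z" by (intro tendsto_intros \<epsilon>0)
        from continuous_on_tendsto_compose[OF contg this]
        have "(\<lambda>n. g (x + \<epsilon> n *\<^sub>R z)) \<longlonglongrightarrow> g (x + 0 *\<^sub>R z)" by simp
        from tendsto_mult_right[OF this, of "gauss z"]
        show "(\<lambda>n. g (x + \<epsilon> n *\<^sub>R z) * gauss z) \<longlonglongrightarrow> g x * gauss z" by simp
      qed
      show "AE z in lborel. norm (g (x + \<epsilon> n *\<^sub>R z) * gauss z) \<le> B * cmod (gauss z)" for n
        using B by (intro AE_I2) (simp add: norm_mult mult_right_mono)
    qed
  qed
  then have "I \<longlonglongrightarrow> of_real (sqrt (2 * pi) ^ CARD('d)) * (LINT z|lborel. g x * gauss (z :: real ^ 'd))"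
    unfolding I[abs_def] by (rule tendsto_mult_left)
  also have "of_real (sqrt (2 * pi) ^ CARD('d)) * (LINT z|lborel. g x * gauss (z :: real ^ 'd)) =
      of_real (sqrt (2 * pi) ^ CARD('d) * sqrt (2 * pi) ^ CARD('d)) * g x"
    unfolding integral_mult_right_zero gauss_integral(2) of_real_mult by (simp only: mult_ac)
  also have "sqrt (2 * pi) ^ CARD('d) * sqrt (2 * pi) ^ CARD('d) = (2 * pi) ^ CARD('d)"
    unfolding power_mult_distrib[symmetric] by (subst real_sqrt_mult_self) simp
  finally show ?thesis using LIMSEQ_unique[OF lim1] by (simp add: G_def)
qed

section \<open>Oscillatory integrals\<close>

text \<open>A real frequency moved off the real space by \<open>- \<i> v\<close>. The exponential
  then grows like \<open>exp (v \<bullet> x)\<close>, and along \<open>v = t \<eta>\<close> the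
  conjugate frequency is an affine function of \<open>t\<close>.\<close>

definition zeta :: "real ^ 'd => real ^ 'd => complex ^ 'd::finite" where
  "zeta v \<xi> = (\<chi> j. of_real (\<xi> $ j) - \<i> * of_real (v $ j))"

text \<open>A product of one-variable weights instead of a power of the norm, so that integrability
  reduces to dimension one by \<open>lborel_prod_integral\<close>. It costs two derivatives in each
  variable, whence the number \<open>2 * CARD('d)\<close> below.\<close>

definition weight :: "real ^ 'd::finite => real" where
  "weight \<xi> = (\<Prod>j\<in>UNIV. inverse (1 + (\<xi> $ j)\<^sup>2))"

lemma weight_pos: "weight \<xi> > 0"
  unfolding weight_def by (intro prod_pos) (auto intro!: add_pos_nonneg)

lemma integrable_weight: "integrable lborel (weight :: real ^ 'd::finite => real)"
proof -
  have "integrable lborel (\<lambda>t::real. inverse (1 + t\<^sup>2))"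
    using integrable_inverse_1_plus_square by (simp add: set_integrable_def)
  then have "integrable lborel (\<lambda>t::real. complex_of_real (inverse (1 + t\<^sup>2)))"
    by (rule integrable_of_real)
  from lborel_prod_integral(1)[of "\<lambda>(j::'d) t. complex_of_real (inverse (1 + t\<^sup>2))", OF this]
  have "integrable lborel (\<lambda>x :: real ^ 'd. complex_of_real (weight x))"
    by (simp add: weight_def)
  then show ?thesis by (simp only: complex_of_real_integrable_eq)
qed

lemma dotc_zeta: "\<i> * dotc (zeta v \<xi>) x = of_real (v \<bullet> x) + \<i> * of_real (\<xi> \<bullet> x)"
proof -
  have "dotc (zeta v \<xi>) x = (\<Sum>j\<in>UNIV. of_real (\<xi> $ j * x $ j) - \<i> * of_real (v $ j * x $ j))"
    unfolding dotc_def zeta_def by (intro sum.cong) (auto simp: algebra_simps)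
  also have "\<dots> = of_real (\<xi> \<bullet> x) - \<i> * of_real (v \<bullet> x)"
    by (simp add: sum_subtractf inner_vec_def sum_distrib_left)
  finally have "\<i> * dotc (zeta v \<xi>) x = \<i> * (of_real (\<xi> \<bullet> x) - \<i> * of_real (v \<bullet> x))" by (simp only:)
  then show ?thesis by (simp add: right_diff_distrib)
qed

lemma norm_exp_dotc_zeta: "cmod (exp (\<i> * dotc (zeta v \<xi>) x)) = exp (v \<bullet> x)"
  by (simp add: dotc_zeta)

lemma norm_exp_neg_dotc_zeta: "cmod (exp (- \<i> * dotc (zeta v \<xi>) x)) = exp (- (v \<bullet> x))"
  using dotc_zeta[of v \<xi> x] by (simp add: norm_exp_eq_Re)

lemma zeta_component_ge: "\<bar>\<xi> $ j\<bar> \<le> cmod (zeta v \<xi> $ j)"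
  using abs_Re_le_cmod[of "zeta v \<xi> $ j"] by (simp add: zeta_def)

lemma cont_supp_jet:
  assumes "smooth_on UNIV w" "\<And>a x. R < norm x ==> w a x = 0"
  shows "cont_supp R (w a)"
  using assms smooth_on_continuous_on[OF assms(1)] by (auto simp: cont_supp_def)

text \<open>Expand the product of the factors \<open>(cmod (zeta v \<xi> $ j))\<^sup>2 + 1\<close>
  over subsets of the coordinates. Each of the \<open>2 ^ CARD('d)\<close> terms is the transform of
  a derivative of order at most \<open>2 * CARD('d)\<close> and is bounded by the supremum of that
  derivative times a volume. The constant precedes \<open>w\<close>, \<open>B\<close>,
  \<open>b\<close> and \<open>\<xi>\<close>, which later makes the solution operator
  continuous.\<close>

lemma fourier_decay:
  fixes v :: "real ^ 'd::finite"
  shows "\<exists>C\<ge>0. \<forall>w B b \<xi>. smooth_on UNIV w --> (\<forall>a x. R < norm x --> w a x = 0) -->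
     (\<forall>a x. mi_size a \<le> 2 * CARD('d) --> cmod (w (b + a) x) \<le> B) -->
     cmod (fourier (w b) (zeta v \<xi>)) \<le> C * B * weight \<xi>"
proof (intro exI conjI allI impI)
  let ?V = "exp (norm v * \<bar>R\<bar>) * measure lborel (cball (0 :: real ^ 'd) R)"
  let ?C = "2 ^ CARD('d) * ?V"
  show "?C \<ge> 0" by simp
  fix w :: "'d jet" and B b \<xi>
  assume w: "smooth_on UNIV w" and supp: "\<forall>a x. R < norm x --> w a x = 0"
    and B: "\<forall>a x. mi_size a \<le> 2 * CARD('d) --> cmod (w (b + a) x) \<le> B"
  have bd: "cmod (fourier (w (b + a)) (zeta v \<xi>)) \<le> B * ?V" if "mi_size a \<le> 2 * CARD('d)" for a
  proof -
    have "cmod (LINT x|lborel. w (b + a) x * exp (- \<i> * dotc (zeta v \<xi>) x))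
       \<le> (B * exp (norm v * \<bar>R\<bar>)) * measure lborel (cball (0 :: real ^ 'd) R)"
    proof (rule cont_supp_integral_bound)
      show "cont_supp R (\<lambda>x. w (b + a) x * exp (- \<i> * dotc (zeta v \<xi>) x))"
        using supp by (intro cont_supp_mult cont_supp_jet w continuous_intros) auto
      fix x :: "real ^ 'd" assume x: "norm x \<le> R"
      have "- (v \<bullet> x) \<le> norm v * norm x" using norm_cauchy_schwarz[of "- v" x] by simp
      also have "\<dots> \<le> norm v * \<bar>R\<bar>" using x by (intro mult_left_mono) auto
      finally have "exp (- (v \<bullet> x)) \<le> exp (norm v * \<bar>R\<bar>)" by simp
      moreover have "0 \<le> B" using B that norm_ge_zero order_trans by blast
      ultimately show "cmod (w (b + a) x * exp (- \<i> * dotc (zeta v \<xi>) x)) \<le> B * exp (norm v * \<bar>R\<bar>)"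
        using B that unfolding norm_mult norm_exp_neg_dotc_zeta by (intro mult_mono) auto
    qed
    then show ?thesis by (simp add: fourier_def mult.assoc)
  qed
  have "(\<Prod>j\<in>UNIV. (cmod (zeta v \<xi> $ j))\<^sup>2 + 1) * cmod (fourier (w b) (zeta v \<xi>)) =
     (\<Sum>S\<in>Pow UNIV. (\<Prod>j\<in>S. (cmod (zeta v \<xi> $ j))\<^sup>2) * cmod (fourier (w b) (zeta v \<xi>)))"
    by (subst prod_add) (simp_all add: sum_distrib_right)
  also have "\<dots> \<le> (\<Sum>S\<in>Pow (UNIV :: 'd set). B * ?V)"
  proof (rule sum_mono)
    fix S :: "'d set"
    define a :: "'d multi_index" where "a = (\<chi> j. if j \<in> S then 2 else 0)"
    have "mi_size a = (\<Sum>j\<in>S. 2)" unfolding mi_size_def a_def by (simp add: sum.If_cases)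
    also have "\<dots> \<le> 2 * CARD('d)" by (simp add: card_mono)
    finally have "cmod (fourier (w (b + a)) (zeta v \<xi>)) \<le> B * ?V" by (rule bd)
    moreover have "cmod (fourier (w (b + a)) (zeta v \<xi>)) = (\<Prod>j\<in>UNIV. cmod (zeta v \<xi> $ j) ^ (a $ j)) * cmod (fourier (w b) (zeta v \<xi>))"
      using fourier_mono[OF w, of R b a] supp by (simp add: norm_mult norm_power prod_norm[symmetric])
    moreover have "(\<Prod>j\<in>UNIV. cmod (zeta v \<xi> $ j) ^ (a $ j)) = (\<Prod>j\<in>S. (cmod (zeta v \<xi> $ j))\<^sup>2)"
    proof -
      have "(\<Prod>j\<in>UNIV. cmod (zeta v \<xi> $ j) ^ (a $ j)) = (\<Prod>j\<in>UNIV. if j \<in> S then (cmod (zeta v \<xi> $ j))\<^sup>2 else 1)"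
        by (intro prod.cong) (auto simp: a_def)
      then show ?thesis by (simp add: prod.If_cases)
    qed
    ultimately show "(\<Prod>j\<in>S. (cmod (zeta v \<xi> $ j))\<^sup>2) * cmod (fourier (w b) (zeta v \<xi>)) \<le> B * ?V" by simp
  qed
  also have "\<dots> = ?C * B" by (simp add: card_Pow)
  finally have 1: "(\<Prod>j\<in>UNIV. (cmod (zeta v \<xi> $ j))\<^sup>2 + 1) * cmod (fourier (w b) (zeta v \<xi>)) \<le> ?C * B" .
  have "(\<Prod>j\<in>UNIV. 1 + (\<xi> $ j)\<^sup>2) \<le> (\<Prod>j\<in>UNIV. (cmod (zeta v \<xi> $ j))\<^sup>2 + 1)"
  proof (intro prod_mono conjI)
    fix j
    show "1 + (\<xi> $ j)\<^sup>2 \<le> (cmod (zeta v \<xi> $ j))\<^sup>2 + 1"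
      using power_mono[OF zeta_component_ge[of \<xi> j v] abs_ge_zero, of 2] by simp
  qed auto
  then have "(\<Prod>j\<in>UNIV. 1 + (\<xi> $ j)\<^sup>2) * cmod (fourier (w b) (zeta v \<xi>)) \<le>
      (\<Prod>j\<in>UNIV. (cmod (zeta v \<xi> $ j))\<^sup>2 + 1) * cmod (fourier (w b) (zeta v \<xi>))"
    by (rule mult_right_mono) simp
  moreover have "weight \<xi> = inverse (\<Prod>j\<in>UNIV. 1 + (\<xi> $ j)\<^sup>2)"
    by (simp add: weight_def inverse_eq_divide prod_dividef)
  ultimately have "inverse (weight \<xi>) * cmod (fourier (w b) (zeta v \<xi>)) \<le> ?C * B"
    using 1 by simp
  then show "cmod (fourier (w b) (zeta v \<xi>)) \<le> ?C * B * weight \<xi>"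
    using weight_pos[of \<xi>] by (simp add: field_simps)
qed

lemma measurable_fourier_zeta:
  assumes "cont_supp R g"
  shows "(\<lambda>\<xi>. fourier g (zeta v \<xi>)) \<in> borel_measurable borel"
proof -
  have "continuous_on UNIV (\<lambda>p. g (snd p) * exp (- (of_real (v \<bullet> snd p) + \<i> * of_real (fst p \<bullet> snd p))))"
    by (intro continuous_intros continuous_on_compose2[OF cont_suppD(1)[OF assms]]) auto
  then have "(\<lambda>p. g (snd p) * exp (- (of_real (v \<bullet> snd p) + \<i> * of_real (fst p \<bullet> snd p)))) \<in> borel_measurable borel"
    by (rule borel_measurable_continuous_onI)
  then have "(\<lambda>(\<xi>, x). g x * exp (- (of_real (v \<bullet> x) + \<i> * of_real (\<xi> \<bullet> x)))) \<in> borel_measurable (lborel \<Otimes>\<^sub>M lborel)"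
    by (simp add: lborel_prod case_prod_beta')
  from lborel.borel_measurable_lebesgue_integral[OF this]
  show ?thesis unfolding fourier_def dotc_zeta[symmetric] by simp
qed

text \<open>The multiplier \<open>h\<close> is arbitrary, so the integral below is a Fourier multiplier applied to \<open>w\<close>.\<close>

definition osc :: "(real ^ 'd => complex) => real ^ 'd => (real ^ 'd::finite => complex) => real ^ 'd => complex" where
  "osc h v g x = (LINT \<xi>|lborel. h \<xi> * fourier g (zeta v \<xi>) * exp (\<i> * dotc (zeta v \<xi>) x))"

lemma continuous_exp_dotc_zeta: "continuous_on UNIV (\<lambda>\<xi>. exp (\<i> * dotc (zeta v \<xi>) x))"
  unfolding dotc_zeta by (intro continuous_intros)

context
  fixes w :: "'d::finite jet" and R :: real and h :: "real ^ 'd => complex"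
  assumes w: "smooth_on UNIV w" and supp: "\<And>a x. R < norm x ==> w a x = 0"
    and h: "h \<in> borel_measurable borel" "\<And>\<xi>. cmod (h \<xi>) \<le> 1"
begin

lemma fourier_deriv': "fourier (w (a + axis j (Suc 0))) \<zeta> = \<i> * \<zeta> $ j * fourier (w a) \<zeta>"
  by (rule fourier_deriv[OF w]) (rule supp)

lemma jet_derivatives_bounded: "\<exists>B. \<forall>a x. mi_size a \<le> n --> cmod (w (b + a) x) \<le> B"
proof -
  have "\<exists>B\<ge>0. \<forall>x. cmod (w a x) \<le> B" for a
  proof -
    have "bounded (w a ` cball 0 R)"
      by (intro compact_imp_bounded compact_continuous_image smooth_on_continuous_on[OF smooth_on_subset[OF w]]) auto
    then obtain B where B: "\<forall>z\<in>w a ` cball 0 R. cmod z \<le> B" unfolding bounded_iff by blast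
    have "cmod (w a x) \<le> max B 0" for x
      using B supp[of x a] by (cases "norm x \<le> R") (auto simp: le_max_iff_disj)
    then show ?thesis by (intro exI[of _ "max B 0"]) auto
  qed
  then obtain B where B: "\<And>a. B a \<ge> 0" "\<And>a x. cmod (w a x) \<le> B a" by metis
  have "cmod (w (b + a) x) \<le> (\<Sum>a | mi_size a \<le> n. B (b + a))" if "mi_size a \<le> n" for a x
    using member_le_sum[of a "{a. mi_size a \<le> n}" "\<lambda>a. B (b + a)"] that B(1) B(2)[of "b + a" x]
    by (auto simp: finite_mi_size_le intro: order_trans)
  then show ?thesis by blast
qed

lemma fourier_weight_bound: "\<exists>C\<ge>0. \<forall>\<xi>. cmod (fourier (w b) (zeta v \<xi>)) \<le> C * weight \<xi>"
proof -
  obtain C where C: "C \<ge> 0" "\<forall>w B b \<xi>. smooth_on UNIV w --> (\<forall>a x. R < norm x --> w a x = 0) -->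
     (\<forall>a x. mi_size a \<le> 2 * CARD('d) --> cmod (w (b + a) x) \<le> B) -->
     cmod (fourier (w b) (zeta v \<xi>)) \<le> C * B * weight \<xi>"
    using fourier_decay[of R v] by blast
  obtain B where B: "\<forall>a x. mi_size a \<le> 2 * CARD('d) --> cmod (w (b + a) x) \<le> B"
    using jet_derivatives_bounded by blast
  then have "0 \<le> B" by (metis mi_size_0 norm_ge_zero order_trans zero_le)
  moreover have "\<forall>\<xi>. cmod (fourier (w b) (zeta v \<xi>)) \<le> C * B * weight \<xi>"
    using C(2) w supp B by blast
  ultimately show ?thesis using C(1) by (intro exI[of _ "C * B"]) auto
qed

lemma osc_measurable:
  "(\<lambda>\<xi>. h \<xi> * fourier (w b) (zeta v \<xi>) * exp (\<i> * dotc (zeta v \<xi>) x)) \<in> borel_measurable borel"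
  by (intro borel_measurable_times h measurable_fourier_zeta[OF cont_supp_jet[OF w supp]]
      measurable_cont continuous_exp_dotc_zeta)

lemma osc_norm_le:
  assumes "\<And>\<xi>. cmod (fourier (w b) (zeta v \<xi>)) \<le> C * weight \<xi>"
  shows "cmod (h \<xi> * fourier (w b) (zeta v \<xi>) * exp (\<i> * dotc (zeta v \<xi>) x)) \<le> C * exp (v \<bullet> x) * weight \<xi>"
proof -
  have "cmod (h \<xi> * fourier (w b) (zeta v \<xi>) * exp (\<i> * dotc (zeta v \<xi>) x)) =
     cmod (h \<xi>) * (cmod (fourier (w b) (zeta v \<xi>)) * exp (v \<bullet> x))"
    by (simp only: norm_mult norm_exp_dotc_zeta mult.assoc)
  also have "\<dots> \<le> 1 * ((C * weight \<xi>) * exp (v \<bullet> x))"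
    using h assms by (intro mult_mono) (auto intro: order_trans[OF norm_ge_zero])
  finally show ?thesis by (simp add: mult_ac)
qed

lemma osc_integrable:
  "integrable lborel (\<lambda>\<xi>. h \<xi> * fourier (w b) (zeta v \<xi>) * exp (\<i> * dotc (zeta v \<xi>) x))"
proof -
  obtain C where C: "C \<ge> 0" "\<And>\<xi>. cmod (fourier (w b) (zeta v \<xi>)) \<le> C * weight \<xi>"
    using fourier_weight_bound by blast
  show ?thesis
  proof (rule Bochner_Integration.integrable_bound[OF integrable_mult_right[OF integrable_weight, of "C * exp (v \<bullet> x)"]])
    show "AE \<xi> in lborel. norm (h \<xi> * fourier (w b) (zeta v \<xi>) * exp (\<i> * dotc (zeta v \<xi>) x)) \<le> norm (C * exp (v \<bullet> x) * weight \<xi>)"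
    proof (rule AE_I2)
      fix \<xi> :: "real ^ 'd"
      have "C * exp (v \<bullet> x) * weight \<xi> \<ge> 0" using C(1) weight_pos[of \<xi>] by simp
      then show "norm (h \<xi> * fourier (w b) (zeta v \<xi>) * exp (\<i> * dotc (zeta v \<xi>) x)) \<le> norm (C * exp (v \<bullet> x) * weight \<xi>)"
        using osc_norm_le[OF C(2), of \<xi> x] by simp
    qed
  qed (use osc_measurable in simp)
qed

lemma osc_bound:
  assumes "\<And>\<xi>. cmod (fourier (w b) (zeta v \<xi>)) \<le> C * weight \<xi>"
  shows "cmod (osc h v (w b) x) \<le> C * exp (v \<bullet> x) * (LINT \<xi>|lborel. weight (\<xi> :: real ^ 'd))"
proof -
  have "cmod (osc h v (w b) x) \<le> (LINT \<xi>|lborel. cmod (h \<xi> * fourier (w b) (zeta v \<xi>) * exp (\<i> * dotc (zeta v \<xi>) x)))"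
    unfolding osc_def by (rule integral_norm_bound)
  also have "\<dots> \<le> (LINT \<xi>|lborel. (C * exp (v \<bullet> x)) * weight (\<xi> :: real ^ 'd))"
    using osc_norm_le[OF assms]
    by (intro integral_mono integrable_norm osc_integrable integrable_mult_right integrable_weight) auto
  finally show ?thesis by simp
qed

text \<open>Differentiation under the integral by an explicit remainder: the second-order error of
  the exponential contributes the square of the frequency, and two further derivatives of
  \<open>w\<close> absorb it. The difference from the linear part is therefore at most
  \<open>K * (norm u)\<^sup>2\<close>.\<close>

lemma smooth_on_osc: "smooth_on UNIV (\<lambda>b. osc h v (w b))"
  unfolding smooth_on_def
proof (intro allI ballI)
  fix b x
  let ?E = "\<lambda>\<xi>. h \<xi> * fourier (w b) (zeta v \<xi>) * exp (\<i> * dotc (zeta v \<xi>) x)"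
  let ?L = "\<lambda>u. \<Sum>j\<in>UNIV. u $ j *\<^sub>R osc h v (w (b + axis j (Suc 0))) x"
  have "\<exists>C\<ge>0. \<forall>\<xi>. cmod (fourier (w (b + axis j (Suc 0) + axis j (Suc 0))) (zeta v \<xi>)) \<le> C * weight \<xi>" for j
    by (rule fourier_weight_bound)
  then obtain C where C: "\<And>j. C j \<ge> 0"
    "\<And>j \<xi>. cmod (fourier (w (b + axis j (Suc 0) + axis j (Suc 0))) (zeta v \<xi>)) \<le> C j * weight \<xi>" by metis
  define d where "d = real CARD('d)"
  define K where "K = d * (\<Sum>j\<in>UNIV. C j) * exp (v \<bullet> x) * exp (norm v) * (LINT \<xi>|lborel. weight (\<xi> :: real ^ 'd))"
  have L: "?L u = (LINT \<xi>|lborel. ?E \<xi> * (\<i> * dotc (zeta v \<xi>) u))" for u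
  proof -
    have "?L u = (\<Sum>j\<in>UNIV. LINT \<xi>|lborel. of_real (u $ j) * (h \<xi> * fourier (w (b + axis j (Suc 0))) (zeta v \<xi>) * exp (\<i> * dotc (zeta v \<xi>) x)))"
      unfolding osc_def scaleR_conv_of_real[where 'a = complex] by (simp only: integral_mult_right_zero)
    also have "\<dots> = (LINT \<xi>|lborel. (\<Sum>j\<in>UNIV. of_real (u $ j) * (h \<xi> * fourier (w (b + axis j (Suc 0))) (zeta v \<xi>) * exp (\<i> * dotc (zeta v \<xi>) x))))"
      by (rule Bochner_Integration.integral_sum[symmetric]) (intro integrable_mult_right osc_integrable)
    also have "(\<lambda>\<xi>. \<Sum>j\<in>UNIV. of_real (u $ j) * (h \<xi> * fourier (w (b + axis j (Suc 0))) (zeta v \<xi>) * exp (\<i> * dotc (zeta v \<xi>) x)))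
       = (\<lambda>\<xi>. ?E \<xi> * (\<i> * dotc (zeta v \<xi>) u))"
      unfolding fourier_deriv' dotc_def[of _ u] by (simp add: sum_distrib_left sum_distrib_right mult_ac)
    finally show ?thesis .
  qed
  have intL: "integrable lborel (\<lambda>\<xi>. ?E \<xi> * (\<i> * dotc (zeta v \<xi>) u))" for u
  proof -
    have "(\<lambda>\<xi>. ?E \<xi> * (\<i> * dotc (zeta v \<xi>) u)) =
       (\<lambda>\<xi>. \<Sum>j\<in>UNIV. of_real (u $ j) * (h \<xi> * fourier (w (b + axis j (Suc 0))) (zeta v \<xi>) * exp (\<i> * dotc (zeta v \<xi>) x)))"
      unfolding fourier_deriv' dotc_def[of _ u] by (simp add: sum_distrib_left sum_distrib_right mult_ac)
    then show ?thesis by (simp only:) (intro Bochner_Integration.integrable_sum integrable_mult_right osc_integrable)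
  qed
  have rem: "cmod (osc h v (w b) (x + u) - osc h v (w b) x - ?L u) \<le> K * (norm u)\<^sup>2" if u: "norm u \<le> 1" for u
  proof -
    let ?r = "\<lambda>\<xi>. exp (\<i> * dotc (zeta v \<xi>) u) - 1 - \<i> * dotc (zeta v \<xi>) u"
    have eq: "h \<xi> * fourier (w b) (zeta v \<xi>) * exp (\<i> * dotc (zeta v \<xi>) (x + u)) - ?E \<xi> - ?E \<xi> * (\<i> * dotc (zeta v \<xi>) u) = ?E \<xi> * ?r \<xi>" for \<xi>
      by (simp add: dotc_add distrib_left exp_add algebra_simps)
    have int: "integrable lborel (\<lambda>\<xi>. ?E \<xi> * ?r \<xi>)"
      unfolding eq[symmetric] by (intro Bochner_Integration.integrable_diff osc_integrable intL)
    have "osc h v (w b) (x + u) - osc h v (w b) x - ?L u = (LINT \<xi>|lborel. ?E \<xi> * ?r \<xi>)"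
    proof -
      let ?A = "\<lambda>\<xi>. h \<xi> * fourier (w b) (zeta v \<xi>) * exp (\<i> * dotc (zeta v \<xi>) (x + u))"
      have "(LINT \<xi>|lborel. ?A \<xi> - ?E \<xi> - ?E \<xi> * (\<i> * dotc (zeta v \<xi>) u)) =
         (LINT \<xi>|lborel. ?A \<xi> - ?E \<xi>) - (LINT \<xi>|lborel. ?E \<xi> * (\<i> * dotc (zeta v \<xi>) u))"
        by (rule Bochner_Integration.integral_diff[OF Bochner_Integration.integrable_diff[OF osc_integrable osc_integrable] intL])
      also have "(LINT \<xi>|lborel. ?A \<xi> - ?E \<xi>) = (LINT \<xi>|lborel. ?A \<xi>) - (LINT \<xi>|lborel. ?E \<xi>)"
        by (rule Bochner_Integration.integral_diff[OF osc_integrable osc_integrable])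
      finally show ?thesis unfolding L eq by (simp only: osc_def)
    qed
    then have "cmod (osc h v (w b) (x + u) - osc h v (w b) x - ?L u) \<le> (LINT \<xi>|lborel. cmod (?E \<xi> * ?r \<xi>))"
      by (simp only: integral_norm_bound)
    also have "\<dots> \<le> (LINT \<xi>|lborel. (d * (\<Sum>j\<in>UNIV. C j) * exp (v \<bullet> x) * exp (norm v) * (norm u)\<^sup>2) * weight (\<xi> :: real ^ 'd))"
    proof (intro integral_mono integrable_norm int integrable_mult_right integrable_weight)
      fix \<xi> :: "real ^ 'd"
      let ?F = "cmod (fourier (w b) (zeta v \<xi>))"
      have "cmod (?r \<xi>) \<le> exp \<bar>Re (\<i> * dotc (zeta v \<xi>) u)\<bar> * (cmod (\<i> * dotc (zeta v \<xi>) u))\<^sup>2"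
        using Taylor_exp[of "\<i> * dotc (zeta v \<xi>) u" 1] by (simp add: power2_eq_square diff_diff_eq)
      also have "\<bar>Re (\<i> * dotc (zeta v \<xi>) u)\<bar> \<le> norm v"
      proof -
        have "\<bar>v \<bullet> u\<bar> \<le> norm v * norm u" by (rule Cauchy_Schwarz_ineq2)
        also have "\<dots> \<le> norm v * 1" using u by (intro mult_left_mono) auto
        finally show ?thesis unfolding dotc_zeta by simp
      qed
      then have "exp \<bar>Re (\<i> * dotc (zeta v \<xi>) u)\<bar> * (cmod (\<i> * dotc (zeta v \<xi>) u))\<^sup>2 \<le> exp (norm v) * (cmod (\<i> * dotc (zeta v \<xi>) u))\<^sup>2"
        by (intro mult_right_mono) auto
      also have "(cmod (\<i> * dotc (zeta v \<xi>) u))\<^sup>2 \<le> d * (norm u)\<^sup>2 * (\<Sum>j\<in>UNIV. (cmod (zeta v \<xi> $ j))\<^sup>2)"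
      proof -
        have "cmod (\<i> * dotc (zeta v \<xi>) u) \<le> norm u * (\<Sum>j\<in>UNIV. cmod (zeta v \<xi> $ j))"
        proof -
          have "cmod (dotc (zeta v \<xi>) u) \<le> (\<Sum>j\<in>UNIV. norm u * cmod (zeta v \<xi> $ j))"
            unfolding dotc_def
          proof (rule sum_norm_le)
            fix j
            show "cmod (zeta v \<xi> $ j * complex_of_real (u $ j)) \<le> norm u * cmod (zeta v \<xi> $ j)"
              using mult_right_mono[OF component_le_norm_cart[of u j], of "cmod (zeta v \<xi> $ j)"]
              by (simp add: norm_mult mult.commute)
          qed
          then show ?thesis by (simp add: norm_mult sum_distrib_left)
        qed
        then have "(cmod (\<i> * dotc (zeta v \<xi>) u))\<^sup>2 \<le> (norm u * (\<Sum>j\<in>UNIV. cmod (zeta v \<xi> $ j)))\<^sup>2"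
          by (intro power_mono) auto
        also have "\<dots> = (norm u)\<^sup>2 * (\<Sum>j\<in>UNIV. cmod (zeta v \<xi> $ j))\<^sup>2" by (rule power_mult_distrib)
        also have "\<dots> \<le> (norm u)\<^sup>2 * (d * (\<Sum>j\<in>UNIV. (cmod (zeta v \<xi> $ j))\<^sup>2))"
          unfolding d_def using sum_squared_le_sum_of_squares[of "\<lambda>j. cmod (zeta v \<xi> $ j)" UNIV]
          by (intro mult_left_mono) (auto simp: mult.commute)
        finally show ?thesis by (simp add: mult_ac)
      qed
      finally have r: "cmod (?r \<xi>) \<le> exp (norm v) * (d * (norm u)\<^sup>2 * (\<Sum>j\<in>UNIV. (cmod (zeta v \<xi> $ j))\<^sup>2))"
        by (simp add: mult_left_mono)
      \<comment> \<open>Each squared frequency component times the transform is the transform of a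
        second derivative, which again decays like \<open>weight\<close>.\<close>
      have F2: "(\<Sum>j\<in>UNIV. (cmod (zeta v \<xi> $ j))\<^sup>2) * ?F \<le> (\<Sum>j\<in>UNIV. C j) * weight \<xi>"
        unfolding sum_distrib_right
      proof (rule sum_mono)
        fix j
        have "(cmod (zeta v \<xi> $ j))\<^sup>2 * ?F = cmod (fourier (w (b + axis j (Suc 0) + axis j (Suc 0))) (zeta v \<xi>))"
          unfolding fourier_deriv' by (simp add: norm_mult power2_eq_square)
        then show "(cmod (zeta v \<xi> $ j))\<^sup>2 * ?F \<le> C j * weight \<xi>" using C(2) by simp
      qed
      have "cmod (?E \<xi>) \<le> ?F * exp (v \<bullet> x)"
        unfolding norm_mult norm_exp_dotc_zeta using h(2)[of \<xi>] by (intro mult_right_mono mult_left_le_one_le) auto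
      then have "cmod (?E \<xi> * ?r \<xi>) \<le> (?F * exp (v \<bullet> x)) * (exp (norm v) * (d * (norm u)\<^sup>2 * (\<Sum>j\<in>UNIV. (cmod (zeta v \<xi> $ j))\<^sup>2)))"
        unfolding norm_mult[of "?E \<xi>"] using r by (intro mult_mono) auto
      also have "\<dots> = (d * exp (v \<bullet> x) * exp (norm v) * (norm u)\<^sup>2) * ((\<Sum>j\<in>UNIV. (cmod (zeta v \<xi> $ j))\<^sup>2) * ?F)"
        by (simp only: mult_ac)
      also have "\<dots> \<le> (d * exp (v \<bullet> x) * exp (norm v) * (norm u)\<^sup>2) * ((\<Sum>j\<in>UNIV. C j) * weight \<xi>)"
        by (rule mult_left_mono[OF F2]) (simp add: d_def)
      finally show "cmod (?E \<xi> * ?r \<xi>) \<le> (d * (\<Sum>j\<in>UNIV. C j) * exp (v \<bullet> x) * exp (norm v) * (norm u)\<^sup>2) * weight \<xi>"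
        by (simp only: mult_ac)
    qed
    also have "\<dots> = K * (norm u)\<^sup>2" by (simp add: K_def)
    finally show ?thesis .
  qed
  show "(osc h v (w b) has_derivative ?L) (at x)"
    unfolding has_derivative_at
  proof (intro conjI)
    show "bounded_linear ?L"
      by (intro bounded_linear_sum bounded_linear_compose[OF bounded_linear_scaleR_left] bounded_linear_vec_nth)
    show "((\<lambda>u. norm (osc h v (w b) (x + u) - osc h v (w b) x - ?L u) / norm u) \<longlongrightarrow> 0) (at 0)"
    proof (rule Lim_null_comparison)
      have "\<forall>\<^sub>F u in at (0 :: real ^ 'd). norm u \<le> 1"
        unfolding eventually_at by (rule exI[of _ 1]) auto
      then show "\<forall>\<^sub>F u in at 0. norm (norm (osc h v (w b) (x + u) - osc h v (w b) x - ?L u) / norm u) \<le> K * norm u"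
      proof eventually_elim
        case (elim u)
        then show ?case using rem[of u] by (cases "u = 0") (auto simp: field_simps power2_eq_square)
      qed
      show "((\<lambda>u :: real ^ 'd. K * norm u) \<longlongrightarrow> 0) (at 0)"
        by (intro tendsto_mult_right_zero tendsto_norm_zero tendsto_ident_at)
    qed
  qed
qed

end

text \<open>The value does not depend on the shift \<open>v\<close>. Instead of moving a contour,
  Fourier inversion is applied to \<open>w b\<close> multiplied by
  \<open>exp (- (v \<bullet> y))\<close>, whose transform at real frequencies is that of
  \<open>w b\<close> at shifted ones.\<close>

lemma osc_one:
  assumes w: "smooth_on UNIV w" and supp: "\<And>a x. R < norm x ==> w a x = 0"
  shows "osc (\<lambda>_. 1) v (w b) x = of_real ((2 * pi) ^ CARD('d)) * w b (x :: real ^ 'd::finite)"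
proof -
  define g where "g = (\<lambda>y. w b y * of_real (exp (- (v \<bullet> y))))"
  have cg: "cont_supp R g" unfolding g_def
    by (intro cont_supp_mult cont_supp_jet w supp continuous_intros) auto
  have F: "fourier g (cvec \<xi>) = fourier (w b) (zeta v \<xi>)" for \<xi>
  proof -
    have "exp (- \<i> * dotc (zeta v \<xi>) y) = of_real (exp (- (v \<bullet> y))) * exp (- \<i> * dotc (cvec \<xi>) y)" for y
      using dotc_zeta[of v \<xi> y] by (simp add: dotc_cvec exp_of_real[symmetric] exp_add[symmetric])
    then show ?thesis by (simp add: fourier_def g_def mult.assoc)
  qed
  have "integrable lborel (\<lambda>\<xi>. 1 * fourier (w b) (zeta v \<xi>) * exp (\<i> * dotc (zeta v \<xi>) 0))"
    by (rule osc_integrable[OF w supp]) auto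
  then have "integrable lborel (\<lambda>\<xi>. fourier g (cvec \<xi>))" unfolding F by (simp add: dotc_def)
  from fourier_inversion[OF cg this, of x]
  have inv: "(LINT \<xi>|lborel. fourier (w b) (zeta v \<xi>) * exp (\<i> * of_real (\<xi> \<bullet> x))) = of_real ((2 * pi) ^ CARD('d)) * g x"
    unfolding F .
  have "osc (\<lambda>_. 1) v (w b) x = (LINT \<xi>|lborel. of_real (exp (v \<bullet> x)) * (fourier (w b) (zeta v \<xi>) * exp (\<i> * of_real (\<xi> \<bullet> x))))"
    unfolding osc_def dotc_zeta exp_add exp_of_real by (simp add: mult_ac)
  also have "\<dots> = of_real (exp (v \<bullet> x)) * (of_real ((2 * pi) ^ CARD('d)) * g x)"
    by (simp only: integral_mult_right_zero inv)
  also have "\<dots> = of_real ((2 * pi) ^ CARD('d)) * w b x"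
    by (simp add: g_def exp_minus)
  finally show ?thesis .
qed

section \<open>Solving constant coefficient equations\<close>

definition mpeval :: "('d::finite) mpoly => complex ^ 'd => complex" where
  "mpeval P \<zeta> = (\<Sum>a\<in>Poly_Mapping.keys P. Poly_Mapping.lookup P a * (\<Prod>j\<in>UNIV. \<zeta> $ j ^ (a $ j)))"

text \<open>Leading coefficients in Lagrange interpolation at the nodes \<open>0, ..., m\<close>:
  the weight \<open>a k\<close> is the reciprocal of the product of \<open>k - l\<close> over the
  other nodes \<open>l\<close>.\<close>

lemma top_coeff_interpolation:
  "\<exists>a :: nat => complex. \<forall>p. degree p \<le> m --> (\<Sum>k\<le>m. a k * poly p (of_nat k)) = coeff p m"
proof -
  define L where "L = (\<lambda>k. \<Prod>l\<in>{..m} - {k}. [:- of_nat l, 1 :: complex:])"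
  define a where "a = (\<lambda>k. 1 / poly (L k) (of_nat k))"
  have L_nz: "poly (L k) (of_nat k) \<noteq> 0" for k
    by (auto simp: L_def poly_prod)
  have L_z: "poly (L k) (of_nat i) = 0" if "i \<le> m" "i \<noteq> k" for i k
    using that by (auto simp: L_def poly_prod)
  have L_deg: "degree (L k) = m" if "k \<le> m" for k
    unfolding L_def using that by (subst degree_prod_eq_sum_degree) auto
  have L_lead: "coeff (L k) m = 1" if "k \<le> m" for k
  proof -
    have "lead_coeff (L k) = 1" unfolding L_def by (simp add: lead_coeff_prod)
    then show ?thesis using L_deg[OF that] by simp
  qed
  have "(\<Sum>k\<le>m. a k * poly p (of_nat k)) = coeff p m" if p: "degree p \<le> m" for p
  proof -
    define q where "q = p - (\<Sum>k\<le>m. smult (a k * poly p (of_nat k)) (L k))"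
    have "degree q \<le> m" unfolding q_def
      by (intro degree_diff_le p degree_sum_le) (auto intro: order_trans[OF degree_smult_le] simp: L_deg)
    moreover have "poly q (of_nat i) = 0" if "i \<le> m" for i
    proof -
      have "(\<Sum>k\<le>m. a k * poly p (of_nat k) * poly (L k) (of_nat i)) = (\<Sum>k\<le>m. if k = i then poly p (of_nat i) else 0)"
        using that L_z[of i] L_nz by (intro sum.cong) (auto simp: a_def)
      then show ?thesis using that by (simp add: q_def poly_sum)
    qed
    ultimately have "q = 0"
    proof -
      assume deg: "degree q \<le> m" and z: "\<And>i. i \<le> m ==> poly q (of_nat i) = 0"
      show "q = 0"
      proof (rule ccontr)
        assume "q \<noteq> 0"
        have "(of_nat :: nat => complex) ` {..m} \<subseteq> {x. poly q x = 0}" using z by auto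
        then have "card ((of_nat :: nat => complex) ` {..m}) \<le> card {x. poly q x = 0}"
          using poly_roots_finite[OF \<open>q \<noteq> 0\<close>] by (rule card_mono[rotated])
        also have "\<dots> \<le> degree q" by (rule card_poly_roots_bound[OF \<open>q \<noteq> 0\<close>])
        finally show False using deg by (simp add: card_image)
      qed
    qed
    then have "coeff p m = coeff (\<Sum>k\<le>m. smult (a k * poly p (of_nat k)) (L k)) m" by (simp add: q_def)
    also have "\<dots> = (\<Sum>k\<le>m. a k * poly p (of_nat k))"
      unfolding coeff_sum by (intro sum.cong) (auto simp: L_lead)
    finally show ?thesis by simp
  qed
  then show ?thesis by blast
qed

lemma cnj_zeta: "cnj (zeta (t *\<^sub>R \<eta>) \<xi> $ j) = zeta (t *\<^sub>R \<eta>) \<xi> $ j + 2 * \<i> * of_real t * of_real (\<eta> $ j)"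
  by (simp add: zeta_def algebra_simps)

text \<open>
  \<open>cnj \<zeta> = \<zeta> + 2 i t \<eta>\<close> turns the anti-holomorphic symbol into a differential operator whose
  coefficients are polynomials in the shift parameter \<open>t\<close>.
\<close>

lemma osc_cnj_monomial:
  fixes w :: "'d::finite jet"
  assumes w: "smooth_on UNIV w" and supp: "\<And>a x. R < norm x ==> w a x = 0"
  shows "\<exists>p. degree p \<le> mi_size a \<and>
     coeff p (mi_size a) = of_real ((2 * pi) ^ CARD('d)) * (\<Prod>j\<in>UNIV. (2 * \<i> * of_real (\<eta> $ j)) ^ (a $ j)) * w b x \<and>
     (\<forall>t. integrable lborel (\<lambda>\<xi>. (\<Prod>j\<in>UNIV. cnj (zeta (t *\<^sub>R \<eta>) \<xi> $ j) ^ (a $ j)) *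
            (fourier (w b) (zeta (t *\<^sub>R \<eta>) \<xi>) * exp (\<i> * dotc (zeta (t *\<^sub>R \<eta>) \<xi>) x))) \<and>
        (LINT \<xi>|lborel. (\<Prod>j\<in>UNIV. cnj (zeta (t *\<^sub>R \<eta>) \<xi> $ j) ^ (a $ j)) *
            (fourier (w b) (zeta (t *\<^sub>R \<eta>) \<xi>) * exp (\<i> * dotc (zeta (t *\<^sub>R \<eta>) \<xi>) x))) = poly p (of_real t))"
proof (induction a arbitrary: b rule: multi_index_induct)
  case zero
  have "integrable lborel (\<lambda>\<xi>. 1 * fourier (w b) (zeta v \<xi>) * exp (\<i> * dotc (zeta v \<xi>) x))" for v
    by (rule osc_integrable[OF w supp]) auto
  moreover have "osc (\<lambda>_. 1) v (w b) x = of_real ((2 * pi) ^ CARD('d)) * w b x" for v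
    by (rule osc_one[OF w supp])
  ultimately show ?case
    by (intro exI[of _ "[:of_real ((2 * pi) ^ CARD('d)) * w b x:]"]) (simp add: osc_def)
next
  case (add a j)
  define E where "E = (\<lambda>a b t \<xi>. (\<Prod>j\<in>UNIV. cnj (zeta (t *\<^sub>R \<eta>) \<xi> $ j) ^ (a $ j)) *
            (fourier (w b) (zeta (t *\<^sub>R \<eta>) \<xi>) * exp (\<i> * dotc (zeta (t *\<^sub>R \<eta>) \<xi>) x)))"
  obtain p0 where p0: "degree p0 \<le> mi_size a"
    "coeff p0 (mi_size a) = of_real ((2 * pi) ^ CARD('d)) * (\<Prod>j\<in>UNIV. (2 * \<i> * of_real (\<eta> $ j)) ^ (a $ j)) * w b x"
    "\<And>t. integrable lborel (E a b t)" "\<And>t. (LINT \<xi>|lborel. E a b t \<xi>) = poly p0 (of_real t)"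
    using add.IH[of b] unfolding E_def by blast
  obtain p1 where p1: "degree p1 \<le> mi_size a"
    "\<And>t. integrable lborel (E a (b + axis j (Suc 0)) t)" "\<And>t. (LINT \<xi>|lborel. E a (b + axis j (Suc 0)) t \<xi>) = poly p1 (of_real t)"
    using add.IH[of "b + axis j (Suc 0)"] unfolding E_def by blast
  \<comment> \<open>The new factor is \<open>cnj \<zeta>_j = \<zeta>_j + 2 \<i> t \<eta>_j\<close>.
    Its first part is \<open>- \<i>\<close> times a derivative and contributes \<open>p1\<close>
    without raising the degree; its second part multiplies \<open>p0\<close> by \<open>t\<close>. So
    the top coefficient comes from \<open>p0\<close> alone.\<close>
  define p where "p = smult (- \<i>) p1 + pCons 0 (smult (2 * \<i> * of_real (\<eta> $ j)) p0)"
  have prod: "(\<Prod>i\<in>UNIV. z i ^ ((a + axis j (Suc 0)) $ i)) = (\<Prod>i\<in>UNIV. z i ^ (a $ i)) * z j" for z :: "'d => complex"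
  proof -
    have "(\<Prod>i\<in>UNIV. z i ^ ((a + axis j (Suc 0)) $ i)) = (\<Prod>i\<in>UNIV. z i ^ (a $ i) * (if i = j then z i else 1))"
      by (intro prod.cong) (auto simp: axis_def)
    then show ?thesis by (simp add: prod.distrib)
  qed
  have E: "E (a + axis j (Suc 0)) b t \<xi> = (- \<i>) * E a (b + axis j (Suc 0)) t \<xi> + (2 * \<i> * of_real t * of_real (\<eta> $ j)) * E a b t \<xi>" for t \<xi>
  proof -
    have "fourier (w (b + axis j (Suc 0))) (zeta (t *\<^sub>R \<eta>) \<xi>) = \<i> * zeta (t *\<^sub>R \<eta>) \<xi> $ j * fourier (w b) (zeta (t *\<^sub>R \<eta>) \<xi>)"
      by (rule fourier_deriv[OF w]) (rule supp)
    then show ?thesis unfolding E_def prod cnj_zeta[of _ _ _ j] by (simp add: algebra_simps)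
  qed
  have deg: "degree p \<le> Suc (mi_size a)"
    unfolding p_def using p0(1) p1(1)
    by (intro degree_add_le) (auto intro!: order_trans[OF degree_smult_le] order_trans[OF degree_pCons_le])
  have cf: "coeff p (Suc (mi_size a)) = of_real ((2 * pi) ^ CARD('d)) *
      (\<Prod>i\<in>UNIV. (2 * \<i> * of_real (\<eta> $ i)) ^ ((a + axis j (Suc 0)) $ i)) * w b x"
    using p1(1) unfolding p_def prod by (simp add: coeff_eq_0 p0(2))
  have "integrable lborel (E (a + axis j (Suc 0)) b t)" for t
    unfolding E[abs_def] by (intro Bochner_Integration.integrable_add integrable_mult_right p0 p1)
  moreover have "(LINT \<xi>|lborel. E (a + axis j (Suc 0)) b t \<xi>) = poly p (of_real t)" for t
  proof -
    have "(LINT \<xi>|lborel. E (a + axis j (Suc 0)) b t \<xi>) =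
      (LINT \<xi>|lborel. (- \<i>) * E a (b + axis j (Suc 0)) t \<xi>) + (LINT \<xi>|lborel. (2 * \<i> * of_real t * of_real (\<eta> $ j)) * E a b t \<xi>)"
      unfolding E by (intro Bochner_Integration.integral_add integrable_mult_right p0 p1)
    then show ?thesis unfolding integral_mult_right_zero p0(4) p1(3) by (simp add: p_def mult_ac)
  qed
  ultimately show ?case
    using deg cf unfolding mi_size_add_axis E_def by (intro exI[of _ p]) blast
qed

lemma mi_size_prod_const: "(\<Prod>j\<in>UNIV. c ^ (a $ j)) = (c :: complex) ^ mi_size a"
  by (simp add: mi_size_def power_sum)

lemma jet_op_eq: "jet_op P f b x = (\<Sum>a\<in>Poly_Mapping.keys P. Poly_Mapping.lookup P a * ((- \<i>) ^ mi_size a * f (b + a) x))"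
  by (simp add: jet_op_def mi_iterate_jet_D)

lemma fourier_jet_op:
  fixes w :: "'d::finite jet"
  assumes w: "smooth_on UNIV w" and supp: "\<And>a x. R < norm x ==> w a x = 0"
  shows "(\<Sum>a\<in>Poly_Mapping.keys P. Poly_Mapping.lookup P a * ((- \<i>) ^ mi_size a * fourier (w (b + a)) \<zeta>)) = mpeval P \<zeta> * fourier (w b) \<zeta>"
proof -
  have "(- \<i>) ^ mi_size a * fourier (w (b + a)) \<zeta> = (\<Prod>j\<in>UNIV. \<zeta> $ j ^ (a $ j)) * fourier (w b) \<zeta>" for a
  proof -
    have "fourier (w (b + a)) \<zeta> = (\<Prod>j\<in>UNIV. (\<i> * \<zeta> $ j) ^ (a $ j)) * fourier (w b) \<zeta>"
      by (rule fourier_mono[OF w]) (rule supp)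
    moreover have "(\<Prod>j\<in>UNIV. (\<i> * \<zeta> $ j) ^ (a $ j)) = \<i> ^ mi_size a * (\<Prod>j\<in>UNIV. \<zeta> $ j ^ (a $ j))"
      by (simp add: power_mult_distrib prod.distrib mi_size_prod_const)
    moreover have "(- \<i>) ^ mi_size a * \<i> ^ mi_size a = 1" by (simp add: power_mult_distrib[symmetric])
    ultimately show ?thesis by (simp add: mult.assoc[symmetric])
  qed
  then show ?thesis by (simp add: mpeval_def sum_distrib_right mult.assoc)
qed

text \<open>
  The Malgrange--Ehrenpreis theorem by the explicit formula of Wagner: the multiplier
  \<open>cnj Q / Q\<close> is bounded by 1 and interpolation in the shift removes all but the leading term
  of \<open>cnj Q\<close>. Where \<open>Q\<close> vanishes, so does \<open>cnj Q\<close>, hence \<open>Q * (cnj Q / Q) = cnj Q\<close> even there.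
\<close>

theorem constant_coeff_solvable:
  fixes P :: "'d::finite mpoly"
  assumes \<eta>: "principal_part P \<eta> \<noteq> 0"
  shows "\<exists>G :: 'd jet => 'd jet.
    (\<forall>w R. smooth_on UNIV w --> (\<forall>l x. R < norm x --> w l x = 0) --> smooth_on UNIV (G w) \<and> jet_op P (G w) = w) \<and>
    (\<forall>R. \<exists>C\<ge>0. \<forall>w B b. smooth_on UNIV w --> (\<forall>l x. R < norm x --> w l x = 0) -->
       (\<forall>l x. mi_size l \<le> 2 * CARD('d) --> cmod (w (b + l) x) \<le> B) -->
       (\<forall>x. norm x \<le> R --> cmod (G w b x) \<le> C * B))"
proof -
  define m where "m = mpoly_degree P"
  obtain a :: "nat => complex" where a: "\<And>p. degree p \<le> m ==> (\<Sum>k\<le>m. a k * poly p (of_nat k)) = coeff p m"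
    using top_coeff_interpolation[of m] by blast
  define Q where "Q = (\<lambda>k \<xi>. mpeval P (zeta (real k *\<^sub>R \<eta>) \<xi>))"
  define h where "h = (\<lambda>k \<xi>. cnj (Q k \<xi>) / Q k \<xi>)"
  \<comment> \<open>The constant left by the interpolation: \<open>(2 pi)^d\<close> from Fourier
    inversion, and \<open>(2 \<i>)^m\<close> times the conjugate of the principal part at
    \<open>\<eta>\<close> from the top coefficient in the shift.\<close>
  define c where "c = of_real ((2 * pi) ^ CARD('d)) * (2 * \<i>) ^ m * cnj (principal_part P \<eta>)"
  have c: "c \<noteq> 0" using \<eta> by (simp add: c_def)
  define G :: "'d jet => 'd jet" where
    "G = (\<lambda>w b x. (1 / c) * (\<Sum>k\<le>m. a k * osc (h k) (real k *\<^sub>R \<eta>) (w b) x))"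
  have hm: "h k \<in> borel_measurable borel" for k
  proof -
    have "continuous_on UNIV (Q k)" unfolding Q_def mpeval_def zeta_def
      by (simp, intro continuous_intros)
    then have "Q k \<in> borel_measurable borel" "(\<lambda>\<xi>. cnj (Q k \<xi>)) \<in> borel_measurable borel"
      by (auto intro!: measurable_cont continuous_intros)
    then show ?thesis unfolding h_def by (rule borel_measurable_divide[rotated])
  qed
  have h1: "cmod (h k \<xi>) \<le> 1" for k \<xi>
    by (cases "Q k \<xi> = 0") (auto simp: h_def norm_divide)
  have hQ: "h k \<xi> * Q k \<xi> = cnj (Q k \<xi>)" for k \<xi>
    by (simp add: h_def)
  have sol: "smooth_on UNIV (G w) \<and> jet_op P (G w) = w"
    if w: "smooth_on UNIV w" and supp: "\<And>l x. R < norm x ==> w l x = 0" for w :: "'d jet" and R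
  proof
    show "smooth_on UNIV (G w)" unfolding G_def
      by (intro smooth_on_cmult smooth_on_sum smooth_on_osc[OF w supp] hm h1)
    show "jet_op P (G w) = w"
    proof (intro ext)
      fix b x
      define F where "F = (\<lambda>b t \<xi>. fourier (w b) (zeta (t *\<^sub>R \<eta>) \<xi>) * exp (\<i> * dotc (zeta (t *\<^sub>R \<eta>) \<xi>) x))"
      define M where "M = (\<lambda>l t \<xi>. \<Prod>j\<in>UNIV. cnj (zeta (t *\<^sub>R \<eta>) \<xi> $ j) ^ ((l :: 'd multi_index) $ j))"
      have "\<forall>l. \<exists>p. degree p \<le> mi_size l \<and>
         coeff p (mi_size l) = of_real ((2 * pi) ^ CARD('d)) * (\<Prod>j\<in>UNIV. (2 * \<i> * of_real (\<eta> $ j)) ^ (l $ j)) * w b x \<and>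
         (\<forall>t. integrable lborel (\<lambda>\<xi>. M l t \<xi> * F b t \<xi>) \<and> (LINT \<xi>|lborel. M l t \<xi> * F b t \<xi>) = poly p (of_real t))"
        unfolding M_def F_def using osc_cnj_monomial[OF w supp] by blast
      from choice[OF this] obtain p where p': "\<forall>l. degree (p l) \<le> mi_size l \<and>
         coeff (p l) (mi_size l) = of_real ((2 * pi) ^ CARD('d)) * (\<Prod>j\<in>UNIV. (2 * \<i> * of_real (\<eta> $ j)) ^ (l $ j)) * w b x \<and>
         (\<forall>t. integrable lborel (\<lambda>\<xi>. M l t \<xi> * F b t \<xi>) \<and> (LINT \<xi>|lborel. M l t \<xi> * F b t \<xi>) = poly (p l) (of_real t))" ..
      have p: "degree (p l) \<le> mi_size l"
        "coeff (p l) (mi_size l) = of_real ((2 * pi) ^ CARD('d)) * (\<Prod>j\<in>UNIV. (2 * \<i> * of_real (\<eta> $ j)) ^ (l $ j)) * w b x"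
        "integrable lborel (\<lambda>\<xi>. M l t \<xi> * F b t \<xi>)"
        "(LINT \<xi>|lborel. M l t \<xi> * F b t \<xi>) = poly (p l) (of_real t)" for l t
        using spec[OF p', of l] by simp_all
      \<comment> \<open>After applying the operator the multiplier turns \<open>Q\<close> into
        \<open>cnj Q\<close>, so the integral is a polynomial \<open>q\<close> in the shift, of
        degree at most \<open>m\<close>. Only multi-indices of size \<open>m\<close> enter its top
        coefficient \<open>c * w b x\<close>, and the interpolation weights extract exactly that
        coefficient.\<close>
      define q where "q = (\<Sum>l\<in>Poly_Mapping.keys P. smult (cnj (Poly_Mapping.lookup P l)) (p l))"
      have degq: "degree q \<le> m" unfolding q_def m_def
        by (intro degree_sum_le) (auto intro: order_trans[OF degree_smult_le] order_trans[OF p(1)] mi_size_le_degree)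
      have "coeff q m = (\<Sum>l\<in>Poly_Mapping.keys P. if mi_size l = m then
           of_real ((2 * pi) ^ CARD('d)) * (2 * \<i>) ^ m * w b x * cnj (Poly_Mapping.lookup P l * of_real (mi_power \<eta> l)) else 0)"
        unfolding q_def coeff_sum
      proof (intro sum.cong refl)
        fix l assume l: "l \<in> Poly_Mapping.keys P"
        show "coeff (smult (cnj (Poly_Mapping.lookup P l)) (p l)) m = (if mi_size l = m then
           of_real ((2 * pi) ^ CARD('d)) * (2 * \<i>) ^ m * w b x * cnj (Poly_Mapping.lookup P l * of_real (mi_power \<eta> l)) else 0)"
        proof (cases "mi_size l = m")
          case True
          have "(\<Prod>j\<in>UNIV. (2 * \<i> * complex_of_real (\<eta> $ j)) ^ (l $ j)) = (2 * \<i>) ^ m * of_real (mi_power \<eta> l)"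
            unfolding mi_power_def power_mult_distrib[of "2 * \<i>"] prod.distrib mi_size_prod_const True by simp
          then show ?thesis using p(2)[of l] True by simp
        next
          case False
          then have "mi_size l < m" using mi_size_le_degree[OF l] by (simp add: m_def)
          then have "coeff (p l) m = 0" using p(1)[of l] by (intro coeff_eq_0) linarith
          then show ?thesis using False by simp
        qed
      qed
      also have "\<dots> = (\<Sum>l | l \<in> Poly_Mapping.keys P \<and> mi_size l = m.
           of_real ((2 * pi) ^ CARD('d)) * (2 * \<i>) ^ m * w b x * cnj (Poly_Mapping.lookup P l * of_real (mi_power \<eta> l)))"
        by (subst sum.inter_filter[symmetric]) (auto intro: sum.cong)
      also have "\<dots> = c * w b x"
        unfolding sum_distrib_left[symmetric] c_def principal_part_def m_def[symmetric] cnj_sum[symmetric] by (simp only: mult_ac)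
      finally have cq: "coeff q m = c * w b x" .
      have step: "(\<Sum>l\<in>Poly_Mapping.keys P. Poly_Mapping.lookup P l * ((- \<i>) ^ mi_size l * osc (h k) (real k *\<^sub>R \<eta>) (w (b + l)) x)) = poly q (of_nat k)" for k
      proof -
        have int: "integrable lborel (\<lambda>\<xi>. h k \<xi> * fourier (w \<gamma>) (zeta (real k *\<^sub>R \<eta>) \<xi>) * exp (\<i> * dotc (zeta (real k *\<^sub>R \<eta>) \<xi>) x))" for \<gamma>
          by (rule osc_integrable[OF w supp hm h1])
        have "(\<Sum>l\<in>Poly_Mapping.keys P. Poly_Mapping.lookup P l * ((- \<i>) ^ mi_size l * osc (h k) (real k *\<^sub>R \<eta>) (w (b + l)) x))
          = (LINT \<xi>|lborel. (\<Sum>l\<in>Poly_Mapping.keys P. Poly_Mapping.lookup P l * ((- \<i>) ^ mi_size l *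
              (h k \<xi> * fourier (w (b + l)) (zeta (real k *\<^sub>R \<eta>) \<xi>) * exp (\<i> * dotc (zeta (real k *\<^sub>R \<eta>) \<xi>) x)))))"
          unfolding osc_def
          by (subst Bochner_Integration.integral_sum) (auto intro!: integrable_mult_right int simp only: integral_mult_right_zero)
        also have "(\<lambda>\<xi>. (\<Sum>l\<in>Poly_Mapping.keys P. Poly_Mapping.lookup P l * ((- \<i>) ^ mi_size l *
              (h k \<xi> * fourier (w (b + l)) (zeta (real k *\<^sub>R \<eta>) \<xi>) * exp (\<i> * dotc (zeta (real k *\<^sub>R \<eta>) \<xi>) x)))))
           = (\<lambda>\<xi>. \<Sum>l\<in>Poly_Mapping.keys P. cnj (Poly_Mapping.lookup P l) * (M l (real k) \<xi> * F b (real k) \<xi>))"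
        proof
          fix \<xi>
          let ?z = "zeta (real k *\<^sub>R \<eta>) \<xi>"
          have "(\<Sum>l\<in>Poly_Mapping.keys P. Poly_Mapping.lookup P l * ((- \<i>) ^ mi_size l *
              (h k \<xi> * fourier (w (b + l)) ?z * exp (\<i> * dotc ?z x)))) =
             h k \<xi> * exp (\<i> * dotc ?z x) * (\<Sum>l\<in>Poly_Mapping.keys P. Poly_Mapping.lookup P l * ((- \<i>) ^ mi_size l * fourier (w (b + l)) ?z))"
            by (simp add: sum_distrib_left mult_ac)
          also have "\<dots> = (h k \<xi> * Q k \<xi>) * F b (real k) \<xi>"
            by (subst fourier_jet_op[OF w], rule supp) (simp_all add: Q_def F_def)
          also have "\<dots> = (\<Sum>l\<in>Poly_Mapping.keys P. cnj (Poly_Mapping.lookup P l) * (M l (real k) \<xi> * F b (real k) \<xi>))"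
            unfolding hQ by (simp add: Q_def mpeval_def M_def sum_distrib_right mult.assoc)
          finally show "(\<Sum>l\<in>Poly_Mapping.keys P. Poly_Mapping.lookup P l * ((- \<i>) ^ mi_size l *
              (h k \<xi> * fourier (w (b + l)) ?z * exp (\<i> * dotc ?z x)))) =
             (\<Sum>l\<in>Poly_Mapping.keys P. cnj (Poly_Mapping.lookup P l) * (M l (real k) \<xi> * F b (real k) \<xi>))" .
        qed
        also have "(LINT \<xi>|lborel. (\<Sum>l\<in>Poly_Mapping.keys P. cnj (Poly_Mapping.lookup P l) * (M l (real k) \<xi> * F b (real k) \<xi>)))
          = (\<Sum>l\<in>Poly_Mapping.keys P. cnj (Poly_Mapping.lookup P l) * poly (p l) (of_real (real k)))"
          by (subst Bochner_Integration.integral_sum) (auto intro!: integrable_mult_right p(3) simp only: integral_mult_right_zero p(4))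
        finally show ?thesis by (simp add: q_def poly_sum)
      qed
      have "jet_op P (G w) b x = (1 / c) * (\<Sum>k\<le>m. a k * (\<Sum>l\<in>Poly_Mapping.keys P. Poly_Mapping.lookup P l *
           ((- \<i>) ^ mi_size l * osc (h k) (real k *\<^sub>R \<eta>) (w (b + l)) x)))"
        unfolding jet_op_eq G_def sum_distrib_left by (subst sum.swap) (simp add: mult_ac)
      also have "\<dots> = w b x"
        unfolding step a[OF degq] cq using c by simp
      finally show "jet_op P (G w) b x = w b x" .
    qed
  qed
  have bound: "\<exists>C\<ge>0. \<forall>w B b. smooth_on UNIV w --> (\<forall>l x. R < norm x --> w l x = 0) -->
       (\<forall>l x. mi_size l \<le> 2 * CARD('d) --> cmod (w (b + l) x) \<le> B) -->
       (\<forall>x. norm x \<le> R --> cmod (G w b x) \<le> C * B)" for R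
  proof -
    have "\<exists>C\<ge>0. \<forall>w B b \<xi>. smooth_on UNIV w --> (\<forall>l x. R < norm x --> w l x = 0) -->
       (\<forall>l x. mi_size l \<le> 2 * CARD('d) --> cmod (w (b + l) x) \<le> B) -->
       cmod (fourier (w b) (zeta (real k *\<^sub>R \<eta>) \<xi>)) \<le> C * B * weight \<xi>" for k
      by (rule fourier_decay)
    then obtain C where C: "\<And>k. C k \<ge> 0" "\<And>k w B b \<xi>. smooth_on UNIV w ==> (\<forall>l x. R < norm x --> w l x = 0) ==>
       (\<forall>l x. mi_size l \<le> 2 * CARD('d) --> cmod (w (b + l) x) \<le> B) ==>
       cmod (fourier (w b) (zeta (real k *\<^sub>R \<eta>) \<xi>)) \<le> C k * B * weight (\<xi> :: real ^ 'd)" by metis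
    define W where "W = (LINT \<xi>|lborel. weight (\<xi> :: real ^ 'd))"
    have W: "W \<ge> 0" unfolding W_def by (intro Bochner_Integration.integral_nonneg less_imp_le[OF weight_pos])
    define K where "K = cmod (1 / c) * (\<Sum>k\<le>m. cmod (a k) * (C k * exp (norm (real k *\<^sub>R \<eta>) * R) * W))"
    have "cmod (G w b x) \<le> K * B" if w: "smooth_on UNIV w" and supp: "\<forall>l x. R < norm x --> w l x = 0"
       and B: "\<forall>l x. mi_size l \<le> 2 * CARD('d) --> cmod (w (b + l) x) \<le> B" and x: "norm x \<le> R" for w B b x
    proof -
      have B0: "B \<ge> 0" using B by (metis mi_size_0 norm_ge_zero order_trans zero_le)
      have "cmod (osc (h k) (real k *\<^sub>R \<eta>) (w b) x) \<le> (C k * exp (norm (real k *\<^sub>R \<eta>) * R) * W) * B" for k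
      proof -
        have "cmod (osc (h k) (real k *\<^sub>R \<eta>) (w b) x) \<le> (C k * B) * exp (real k *\<^sub>R \<eta> \<bullet> x) * W"
          unfolding W_def using supp by (intro osc_bound[OF w _ hm h1] C(2)[OF w supp B]) auto
        also have "\<dots> \<le> (C k * B) * exp (norm (real k *\<^sub>R \<eta>) * R) * W"
        proof -
          have "real k *\<^sub>R \<eta> \<bullet> x \<le> norm (real k *\<^sub>R \<eta>) * norm x" by (rule norm_cauchy_schwarz)
          also have "\<dots> \<le> norm (real k *\<^sub>R \<eta>) * R" using x by (intro mult_left_mono) auto
          finally show ?thesis using C(1)[of k] B0 W by (intro mult_right_mono mult_left_mono) auto
        qed
        finally show ?thesis by (simp only: mult_ac)
      qed
      then have "cmod (\<Sum>k\<le>m. a k * osc (h k) (real k *\<^sub>R \<eta>) (w b) x) \<le> (\<Sum>k\<le>m. cmod (a k) * ((C k * exp (norm (real k *\<^sub>R \<eta>) * R) * W) * B))"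
        by (intro sum_norm_le) (simp add: norm_mult mult_left_mono)
      then have "cmod (G w b x) \<le> cmod (1 / c) * (\<Sum>k\<le>m. cmod (a k) * ((C k * exp (norm (real k *\<^sub>R \<eta>) * R) * W) * B))"
        unfolding G_def norm_mult by (intro mult_left_mono) auto
      then show ?thesis by (simp add: K_def sum_distrib_left sum_distrib_right mult_ac)
    qed
    moreover have "K \<ge> 0" unfolding K_def using C(1) W by (intro mult_nonneg_nonneg sum_nonneg) auto
    ultimately show "\<exists>C\<ge>0. \<forall>w B b. smooth_on UNIV w --> (\<forall>l x. R < norm x --> w l x = 0) -->
       (\<forall>l x. mi_size l \<le> 2 * CARD('d) --> cmod (w (b + l) x) \<le> B) -->
       (\<forall>x. norm x \<le> R --> cmod (G w b x) \<le> C * B)"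
      by (intro exI[of _ K]) blast
  qed
  show ?thesis using sol bound by blast
qed

lemma fourier_jet_op_0:
  fixes w :: "'d::finite jet"
  assumes w: "smooth_on UNIV w" and supp: "\<And>a x. R < norm x ==> w a x = 0"
  shows "fourier (jet_op P w b) \<zeta> = mpeval P \<zeta> * fourier (w b) \<zeta>"
proof -
  have int: "integrable lborel (\<lambda>x. w \<gamma> x * exp (- \<i> * dotc \<zeta> x))" for \<gamma>
    by (intro cont_supp_integrable[where R = R] cont_supp_mult cont_supp_jet w supp continuous_intros)
  have "fourier (jet_op P w b) \<zeta> = (LINT x|lborel. (\<Sum>a\<in>Poly_Mapping.keys P. Poly_Mapping.lookup P a * ((- \<i>) ^ mi_size a *
      (w (b + a) x * exp (- \<i> * dotc \<zeta> x)))))"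
    unfolding fourier_def jet_op_eq sum_distrib_right by (simp only: mult.assoc)
  also have "\<dots> = (\<Sum>a\<in>Poly_Mapping.keys P. Poly_Mapping.lookup P a * ((- \<i>) ^ mi_size a * fourier (w (b + a)) \<zeta>))"
    unfolding fourier_def
    by (subst Bochner_Integration.integral_sum) (auto intro!: integrable_mult_right int simp only: integral_mult_right_zero)
  also have "\<dots> = mpeval P \<zeta> * fourier (w b) \<zeta>"
    by (rule fourier_jet_op[OF w]) (rule supp)
  finally show ?thesis .
qed

section \<open>Interior estimates for elliptic operators\<close>

definition op_symbol :: "nat => ('d::finite multi_index => complex) => real ^ 'd => complex" where
  "op_symbol m c \<xi> = (\<Sum>a | mi_size a \<le> m. c a * (\<Prod>j\<in>UNIV. (\<i> * of_real (\<xi> $ j)) ^ (a $ j)))"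

text \<open>A class with common bounds instead of a single operator: it is stable under the
  rescaling in \<open>elliptic_class_scale\<close>, so that one estimate on the unit ball covers all
  radii up to 1.\<close>

definition elliptic_class :: "nat => real => real => real => ('d::finite multi_index => complex) => bool" where
  "elliptic_class m A \<kappa> R c \<longleftrightarrow> (\<forall>a. mi_size a \<le> m --> cmod (c a) \<le> A) \<and>
     (\<forall>\<xi>. R \<le> norm \<xi> --> \<kappa> * norm \<xi> ^ m \<le> cmod (op_symbol m c \<xi>))"

definition bump_jet :: "('d::finite) jet => bool" where
  "bump_jet \<theta> \<longleftrightarrow> smooth_on UNIV \<theta> \<and> (\<exists>r<1. \<forall>a x. r < norm x --> \<theta> a x = 0)"

definition unit_solution :: "nat => ('d::finite multi_index => complex) => real => 'd jet => bool" where
  "unit_solution m c M u \<longleftrightarrow> smooth_on (ball 0 1) u \<and> (\<forall>x\<in>ball 0 1. const_op m c u 0 x = 0) \<and>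
     (\<forall>x\<in>ball 0 1. cmod (u 0 x) \<le> M)"

lemma bump_jet_shift: "bump_jet \<theta> ==> bump_jet (\<lambda>a. \<theta> (a + b))"
  unfolding bump_jet_def using smooth_on_shift by blast

lemma smooth_on_zero_cong: "open S ==> (\<And>a x. x \<in> S ==> f a x = 0) ==> smooth_on S f"
  by (rule smooth_on_cong_open[OF smooth_on_zero]) auto

lemma smooth_on_cutoff:
  assumes "smooth_on S \<theta>" "smooth_on S u" "closed K" "K \<subseteq> S" "\<And>a x. x \<notin> K ==> \<theta> a x = 0"
  shows "smooth_on UNIV (jet_mult \<theta> u)"
proof -
  have "smooth_on (- K) (jet_mult \<theta> u)"
    using assms by (intro smooth_on_zero_cong) (auto intro: jet_mult_zero_left)
  from smooth_on_Un[OF smooth_on_mult[OF assms(1,2)] this] show ?thesis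
    by (rule smooth_on_subset) (use assms(4) in auto)
qed

lemma jet_mult_axis: "jet_mult f g (axis j (Suc 0)) x = f (axis j (Suc 0)) x * g 0 x + f 0 x * g (axis j (Suc 0)) x"
  using prod_step_iterate[of 0 j "\<lambda>b \<gamma>. f b x * g \<gamma> x"] unfolding jet_mult_def by (simp add: prod_step_def[of j])

lemma norm_monomial_le:
  "cmod (\<Prod>j\<in>UNIV. (\<i> * of_real (\<xi> $ j)) ^ (a $ j)) \<le> norm \<xi> ^ mi_size a"
proof -
  have "cmod (\<Prod>j\<in>UNIV. (\<i> * of_real (\<xi> $ j)) ^ (a $ j)) = (\<Prod>j\<in>UNIV. \<bar>\<xi> $ j\<bar> ^ (a $ j))"
    by (simp add: prod_norm[symmetric] norm_power norm_mult)
  also have "\<dots> \<le> (\<Prod>j\<in>UNIV. norm \<xi> ^ (a $ j))"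
    by (intro prod_mono) (auto intro!: power_mono component_le_norm_cart)
  finally show ?thesis by (simp add: mi_size_def power_sum)
qed

lemma cutoff_compact_support:
  assumes "bump_jet \<theta>" "smooth_on (ball 0 1) u"
  shows "smooth_on UNIV (jet_mult \<theta> u)" "1 < norm x ==> jet_mult \<theta> u a x = 0"
    "cont_supp 1 (\<lambda>x. \<theta> 0 x * u b x)"
proof -
  obtain r where r: "r < 1" "\<And>a x. r < norm x ==> \<theta> a x = 0" and \<theta>: "smooth_on UNIV \<theta>"
    using assms(1) by (auto simp: bump_jet_def)
  have sm: "smooth_on UNIV (jet_mult \<theta> u)" if "smooth_on (ball 0 1) u" for u
    by (rule smooth_on_cutoff[OF smooth_on_subset[OF \<theta>] that, where K = "cball 0 r"]) (use r in auto)
  show "smooth_on UNIV (jet_mult \<theta> u)" by (rule sm[OF assms(2)])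
  show "1 < norm x ==> jet_mult \<theta> u a x = 0" using r by (intro jet_mult_zero_left) auto
  have "continuous_on UNIV (jet_mult \<theta> (\<lambda>a. u (a + b)) 0)"
    by (rule smooth_on_continuous_on[OF sm[OF smooth_on_shift[OF assms(2)]]])
  moreover have "jet_mult \<theta> (\<lambda>a. u (a + b)) 0 = (\<lambda>x. \<theta> 0 x * u b x)" by (simp add: fun_eq_iff)
  ultimately show "cont_supp 1 (\<lambda>x. \<theta> 0 x * u b x)" using r by (simp add: cont_supp_def)
qed

lemma fourier_cutoff_derivative:
  assumes \<theta>: "bump_jet \<theta>" and u: "smooth_on (ball 0 1) u"
  shows "fourier (\<lambda>x. \<theta> 0 x * u (a + axis j (Suc 0)) x) \<zeta> =
     \<i> * \<zeta> $ j * fourier (\<lambda>x. \<theta> 0 x * u a x) \<zeta> - fourier (\<lambda>x. \<theta> (axis j (Suc 0)) x * u a x) \<zeta>"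
proof -
  let ?v = "\<lambda>b. u (b + a)"
  have v: "smooth_on (ball 0 1) ?v" by (rule smooth_on_shift[OF u])
  have "fourier (jet_mult \<theta> ?v (0 + axis j (Suc 0))) \<zeta> = \<i> * \<zeta> $ j * fourier (jet_mult \<theta> ?v 0) \<zeta>"
    by (rule fourier_deriv[OF cutoff_compact_support(1)[OF \<theta> v]]) (rule cutoff_compact_support(2)[OF \<theta> v])
  moreover have "fourier (jet_mult \<theta> ?v (0 + axis j (Suc 0))) \<zeta> =
      fourier (\<lambda>x. \<theta> (axis j (Suc 0)) x * u a x) \<zeta> + fourier (\<lambda>x. \<theta> 0 x * u (a + axis j (Suc 0)) x) \<zeta>"
  proof -
    have i: "integrable lborel (\<lambda>x. (\<psi> 0 x * u \<gamma> x) * exp (- \<i> * dotc \<zeta> x))" if "bump_jet \<psi>" for \<psi> \<gamma>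
      by (intro cont_supp_integrable[where R = 1] cont_supp_mult cutoff_compact_support(3)[OF that u] continuous_intros)
    have "fourier (jet_mult \<theta> ?v (0 + axis j (Suc 0))) \<zeta> = (LINT x|lborel. (\<theta> (0 + axis j (Suc 0)) x * u a x) * exp (- \<i> * dotc \<zeta> x)
        + (\<theta> 0 x * u (a + axis j (Suc 0)) x) * exp (- \<i> * dotc \<zeta> x))"
      unfolding fourier_def by (simp add: jet_mult_axis distrib_right add.commute)
    also have "\<dots> = (LINT x|lborel. (\<theta> (0 + axis j (Suc 0)) x * u a x) * exp (- \<i> * dotc \<zeta> x))
        + (LINT x|lborel. (\<theta> 0 x * u (a + axis j (Suc 0)) x) * exp (- \<i> * dotc \<zeta> x))"
      by (intro Bochner_Integration.integral_add i[OF bump_jet_shift[OF \<theta>]] i[OF \<theta>])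
    finally show ?thesis by (simp add: fourier_def)
  qed
  moreover have "fourier (jet_mult \<theta> ?v 0) \<zeta> = fourier (\<lambda>x. \<theta> 0 x * u a x) \<zeta>"
    by (simp add: fourier_def)
  ultimately show ?thesis by (simp add: algebra_simps)
qed

context
  fixes m :: nat and A \<kappa> R :: real and dummy :: "'d::finite"
  assumes A: "A \<ge> 0" and \<kappa>: "\<kappa> > 0"
begin

text \<open>Decay of order \<open>s\<close> for all cutoffs at once, because the passage to the next
  order uses the statement for the derivatives of \<open>\<theta>\<close>. The constant depends on
  \<open>\<theta>\<close> but not on the operator in the class, the solution or the frequency. The
  context element \<open>dummy\<close> supplies the dimension \<open>'d\<close>, which the type of
  \<open>reg\<close> does not show.\<close>

definition reg :: "nat => bool" where
  "reg s \<longleftrightarrow> (\<forall>\<theta> :: 'd jet. bump_jet \<theta> --> (\<exists>C\<ge>0. \<forall>c u M \<xi>. elliptic_class m A \<kappa> R c --> unit_solution m c M u -->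
     (1 + norm \<xi>) ^ s * cmod (fourier (\<lambda>x. \<theta> 0 x * u 0 x) (cvec \<xi>)) \<le> C * M))"

lemma unit_solution_nonneg: "unit_solution m c M u ==> M \<ge> 0"
  unfolding unit_solution_def by (metis centre_in_ball norm_ge_zero order_trans zero_less_one)

lemma reg_0: "reg 0"
  unfolding reg_def
proof (intro allI impI)
  fix \<theta> :: "'d jet" assume \<theta>: "bump_jet \<theta>"
  then obtain r where r: "r < 1" "\<And>a x. r < norm x ==> \<theta> a x = 0" and sm: "smooth_on UNIV \<theta>"
    by (auto simp: bump_jet_def)
  have "bounded (\<theta> 0 ` cball 0 1)"
    by (intro compact_imp_bounded compact_continuous_image smooth_on_continuous_on[OF smooth_on_subset[OF sm]]) auto
  then obtain B where B: "\<forall>z\<in>\<theta> 0 ` cball 0 1. cmod z \<le> B" unfolding bounded_iff by blast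
  define V where "V = measure lborel (cball (0 :: real ^ 'd) 1)"
  have "cmod (\<theta> 0 0) \<le> B" using B by simp
  then have B0: "B \<ge> 0" by (rule order_trans[OF norm_ge_zero])
  have "cmod (fourier (\<lambda>x. \<theta> 0 x * u 0 x) (cvec \<xi>)) \<le> B * V * M" if u: "unit_solution m c M u" for c u M \<xi>
  proof -
    have M0: "M \<ge> 0" by (rule unit_solution_nonneg[OF u])
    have us: "smooth_on (ball 0 1) u" using u by (simp add: unit_solution_def)
    have "cmod (LINT x|lborel. (\<theta> 0 x * u 0 x) * exp (- \<i> * dotc (cvec \<xi>) x)) \<le> (B * M) * V"
      unfolding V_def
    proof (rule cont_supp_integral_bound)
      show "cont_supp 1 (\<lambda>x. (\<theta> 0 x * u 0 x) * exp (- \<i> * dotc (cvec \<xi>) x))"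
        by (intro cont_supp_mult cutoff_compact_support(3)[OF \<theta> us] continuous_intros)
      fix x :: "real ^ 'd" assume x: "norm x \<le> 1"
      have "cmod (\<theta> 0 x * u 0 x) \<le> B * M"
      proof (cases "norm x < 1")
        case True
        then have "cmod (u 0 x) \<le> M" using u by (simp add: unit_solution_def)
        moreover have "cmod (\<theta> 0 x) \<le> B" using B x by simp
        ultimately show ?thesis unfolding norm_mult by (intro mult_mono B0) auto
      next
        case False
        then show ?thesis using r B0 M0 by simp
      qed
      then show "cmod ((\<theta> 0 x * u 0 x) * exp (- \<i> * dotc (cvec \<xi>) x)) \<le> B * M"
        by (simp add: norm_mult dotc_cvec)
    qed
    then show ?thesis by (simp add: fourier_def mult_ac)
  qed
  moreover have "B * V \<ge> 0" using B0 by (simp add: V_def)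
  ultimately show "\<exists>C\<ge>0. \<forall>c u M \<xi>. elliptic_class m A \<kappa> R c --> unit_solution m c M u -->
     (1 + norm \<xi>) ^ 0 * cmod (fourier (\<lambda>x. \<theta> 0 x * u 0 x) (cvec \<xi>)) \<le> C * M"
    by (intro exI[of _ "B * V"]) simp
qed

text \<open>Interchanging the cutoff with a derivative only produces terms in which a derivative
  falls on \<open>\<theta>\<close>. Such a term has one frequency factor less, so the decay already
  known for the derivatives of \<open>\<theta>\<close> makes the error one order better than the
  main term. The induction has to vary \<open>\<theta>\<close> for this reason.\<close>

lemma reg_commutator:
  assumes reg: "reg s"
  shows "bump_jet (\<theta> :: 'd jet) ==> \<exists>C\<ge>0. \<forall>c u M \<xi>. elliptic_class m A \<kappa> R c --> unit_solution m c M u -->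
     (1 + norm \<xi>) ^ Suc s * cmod (fourier (\<lambda>x. \<theta> 0 x * u a x) (cvec \<xi>) -
        (\<Prod>j\<in>UNIV. (\<i> * of_real (\<xi> $ j)) ^ (a $ j)) * fourier (\<lambda>x. \<theta> 0 x * u 0 x) (cvec \<xi>)) \<le> C * M * (1 + norm \<xi>) ^ mi_size a"
proof (induction a arbitrary: \<theta> rule: multi_index_induct)
  case zero
  then show ?case by (intro exI[of _ 0]) simp
next
  case (add a j)
  let ?d = "\<lambda>\<theta> a u \<xi>. fourier (\<lambda>x. \<theta> 0 x * u a x) (cvec \<xi>) -
        (\<Prod>j\<in>UNIV. (\<i> * of_real (\<xi> $ j)) ^ (a $ j)) * fourier (\<lambda>x. \<theta> 0 x * u 0 x) (cvec \<xi>)"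
  define \<psi> where "\<psi> = (\<lambda>b. \<theta> (b + axis j (Suc 0)))"
  have \<psi>: "bump_jet \<psi>" unfolding \<psi>_def by (rule bump_jet_shift[OF add.prems])
  obtain C1 where C1: "C1 \<ge> 0" "\<And>c u M \<xi>. elliptic_class m A \<kappa> R c ==> unit_solution m c M u ==>
     (1 + norm \<xi>) ^ Suc s * cmod (?d \<theta> a u \<xi>) \<le> C1 * M * (1 + norm \<xi>) ^ mi_size a"
    using add.IH[OF add.prems] by blast
  obtain C2 where C2: "C2 \<ge> 0" "\<And>c u M \<xi>. elliptic_class m A \<kappa> R c ==> unit_solution m c M u ==>
     (1 + norm \<xi>) ^ Suc s * cmod (?d \<psi> a u \<xi>) \<le> C2 * M * (1 + norm \<xi>) ^ mi_size a"
    using add.IH[OF \<psi>] by blast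
  obtain C3 where C3: "C3 \<ge> 0" "\<And>c u M \<xi>. elliptic_class m A \<kappa> R c ==> unit_solution m c M u ==>
     (1 + norm \<xi>) ^ s * cmod (fourier (\<lambda>x. \<psi> 0 x * u 0 x) (cvec \<xi>)) \<le> C3 * M"
    using reg \<psi> unfolding reg_def by blast
  have "(1 + norm \<xi>) ^ Suc s * cmod (?d \<theta> (a + axis j (Suc 0)) u \<xi>) \<le> (C1 + C2 + C3) * M * (1 + norm \<xi>) ^ mi_size (a + axis j (Suc 0))"
    if c: "elliptic_class m A \<kappa> R c" and u: "unit_solution m c M u" for c u M \<xi>
  proof -
    let ?Y = "1 + norm \<xi>"
    have Y: "?Y \<ge> 1" by simp
    have M0: "M \<ge> 0" by (rule unit_solution_nonneg[OF u])
    have us: "smooth_on (ball 0 1) u" using u by (simp add: unit_solution_def)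
    have prod: "(\<Prod>i\<in>UNIV. z i ^ ((a + axis j (Suc 0)) $ i)) = (\<Prod>i\<in>UNIV. z i ^ (a $ i)) * z j" for z :: "'d => complex"
    proof -
      have "(\<Prod>i\<in>UNIV. z i ^ ((a + axis j (Suc 0)) $ i)) = (\<Prod>i\<in>UNIV. z i ^ (a $ i) * (if i = j then z i else 1))"
        by (intro prod.cong) (auto simp: axis_def)
      then show ?thesis by (simp add: prod.distrib)
    qed
    have eq: "?d \<theta> (a + axis j (Suc 0)) u \<xi> = \<i> * of_real (\<xi> $ j) * ?d \<theta> a u \<xi> -
        (?d \<psi> a u \<xi> + (\<Prod>j\<in>UNIV. (\<i> * of_real (\<xi> $ j)) ^ (a $ j)) * fourier (\<lambda>x. \<psi> 0 x * u 0 x) (cvec \<xi>))"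
      unfolding prod fourier_cutoff_derivative[OF add.prems us] by (simp add: \<psi>_def cvec_def algebra_simps)
    have "cmod (?d \<theta> (a + axis j (Suc 0)) u \<xi>) \<le> cmod (\<i> * of_real (\<xi> $ j) * ?d \<theta> a u \<xi>) +
        (cmod (?d \<psi> a u \<xi>) + cmod ((\<Prod>j\<in>UNIV. (\<i> * of_real (\<xi> $ j)) ^ (a $ j)) * fourier (\<lambda>x. \<psi> 0 x * u 0 x) (cvec \<xi>)))"
      unfolding eq by (rule order_trans[OF norm_triangle_ineq4 add_left_mono[OF norm_triangle_ineq]])
    also have "\<dots> \<le> ?Y * cmod (?d \<theta> a u \<xi>) + (?Y * cmod (?d \<psi> a u \<xi>) + ?Y ^ mi_size a * cmod (fourier (\<lambda>x. \<psi> 0 x * u 0 x) (cvec \<xi>)))"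
    proof (intro add_mono)
      have "\<bar>\<xi> $ j\<bar> \<le> ?Y" using component_le_norm_cart[of \<xi> j] by simp
      then show "cmod (\<i> * of_real (\<xi> $ j) * ?d \<theta> a u \<xi>) \<le> ?Y * cmod (?d \<theta> a u \<xi>)"
        unfolding norm_mult by (intro mult_right_mono) auto
      show "cmod (?d \<psi> a u \<xi>) \<le> ?Y * cmod (?d \<psi> a u \<xi>)" by (simp add: mult_left_le_one_le distrib_right)
      have "norm \<xi> ^ mi_size a \<le> ?Y ^ mi_size a" by (intro power_mono) auto
      then show "cmod ((\<Prod>j\<in>UNIV. (\<i> * of_real (\<xi> $ j)) ^ (a $ j)) * fourier (\<lambda>x. \<psi> 0 x * u 0 x) (cvec \<xi>))
        \<le> ?Y ^ mi_size a * cmod (fourier (\<lambda>x. \<psi> 0 x * u 0 x) (cvec \<xi>))"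
        unfolding norm_mult by (intro mult_right_mono order_trans[OF norm_monomial_le]) auto
    qed
    finally have "?Y ^ Suc s * cmod (?d \<theta> (a + axis j (Suc 0)) u \<xi>) \<le> ?Y ^ Suc s *
       (?Y * cmod (?d \<theta> a u \<xi>) + (?Y * cmod (?d \<psi> a u \<xi>) + ?Y ^ mi_size a * cmod (fourier (\<lambda>x. \<psi> 0 x * u 0 x) (cvec \<xi>))))"
      by (rule mult_left_mono) simp
    also have "\<dots> = ?Y * (?Y ^ Suc s * cmod (?d \<theta> a u \<xi>)) + ?Y * (?Y ^ Suc s * cmod (?d \<psi> a u \<xi>)) +
         ?Y ^ Suc (mi_size a) * (?Y ^ s * cmod (fourier (\<lambda>x. \<psi> 0 x * u 0 x) (cvec \<xi>)))"
      unfolding power_Suc distrib_left by (simp only: mult_ac add_ac)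
    also have "\<dots> \<le> ?Y * (C1 * M * ?Y ^ mi_size a) + ?Y * (C2 * M * ?Y ^ mi_size a) + ?Y ^ Suc (mi_size a) * (C3 * M)"
      by (intro add_mono mult_left_mono C1(2)[OF c u] C2(2)[OF c u] C3(2)[OF c u]) auto
    also have "\<dots> = (C1 + C2 + C3) * M * ?Y ^ mi_size (a + axis j (Suc 0))"
      by (simp add: algebra_simps)
    finally show ?thesis .
  qed
  then show ?case using C1(1) C2(1) C3(1) by (intro exI[of _ "C1 + C2 + C3"]) simp
qed

text \<open>Multiplying the equation by \<open>\<theta>\<close> and transforming shows that the
  symbol times the transform of \<open>\<theta> u\<close> is a sum of commutators. Ellipticity
  divides by a multiple of \<open>norm \<xi> ^ m\<close>, and the commutators leave one power of
  decay to spare.\<close>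

lemma reg_Suc:
  assumes reg: "reg s"
  shows "reg (Suc s)"
  unfolding reg_def
proof (intro allI impI)
  fix \<theta> :: "'d jet" assume \<theta>: "bump_jet \<theta>"
  let ?d = "\<lambda>a u \<xi>. fourier (\<lambda>x. \<theta> 0 x * u a x) (cvec \<xi>) -
        (\<Prod>j\<in>UNIV. (\<i> * of_real (\<xi> $ j)) ^ (a $ j)) * fourier (\<lambda>x. \<theta> 0 x * u 0 x) (cvec \<xi>)"
  let ?F = "\<lambda>u \<xi>. fourier (\<lambda>x. \<theta> 0 x * u 0 x) (cvec \<xi>)"
  have "\<forall>a. \<exists>C\<ge>0. \<forall>c u M \<xi>. elliptic_class m A \<kappa> R c --> unit_solution m c M u -->
     (1 + norm \<xi>) ^ Suc s * cmod (?d a u \<xi>) \<le> C * M * (1 + norm \<xi>) ^ mi_size a"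
    using reg_commutator[OF reg \<theta>] by blast
  from choice[OF this] obtain C where C': "\<forall>a. C a \<ge> 0 \<and> (\<forall>c u M \<xi>. elliptic_class m A \<kappa> R c --> unit_solution m c M u -->
     (1 + norm \<xi>) ^ Suc s * cmod (?d a u \<xi>) \<le> C a * M * (1 + norm \<xi>) ^ mi_size a)" ..
  have C: "C a \<ge> 0" "elliptic_class m A \<kappa> R c ==> unit_solution m c M u ==>
     (1 + norm \<xi>) ^ Suc s * cmod (?d a u \<xi>) \<le> C a * M * (1 + norm \<xi>) ^ mi_size a" for a c u M \<xi>
    using C' by blast+
  obtain C3 where C3: "C3 \<ge> 0" "\<And>c u M \<xi>. elliptic_class m A \<kappa> R c ==> unit_solution m c M u ==>
     (1 + norm \<xi>) ^ s * cmod (?F u \<xi>) \<le> C3 * M"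
    using reg \<theta> unfolding reg_def by blast
  \<comment> \<open>Below \<open>R1\<close> the previous order suffices because the additional
    factor is bounded. From \<open>R1\<close> on ellipticity is available, and
    \<open>1 + norm \<xi>\<close> is at most \<open>2 * norm \<xi>\<close>.\<close>
  define R1 where "R1 = max R 1"
  define S where "S = (\<Sum>a | mi_size a \<le> m. A * C a)"
  have S0: "S \<ge> 0" unfolding S_def using A C(1) by (intro sum_nonneg) auto
  define K where "K = max ((1 + R1) * C3) (2 ^ m * S / \<kappa>)"
  have "(1 + norm \<xi>) ^ Suc s * cmod (?F u \<xi>) \<le> K * M"
    if c: "elliptic_class m A \<kappa> R c" and u: "unit_solution m c M u" for c u M \<xi>
  proof -
    let ?Y = "1 + norm \<xi>"
    have M0: "M \<ge> 0" by (rule unit_solution_nonneg[OF u])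
    have us: "smooth_on (ball 0 1) u" and eq0: "\<And>x. x \<in> ball 0 1 ==> const_op m c u 0 x = 0"
      using u by (auto simp: unit_solution_def)
    show ?thesis
    proof (cases "norm \<xi> < R1")
      case True
      have "?Y ^ Suc s * cmod (?F u \<xi>) = ?Y * (?Y ^ s * cmod (?F u \<xi>))" by simp
      also have "\<dots> \<le> (1 + R1) * (C3 * M)"
        using True by (intro mult_mono C3(2)[OF c u]) (auto simp: R1_def)
      also have "\<dots> \<le> K * M" using M0 by (simp add: K_def mult_right_mono mult.assoc[symmetric])
      finally show ?thesis .
    next
      case False
      then have x1: "norm \<xi> \<ge> 1" and xR: "norm \<xi> \<ge> R" by (auto simp: R1_def)
      have "(\<Sum>a | mi_size a \<le> m. c a * fourier (\<lambda>x. \<theta> 0 x * u a x) (cvec \<xi>)) =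
         (LINT x|lborel. (\<Sum>a | mi_size a \<le> m. c a * ((\<theta> 0 x * u a x) * exp (- \<i> * dotc (cvec \<xi>) x))))"
      proof -
        have "integrable lborel (\<lambda>x. (\<theta> 0 x * u a x) * exp (- \<i> * dotc (cvec \<xi>) x))" for a
          by (intro cont_supp_integrable[where R = 1] cont_supp_mult cutoff_compact_support(3)[OF \<theta> us] continuous_intros)
        then show ?thesis unfolding fourier_def
          by (subst Bochner_Integration.integral_sum) (simp_all only: integrable_mult_right integral_mult_right_zero)
      qed
      also have "(\<lambda>x. \<Sum>a | mi_size a \<le> m. c a * ((\<theta> 0 x * u a x) * exp (- \<i> * dotc (cvec \<xi>) x))) = (\<lambda>x. 0)"
      proof
        fix x :: "real ^ 'd"
        have "(\<Sum>a | mi_size a \<le> m. c a * ((\<theta> 0 x * u a x) * exp (- \<i> * dotc (cvec \<xi>) x))) =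
           \<theta> 0 x * exp (- \<i> * dotc (cvec \<xi>) x) * const_op m c u 0 x"
          by (simp add: const_op_def sum_distrib_left mult_ac)
        also have "\<dots> = 0"
        proof (cases "norm x < 1")
          case True
          then show ?thesis using eq0[of x] by simp
        next
          case False
          have "\<theta> 0 x = 0" using \<theta> False unfolding bump_jet_def by force
          then show ?thesis by simp
        qed
        finally show "(\<Sum>a | mi_size a \<le> m. c a * ((\<theta> 0 x * u a x) * exp (- \<i> * dotc (cvec \<xi>) x))) = 0" .
      qed
      finally have zero: "(\<Sum>a | mi_size a \<le> m. c a * fourier (\<lambda>x. \<theta> 0 x * u a x) (cvec \<xi>)) = 0" by simp
      have "op_symbol m c \<xi> * ?F u \<xi> = - (\<Sum>a | mi_size a \<le> m. c a * ?d a u \<xi>)"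
        using zero by (simp add: op_symbol_def right_diff_distrib sum_subtractf sum_distrib_right mult.assoc)
      then have "cmod (op_symbol m c \<xi>) * cmod (?F u \<xi>) = cmod (\<Sum>a | mi_size a \<le> m. c a * ?d a u \<xi>)"
        unfolding norm_mult[symmetric] by (simp only: norm_minus_cancel)
      also have "\<dots> \<le> (\<Sum>a | mi_size a \<le> m. cmod (c a) * cmod (?d a u \<xi>))"
        by (intro sum_norm_le) (simp add: norm_mult)
      finally have "?Y ^ Suc s * (cmod (op_symbol m c \<xi>) * cmod (?F u \<xi>)) \<le> ?Y ^ Suc s * (\<Sum>a | mi_size a \<le> m. cmod (c a) * cmod (?d a u \<xi>))"
        by (rule mult_left_mono) simp
      also have "\<dots> = (\<Sum>a | mi_size a \<le> m. cmod (c a) * (?Y ^ Suc s * cmod (?d a u \<xi>)))"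
        unfolding sum_distrib_left by (simp only: mult_ac)
      also have "\<dots> \<le> (\<Sum>a | mi_size a \<le> m. A * (C a * M * ?Y ^ m))"
      proof (rule sum_mono)
        fix a :: "'d multi_index" assume "a \<in> {a. mi_size a \<le> m}"
        then have a: "mi_size a \<le> m" by simp
        have "?Y ^ Suc s * cmod (?d a u \<xi>) \<le> C a * M * ?Y ^ mi_size a" by (rule C(2)[OF c u])
        also have "\<dots> \<le> C a * M * ?Y ^ m"
          using a C(1)[of a] M0 by (intro mult_left_mono power_increasing) auto
        finally have h: "?Y ^ Suc s * cmod (?d a u \<xi>) \<le> C a * M * ?Y ^ m" .
        have ca: "cmod (c a) \<le> A" using c a by (simp add: elliptic_class_def)
        show "cmod (c a) * (?Y ^ Suc s * cmod (?d a u \<xi>)) \<le> A * (C a * M * ?Y ^ m)"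
          by (rule mult_mono[OF ca h A]) simp
      qed
      also have "\<dots> = S * M * ?Y ^ m" by (simp add: S_def sum_distrib_left sum_distrib_right mult_ac)
      finally have 1: "?Y ^ Suc s * (cmod (op_symbol m c \<xi>) * cmod (?F u \<xi>)) \<le> S * M * ?Y ^ m" .
      have "?Y ^ m \<le> (2 * norm \<xi>) ^ m" using x1 by (intro power_mono) auto
      then have Ym: "?Y ^ m \<le> 2 ^ m * norm \<xi> ^ m" by (simp add: power_mult_distrib)
      have "(?Y ^ Suc s * cmod (?F u \<xi>)) * (\<kappa> * norm \<xi> ^ m) \<le> (?Y ^ Suc s * cmod (?F u \<xi>)) * cmod (op_symbol m c \<xi>)"
        using c xR unfolding elliptic_class_def by (intro mult_left_mono) auto
      also have "\<dots> \<le> S * M * ?Y ^ m" using 1 by (simp only: mult_ac)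
      also have "\<dots> \<le> S * M * (2 ^ m * norm \<xi> ^ m)" using S0 M0 by (intro mult_left_mono Ym) auto
      finally have "(?Y ^ Suc s * cmod (?F u \<xi>) * \<kappa>) * norm \<xi> ^ m \<le> (2 ^ m * S * M) * norm \<xi> ^ m" by (simp only: mult_ac)
      moreover have "norm \<xi> ^ m > 0" using x1 by (intro zero_less_power) linarith
      ultimately have "?Y ^ Suc s * cmod (?F u \<xi>) * \<kappa> \<le> 2 ^ m * S * M" by (rule mult_right_le_imp_le)
      then have "?Y ^ Suc s * cmod (?F u \<xi>) \<le> (2 ^ m * S / \<kappa>) * M" using \<kappa> by (simp add: field_simps)
      also have "\<dots> \<le> K * M" using M0 by (intro mult_right_mono) (auto simp: K_def)
      finally show ?thesis .
    qed
  qed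
  moreover have "K \<ge> 0" using C3(1) by (simp add: K_def R1_def le_max_iff_disj)
  ultimately show "\<exists>C\<ge>0. \<forall>c u M \<xi>. elliptic_class m A \<kappa> R c --> unit_solution m c M u -->
     (1 + norm \<xi>) ^ Suc s * cmod (?F u \<xi>) \<le> C * M" by blast
qed

lemma reg: "reg s"
  by (induction s) (rule reg_0, rule reg_Suc)

text \<open>The derivative at 0 is recovered by Fourier inversion from the transform of
  \<open>\<theta> u\<close>, for a cutoff whose jet at 0 is that of the constant 1.\<close>

lemma unit_interior_estimate:
  "\<exists>C\<ge>0. \<forall>c (u :: 'd jet) M j. elliptic_class m A \<kappa> R c --> unit_solution m c M u --> cmod (u (axis j (Suc 0)) 0) \<le> C * M"
proof -
  define d where "d = CARD('d)"
  have d0: "d > 0" by (simp add: d_def)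
  \<comment> \<open>A grid function active at 0 lives within \<open>2 d \<delta> = 1 / 2\<close> of
    the origin, so the sum of these functions is a cutoff with support well inside the unit
    ball.\<close>
  define \<delta> where "\<delta> = 1 / (4 * real d)"
  have \<delta>: "\<delta> > 0" "real d * \<delta> = 1 / 4" using d0 by (auto simp: \<delta>_def)
  define \<theta> :: "'d jet" where "\<theta> = (\<lambda>a x. \<Sum>\<kappa>\<in>grid_active \<delta> 0. grid_fun \<delta> \<kappa> a x)"
  have \<theta>1: "\<theta> b 0 = (if b = 0 then 1 else 0)" for b
    unfolding \<theta>_def by (rule grid_partition[OF \<delta>(1) grid_active_card(1)]) simp
  have "\<theta> a x = 0" if x: "1 / 2 < norm x" for a x
    unfolding \<theta>_def
  proof (intro sum.neutral ballI grid_fun_eq_0 notI)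
    fix \<kappa> assume "\<kappa> \<in> grid_active \<delta> (0 :: real ^ 'd)" "\<kappa> \<in> grid_active \<delta> x"
    from this[THEN grid_active_dist, OF \<delta>(1)]
    have "norm (grid_pt \<delta> \<kappa>) \<le> 1 / 4" "norm (x - grid_pt \<delta> \<kappa>) \<le> 1 / 4" using \<delta> by (auto simp: d_def)
    moreover have "norm x \<le> norm (x - grid_pt \<delta> \<kappa>) + norm (grid_pt \<delta> \<kappa>)"
      by (metis diff_add_cancel norm_triangle_ineq)
    ultimately show False using x by linarith
  qed
  then have \<theta>: "bump_jet \<theta>" unfolding bump_jet_def
    by (intro conjI exI[of _ "1 / 2"]) (auto simp: \<theta>_def intro!: smooth_on_sum smooth_on_grid_fun)
  \<comment> \<open>Of the \<open>2 * d + 1\<close> powers of decay, one pays for the derivative and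
    \<open>2 * d\<close> for domination by the integrable \<open>weight\<close>.\<close>
  obtain C where C: "C \<ge> 0" "\<And>c u M \<xi>. elliptic_class m A \<kappa> R c ==> unit_solution m c M u ==>
     (1 + norm \<xi>) ^ (2 * d + 1) * cmod (fourier (\<lambda>x. \<theta> 0 x * u 0 x) (cvec \<xi>)) \<le> C * M"
    using reg[of "2 * d + 1"] \<theta> unfolding reg_def by blast
  define W where "W = (LINT \<xi>|lborel. weight (\<xi> :: real ^ 'd))"
  have W: "W \<ge> 0" unfolding W_def by (intro Bochner_Integration.integral_nonneg less_imp_le[OF weight_pos])
  have weight: "1 \<le> (1 + norm \<xi>) ^ (2 * d) * weight \<xi>" for \<xi> :: "real ^ 'd"
  proof -
    have "1 = (\<Prod>j\<in>(UNIV :: 'd set). 1)" by simp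
    also have "\<dots> \<le> (\<Prod>j\<in>UNIV. (1 + norm \<xi>)\<^sup>2 * inverse (1 + (\<xi> $ j)\<^sup>2))"
    proof (intro prod_mono conjI)
      fix j
      have "(\<xi> $ j)\<^sup>2 \<le> (norm \<xi>)\<^sup>2" using power_mono[OF component_le_norm_cart[of \<xi> j] abs_ge_zero, of 2] by simp
      moreover have "(1 + norm \<xi>)\<^sup>2 = 1 + 2 * norm \<xi> + (norm \<xi>)\<^sup>2" by (simp add: power2_sum)
      ultimately have "1 + (\<xi> $ j)\<^sup>2 \<le> (1 + norm \<xi>)\<^sup>2" using norm_ge_zero[of \<xi>] by linarith
      then show "1 \<le> (1 + norm \<xi>)\<^sup>2 * inverse (1 + (\<xi> $ j)\<^sup>2)"
        by (simp add: field_simps add_pos_nonneg)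
    qed auto
    also have "\<dots> = (1 + norm \<xi>) ^ (2 * d) * weight \<xi>"
      by (simp add: prod.distrib weight_def d_def power_mult)
    finally show ?thesis .
  qed
  define K where "K = C * W / (2 * pi) ^ d"
  have "cmod (u (axis j (Suc 0)) 0) \<le> K * M"
    if c: "elliptic_class m A \<kappa> R c" and u: "unit_solution m c M u" for c and u :: "'d jet" and M j
  proof -
    have M0: "M \<ge> 0" by (rule unit_solution_nonneg[OF u])
    have us: "smooth_on (ball 0 1) u" using u by (simp add: unit_solution_def)
    note sm = cutoff_compact_support(1)[OF \<theta> us]
    note sp = cutoff_compact_support(2)[OF \<theta> us]
    have z0: "zeta 0 = cvec" by (simp add: zeta_def cvec_def fun_eq_iff)
    have F: "cmod (fourier (jet_mult \<theta> u (0 + axis j (Suc 0))) (zeta 0 \<xi>)) \<le> (C * M) * weight \<xi>" for \<xi>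
    proof -
      let ?Y = "1 + norm \<xi>"
      have "fourier (jet_mult \<theta> u (0 + axis j (Suc 0))) (zeta 0 \<xi>) = \<i> * zeta 0 \<xi> $ j * fourier (jet_mult \<theta> u 0) (zeta 0 \<xi>)"
        by (rule fourier_deriv[OF sm]) (rule sp)
      also have "fourier (jet_mult \<theta> u 0) (zeta 0 \<xi>) = fourier (\<lambda>x. \<theta> 0 x * u 0 x) (cvec \<xi>)"
        by (simp add: fourier_def z0)
      finally have "cmod (fourier (jet_mult \<theta> u (0 + axis j (Suc 0))) (zeta 0 \<xi>)) = \<bar>\<xi> $ j\<bar> * cmod (fourier (\<lambda>x. \<theta> 0 x * u 0 x) (cvec \<xi>))"
        by (simp add: norm_mult z0 cvec_def)
      also have "\<dots> \<le> ?Y * cmod (fourier (\<lambda>x. \<theta> 0 x * u 0 x) (cvec \<xi>))"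
        using component_le_norm_cart[of \<xi> j] by (intro mult_right_mono) auto
      also have "\<dots> \<le> (?Y ^ (2 * d) * weight \<xi>) * (?Y * cmod (fourier (\<lambda>x. \<theta> 0 x * u 0 x) (cvec \<xi>)))"
        using mult_right_mono[OF weight[of \<xi>], of "?Y * cmod (fourier (\<lambda>x. \<theta> 0 x * u 0 x) (cvec \<xi>))"] by simp
      also have "\<dots> = (?Y ^ (2 * d + 1) * cmod (fourier (\<lambda>x. \<theta> 0 x * u 0 x) (cvec \<xi>))) * weight \<xi>"
        by (simp add: mult_ac)
      also have "\<dots> \<le> (C * M) * weight \<xi>"
        by (intro mult_right_mono C(2)[OF c u] less_imp_le[OF weight_pos])
      finally show ?thesis .
    qed
    have "cmod (osc (\<lambda>_. 1) 0 (jet_mult \<theta> u (0 + axis j (Suc 0))) 0) \<le> (C * M) * exp (0 \<bullet> (0 :: real ^ 'd)) * W"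
      unfolding W_def by (rule osc_bound[OF sm sp _ _ F]) auto
    also have "osc (\<lambda>_. 1) 0 (jet_mult \<theta> u (0 + axis j (Suc 0))) 0 = of_real ((2 * pi) ^ CARD('d)) * jet_mult \<theta> u (0 + axis j (Suc 0)) 0"
      by (rule osc_one[OF sm sp])
    also have "jet_mult \<theta> u (0 + axis j (Suc 0)) 0 = u (axis j (Suc 0)) 0"
      by (simp add: jet_mult_axis \<theta>1 axis_eq_0_iff)
    finally have "(2 * pi) ^ d * cmod (u (axis j (Suc 0)) 0) \<le> C * M * W"
      by (simp add: norm_mult d_def norm_power)
    then show ?thesis by (simp add: K_def field_simps)
  qed
  moreover have "K \<ge> 0" using C(1) W by (simp add: K_def)
  ultimately show ?thesis by blast
qed

end

text \<open>The symbol of the rescaled operator is \<open>\<delta> ^ m\<close> times the old symbol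
  at \<open>\<xi> / \<delta>\<close>. As \<open>\<delta> \<le> 1\<close>, frequencies only grow and
  the threshold \<open>R\<close> is kept; the factors \<open>\<delta> ^ (m - mi_size a)\<close> do
  not enlarge the coefficients.\<close>

lemma elliptic_class_scale:
  fixes c :: "'d::finite multi_index => complex"
  assumes c: "elliptic_class m A \<kappa> R c" and \<delta>: "0 < \<delta>" "\<delta> \<le> 1" and A: "A \<ge> 0"
  shows "elliptic_class m A \<kappa> R (\<lambda>a. of_real (\<delta> ^ (m - mi_size a)) * c a)"
  unfolding elliptic_class_def
proof (intro conjI allI impI)
  fix a :: "'d multi_index" assume "mi_size a \<le> m"
  then have "cmod (c a) \<le> A" using c by (simp add: elliptic_class_def)
  moreover have "\<delta> ^ (m - mi_size a) \<le> 1" using \<delta> by (intro power_le_one) auto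
  ultimately have "\<delta> ^ (m - mi_size a) * cmod (c a) \<le> 1 * A" using \<delta> by (intro mult_mono) auto
  then show "cmod (of_real (\<delta> ^ (m - mi_size a)) * c a) \<le> A"
    unfolding norm_mult norm_of_real using \<delta> by simp
next
  fix \<xi> :: "real ^ 'd" assume R: "R \<le> norm \<xi>"
  have op_eq: "op_symbol m (\<lambda>a. of_real (\<delta> ^ (m - mi_size a)) * c a) \<xi> = of_real (\<delta> ^ m) * op_symbol m c ((1 / \<delta>) *\<^sub>R \<xi>)"
    unfolding op_symbol_def sum_distrib_left
  proof (intro sum.cong refl)
    fix a :: "'d multi_index" assume "a \<in> {a. mi_size a \<le> m}"
    then have a: "mi_size a \<le> m" by simp
    have eq: "\<i> * of_real (((1 / \<delta>) *\<^sub>R \<xi>) $ j) = of_real (1 / \<delta>) * (\<i> * of_real (\<xi> $ j))" for j by simp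
    have "(\<Prod>j\<in>UNIV. (\<i> * of_real (((1 / \<delta>) *\<^sub>R \<xi>) $ j)) ^ (a $ j)) =
       of_real (1 / \<delta>) ^ mi_size a * (\<Prod>j\<in>UNIV. (\<i> * of_real (\<xi> $ j)) ^ (a $ j))"
      unfolding eq power_mult_distrib[of "of_real (1 / \<delta>)"] prod.distrib mi_size_prod_const ..
    note 1 = this
    have "\<delta> ^ m * (1 / \<delta>) ^ mi_size a = \<delta> ^ (m - mi_size a)"
      using \<delta> a by (simp add: power_diff power_one_over field_simps)
    then have 2: "complex_of_real (\<delta> ^ (m - mi_size a)) = of_real (\<delta> ^ m) * of_real (1 / \<delta>) ^ mi_size a"
      by (simp only: of_real_power[symmetric] of_real_mult[symmetric])
    show "of_real (\<delta> ^ (m - mi_size a)) * c a * (\<Prod>j\<in>UNIV. (\<i> * of_real (\<xi> $ j)) ^ (a $ j)) =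
       of_real (\<delta> ^ m) * (c a * (\<Prod>j\<in>UNIV. (\<i> * of_real (((1 / \<delta>) *\<^sub>R \<xi>) $ j)) ^ (a $ j)))"
      unfolding 1 2 by (simp only: mult_ac)
  qed
  moreover have "R \<le> norm ((1 / \<delta>) *\<^sub>R \<xi>)"
  proof -
    have "norm \<xi> \<le> norm \<xi> / \<delta>" using \<delta> by (simp add: field_simps mult_left_le_one_le)
    then show ?thesis using R \<delta> by simp
  qed
  then have "\<kappa> * norm ((1 / \<delta>) *\<^sub>R \<xi>) ^ m \<le> cmod (op_symbol m c ((1 / \<delta>) *\<^sub>R \<xi>))"
    using c unfolding elliptic_class_def by blast
  then have "\<delta> ^ m * (\<kappa> * norm ((1 / \<delta>) *\<^sub>R \<xi>) ^ m) \<le> \<delta> ^ m * cmod (op_symbol m c ((1 / \<delta>) *\<^sub>R \<xi>))"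
    using \<delta> by (intro mult_left_mono) auto
  moreover have "\<delta> ^ m * (\<kappa> * norm ((1 / \<delta>) *\<^sub>R \<xi>) ^ m) = \<kappa> * norm \<xi> ^ m"
    using \<delta> by (simp add: power_divide)
  ultimately have "\<kappa> * norm \<xi> ^ m \<le> \<delta> ^ m * cmod (op_symbol m c ((1 / \<delta>) *\<^sub>R \<xi>))" by linarith
  then show "\<kappa> * norm \<xi> ^ m \<le> cmod (op_symbol m (\<lambda>a. of_real (\<delta> ^ (m - mi_size a)) * c a) \<xi>)"
    unfolding op_eq using \<delta> by (simp add: norm_mult norm_power)
qed

lemma interior_estimate:
  fixes c :: "'d::finite multi_index => complex"
  assumes c: "elliptic_class m A \<kappa> R c" and "A \<ge> 0" "\<kappa> > 0"
  obtains C where "C \<ge> 0" "\<And>\<delta> x u M j. 0 < \<delta> ==> \<delta> \<le> 1 ==> smooth_on (ball x \<delta>) u ==>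
    (\<And>y. y \<in> ball x \<delta> ==> const_op m c u 0 y = 0) ==> (\<And>y. y \<in> ball x \<delta> ==> cmod (u 0 y) \<le> M) ==>
    \<delta> * cmod (u (axis j (Suc 0)) x) \<le> C * M"
proof -
  obtain C where C: "C \<ge> 0" "\<And>c (u :: 'd jet) M j. elliptic_class m A \<kappa> R c ==> unit_solution m c M u ==> cmod (u (axis j (Suc 0)) 0) \<le> C * M"
    using unit_interior_estimate[OF assms(2,3), of m R] by blast
  show ?thesis
  proof
    fix \<delta> x and u :: "'d jet" and M j
    assume \<delta>: "0 < \<delta>" "\<delta> \<le> 1" and u: "smooth_on (ball x \<delta>) u"
      and eq: "\<And>y. y \<in> ball x \<delta> ==> const_op m c u 0 y = 0" and M: "\<And>y. y \<in> ball x \<delta> ==> cmod (u 0 y) \<le> M"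
    define v where "v = (\<lambda>a y. of_real (\<delta> ^ mi_size a) * u a (x + \<delta> *\<^sub>R y))"
    have inb: "x + \<delta> *\<^sub>R y \<in> ball x \<delta>" if "y \<in> ball 0 1" for y
      using that \<delta> by (simp add: dist_norm)
    have "unit_solution m (\<lambda>a. of_real (\<delta> ^ (m - mi_size a)) * c a) M v"
      unfolding unit_solution_def
    proof (intro conjI ballI)
      show "smooth_on (ball 0 1) v" unfolding v_def
        by (rule smooth_on_subset[OF smooth_on_affine[OF u]]) (use inb in auto)
      fix y :: "real ^ 'd" assume y: "y \<in> ball 0 1"
      have "const_op m (\<lambda>a. of_real (\<delta> ^ (m - mi_size a)) * c a) v 0 y = of_real (\<delta> ^ m) * const_op m c u 0 (x + \<delta> *\<^sub>R y)"
        unfolding const_op_def sum_distrib_left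
      proof (intro sum.cong refl)
        fix a :: "'d multi_index" assume "a \<in> {a. mi_size a \<le> m}"
        then have "\<delta> ^ (m - mi_size a) * \<delta> ^ mi_size a = \<delta> ^ m" by (simp add: power_add[symmetric])
        then have "complex_of_real (\<delta> ^ (m - mi_size a)) * of_real (\<delta> ^ mi_size a) = of_real (\<delta> ^ m)"
          by (simp only: of_real_mult[symmetric])
        then show "of_real (\<delta> ^ (m - mi_size a)) * c a * v (0 + a) y = of_real (\<delta> ^ m) * (c a * u (0 + a) (x + \<delta> *\<^sub>R y))"
          unfolding v_def add_0 by (metis mult.assoc mult.left_commute)
      qed
      then show "const_op m (\<lambda>a. of_real (\<delta> ^ (m - mi_size a)) * c a) v 0 y = 0" using eq[OF inb[OF y]] by simp
      show "cmod (v 0 y) \<le> M" using M[OF inb[OF y]] by (simp add: v_def)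
    qed
    from C(2)[OF elliptic_class_scale[OF c \<delta> assms(2)] this, of j]
    show "\<delta> * cmod (u (axis j (Suc 0)) x) \<le> C * M" using \<delta> by (simp add: v_def norm_mult)
  qed (rule C(1))
qed

text \<open>Derivatives of a solution are solutions, so the interior estimate can be iterated.
  Spending an equal share of the radius on each derivative gives growth of type
  \<open>k ^ k\<close>, comparable to factorials, which is real analyticity with explicit
  constants.\<close>

lemma solution_derivative_bound:
  fixes c :: "'d::finite multi_index => complex"
  assumes c: "elliptic_class m A \<kappa> R c" and "A \<ge> 0" "\<kappa> > 0"
  obtains C where "C \<ge> 1" "\<And>s x u M a. 0 < s ==> s \<le> 1 ==> smooth_on (ball x s) u ==>
    (\<And>b y. y \<in> ball x s ==> const_op m c u b y = 0) ==> (\<And>y. y \<in> ball x s ==> cmod (u 0 y) \<le> M) ==>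
    cmod (u a x) \<le> (C * real (Suc (mi_size a)) / s) ^ mi_size a * M"
proof -
  obtain C where C: "C \<ge> 0" "\<And>\<delta> x (u :: 'd jet) M j. 0 < \<delta> ==> \<delta> \<le> 1 ==> smooth_on (ball x \<delta>) u ==>
    (\<And>y. y \<in> ball x \<delta> ==> const_op m c u 0 y = 0) ==> (\<And>y. y \<in> ball x \<delta> ==> cmod (u 0 y) \<le> M) ==>
    \<delta> * cmod (u (axis j (Suc 0)) x) \<le> C * M"
    using interior_estimate[OF assms] by metis
  have main: "cmod (u a x) \<le> (C * real (Suc (mi_size a)) / s) ^ mi_size a * M"
    if s: "0 < s" "s \<le> 1" and u: "smooth_on (ball x s) u"
      and eq: "\<And>b y. y \<in> ball x s ==> const_op m c u b y = 0" and M: "\<And>y. y \<in> ball x s ==> cmod (u 0 y) \<le> M"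
    for s x and u :: "'d jet" and M a
  proof -
    define k where "k = mi_size a"
    \<comment> \<open>There are \<open>k\<close> steps of this length. The extra share keeps the
      centre strictly inside the last ball.\<close>
    define \<delta> where "\<delta> = s / real (Suc k)"
    have \<delta>: "\<delta> > 0" "\<delta> \<le> 1" using s by (auto simp: \<delta>_def field_simps)
    have "cmod (u \<gamma> y) \<le> (C / \<delta>) ^ mi_size \<gamma> * M" if "dist x y < s - real (mi_size \<gamma>) * \<delta>" for \<gamma> y
      using that
    proof (induction \<gamma> arbitrary: y rule: multi_index_induct)
      case zero
      then show ?case using M by simp
    next
      case (add \<gamma> j)
      let ?v = "\<lambda>b. u (b + \<gamma>)"
      have d: "dist x z < s - real (mi_size \<gamma>) * \<delta>" if "z \<in> ball y \<delta>" for z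
      proof -
        have "dist x z \<le> dist x y + dist y z" by (rule dist_triangle)
        then show ?thesis using add.prems that by (simp add: algebra_simps)
      qed
      have sub: "z \<in> ball x s" if "z \<in> ball y \<delta>" for z
        using d[OF that] \<delta> by (simp, smt (verit) mult_nonneg_nonneg of_nat_0_le_iff)
      have "\<delta> * cmod (?v (axis j (Suc 0)) y) \<le> C * ((C / \<delta>) ^ mi_size \<gamma> * M)"
      proof (rule C(2)[OF \<delta>])
        show "smooth_on (ball y \<delta>) ?v" by (rule smooth_on_shift[OF smooth_on_subset[OF u]]) (use sub in auto)
        show "const_op m c ?v 0 z = 0" if "z \<in> ball y \<delta>" for z
          using eq[OF sub[OF that], of \<gamma>] by (simp add: const_op_def add.commute)
        show "cmod (?v 0 z) \<le> (C / \<delta>) ^ mi_size \<gamma> * M" if "z \<in> ball y \<delta>" for z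
          using add.IH[OF d[OF that]] by simp
      qed
      then have "cmod (u (\<gamma> + axis j (Suc 0)) y) \<le> (C * ((C / \<delta>) ^ mi_size \<gamma> * M)) / \<delta>"
        using \<delta> by (simp add: field_simps add.commute)
      then show ?case by (simp add: mult_ac)
    qed
    moreover have "dist x x < s - real (mi_size a) * \<delta>"
      using s by (simp add: \<delta>_def k_def[symmetric] field_simps)
    ultimately have "cmod (u a x) \<le> (C / \<delta>) ^ mi_size a * M" by blast
    then show ?thesis by (simp add: \<delta>_def k_def)
  qed
  show ?thesis
  proof
    show "max C 1 \<ge> 1" by simp
    fix s x and u :: "'d jet" and M a
    assume s: "0 < s" "s \<le> 1" and u: "smooth_on (ball x s) u"
      and eq: "\<And>b y. y \<in> ball x s ==> const_op m c u b y = 0" and M: "\<And>y. y \<in> ball x s ==> cmod (u 0 y) \<le> M"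
    have "cmod (u 0 x) \<le> M" using M s by simp
    then have "M \<ge> 0" by (rule order_trans[OF norm_ge_zero])
    have "cmod (u a x) \<le> (C * real (Suc (mi_size a)) / s) ^ mi_size a * M" by (rule main[OF s u eq M])
    also have "\<dots> \<le> (max C 1 * real (Suc (mi_size a)) / s) ^ mi_size a * M"
      using C(1) s \<open>M \<ge> 0\<close> by (intro mult_right_mono power_mono divide_right_mono) auto
    finally show "cmod (u a x) \<le> (max C 1 * real (Suc (mi_size a)) / s) ^ mi_size a * M" .
  qed
qed

lemma mi_power_cmod_le: "\<bar>mi_power \<xi> a\<bar> \<le> norm \<xi> ^ mi_size a"
proof -
  have "\<bar>mi_power \<xi> a\<bar> = (\<Prod>j\<in>UNIV. \<bar>\<xi> $ j\<bar> ^ (a $ j))" by (simp add: mi_power_def abs_prod power_abs)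
  also have "\<dots> \<le> (\<Prod>j\<in>UNIV. norm \<xi> ^ (a $ j))"
    by (intro prod_mono) (auto intro!: power_mono component_le_norm_cart)
  finally show ?thesis by (simp add: mi_size_def power_sum)
qed

text \<open>The principal part is homogeneous and attains a positive minimum \<open>k0\<close> on
  the unit sphere; for large frequencies the remaining terms take away at most half of it.\<close>

lemma elliptic_imp_class:
  fixes P :: "'d::finite mpoly"
  assumes "elliptic P"
  obtains A \<kappa> R where "A \<ge> 0" "\<kappa> > 0" "elliptic_class (mpoly_degree P) A \<kappa> R (op_coeff P)"
proof -
  define m where "m = mpoly_degree P"
  define K where "K = Poly_Mapping.keys P"
  have finK: "finite K" by (simp add: K_def)
  have symb: "op_symbol m (op_coeff P) \<xi> = (\<Sum>a\<in>K. Poly_Mapping.lookup P a * of_real (mi_power \<xi> a))" for \<xi>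
    unfolding op_symbol_def
  proof (rule sum.mono_neutral_cong_right)
    show "finite {a :: 'd multi_index. mi_size a \<le> m}" by (rule finite_mi_size_le)
    show "K \<subseteq> {a. mi_size a \<le> m}" using mi_size_le_degree by (auto simp: K_def m_def)
    show "\<forall>a\<in>{a. mi_size a \<le> m} - K. op_coeff P a * (\<Prod>j\<in>UNIV. (\<i> * of_real (\<xi> $ j)) ^ (a $ j)) = 0"
      by (simp add: K_def op_coeff_def in_keys_iff)
    fix a assume "a \<in> K"
    have "(\<Prod>j\<in>UNIV. (\<i> * complex_of_real (\<xi> $ j)) ^ (a $ j)) = \<i> ^ mi_size a * of_real (mi_power \<xi> a)"
      unfolding power_mult_distrib prod.distrib mi_size_prod_const by (simp add: mi_power_def)
    moreover have "(- \<i>) ^ mi_size a * \<i> ^ mi_size a = 1" by (simp add: power_mult_distrib[symmetric])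
    ultimately show "op_coeff P a * (\<Prod>j\<in>UNIV. (\<i> * of_real (\<xi> $ j)) ^ (a $ j)) = Poly_Mapping.lookup P a * of_real (mi_power \<xi> a)"
      unfolding op_coeff_def by (metis mult.assoc mult.commute mult_1)
  qed
  have cont: "continuous_on S (\<lambda>\<xi>. cmod (principal_part P \<xi>))" for S
    unfolding principal_part_def mi_power_def by (intro continuous_intros)
  have "sphere (0 :: real ^ 'd) 1 \<noteq> {}" by simp
  then obtain \<xi>0 where \<xi>0: "\<xi>0 \<in> sphere 0 1" "\<And>\<xi>. \<xi> \<in> sphere 0 1 ==> cmod (principal_part P \<xi>0) \<le> cmod (principal_part P \<xi>)"
    using continuous_attains_inf[OF compact_sphere _ cont, of 0 1] by blast
  define k0 where "k0 = cmod (principal_part P \<xi>0)"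
  have "\<xi>0 \<noteq> 0" using \<xi>0(1) by auto
  then have k0: "k0 > 0" using assms by (simp add: k0_def elliptic_def)
  have princ: "k0 * norm \<xi> ^ m \<le> cmod (principal_part P \<xi>)" if "\<xi> \<noteq> 0" for \<xi>
  proof -
    define \<omega> where "\<omega> = (1 / norm \<xi>) *\<^sub>R \<xi>"
    have "mi_power (norm \<xi> *\<^sub>R \<omega>) a = norm \<xi> ^ mi_size a * mi_power \<omega> a" for a
      by (simp add: mi_power_def mi_size_def power_sum power_mult_distrib prod.distrib)
    moreover have "norm \<xi> *\<^sub>R \<omega> = \<xi>" using that by (simp add: \<omega>_def)
    ultimately have "mi_power \<xi> a = norm \<xi> ^ mi_size a * mi_power \<omega> a" for a by metis
    then have "principal_part P \<xi> = of_real (norm \<xi> ^ m) * principal_part P \<omega>"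
      unfolding principal_part_def sum_distrib_left m_def by (intro sum.cong) auto
    moreover have "\<omega> \<in> sphere 0 1" using that by (simp add: \<omega>_def)
    ultimately show ?thesis using \<xi>0(2)[of \<omega>] by (simp add: norm_mult norm_power k0_def mult.commute mult_left_mono)
  qed
  define S where "S = (\<Sum>a\<in>K. cmod (Poly_Mapping.lookup P a))"
  have S0: "S \<ge> 0" by (simp add: S_def sum_nonneg)
  \<comment> \<open>Where \<open>norm \<xi> \<ge> 1\<close>, terms of lower order are at most
    \<open>S * norm \<xi> ^ m / norm \<xi>\<close>, and beyond \<open>2 * S / k0\<close> this is
    half of the principal bound.\<close>
  define R where "R = max 1 (2 * S / k0)"
  have "elliptic_class m S (k0 / 2) R (op_coeff P)"
    unfolding elliptic_class_def
  proof (intro conjI allI impI)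
    fix a :: "'d multi_index" assume "mi_size a \<le> m"
    show "cmod (op_coeff P a) \<le> S"
    proof (cases "a \<in> K")
      case True
      then have "cmod (Poly_Mapping.lookup P a) \<le> S" unfolding S_def by (intro member_le_sum finK) auto
      then show ?thesis by (simp add: op_coeff_def norm_mult norm_power)
    next
      case False
      then show ?thesis using S0 by (simp add: K_def op_coeff_def in_keys_iff)
    qed
  next
    fix \<xi> :: "real ^ 'd" assume "R \<le> norm \<xi>"
    then have n1: "norm \<xi> \<ge> 1" and nS: "2 * S / k0 \<le> norm \<xi>" by (auto simp: R_def)
    have n0: "norm \<xi> > 0" using n1 by linarith
    define L where "L = (\<Sum>a\<in>{a\<in>K. mi_size a \<noteq> m}. Poly_Mapping.lookup P a * of_real (mi_power \<xi> a))"
    have split: "op_symbol m (op_coeff P) \<xi> = principal_part P \<xi> + L"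
    proof -
      have "K = {a\<in>K. mi_size a = m} \<union> {a\<in>K. mi_size a \<noteq> m}" by blast
      then have "(\<Sum>a\<in>K. Poly_Mapping.lookup P a * of_real (mi_power \<xi> a)) =
        (\<Sum>a\<in>{a\<in>K. mi_size a = m}. Poly_Mapping.lookup P a * of_real (mi_power \<xi> a)) + L"
        unfolding L_def using finK by (metis (no_types, lifting) sum.union_disjoint[of "{a\<in>K. mi_size a = m}" "{a\<in>K. mi_size a \<noteq> m}"] Collect_mem_eq disjoint_iff finite_Un mem_Collect_eq)
      then show ?thesis unfolding symb by (simp add: principal_part_def K_def m_def)
    qed
    have "cmod L \<le> (\<Sum>a\<in>{a\<in>K. mi_size a \<noteq> m}. cmod (Poly_Mapping.lookup P a) * (norm \<xi> ^ m / norm \<xi>))"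
      unfolding L_def
    proof (rule sum_norm_le)
      fix a assume "a \<in> {a\<in>K. mi_size a \<noteq> m}"
      then have "mi_size a < m" using mi_size_le_degree[of a P] by (auto simp: K_def m_def)
      then have "norm \<xi> ^ Suc (mi_size a) \<le> norm \<xi> ^ m" using n1 by (intro power_increasing) auto
      then have "norm \<xi> ^ mi_size a \<le> norm \<xi> ^ m / norm \<xi>" using n0 by (simp add: field_simps)
      then have "\<bar>mi_power \<xi> a\<bar> \<le> norm \<xi> ^ m / norm \<xi>" using mi_power_cmod_le[of \<xi> a] by linarith
      then show "cmod (Poly_Mapping.lookup P a * of_real (mi_power \<xi> a)) \<le> cmod (Poly_Mapping.lookup P a) * (norm \<xi> ^ m / norm \<xi>)"
        unfolding norm_mult norm_of_real by (rule mult_left_mono) simp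
    qed
    also have "\<dots> \<le> S * (norm \<xi> ^ m / norm \<xi>)"
      unfolding sum_distrib_right[symmetric] S_def using finK by (intro mult_right_mono sum_mono2) auto
    also have "\<dots> \<le> (k0 / 2) * norm \<xi> ^ m"
    proof -
      have "S / norm \<xi> \<le> k0 / 2" using nS k0 n0 by (simp add: field_simps)
      then have "S / norm \<xi> * norm \<xi> ^ m \<le> (k0 / 2) * norm \<xi> ^ m" by (rule mult_right_mono) simp
      then show ?thesis by simp
    qed
    finally have "cmod L \<le> (k0 / 2) * norm \<xi> ^ m" .
    moreover have "k0 * norm \<xi> ^ m \<le> cmod (principal_part P \<xi>)" using n0 by (intro princ) auto
    moreover have "cmod (principal_part P \<xi>) \<le> cmod (op_symbol m (op_coeff P) \<xi>) + cmod L"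
      unfolding split by (metis add_diff_cancel_right' norm_triangle_ineq4)
    moreover have "k0 * norm \<xi> ^ m = (k0 / 2) * norm \<xi> ^ m + (k0 / 2) * norm \<xi> ^ m" by simp
    ultimately show "k0 / 2 * norm \<xi> ^ m \<le> cmod (op_symbol m (op_coeff P) \<xi>)" by linarith
  qed
  then show ?thesis using that[of S "k0 / 2" R] S0 k0 by (simp add: m_def)
qed


section \<open>Analyticity: translating solutions by their Taylor series\<close>

text \<open>Differentiation along \<open>h\<close>, acting on the whole family. It commutes with
  constant coefficient operators, so a partial sum of the Taylor series of a translation solves the
  equation wherever the original function does: the set of sources is not enlarged.\<close>

definition dir_op :: "real ^ 'd => ('d::finite) jet => 'd jet" where
  "dir_op h f = (\<lambda>a x. \<Sum>j\<in>UNIV. (h $ j) *\<^sub>R f (a + axis j (Suc 0)) x)"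

lemma smooth_on_dir_op: "smooth_on S f ==> smooth_on S (dir_op h f)"
  unfolding dir_op_def scaleR_conv_of_real[where 'a = complex]
  by (intro smooth_on_sum smooth_on_cmult smooth_on_shift)

lemma smooth_on_dir_op_pow: "smooth_on S f ==> smooth_on S ((dir_op h ^^ k) f)"
  by (induction k) (auto intro: smooth_on_dir_op)

lemma const_op_dir_op: "const_op m c (dir_op h f) = dir_op h (const_op m c f)"
proof (intro ext)
  fix b x
  show "const_op m c (dir_op h f) b x = dir_op h (const_op m c f) b x"
    unfolding const_op_def dir_op_def sum_distrib_left scaleR_sum_right
    by (subst sum.swap) (simp add: add_ac)
qed

lemma const_op_dir_op_pow: "const_op m c ((dir_op h ^^ k) f) = (dir_op h ^^ k) (const_op m c f)"
  by (induction k) (auto simp: const_op_dir_op)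

lemma dir_op_pow_zero: "(\<And>a. f a x = 0) ==> (dir_op h ^^ k) f a x = 0"
  by (induction k arbitrary: a) (auto simp: dir_op_def)

lemma dir_op_pow_bound:
  fixes f :: "'d::finite jet"
  assumes "\<And>\<gamma>. mi_size \<gamma> = k ==> cmod (f (a + \<gamma>) x) \<le> B"
  shows "cmod ((dir_op h ^^ k) f a x) \<le> (real CARD('d) * norm h) ^ k * B"
  using assms
proof (induction k arbitrary: a)
  case 0
  then show ?case by (metis add_0_right funpow_0 mi_size_0 mult_1 power_0)
next
  case (Suc k)
  have "cmod ((dir_op h ^^ k) f (a + axis j (Suc 0)) x) \<le> (real CARD('d) * norm h) ^ k * B" for j
  proof (rule Suc.IH)
    fix \<gamma> :: "'d multi_index" assume "mi_size \<gamma> = k"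
    then show "cmod (f (a + axis j (Suc 0) + \<gamma>) x) \<le> B"
      using Suc.prems[of "axis j (Suc 0) + \<gamma>"] by (simp add: mi_size_add add.assoc)
  qed
  from norm_sum_scaleR_le[OF this, of h "\<lambda>j. j"]
  show ?case by (simp add: dir_op_def[of h "(dir_op h ^^ k) f"] mult_ac)
qed

lemma dir_op_has_derivative:
  assumes "smooth_on S f" "x + t *\<^sub>R h \<in> S"
  shows "((\<lambda>t. f a (x + t *\<^sub>R h)) has_vector_derivative dir_op h f a (x + t *\<^sub>R h)) (at t)"
proof -
  have "((\<lambda>t::real. x + t *\<^sub>R h) has_derivative (\<lambda>t. t *\<^sub>R h)) (at t)"
    by (auto intro!: derivative_eq_intros)
  from diff_chain_at[OF this smooth_onD[OF assms], unfolded o_def, of a]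
  show ?thesis by (simp add: has_vector_derivative_def dir_op_def scaleR_sum_right)
qed

text \<open>The real form of Taylor's theorem is applied to the real and the imaginary part
  separately, which accounts for the factor 2.\<close>

lemma taylor_translate:
  fixes f :: "'d::finite jet"
  assumes f: "smooth_on S f" and seg: "\<And>t. 0 \<le> t ==> t \<le> 1 ==> x + t *\<^sub>R h \<in> S"
    and B: "\<And>t. 0 \<le> t ==> t \<le> 1 ==> cmod ((dir_op h ^^ Suc n) f a (x + t *\<^sub>R h)) \<le> B"
  shows "cmod (f a (x + h) - (\<Sum>k\<le>n. (dir_op h ^^ k) f a x / fact k)) \<le> 2 * (B / fact n)"
proof -
  let ?g = "\<lambda>k t. (dir_op h ^^ k) f a (x + t *\<^sub>R h)"
  have der: "(?g k has_vector_derivative ?g (Suc k) t) (at t within {0..1})" if "t \<in> {0..1}" for k t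
    using dir_op_has_derivative[OF smooth_on_dir_op_pow[OF f, where h = h and k = k], of x t h a] seg that
    by (auto intro: has_vector_derivative_at_within)
  let ?E = "f a (x + h) - (\<Sum>k\<le>n. (dir_op h ^^ k) f a x / fact k)"
  have "norm (Re (?g 0 1) - (\<Sum>i\<le>n. Re (?g i 0) * (1 - 0) ^ i / fact i)) \<le> B * norm (1 - 0 :: real) ^ Suc n / fact n"
  proof (rule field_Taylor[of "{0..1}" n "\<lambda>k t. Re (?g k t)" B 0 1])
    show "((\<lambda>t. Re (?g i t)) has_field_derivative Re (?g (Suc i) t)) (at t within {0..1})" if "t \<in> {0..1}" "i \<le> n" for i t
      unfolding has_real_derivative_iff_has_vector_derivative by (rule bounded_linear.has_vector_derivative[OF bounded_linear_Re der[OF that(1)]])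
    show "norm (Re (?g (Suc n) t)) \<le> B" if "t \<in> {0..1}" for t
      using B[of t] abs_Re_le_cmod[of "?g (Suc n) t"] that by (auto simp del: funpow.simps intro: order_trans)
  qed auto
  moreover have RI: "Re (z / fact i) = Re z / fact i" "Im (z / fact i) = Im z / fact i" for z i
    using Re_divide_of_real[of z "fact i"] Im_divide_of_real[of z "fact i"] by simp_all
  ultimately have R: "\<bar>Re ?E\<bar> \<le> B / fact n" by (simp add: RI)
  have "norm (Im (?g 0 1) - (\<Sum>i\<le>n. Im (?g i 0) * (1 - 0) ^ i / fact i)) \<le> B * norm (1 - 0 :: real) ^ Suc n / fact n"
  proof (rule field_Taylor[of "{0..1}" n "\<lambda>k t. Im (?g k t)" B 0 1])
    show "((\<lambda>t. Im (?g i t)) has_field_derivative Im (?g (Suc i) t)) (at t within {0..1})" if "t \<in> {0..1}" "i \<le> n" for i t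
      unfolding has_real_derivative_iff_has_vector_derivative by (rule bounded_linear.has_vector_derivative[OF bounded_linear_Im der[OF that(1)]])
    show "norm (Im (?g (Suc n) t)) \<le> B" if "t \<in> {0..1}" for t
      using B[of t] abs_Im_le_cmod[of "?g (Suc n) t"] that by (auto simp del: funpow.simps intro: order_trans)
  qed auto
  then have I: "\<bar>Im ?E\<bar> \<le> B / fact n" by (simp add: RI)
  have "cmod ?E \<le> \<bar>Re ?E\<bar> + \<bar>Im ?E\<bar>" by (rule cmod_le)
  with R I show ?thesis by linarith
qed

text \<open>The quotient of \<open>n ^ n\<close> by \<open>n!\<close> is a single term of the series
  for \<open>exp n\<close>, and \<open>exp 1 \<le> 3\<close>.\<close>

lemma power_le_fact: "real n ^ n \<le> 3 ^ n * fact n"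
proof -
  have s: "(\<lambda>k. real n ^ k /\<^sub>R fact k) sums exp (real n)" by (rule exp_converges)
  have "real n ^ n /\<^sub>R fact n = (\<Sum>k\<in>{n}. real n ^ k /\<^sub>R fact k)" by simp
  also have "\<dots> \<le> exp (real n)"
    unfolding sums_unique[OF s] by (rule sum_le_suminf[OF sums_summable[OF s]]) auto
  also have "exp (real n) = exp 1 ^ n" by (simp add: exp_of_nat_mult[symmetric])
  also have "\<dots> \<le> 3 ^ n" using exp_le by (intro power_mono) auto
  finally show ?thesis by (simp add: field_simps)
qed

text \<open>Solutions of elliptic equations are real analytic, with a radius depending only on the room available.\<close>

lemma solution_translate:
  fixes c :: "'d::finite multi_index => complex"
  assumes c: "elliptic_class m A \<kappa> R c" and "A \<ge> 0" "\<kappa> > 0"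
  shows "\<exists>\<rho>>0. \<forall>s v X n \<epsilon> h. 0 < s --> s \<le> 1 --> smooth_on UNIV v --> bounded X -->
    (\<forall>x\<in>X. \<forall>y. dist x y < 2 * s --> (\<forall>j. const_op m c v j y = 0)) --> norm h \<le> \<rho> * s --> \<epsilon> > 0 -->
    (\<exists>N. \<forall>x\<in>X. \<forall>a. mi_size a \<le> n --> cmod (v a (x + h) - (\<Sum>k\<le>N. (dir_op h ^^ k) v a x / fact k)) < \<epsilon>)"
proof -
  obtain C where C: "C \<ge> 1" "\<And>s x (u :: 'd jet) M a. 0 < s ==> s \<le> 1 ==> smooth_on (ball x s) u ==>
    (\<And>j y. y \<in> ball x s ==> const_op m c u j y = 0) ==> (\<And>y. y \<in> ball x s ==> cmod (u 0 y) \<le> M) ==>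
    cmod (u a x) \<le> (C * real (Suc (mi_size a)) / s) ^ mi_size a * M"
    using solution_derivative_bound[OF assms] by metis
  define d where "d = real CARD('d)"
  have d: "d \<ge> 1" unfolding d_def by simp
  \<comment> \<open>\<open>d\<close> and \<open>C\<close> cancel the factors per derivative of
    \<open>dir_op_pow_bound\<close> and of the derivative bound. Of the 6, a factor 3 compensates
    \<open>n ^ n\<close> against \<open>n!\<close> and a factor 2 remains as the ratio of a
    convergent series.\<close>
  define \<rho> where "\<rho> = 1 / (6 * d * C)"
  have dC: "d * C \<ge> 1" using mult_mono[of 1 d 1 C] d C(1) by simp
  have \<rho>: "0 < \<rho>" "\<rho> \<le> 1" using dC d C(1) by (auto simp: \<rho>_def field_simps)
  show ?thesis
  proof (intro exI[of _ \<rho>] conjI allI impI \<rho>(1))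
    fix s :: real and v :: "'d jet" and X and n and \<epsilon> :: real and h :: "real ^ 'd"
    assume s: "0 < s" "s \<le> 1" and v: "smooth_on UNIV (v :: 'd jet)" and X: "bounded X"
      and sol': "\<forall>x\<in>X. \<forall>y. dist x y < 2 * s --> (\<forall>j. const_op m c v j y = 0)"
      and h: "norm h \<le> \<rho> * s" and \<epsilon>: "\<epsilon> > (0::real)"
    have sol: "const_op m c v j y = 0" if "x \<in> X" "dist x y < 2 * s" for j x y
      using sol' that by blast
    obtain b where b: "\<And>x. x \<in> X ==> norm x \<le> b" using X unfolding bounded_iff by blast
    have "\<exists>B\<ge>0. \<forall>x\<in>cball 0 (b + 2). cmod (v a x) \<le> B" for a
    proof -
      have "bounded (v a ` cball 0 (b + 2))"
        by (intro compact_imp_bounded compact_continuous_image smooth_on_continuous_on[OF smooth_on_subset[OF v]]) auto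
      then obtain B where B: "\<forall>z\<in>v a ` cball 0 (b + 2). cmod z \<le> B" unfolding bounded_iff by blast
      then show ?thesis by (intro exI[of _ "max B 0"]) (auto simp: le_max_iff_disj)
    qed
    then obtain B where B: "\<And>a. B a \<ge> 0" "\<And>a x. x \<in> cball 0 (b + 2) ==> cmod (v a x) \<le> B a" by metis
    define M where "M = (\<Sum>a | mi_size a \<le> n. B a)"
    have M: "cmod (v a x) \<le> M" if "mi_size a \<le> n" "x \<in> cball 0 (b + 2)" for a x
      using member_le_sum[of a "{a. mi_size a \<le> n}" B] that B(1) B(2)[of x a]
      by (auto simp: finite_mi_size_le M_def intro: order_trans)
    have M0: "M \<ge> 0" unfolding M_def by (intro sum_nonneg B(1))
    \<comment> \<open>A generous form of the Taylor error of degree \<open>N\<close> that is derived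
      below. It depends on neither the point nor the multi-index, so one \<open>N\<close> serves all
      of them.\<close>
    have "(\<lambda>N. 2 * (9 * M * real (Suc N) * (1 / 2) ^ Suc N)) \<longlonglongrightarrow> 0" by real_asymp
    then obtain N where N: "2 * (9 * M * real (Suc N) * (1 / 2) ^ Suc N) < \<epsilon>"
      using order_tendstoD(2)[OF _ \<epsilon>] eventually_happens'[OF sequentially_bot] by blast
    have "cmod (v a (x + h) - (\<Sum>k\<le>N. (dir_op h ^^ k) v a x / fact k)) < \<epsilon>" if x: "x \<in> X" and a: "mi_size a \<le> n" for x a
    proof -
      let ?k = "real (Suc (Suc N))"
      let ?B = "(d * norm h) ^ Suc N * ((C * ?k / s) ^ Suc N * M)"
      have hs: "norm h \<le> s" using h \<rho>(2) s by (meson mult_left_le_one_le less_imp_le order_trans \<rho>(1))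
      have "cmod ((dir_op h ^^ Suc N) v a (x + t *\<^sub>R h)) \<le> ?B" if t: "0 \<le> t" "t \<le> 1" for t
        unfolding d_def
      proof (rule dir_op_pow_bound)
        fix \<gamma> :: "'d multi_index" assume \<gamma>: "mi_size \<gamma> = Suc N"
        let ?z = "x + t *\<^sub>R h"
        have th: "norm (t *\<^sub>R h) \<le> s" using t hs mult_mono[of t 1 "norm h" s] by simp
        have "cmod ((\<lambda>j. v (j + a)) \<gamma> ?z) \<le> (C * real (Suc (mi_size \<gamma>)) / s) ^ mi_size \<gamma> * M"
        proof (rule C(2)[OF s])
          show "smooth_on (ball ?z s) (\<lambda>j. v (j + a))" by (rule smooth_on_shift[OF smooth_on_subset[OF v]]) simp
          fix y assume y: "y \<in> ball ?z s"
          \<comment> \<open>Points of the segment stay within \<open>s\<close> of \<open>x\<close>,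
            and the derivative bound is used on balls of radius \<open>s\<close> around them; hence
            the room \<open>2 * s\<close>.\<close>
          have dy: "dist x y < 2 * s"
          proof -
            have "dist x y \<le> dist x ?z + dist ?z y" by (rule dist_triangle)
            then show ?thesis using th y by (simp add: dist_norm)
          qed
          then show "const_op m c (\<lambda>j. v (j + a)) j y = 0" for j
            using sol[OF x dy, of "j + a"] by (simp add: const_op_def add_ac)
          have "norm y \<le> norm x + dist x y" by (metis dist_norm norm_minus_commute norm_triangle_sub)
          then have "y \<in> cball 0 (b + 2)" using b[OF x] dy s by simp
          then show "cmod (v (0 + a) y) \<le> M" using M[OF a] by simp
        qed
        then show "cmod (v (a + \<gamma>) ?z) \<le> (C * ?k / s) ^ Suc N * M" by (simp add: \<gamma> add.commute del: power_Suc)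
      qed
      then have "cmod (v a (x + h) - (\<Sum>k\<le>N. (dir_op h ^^ k) v a x / fact k)) \<le> 2 * (?B / fact N)"
        by (intro taylor_translate[OF v]) auto
      also have "?B = (d * norm h * C / s) ^ Suc N * ?k ^ Suc N * M"
        unfolding power_mult_distrib power_divide by (simp add: mult_ac)
      also have "\<dots> \<le> (1 / 6) ^ Suc N * ?k ^ Suc N * M"
      proof -
        have "d * norm h * C \<le> d * (\<rho> * s) * C" using h d C(1) by (intro mult_right_mono mult_left_mono) auto
        also have "\<dots> = s / 6" using d C(1) by (simp add: \<rho>_def)
        finally have "d * norm h * C / s \<le> 1 / 6" using s by (simp add: field_simps)
        moreover have "0 \<le> d * norm h * C / s" using d C(1) s by simp
        ultimately show ?thesis using M0 by (intro mult_right_mono power_mono) auto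
      qed
      also have "?k ^ Suc N \<le> 3 ^ Suc (Suc N) * fact (Suc N)"
      proof -
        have "?k ^ Suc N * ?k \<le> 3 ^ Suc (Suc N) * fact (Suc (Suc N))"
          using power_le_fact[of "Suc (Suc N)"] by (simp only: power_Suc mult.commute)
        also have "\<dots> = 3 ^ Suc (Suc N) * fact (Suc N) * ?k" by (simp only: fact_Suc of_nat_mult mult_ac)
        finally show ?thesis by (rule mult_right_le_imp_le) simp
      qed
      then have "(1 / 6) ^ Suc N * ?k ^ Suc N * M \<le> (1 / 6) ^ Suc N * (3 ^ Suc (Suc N) * fact (Suc N)) * M"
        using M0 by (intro mult_right_mono mult_left_mono) auto
      also have "\<dots> = 9 * (1 / 2) ^ Suc N * M * (real (Suc N) * fact N) / 3"
      proof -
        have "(1 / 6 :: real) ^ Suc N * 3 ^ Suc (Suc N) = 3 * (1 / 2) ^ Suc N"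
          by (simp add: power_mult_distrib[symmetric] power_divide field_simps)
        then show ?thesis by (simp add: mult_ac)
      qed
      finally have "cmod (v a (x + h) - (\<Sum>k\<le>N. (dir_op h ^^ k) v a x / fact k)) \<le>
           2 * (9 * (1 / 2) ^ Suc N * M * (real (Suc N) * fact N) / 3 / fact N)"
        by (simp add: divide_right_mono)
      also have "\<dots> \<le> 2 * (9 * M * real (Suc N) * (1 / 2) ^ Suc N)"
      proof -
        define X where "X = M * real (Suc N) * (1 / 2) ^ Suc N"
        have "2 * (9 * (1 / 2) ^ Suc N * M * (real (Suc N) * fact N) / 3 / fact N) = 6 * X"
          by (simp add: X_def del: of_nat_Suc power_Suc)
        moreover have "2 * (9 * M * real (Suc N) * (1 / 2) ^ Suc N) = 18 * X"
          by (simp add: X_def del: of_nat_Suc power_Suc)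
        moreover have "X \<ge> 0" using M0 by (simp add: X_def)
        ultimately show ?thesis by linarith
      qed
      finally show ?thesis using N by linarith
    qed
    then show "\<exists>N. \<forall>x\<in>X. \<forall>a. mi_size a \<le> n --> cmod (v a (x + h) - (\<Sum>k\<le>N. (dir_op h ^^ k) v a x / fact k)) < \<epsilon>"
      by blast
  qed
qed

section \<open>Moving the sources of solutions\<close>

definition source_in :: "('d::finite) mpoly => (real ^ 'd) set => 'd jet => bool" where
  "source_in P S u \<longleftrightarrow> smooth_on UNIV u \<and> (\<forall>x. x \<notin> S --> (\<forall>b. jet_op P u b x = 0))"

definition close_on :: "nat => (real ^ 'd) set => real => ('d::finite) jet => 'd jet => bool" where
  "close_on n X \<epsilon> f g \<longleftrightarrow> (\<forall>x\<in>X. \<forall>a. mi_size a \<le> n --> cmod (f a x - g a x) < \<epsilon>)"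

definition neighbourhood :: "(real ^ 'd::finite) set => real => (real ^ 'd) set" where
  "neighbourhood K s = {x. \<exists>k\<in>K. dist k x \<le> s}"

lemma close_on_trans:
  fixes f g h :: "'d::finite jet"
  assumes "close_on n X \<epsilon> f g" "close_on n X \<epsilon>' g h"
  shows "close_on n X (\<epsilon> + \<epsilon>') f h"
  unfolding close_on_def
proof (intro ballI allI impI)
  fix x and a :: "'d multi_index" assume "x \<in> X" "mi_size a \<le> n"
  then have "cmod (f a x - g a x) < \<epsilon>" "cmod (g a x - h a x) < \<epsilon>'"
    using assms by (auto simp: close_on_def)
  moreover have "cmod (f a x - h a x) \<le> cmod (f a x - g a x) + cmod (g a x - h a x)"
    using norm_triangle_ineq[of "f a x - g a x" "g a x - h a x"] by simp
  ultimately show "cmod (f a x - h a x) < \<epsilon> + \<epsilon>'" by linarith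
qed

lemma close_on_mono:
  fixes f g :: "'d::finite jet"
  shows "close_on n X \<epsilon> f g ==> n' \<le> n ==> X' \<subseteq> X ==> \<epsilon> \<le> \<epsilon>' ==> close_on n' X' \<epsilon>' f g"
  unfolding close_on_def
proof (intro ballI allI impI)
  fix x and a :: "'d multi_index"
  assume *: "\<forall>x\<in>X. \<forall>a. mi_size a \<le> n --> cmod (f a x - g a x) < \<epsilon>" "n' \<le> n" "X' \<subseteq> X" "\<epsilon> \<le> \<epsilon>'"
    and "x \<in> X'" "mi_size a \<le> n'"
  then have "x \<in> X" "mi_size a \<le> n" by auto
  then have "cmod (f a x - g a x) < \<epsilon>" using *(1) by blast
  then show "cmod (f a x - g a x) < \<epsilon>'" using *(4) by linarith
qed

lemma source_in_mono: "source_in P S u ==> S \<subseteq> T ==> source_in P T u"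
  by (auto simp: source_in_def)

lemma smooth_on_jet_op: "smooth_on S f ==> smooth_on S (jet_op P f)"
  unfolding jet_op_eq_const_op by (rule smooth_on_const_op)

lemma jet_op_diff: "jet_op P (\<lambda>a x. f a x - g a x) b x = jet_op P f b x - jet_op P g b x"
  and jet_op_add: "jet_op P (\<lambda>a x. f a x + g a x) b x = jet_op P f b x + jet_op P g b x"
  and jet_op_sum: "jet_op P (\<lambda>a x. \<Sum>i\<in>I. F i a x) b x = (\<Sum>i\<in>I. jet_op P (F i) b x)"
  unfolding jet_op_eq_const_op by (rule const_op_diff const_op_add const_op_sum)+

lemma jet_op_cong: "(\<And>a. f a x = g a x) ==> jet_op P f b x = jet_op P g b x"
  unfolding jet_op_eq_const_op by (rule const_op_cong)

lemma jet_op_zero: "(\<And>a. f a x = 0) ==> jet_op P f b x = 0"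
  unfolding jet_op_eq_const_op by (rule const_op_eq_0)

lemma jet_op_translate: "jet_op P (\<lambda>i x. f i (x + a)) b x = jet_op P f b (x + a)"
  by (simp add: jet_op_eq)

text \<open>The radius of the source ball stays the same and the precision is arbitrary, so the
  relation is transitive; the new solution may depend on order and precision.\<close>

definition transfers :: "('d::finite) mpoly => real => (real ^ 'd) set => real ^ 'd => real ^ 'd => bool" where
  "transfers P r X y z \<longleftrightarrow> (\<forall>u n \<epsilon>. source_in P (cball y r) u --> \<epsilon> > 0 -->
     (\<exists>u'. source_in P (cball z r) u' \<and> close_on n X \<epsilon> u u'))"

lemma transfers_trans:
  assumes "transfers P r X a b" "transfers P r X b c"
  shows "transfers P r X a c"
  unfolding transfers_def
proof (intro allI impI)
  fix u n and \<epsilon> :: real assume u: "source_in P (cball a r) u" and \<epsilon>: "\<epsilon> > 0"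
  obtain v where v: "source_in P (cball b r) v" "close_on n X (\<epsilon> / 2) u v"
    using assms(1) u \<epsilon> unfolding transfers_def by (meson half_gt_zero)
  obtain w where w: "source_in P (cball c r) w" "close_on n X (\<epsilon> / 2) v w"
    using assms(2) v(1) \<epsilon> unfolding transfers_def by (meson half_gt_zero)
  show "\<exists>u'. source_in P (cball c r) u' \<and> close_on n X \<epsilon> u u'"
    using w(1) close_on_trans[OF v(2) w(2)] by auto
qed

text \<open>Let \<open>v\<close> be the translate of \<open>u\<close> with its source around
  \<open>z\<close>. Then \<open>u\<close> is \<open>v\<close> translated back, and away from the
  source this translation is a Taylor sum of \<open>v\<close>, which has the source of
  \<open>v\<close>. A distance of \<open>3 * r\<close> from \<open>z\<close> leaves the room
  \<open>2 * r\<close> around each point of \<open>X\<close>.\<close>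

lemma transfers_near:
  fixes P :: "'d::finite mpoly"
  assumes "elliptic P"
  shows "\<exists>\<rho>>0. \<forall>r X y z. 0 < r --> r \<le> 1 --> bounded X --> (\<forall>x\<in>X. 3 * r \<le> dist x z) -->
     dist y z \<le> \<rho> * r --> transfers P r X y z"
proof -
  obtain A \<kappa> R where cl: "A \<ge> 0" "\<kappa> > 0" "elliptic_class (mpoly_degree P) A \<kappa> R (op_coeff P)"
    using elliptic_imp_class[OF assms] by blast
  obtain \<rho> where \<rho>: "0 < \<rho>" and tr: "\<forall>s v X n \<epsilon> h. 0 < s --> s \<le> 1 --> smooth_on UNIV v --> bounded X -->
    (\<forall>x\<in>X. \<forall>y. dist x y < 2 * s --> (\<forall>b. const_op (mpoly_degree P) (op_coeff P) v b y = 0)) --> norm h \<le> \<rho> * s --> \<epsilon> > 0 -->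
    (\<exists>N. \<forall>x\<in>X. \<forall>a. mi_size a \<le> n --> cmod (v a (x + h) - (\<Sum>k\<le>N. (dir_op h ^^ k) v a x / fact k)) < \<epsilon>)"
    using solution_translate[OF cl(3,1,2)] by blast
  show ?thesis
  proof (intro exI[of _ \<rho>] conjI allI impI \<rho>)
    fix r :: real and X and y z :: "real ^ 'd"
    assume r: "0 < r" "r \<le> 1" and X: "bounded X" and far': "\<forall>x\<in>X. 3 * r \<le> dist x z" and yz: "dist y z \<le> \<rho> * r"
    show "transfers P r X y z"
      unfolding transfers_def
    proof (intro allI impI)
      fix u n and \<epsilon> :: real assume u: "source_in P (cball y r) u" and \<epsilon>: "\<epsilon> > 0"
      define h where "h = z - y"
      define v where "v = (\<lambda>a x. u a (x + - h))"
      have v: "smooth_on UNIV v" unfolding v_def using u by (intro smooth_on_translate) (simp add: source_in_def)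
      have Pv: "jet_op P v b x = 0" if "x \<notin> cball z r" for b x
      proof -
        have "dist z x = dist y (x + - h)" by (simp add: h_def dist_norm algebra_simps)
        then have "x + - h \<notin> cball y r" using that by simp
        then show ?thesis using u unfolding v_def jet_op_translate source_in_def by blast
      qed
      have "const_op (mpoly_degree P) (op_coeff P) v b x' = 0" if x: "x \<in> X" and d: "dist x x' < 2 * r" for b x x'
      proof -
        have "dist x z \<le> dist x x' + dist z x'" using dist_triangle[of x z x'] by (simp add: dist_commute)
        moreover have "3 * r \<le> dist x z" using far' x by blast
        ultimately have "x' \<notin> cball z r" using d by simp
        then show ?thesis using Pv unfolding jet_op_eq_const_op by blast
      qed
      moreover have "norm h \<le> \<rho> * r" using yz by (simp add: h_def dist_norm norm_minus_commute)
      ultimately have "\<exists>N. \<forall>x\<in>X. \<forall>a. mi_size a \<le> n --> cmod (v a (x + h) - (\<Sum>k\<le>N. (dir_op h ^^ k) v a x / fact k)) < \<epsilon>"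
        using tr r v X \<epsilon> by blast
      then obtain N where N: "\<And>x a. x \<in> X ==> mi_size a \<le> n ==> cmod (u a x - (\<Sum>k\<le>N. (dir_op h ^^ k) v a x / fact k)) < \<epsilon>"
        by (auto simp: v_def)
      define u' where "u' = (\<lambda>a x. \<Sum>k\<le>N. (1 / fact k) * (dir_op h ^^ k) v a x)"
      have "close_on n X \<epsilon> u u'" using N by (simp add: close_on_def u'_def)
      moreover have "source_in P (cball z r) u'"
        unfolding source_in_def
      proof (intro conjI allI impI)
        show "smooth_on UNIV u'" unfolding u'_def by (intro smooth_on_sum smooth_on_cmult smooth_on_dir_op_pow v)
        fix x b assume x: "x \<notin> cball z r"
        have "jet_op P u' b x = (\<Sum>k\<le>N. (1 / fact k) * (dir_op h ^^ k) (jet_op P v) b x)"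
          unfolding u'_def jet_op_eq_const_op const_op_sum const_op_cmult const_op_dir_op_pow ..
        also have "\<dots> = 0" using Pv[OF x] by (intro sum.neutral) (simp add: dir_op_pow_zero)
        finally show "jet_op P u' b x = 0" .
      qed
      ultimately show "\<exists>u'. source_in P (cball z r) u' \<and> close_on n X \<epsilon> u u'" by blast
    qed
  qed
qed

text \<open>The admissible step \<open>\<rho> * r\<close> is the same at all points of
  \<open>S\<close>, so transferability in both directions is a transitive relation that holds
  between neighbouring points of \<open>S\<close>; on a connected set it holds between any
  two.\<close>

lemma transfers_connected:
  fixes P :: "'d::finite mpoly"
  assumes ell: "elliptic P" and r: "0 < r" "r \<le> 1" and X: "bounded X" and S: "connected S" "a \<in> S" "b \<in> S"
    and far: "\<And>x z. x \<in> X ==> z \<in> S ==> 3 * r \<le> dist x z"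
  shows "transfers P r X a b"
proof -
  obtain \<rho> where \<rho>: "\<rho> > 0" "\<forall>r X y z. 0 < r --> r \<le> 1 --> bounded X --> (\<forall>x\<in>X. 3 * r \<le> dist x z) -->
     dist y z \<le> \<rho> * r --> transfers P r X y z"
    using transfers_near[OF ell] by blast
  have "transfers P r X a b \<and> transfers P r X b a"
  proof (rule connected_equivalence_relation[OF S, of "\<lambda>a b. transfers P r X a b \<and> transfers P r X b a"])
    fix y assume y: "y \<in> S"
    have "transfers P r X y z \<and> transfers P r X z y" if z: "z \<in> S \<inter> ball y (\<rho> * r)" for z
    proof -
      have "dist y z \<le> \<rho> * r" "dist z y \<le> \<rho> * r" using z by (auto simp: dist_commute)
      then show ?thesis using \<rho>(2) r X far y z by blast
    qed
    moreover have "openin (top_of_set S) (S \<inter> ball y (\<rho> * r))" by (simp add: openin_open_Int)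
    moreover have "y \<in> S \<inter> ball y (\<rho> * r)" using y \<rho>(1) r by simp
    ultimately show "\<exists>T. openin (top_of_set S) T \<and> y \<in> T \<and> (\<forall>z\<in>T. transfers P r X y z \<and> transfers P r X z y)"
      by blast
  qed (auto intro: transfers_trans)
  then show ?thesis ..
qed

text \<open>Orders and radii grow while the errors are summable, so every entry converges uniformly
  on bounded sets together with its first derivatives, and the limit family is again smooth.\<close>

lemma jet_limit:
  fixes u :: "nat => 'd::finite jet"
  assumes u: "\<And>k. smooth_on UNIV (u k)"
    and cl: "\<And>k. close_on (n + k) (cball 0 (R + real k)) (\<epsilon> / 2 ^ (k + 2)) (u k) (u (Suc k))" and \<epsilon>: "\<epsilon> > 0"
  obtains g where "smooth_on UNIV g"
    "\<And>k x a. norm x \<le> R + real k ==> mi_size a \<le> n + k ==> cmod (u k a x - g a x) \<le> \<epsilon> / 2 ^ (k + 1)"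
proof -
  have diff: "cmod (u (k + j) a x - u k a x) \<le> \<epsilon> / 2 ^ (k + 1) - \<epsilon> / 2 ^ (k + j + 1)"
    if "norm x \<le> R + real k" "mi_size a \<le> n + k" for k j a x
  proof (induction j)
    case 0
    then show ?case by simp
  next
    case (Suc j)
    have "cmod (u (k + j) a x - u (Suc (k + j)) a x) < \<epsilon> / 2 ^ (k + j + 2)"
      using cl[of "k + j"] that by (auto simp: close_on_def)
    moreover have "cmod (u (k + Suc j) a x - u k a x) \<le> cmod (u (k + j) a x - u (Suc (k + j)) a x) + cmod (u (k + j) a x - u k a x)"
      using norm_triangle_ineq4[of "u (k + j) a x - u k a x" "u (k + j) a x - u (Suc (k + j)) a x"] by simp
    moreover have "\<epsilon> / 2 ^ (k + j + 1) = \<epsilon> / 2 ^ (k + j + 2) + \<epsilon> / 2 ^ (k + j + 2)" by simp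
    ultimately show ?case using Suc.IH by simp
  qed
  have big: "\<exists>k0. \<forall>k\<ge>k0. norm x \<le> R + real k \<and> mi_size a \<le> n + k" for x :: "real ^ 'd" and a :: "'d multi_index"
  proof (intro exI allI impI)
    fix k assume "k \<ge> max (nat \<lceil>norm x - R\<rceil>) (mi_size a)"
    then show "norm x \<le> R + real k \<and> mi_size a \<le> n + k" by (auto simp: nat_le_iff ceiling_le_iff)
  qed
  have tail: "(\<lambda>k. \<epsilon> / 2 ^ (k + 1)) \<longlonglongrightarrow> 0" by real_asymp
  have conv: "convergent (\<lambda>k. u k a x)" for a x
  proof (rule Cauchy_convergent, rule CauchyI)
    fix e :: real assume e: "e > 0"
    obtain k0 where k0: "\<And>k. k \<ge> k0 ==> norm x \<le> R + real k \<and> mi_size a \<le> n + k" using big by blast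
    obtain k1 where k1: "\<And>k. k \<ge> k1 ==> \<epsilon> / 2 ^ (k + 1) < e / 2"
      using order_tendstoD(2)[OF tail, of "e / 2"] e by (auto simp: eventually_sequentially)
    define k where "k = max k0 k1"
    have near: "cmod (u l a x - u k a x) < e / 2" if "l \<ge> k" for l
    proof -
      obtain j where l: "l = k + j" using \<open>l \<ge> k\<close> le_Suc_ex by blast
      have "k \<ge> k0" "k \<ge> k1" by (auto simp: k_def)
      then have "cmod (u (k + j) a x - u k a x) \<le> \<epsilon> / 2 ^ (k + 1) - \<epsilon> / 2 ^ (k + j + 1)"
        using k0[of k] by (intro diff) blast+
      moreover have "\<epsilon> / 2 ^ (k + 1) < e / 2" by (rule k1[OF \<open>k \<ge> k1\<close>])
      moreover have "\<epsilon> / 2 ^ (k + j + 1) > 0" using \<epsilon> by simp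
      ultimately show ?thesis unfolding l by linarith
    qed
    have "norm (u l a x - u l' a x) < e" if "l \<ge> k" "l' \<ge> k" for l l'
      using norm_triangle_ineq4[of "u l a x - u k a x" "u l' a x - u k a x"] near[OF that(1)] near[OF that(2)] by simp
    then show "\<exists>M. \<forall>m\<ge>M. \<forall>n\<ge>M. norm (u m a x - u n a x) < e" by blast
  qed
  define g where "g = (\<lambda>a x. lim (\<lambda>k. u k a x))"
  have lim: "(\<lambda>k. u k a x) \<longlonglongrightarrow> g a x" for a x
    using conv[of a x] by (simp add: g_def convergent_LIMSEQ_iff)
  have est: "cmod (u k a x - g a x) \<le> \<epsilon> / 2 ^ (k + 1)" if "norm x \<le> R + real k" "mi_size a \<le> n + k" for k a x
  proof (rule LIMSEQ_le_const2)
    show "(\<lambda>j. cmod (u k a x - u (j + k) a x)) \<longlonglongrightarrow> cmod (u k a x - g a x)"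
      by (intro tendsto_intros LIMSEQ_ignore_initial_segment lim)
    have "cmod (u k a x - u (j + k) a x) \<le> \<epsilon> / 2 ^ (k + 1)" for j
    proof -
      have "\<epsilon> / 2 ^ (k + j + 1) > 0" using \<epsilon> by simp
      with diff[OF that, of j] show ?thesis unfolding norm_minus_commute[of "u k a x"] add.commute[of j k] by linarith
    qed
    then show "\<exists>N. \<forall>j\<ge>N. cmod (u k a x - u (j + k) a x) \<le> \<epsilon> / 2 ^ (k + 1)" by blast
  qed
  have "smooth_on UNIV g"
    unfolding smooth_on_def
  proof (intro allI ballI)
    fix a and x :: "real ^ 'd"
    let ?S = "ball x 1"
    let ?f' = "\<lambda>k x h. \<Sum>j\<in>UNIV. (h $ j) *\<^sub>R u k (a + axis j (Suc 0)) x"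
    let ?g' = "\<lambda>x h. \<Sum>j\<in>UNIV. (h $ j) *\<^sub>R g (a + axis j (Suc 0)) x"
    have "\<exists>g0. \<forall>y\<in>?S. (\<lambda>k. u k a y) \<longlonglongrightarrow> g0 y \<and> (g0 has_derivative ?g' y) (at y within ?S)"
    proof (rule has_derivative_sequence[where f' = ?f' and ?x0.0 = x and l = "g a x"])
      show "(u k a has_derivative ?f' k y) (at y within ?S)" for k y
        by (rule has_derivative_at_withinI[OF smooth_onD[OF u]]) simp
      fix e :: real assume e: "e > 0"
      define e' where "e' = e / real CARD('d)"
      have e': "e' > 0" using e by (simp add: e'_def)
      obtain k0 where k0: "\<And>k. k \<ge> k0 ==> norm x + 1 \<le> R + real k \<and> Suc (mi_size a) \<le> n + k"
      proof (rule that)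
        fix k assume "k \<ge> max (nat \<lceil>norm x + 1 - R\<rceil>) (Suc (mi_size a))"
        then show "norm x + 1 \<le> R + real k \<and> Suc (mi_size a) \<le> n + k" by (auto simp: nat_le_iff ceiling_le_iff)
      qed
      obtain k1 where k1: "\<And>k. k \<ge> k1 ==> \<epsilon> / 2 ^ (k + 1) < e'"
        using order_tendstoD(2)[OF tail e'] by (auto simp: eventually_sequentially)
      show "\<forall>\<^sub>F k in sequentially. \<forall>y\<in>?S. \<forall>h. norm (?f' k y h - ?g' y h) \<le> e * norm h"
        unfolding eventually_sequentially
      proof (intro exI allI impI ballI)
        fix k y h assume k: "k \<ge> max k0 k1" and y: "y \<in> ?S"
        have "norm y \<le> norm x + dist x y" by (metis dist_norm norm_minus_commute norm_triangle_sub)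
        then have "norm y \<le> R + real k" using k0[of k] k y by simp
        then have "cmod (u k (a + axis j (Suc 0)) y - g (a + axis j (Suc 0)) y) \<le> e'" for j
          using est[of y k "a + axis j (Suc 0)"] k0[of k] k1[of k] k by simp
        then have "norm (\<Sum>j\<in>UNIV. (h $ j) *\<^sub>R (u k (a + axis j (Suc 0)) y - g (a + axis j (Suc 0)) y)) \<le> real CARD('d) * e' * norm h"
          by (intro norm_sum_scaleR_le[where F = "\<lambda>j. u k (a + axis j (Suc 0)) y - g (a + axis j (Suc 0)) y"]) blast
        then show "norm (?f' k y h - ?g' y h) \<le> e * norm h"
          by (simp add: scaleR_diff_right sum_subtractf e'_def)
      qed
    qed (auto intro: lim)
    then obtain g0 where g0: "\<And>y. y \<in> ?S ==> (\<lambda>k. u k a y) \<longlonglongrightarrow> g0 y" "\<And>y. y \<in> ?S ==> (g0 has_derivative ?g' y) (at y within ?S)"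
      by blast
    have eq: "g0 y = g a y" if "y \<in> ?S" for y using LIMSEQ_unique[OF g0(1)[OF that] lim] .
    have d: "(g0 has_derivative ?g' x) (at x)"
      using g0(2)[of x] at_within_open[of x ?S] by simp
    show "(g a has_derivative ?g' x) (at x)"
      by (rule has_derivative_transform_within_open[OF d open_ball[of x 1]]) (simp_all add: eq)
  qed
  then show ?thesis using est by (rule that)
qed

text \<open>The source is pushed outwards along a ray while the approximation is demanded on larger
  and larger balls. At any fixed point all but finitely many of the functions solve the equation, so
  the limit is a solution on the whole space.\<close>

lemma source_to_infinity:
  fixes P :: "'d::finite mpoly"
  assumes ell: "elliptic P" and r: "0 < r" "r \<le> 1" and u: "source_in P (cball z r) u"
    and z: "R + 3 * r \<le> norm z" "R \<ge> 0" and X: "X \<subseteq> cball 0 R" and \<epsilon>: "\<epsilon> > 0"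
  obtains g where "smooth_on UNIV g" "jet_op P g = (\<lambda>b x. 0)" "close_on n X \<epsilon> u g"
proof -
  have nz: "norm z > 0" using z r by linarith
  \<comment> \<open>\<open>norm (p t) = norm z + t\<close>: the source ball keeps its distance from
    the growing balls of radius \<open>R + k\<close>, so each unit move along the ray is
    possible.\<close>
  define p where "p = (\<lambda>t::real. (1 + t / norm z) *\<^sub>R z)"
  have np: "norm (p t) = norm z + t" if "t \<ge> 0" for t
    using nz that by (simp add: p_def field_simps)
  have tr: "transfers P r (cball 0 (R + real k)) (p (real k)) (p (real (Suc k)))" for k
  proof (rule transfers_connected[OF ell r bounded_cball])
    show "connected (p ` {real k..real (Suc k)})" unfolding p_def using nz by (intro connected_continuous_image continuous_intros) auto
    fix x y :: "real ^ 'd" assume x: "x \<in> cball 0 (R + real k)" and "y \<in> p ` {real k..real (Suc k)}"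
    then obtain t where t: "y = p t" "t \<ge> real k" by auto
    have "norm y \<ge> norm z + real k" using np[of t] t by simp
    moreover have "norm y \<le> norm x + dist x y" by (metis dist_norm norm_minus_commute norm_triangle_sub)
    ultimately show "3 * r \<le> dist x y" using x z by simp
  qed (rule imageI, simp)+
  have "\<exists>f. \<forall>k. source_in P (cball (p (real k)) r) (f k) \<and> (k = 0 --> f k = u) \<and>
      close_on (n + k) (cball 0 (R + real k)) (\<epsilon> / 2 ^ (k + 2)) (f k) (f (Suc k))"
  proof -
    have "\<exists>f. \<forall>k. (source_in P (cball (p (real k)) r) (f k) \<and> (k = 0 --> f k = u)) \<and>
      close_on (n + k) (cball 0 (R + real k)) (\<epsilon> / 2 ^ (k + 2)) (f k) (f (Suc k))"
    proof (rule dependent_nat_choice[of "\<lambda>k v. source_in P (cball (p (real k)) r) v \<and> (k = 0 --> v = u)"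
          "\<lambda>k v v'. close_on (n + k) (cball 0 (R + real k)) (\<epsilon> / 2 ^ (k + 2)) v v'"])
      show "\<exists>x. source_in P (cball (p (real 0)) r) x \<and> (0 = 0 --> x = u)" using u by (simp add: p_def)
      fix v k assume "source_in P (cball (p (real k)) r) v \<and> (k = 0 --> v = u)"
      moreover have "\<epsilon> / 2 ^ (k + 2) > 0" using \<epsilon> by simp
      ultimately obtain v' where "source_in P (cball (p (real (Suc k))) r) v'" "close_on (n + k) (cball 0 (R + real k)) (\<epsilon> / 2 ^ (k + 2)) v v'"
        using tr[of k] unfolding transfers_def by blast
      then show "\<exists>y. (source_in P (cball (p (real (Suc k))) r) y \<and> (Suc k = 0 --> y = u)) \<and>
         close_on (n + k) (cball 0 (R + real k)) (\<epsilon> / 2 ^ (k + 2)) v y" by auto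
    qed
    then show ?thesis by blast
  qed
  then obtain f where f: "\<And>k. source_in P (cball (p (real k)) r) (f k)" "f 0 = u"
      "\<And>k. close_on (n + k) (cball 0 (R + real k)) (\<epsilon> / 2 ^ (k + 2)) (f k) (f (Suc k))" by blast
  have fs: "smooth_on UNIV (f k)" for k using f(1) by (simp add: source_in_def)
  obtain g where g: "smooth_on UNIV g"
    "\<And>k x a. norm x \<le> R + real k ==> mi_size a \<le> n + k ==> cmod (f k a x - g a x) \<le> \<epsilon> / 2 ^ (k + 1)"
    using jet_limit[OF fs f(3) \<epsilon>] by metis
  have "jet_op P g b x = 0" for b x
  proof -
    define m where "m = mpoly_degree P"
    define S where "S = (\<Sum>a | mi_size (a :: 'd multi_index) \<le> m. cmod (op_coeff P a))"
    obtain k0 where k0: "\<And>k. k \<ge> k0 ==> norm x \<le> R + real k \<and> mi_size b + m \<le> n + k"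
    proof (rule that)
      fix k assume "k \<ge> max (nat \<lceil>norm x - R\<rceil>) (mi_size b + m)"
      then show "norm x \<le> R + real k \<and> mi_size b + m \<le> n + k" by (auto simp: nat_le_iff ceiling_le_iff)
    qed
    \<comment> \<open>For large \<open>k\<close> the point \<open>x\<close> is outside the source
      ball of \<open>f k\<close>, so the operator applied to \<open>g\<close> equals that applied to
      the small difference of \<open>g\<close> and \<open>f k\<close>.\<close>
    have "cmod (jet_op P g b x) \<le> S * (\<epsilon> / 2 ^ (k + 1))" if k: "k \<ge> k0" for k
    proof -
      have "dist (p (real k)) x > r"
      proof -
        have "norm (p (real k)) \<le> norm x + dist (p (real k)) x" by (metis dist_norm norm_triangle_sub)
        then show ?thesis using k0[OF k] np[of "real k"] z r by simp
      qed
      then have "jet_op P (f k) b x = 0" using f(1)[of k] by (simp add: source_in_def)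
      then have "jet_op P g b x = - (\<Sum>a | mi_size a \<le> m. op_coeff P a * (f k (b + a) x - g (b + a) x))"
        unfolding jet_op_eq_const_op const_op_def m_def by (simp add: right_diff_distrib sum_subtractf)
      then have "cmod (jet_op P g b x) = cmod (\<Sum>a | mi_size a \<le> m. op_coeff P a * (f k (b + a) x - g (b + a) x))"
        by (simp only: norm_minus_cancel)
      also have "\<dots> \<le> (\<Sum>a | mi_size (a :: 'd multi_index) \<le> m. cmod (op_coeff P a) * (\<epsilon> / 2 ^ (k + 1)))"
      proof (rule sum_norm_le)
        fix a :: "'d multi_index" assume "a \<in> {a. mi_size a \<le> m}"
        then have "cmod (f k (b + a) x - g (b + a) x) \<le> \<epsilon> / 2 ^ (k + 1)"
          using k0[OF k] by (intro g(2)) (auto simp: mi_size_add)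
        then show "cmod (op_coeff P a * (f k (b + a) x - g (b + a) x)) \<le> cmod (op_coeff P a) * (\<epsilon> / 2 ^ (k + 1))"
          unfolding norm_mult by (rule mult_left_mono) simp
      qed
      finally show ?thesis unfolding S_def sum_distrib_right .
    qed
    moreover have "(\<lambda>k. S * (\<epsilon> / 2 ^ (k + 1))) \<longlonglongrightarrow> 0" by real_asymp
    ultimately have "cmod (jet_op P g b x) \<le> 0"
      by (intro LIMSEQ_le_const[of "\<lambda>k. S * (\<epsilon> / 2 ^ (k + 1))"]) auto
    then show ?thesis by simp
  qed
  moreover have "close_on n X \<epsilon> u g"
    unfolding close_on_def
  proof (intro ballI allI impI)
    fix x and a :: "'d multi_index" assume "x \<in> X" "mi_size a \<le> n"
    then have "cmod (f 0 a x - g a x) \<le> \<epsilon> / 2 ^ (0 + 1)" using X by (intro g(2)) auto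
    then show "cmod (u a x - g a x) < \<epsilon>" using \<epsilon> f(2) by simp
  qed
  ultimately show ?thesis using g(1) by (intro that[of g]) auto
qed

text \<open>The approximating functions are smooth everywhere and solve the equation on
  \<open>F\<close> to infinite order, so that their jets on \<open>F\<close> belong to
  \<open>jet_kernel\<close>.\<close>

definition approximable :: "('d::finite) mpoly => (real ^ 'd) set => (real ^ 'd) set => 'd jet => bool" where
  "approximable P F X u \<longleftrightarrow> (\<forall>n \<epsilon>. \<epsilon> > 0 -->
     (\<exists>g. smooth_on UNIV g \<and> (\<forall>x\<in>F. \<forall>b. jet_op P g b x = 0) \<and> close_on n X \<epsilon> u g))"

lemma approximable_sum:
  fixes u :: "'i => 'd::finite jet"
  assumes "finite I" "\<And>i. i \<in> I ==> approximable P F X (u i)"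
  shows "approximable P F X (\<lambda>a x. \<Sum>i\<in>I. u i a x)"
  using assms
proof (induction I rule: finite_induct)
  case empty
  show ?case unfolding approximable_def
    by (intro allI impI exI[of _ "\<lambda>a x. 0"]) (auto simp: smooth_on_zero close_on_def jet_op_zero)
next
  case (insert i I)
  show ?case unfolding approximable_def
  proof (intro allI impI)
    fix n and \<epsilon> :: real assume "\<epsilon> > 0"
    then have \<epsilon>: "\<epsilon> / 2 > 0" by simp
    obtain g where g: "smooth_on UNIV g" "\<forall>x\<in>F. \<forall>b. jet_op P g b x = 0" "close_on n X (\<epsilon> / 2) (u i) g"
      using insert.prems[of i] \<epsilon> unfolding approximable_def by blast
    obtain h where h: "smooth_on UNIV h" "\<forall>x\<in>F. \<forall>b. jet_op P h b x = 0" "close_on n X (\<epsilon> / 2) (\<lambda>a x. \<Sum>i\<in>I. u i a x) h"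
      using insert.IH insert.prems \<epsilon> unfolding approximable_def by blast
    have "close_on n X \<epsilon> (\<lambda>a x. \<Sum>i\<in>insert i I. u i a x) (\<lambda>a x. g a x + h a x)"
      unfolding close_on_def
    proof (intro ballI allI impI)
      fix x and a :: "'d multi_index" assume "x \<in> X" "mi_size a \<le> n"
      then have small: "cmod (u i a x - g a x) < \<epsilon> / 2" "cmod ((\<Sum>i\<in>I. u i a x) - h a x) < \<epsilon> / 2"
        using g(3) h(3) by (auto simp: close_on_def)
      have eq: "(\<Sum>i\<in>insert i I. u i a x) - (g a x + h a x) = (u i a x - g a x) + ((\<Sum>i\<in>I. u i a x) - h a x)"
        using insert.hyps by simp
      have "cmod ((\<Sum>i\<in>insert i I. u i a x) - (g a x + h a x)) \<le> cmod (u i a x - g a x) + cmod ((\<Sum>i\<in>I. u i a x) - h a x)"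
        unfolding eq by (rule norm_triangle_ineq)
      with small show "cmod ((\<Sum>i\<in>insert i I. u i a x) - (g a x + h a x)) < \<epsilon>" by linarith
    qed
    moreover have "smooth_on UNIV (\<lambda>a x. g a x + h a x)" by (intro smooth_on_add g h)
    moreover have "\<forall>x\<in>F. \<forall>b. jet_op P (\<lambda>a x. g a x + h a x) b x = 0" using g(2) h(2) by (simp add: jet_op_add)
    ultimately show "\<exists>g. smooth_on UNIV g \<and> (\<forall>x\<in>F. \<forall>b. jet_op P g b x = 0) \<and> close_on n X \<epsilon> (\<lambda>a x. \<Sum>i\<in>insert i I. u i a x) g"
      by blast
  qed
qed

lemma approximable_mono: "approximable P F X u ==> X' \<subseteq> X ==> approximable P F X' u"
  unfolding approximable_def using close_on_mono[OF _ order_refl _ order_refl] by blast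

lemma neighbourhood_mono: "s \<le> t ==> neighbourhood K s \<subseteq> neighbourhood K t"
  by (force simp: neighbourhood_def)

lemma neighbourhood_subset_cball:
  assumes "K \<subseteq> cball 0 R" shows "neighbourhood K s \<subseteq> cball 0 (R + s)"
proof
  fix x assume "x \<in> neighbourhood K s"
  then obtain k where k: "k \<in> K" "dist k x \<le> s" by (auto simp: neighbourhood_def)
  moreover have "norm x \<le> norm k + dist k x" by (metis dist_norm norm_minus_commute norm_triangle_sub)
  ultimately show "x \<in> cball 0 (R + s)" using assms by auto
qed

text \<open>The component condition enters here. The component of \<open>y\<close> in the complement
  of \<open>F1\<close> contains either a point outside \<open>F2\<close>, where the source does no
  harm, or points arbitrarily far away, from which the source can be sent to infinity. A far
  \<open>y\<close> is sent to infinity directly, even if it lies in \<open>F1\<close>.\<close>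

lemma source_approximable:
  fixes P :: "'d::finite mpoly"
  assumes ell: "elliptic P" and F1: "closed F1" and F2: "closed F2"
    and comp: "\<not> (\<exists>C \<in> components (- F1). bounded C \<and> C \<subseteq> F2)"
    and K: "K \<subseteq> F1" "K \<subseteq> cball 0 R" "R \<ge> 0" and y: "y \<notin> F1 \<or> R + 4 \<le> norm y"
  obtains r where "0 < r" "r \<le> 1" "\<And>u. source_in P (cball y r) u ==> approximable P F2 (neighbourhood K r) u"
proof -
  \<comment> \<open>The 4 consists of 1 for the neighbourhood of \<open>K\<close> and 3 for the room
    \<open>3 * r\<close> needed by a move, both with \<open>r \<le> 1\<close>.\<close>
  have inf: "approximable P F2 (neighbourhood K r) u"
    if su: "source_in P (cball z r) u" and nz: "R + 4 \<le> norm z" and r: "0 < r" "r \<le> 1" for z r u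
    unfolding approximable_def
  proof (intro allI impI)
    fix n and \<epsilon> :: real assume \<epsilon>: "\<epsilon> > 0"
    have "neighbourhood K r \<subseteq> cball 0 (R + 1)"
      using neighbourhood_subset_cball[OF K(2), of r] r by (auto intro: order_trans)
    moreover have "R + 1 + 3 * r \<le> norm z" using nz r by linarith
    ultimately obtain g where "smooth_on UNIV g" "jet_op P g = (\<lambda>j x. 0)" "close_on n (neighbourhood K r) \<epsilon> u g"
      using source_to_infinity[OF ell r su, of "R + 1" "neighbourhood K r" \<epsilon> n] K(3) \<epsilon> by auto
    then show "\<exists>g. smooth_on UNIV g \<and> (\<forall>x\<in>F2. \<forall>j. jet_op P g j x = 0) \<and> close_on n (neighbourhood K r) \<epsilon> u g"
      by (intro exI[of _ g]) auto
  qed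
  show ?thesis
  proof (cases "R + 4 \<le> norm y")
    case True
    then show ?thesis using inf by (intro that[of 1]) auto
  next
    case False
    then have yF: "y \<notin> F1" using y by blast
    define C where "C = connected_component_set (- F1) y"
    have C: "C \<in> components (- F1)" using yF by (auto simp: components_def C_def)
    have "\<exists>z\<in>C. z \<notin> F2 \<or> R + 4 \<le> norm z"
    proof (cases "bounded C")
      case True
      then show ?thesis using comp C by blast
    next
      case False
      then show ?thesis unfolding bounded_iff by (meson linear)
    qed
    then obtain z where z: "z \<in> C" "z \<notin> F2 \<or> R + 4 \<le> norm z" by blast
    have "open C" unfolding C_def using F1 by (intro open_connected_component) auto
    moreover have "connected C" by (simp add: C_def)
    ultimately have "path_connected C" by (rule connected_open_path_connected)
    moreover have "y \<in> C" using yF by (simp add: C_def)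
    ultimately obtain \<gamma> where \<gamma>: "path \<gamma>" "path_image \<gamma> \<subseteq> C" "pathstart \<gamma> = y" "pathfinish \<gamma> = z"
      using z(1) unfolding path_connected_def by blast
    define S where "S = path_image \<gamma>"
    have S: "connected S" "compact S" "y \<in> S" "z \<in> S" "S \<inter> F1 = {}"
      using \<gamma> pathstart_in_path_image[of \<gamma>] pathfinish_in_path_image[of \<gamma>] connected_component_subset[of "- F1" y]
      by (auto simp: S_def C_def intro: connected_path_image compact_path_image)
    obtain e where e: "e > 0" "\<And>a b. a \<in> S ==> b \<in> F1 ==> e \<le> dist a b"
      using separate_compact_closed[OF S(2) F1 S(5)] by blast
    have "\<exists>q>0. z \<in> F2 \<or> cball z q \<inter> F2 = {}"
    proof (cases "z \<in> F2")
      case False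
      then obtain q where "q > 0" "ball z q \<subseteq> - F2" using F2 open_contains_ball[of "- F2"] by auto
      then show ?thesis by (intro exI[of _ "q / 2"]) (auto simp: disjoint_iff subset_iff)
    qed (auto intro: exI[of _ 1])
    then obtain q where q: "q > 0" "z \<in> F2 \<or> cball z q \<inter> F2 = {}" by blast
    \<comment> \<open>The path keeps the distance \<open>e\<close> from \<open>F1\<close>, hence at
      least \<open>e - r \<ge> 3 * r\<close> from the neighbourhood of \<open>K\<close>;
      \<open>r \<le> q\<close> keeps the final ball off \<open>F2\<close> when \<open>z\<close> is
      outside it.\<close>
    define r where "r = min 1 (min (e / 4) q)"
    have r: "0 < r" "r \<le> 1" "4 * r \<le> e" "r \<le> q" using e(1) q(1) by (auto simp: r_def)
    have X: "bounded (neighbourhood K r)"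
      using neighbourhood_subset_cball[OF K(2), of r] bounded_subset bounded_cball by blast
    have T: "transfers P r (neighbourhood K r) y z"
    proof (rule transfers_connected[OF ell r(1,2) X S(1,3,4)])
      fix x w assume "x \<in> neighbourhood K r" and w: "w \<in> S"
      then obtain k where k: "k \<in> K" "dist k x \<le> r" by (auto simp: neighbourhood_def)
      have "e \<le> dist w k" using e(2)[OF w] k K(1) by auto
      also have "dist w k \<le> dist x w + dist k x" by (metis dist_commute dist_triangle add.commute)
      finally show "3 * r \<le> dist x w" using k r by linarith
    qed
    have "approximable P F2 (neighbourhood K r) u" if u: "source_in P (cball y r) u" for u
      unfolding approximable_def
    proof (intro allI impI)
      fix n and \<epsilon> :: real assume "\<epsilon> > 0"
      then have \<epsilon>: "\<epsilon> / 2 > 0" by simp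
      obtain v where v: "source_in P (cball z r) v" "close_on n (neighbourhood K r) (\<epsilon> / 2) u v"
        using T u \<epsilon> unfolding transfers_def by blast
      have "approximable P F2 (neighbourhood K r) v"
      proof (cases "z \<in> F2")
        case True
        then show ?thesis using z(2) inf[OF v(1)] r by blast
      next
        case False
        then have "cball z r \<inter> F2 = {}" using q r subset_cball[OF r(4), of z] by blast
        then have "\<forall>x\<in>F2. \<forall>j. jet_op P v j x = 0" using v(1) unfolding source_in_def by blast
        then show ?thesis using v(1) unfolding approximable_def source_in_def
          by (intro allI impI exI[of _ v]) (auto simp: close_on_def)
      qed
      then obtain g where "smooth_on UNIV g" "\<forall>x\<in>F2. \<forall>j. jet_op P g j x = 0" "close_on n (neighbourhood K r) (\<epsilon> / 2) v g"
        using \<epsilon> unfolding approximable_def by blast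
      with close_on_trans[OF v(2) this(3)]
      show "\<exists>g. smooth_on UNIV g \<and> (\<forall>x\<in>F2. \<forall>j. jet_op P g j x = 0) \<and> close_on n (neighbourhood K r) \<epsilon> u g" by auto
    qed
    then show ?thesis using r by (intro that[of r]) auto
  qed
qed

lemma grid_active_finite_Union:
  assumes "bounded Z"
  shows "finite (\<Union>x\<in>Z. grid_active \<delta> (x :: real ^ 'd::finite))"
proof -
  obtain b where b: "\<And>x. x \<in> Z ==> norm x \<le> b" using assms unfolding bounded_iff by blast
  define M where "M = \<lceil>b / \<bar>\<delta>\<bar> + 1\<rceil>"
  have "(\<Union>x\<in>Z. grid_active \<delta> x) \<subseteq> PiE UNIV (\<lambda>j. {-M..M})"
  proof (intro UN_least subsetI)
    fix x \<kappa> assume x: "x \<in> Z" and \<kappa>: "\<kappa> \<in> grid_active \<delta> x"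
    have "\<kappa> j \<in> {-M..M}" for j
    proof -
      have "\<bar>x $ j / \<delta>\<bar> \<le> b / \<bar>\<delta>\<bar>"
        using component_le_norm_cart[of x j] b[OF x] by (auto simp: abs_divide intro: divide_right_mono)
      moreover have "\<bar>x $ j / \<delta> - real_of_int (\<kappa> j)\<bar> < 1" using \<kappa> by (simp add: grid_active_def)
      moreover have "b / \<bar>\<delta>\<bar> + 1 \<le> real_of_int M" by (simp add: M_def)
      ultimately have "real_of_int (\<kappa> j) \<le> real_of_int M" "- real_of_int M \<le> real_of_int (\<kappa> j)" by linarith+
      then show ?thesis by simp
    qed
    then show "\<kappa> \<in> PiE UNIV (\<lambda>j. {-M..M})" by (simp add: PiE_def)
  qed
  moreover have "finite (PiE (UNIV :: 'd set) (\<lambda>j. {-M..M}))" by (intro finite_PiE) auto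
  ultimately show ?thesis by (rule finite_subset)
qed

text \<open>The source of \<open>v\<close>, not \<open>v\<close> itself, is cut by a fine partition
  of unity. Solving the equation for each piece gives functions with sources in small balls, and
  \<open>v\<close> differs from their sum by a solution on the whole space.\<close>

theorem approximable_off_F1:
  fixes P :: "'d::finite mpoly"
  assumes ell: "elliptic P" and F1: "closed F1" and F2: "closed F2"
    and comp: "\<not> (\<exists>C \<in> components (- F1). bounded C \<and> C \<subseteq> F2)"
    and K: "K \<subseteq> F1" "K \<subseteq> cball 0 R" "R \<ge> 0"
    and Z: "compact Z" "\<And>y. y \<in> Z ==> y \<notin> F1 \<or> R + 4 \<le> norm y"
    and v: "source_in P Z v" and \<eta>: "principal_part P \<eta> \<noteq> 0"
  obtains s where "s > 0" "approximable P F2 (neighbourhood K s) v"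
proof -
  define \<psi> where "\<psi> = jet_op P v"
  have sv: "smooth_on UNIV v" and \<psi>0: "\<And>x j. x \<notin> Z ==> \<psi> j x = 0" using v by (auto simp: source_in_def \<psi>_def)
  have s\<psi>: "smooth_on UNIV \<psi>" unfolding \<psi>_def by (rule smooth_on_jet_op[OF sv])
  define good where "good = (\<lambda>r y. \<forall>u. source_in P (cball y r) u --> approximable P F2 (neighbourhood K r) u)"
  have good_mono: "good r' y'" if "good r y" "cball y' r' \<subseteq> cball y r" "r' \<le> r" for r r' y y'
    using that neighbourhood_mono[OF that(3)] unfolding good_def by (meson approximable_mono source_in_mono)
  have "\<exists>r>0. good r y" if "y \<in> Z" for y
    using source_approximable[OF ell F1 F2 comp K Z(2)[OF that]] unfolding good_def by metis
  then obtain \<rho> where \<rho>: "\<And>y. y \<in> Z ==> \<rho> y > 0" "\<And>y. y \<in> Z ==> good (\<rho> y) y" by metis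
  \<comment> \<open>Half radii leave room around every point of \<open>Z\<close>, so compactness
    produces one radius \<open>r\<close> that is good at all of them.\<close>
  have "Z \<subseteq> (\<Union>y\<in>Z. ball y (\<rho> y / 2))" using \<rho>(1) by force
  then obtain D where D: "D \<subseteq> Z" "finite D" "Z \<subseteq> (\<Union>y\<in>D. ball y (\<rho> y / 2))"
    using compactE_image[OF Z(1), of Z "\<lambda>y. ball y (\<rho> y / 2)"] by auto
  define r where "r = Min (insert 1 ((\<lambda>y. \<rho> y / 2) ` D))"
  have r: "r > 0" using D \<rho>(1) by (auto simp: r_def)
  have rD: "r \<le> \<rho> y / 2" if "y \<in> D" for y
    unfolding r_def using that D(2) by (intro Min_le) auto
  have good: "good r y'" if y': "y' \<in> Z" for y'
  proof -
    obtain y where y: "y \<in> D" "dist y y' < \<rho> y / 2" using D(3) y' by auto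
    have "cball y' r \<subseteq> cball y (\<rho> y)"
    proof
      fix x assume "x \<in> cball y' r"
      then show "x \<in> cball y (\<rho> y)" using dist_triangle[of y x y'] y rD[OF y(1)] by simp
    qed
    moreover have "r \<le> \<rho> y" using rD[OF y(1)] \<rho>(1)[of y] y(1) D(1) by force
    ultimately show ?thesis using y(1) D(1) by (intro good_mono[OF \<rho>(2)[of y]]) auto
  qed
  \<comment> \<open>Two points at which the same grid function is active are at most
    \<open>2 d \<delta> = r\<close> apart, so every piece has its source in a ball of radius
    \<open>r\<close> around a point of \<open>Z\<close>.\<close>
  define \<delta> where "\<delta> = r / (2 * real CARD('d))"
  have \<delta>: "\<delta> > 0" "2 * (real CARD('d) * \<delta>) = r" using r by (auto simp: \<delta>_def)
  define I where "I = (\<Union>x\<in>Z. grid_active \<delta> x)"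
  have I: "finite I" unfolding I_def by (rule grid_active_finite_Union[OF compact_imp_bounded[OF Z(1)]])
  have "\<forall>\<kappa>\<in>I. \<exists>y\<in>Z. \<kappa> \<in> grid_active \<delta> y" by (auto simp: I_def)
  then obtain y where y: "\<And>\<kappa>. \<kappa> \<in> I ==> y \<kappa> \<in> Z" "\<And>\<kappa>. \<kappa> \<in> I ==> \<kappa> \<in> grid_active \<delta> (y \<kappa>)" by metis
  define w where "w = (\<lambda>\<kappa>. jet_mult (grid_fun \<delta> \<kappa>) \<psi>)"
  have sw: "smooth_on UNIV (w \<kappa>)" for \<kappa> unfolding w_def by (intro smooth_on_mult smooth_on_grid_fun s\<psi>)
  obtain b where b: "\<And>x. x \<in> Z ==> norm x \<le> b" using compact_imp_bounded[OF Z(1)] unfolding bounded_iff by blast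
  have wb: "w \<kappa> i x = 0" if "b < norm x" for \<kappa> i x
    unfolding w_def by (rule jet_mult_zero_right, rule \<psi>0) (use b that in force)
  have w0: "w \<kappa> i x = 0" if \<kappa>: "\<kappa> \<in> I" and x: "x \<notin> cball (y \<kappa>) r" for \<kappa> i x
  proof -
    have "\<kappa> \<notin> grid_active \<delta> x"
    proof
      assume a: "\<kappa> \<in> grid_active \<delta> x"
      have "dist (y \<kappa>) x \<le> norm (y \<kappa> - grid_pt \<delta> \<kappa>) + norm (x - grid_pt \<delta> \<kappa>)"
        using norm_triangle_ineq4[of "y \<kappa> - grid_pt \<delta> \<kappa>" "x - grid_pt \<delta> \<kappa>"] by (simp add: dist_norm)
      then show False using x \<delta> grid_active_dist[OF a \<delta>(1)] grid_active_dist[OF y(2)[OF \<kappa>] \<delta>(1)] by simp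
    qed
    then show ?thesis unfolding w_def by (intro jet_mult_zero_left grid_fun_eq_0)
  qed
  have sum: "(\<Sum>\<kappa>\<in>I. w \<kappa> i x) = \<psi> i x" for i x
  proof (cases "x \<in> Z")
    case True
    have "(\<Sum>\<kappa>\<in>I. w \<kappa> i x) = jet_mult (\<lambda>j x. \<Sum>\<kappa>\<in>I. grid_fun \<delta> \<kappa> j x) \<psi> i x"
      unfolding w_def by (rule jet_mult_sum_left[symmetric])
    also have "\<dots> = \<psi> i x"
      by (rule jet_mult_one_left, rule grid_partition[OF \<delta>(1) I]) (use True in \<open>auto simp: I_def\<close>)
    finally show ?thesis .
  next
    case False
    then show ?thesis unfolding w_def by (simp add: \<psi>0 jet_mult_zero_right)
  qed
  obtain G :: "'d jet => 'd jet" where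
    G: "\<forall>w R. smooth_on UNIV w --> (\<forall>i x. R < norm x --> w i x = 0) --> smooth_on UNIV (G w) \<and> jet_op P (G w) = w"
    using constant_coeff_solvable[OF \<eta>] by blast
  have Gs: "smooth_on UNIV (G (w \<kappa>))" and GP: "jet_op P (G (w \<kappa>)) = w \<kappa>" for \<kappa>
    using G sw wb by blast+
  have ap: "approximable P F2 (neighbourhood K r) (G (w \<kappa>))" if \<kappa>: "\<kappa> \<in> I" for \<kappa>
  proof -
    have "source_in P (cball (y \<kappa>) r) (G (w \<kappa>))" using Gs w0[OF \<kappa>] by (auto simp: source_in_def GP)
    then show ?thesis using good[OF y(1)[OF \<kappa>]] unfolding good_def by blast
  qed
  \<comment> \<open>\<open>v0\<close> has no source at all and is its own approximation.\<close>
  define v0 where "v0 = (\<lambda>i x. v i x - (\<Sum>\<kappa>\<in>I. G (w \<kappa>) i x))"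
  have "smooth_on UNIV v0" unfolding v0_def by (intro smooth_on_diff smooth_on_sum sv Gs)
  moreover have "jet_op P v0 j x = 0" for j x
    unfolding v0_def jet_op_diff jet_op_sum GP sum by (simp add: \<psi>_def)
  ultimately have "approximable P F2 (neighbourhood K r) v0"
    unfolding approximable_def by (intro allI impI exI[of _ v0]) (auto simp: close_on_def)
  moreover have "approximable P F2 (neighbourhood K r) (\<lambda>i x. \<Sum>\<kappa>\<in>I. G (w \<kappa>) i x)"
    by (rule approximable_sum[OF I ap])
  \<comment> \<open>The sum of two functions is treated as a sum indexed by
    \<open>bool\<close>.\<close>
  ultimately have "approximable P F2 (neighbourhood K r) (\<lambda>i x. \<Sum>b\<in>(UNIV :: bool set). if b then v0 i x else (\<Sum>\<kappa>\<in>I. G (w \<kappa>) i x))"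
    using approximable_sum[of "UNIV :: bool set" P F2 "neighbourhood K r" "\<lambda>b. if b then v0 else (\<lambda>i x. \<Sum>\<kappa>\<in>I. G (w \<kappa>) i x)"]
    by (simp add: UNIV_bool)
  moreover have "(\<lambda>i x. \<Sum>b\<in>(UNIV :: bool set). if b then v0 i x else (\<Sum>\<kappa>\<in>I. G (w \<kappa>) i x)) = v"
    by (simp add: UNIV_bool v0_def fun_eq_iff)
  ultimately show ?thesis using r by (intro that[of r]) auto
qed

section \<open>Whitney norms and the topology of jets\<close>

definition whitney_bound :: "(real ^ 'd) set => nat => real => ('d::finite) jet => bool" where
  "whitney_bound K n a h \<longleftrightarrow> (\<forall>x\<in>K. \<forall>i. mi_size i \<le> n --> cmod (h i x) \<le> a) \<and>
     (\<forall>x\<in>K. \<forall>y\<in>K. \<forall>i. mi_size i \<le> n --> cmod (h i y - taylor_jet n x h i y) \<le> a * dist x y ^ (n - mi_size i))"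

lemma whitney_q_eq:
  "whitney_q K n t f = Sup {ennreal (cmod (f a y - taylor_jet n x f a y) / norm (x - y) ^ (n - mi_size a)) | a x y.
            mi_size a \<le> n \<and> x \<in> K \<and> y \<in> K \<and> 0 < norm (x - y) \<and> norm (x - y) < t}"
  unfolding whitney_q_def mi_iterate_partial_deriv_taylor ..

lemma whitney_qD:
  assumes "whitney_q K n t f \<le> ennreal c" "c \<ge> 0" "mi_size a \<le> n" "x \<in> K" "y \<in> K" "dist x y < t"
  shows "cmod (f a y - taylor_jet n x f a y) \<le> c * dist x y ^ (n - mi_size a)"
proof (cases "x = y")
  case True
  then show ?thesis using assms by (simp add: taylor_jet_at)
next
  case False
  then have pos: "0 < norm (x - y)" by simp
  have "ennreal (cmod (f a y - taylor_jet n x f a y) / norm (x - y) ^ (n - mi_size a)) \<le> whitney_q K n t f"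
    unfolding whitney_q_eq by (rule Sup_upper) (use assms pos in \<open>auto simp: dist_norm\<close>)
  then have "ennreal (cmod (f a y - taylor_jet n x f a y) / norm (x - y) ^ (n - mi_size a)) \<le> ennreal c"
    using assms(1) by (rule order_trans)
  then have "cmod (f a y - taylor_jet n x f a y) / norm (x - y) ^ (n - mi_size a) \<le> c"
    using assms(2) by (simp add: ennreal_le_iff)
  then show ?thesis using pos by (simp add: pos_divide_le_eq dist_norm)
qed

lemma whitney_qI:
  fixes f :: "'d::finite jet"
  assumes "\<And>a x y. mi_size a \<le> n ==> x \<in> K ==> y \<in> K ==> dist x y < t ==>
     cmod (f a y - taylor_jet n x f a y) \<le> c * dist x y ^ (n - mi_size a)"
  shows "whitney_q K n t f \<le> ennreal c"
  unfolding whitney_q_eq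
proof (rule Sup_least, clarify)
  fix a :: "'d multi_index" and x y assume *: "mi_size a \<le> n" "x \<in> K" "y \<in> K" "0 < norm (x - y)" "norm (x - y) < t"
  have "cmod (f a y - taylor_jet n x f a y) \<le> c * norm (x - y) ^ (n - mi_size a)"
    using assms[of a x y] * by (simp add: dist_norm)
  then have "cmod (f a y - taylor_jet n x f a y) / norm (x - y) ^ (n - mi_size a) \<le> c"
    using *(4) by (simp add: pos_divide_le_eq)
  then show "ennreal (cmod (f a y - taylor_jet n x f a y) / norm (x - y) ^ (n - mi_size a)) \<le> ennreal c"
    by (rule ennreal_leI)
qed

lemma whitney_norm_imp_bound:
  fixes h :: "'d::finite jet"
  assumes "whitney_norm K n h < ennreal \<epsilon>" "\<epsilon> > 0"
  shows "whitney_bound K n \<epsilon> h"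
  unfolding whitney_bound_def
proof (intro conjI ballI allI impI)
  fix x and a :: "'d multi_index" assume x: "x \<in> K" and a: "mi_size a \<le> n"
  have "ennreal (cmod (h a x)) \<le> Sup {ennreal (cmod (h a x)) |a x. x \<in> K \<and> mi_size a \<le> n}"
    using x a by (intro Sup_upper) auto
  also have "\<dots> \<le> whitney_norm K n h" by (simp add: whitney_norm_def)
  also have "\<dots> \<le> ennreal \<epsilon>" using assms by simp
  finally show "cmod (h a x) \<le> \<epsilon>" using assms(2) by (simp add: ennreal_le_iff)
  fix y assume y: "y \<in> K"
  have "whitney_q K n (dist x y + 1) h \<le> (SUP t\<in>{0<..}. whitney_q K n t h)"
    by (intro SUP_upper) (simp add: add_nonneg_pos)
  also have "\<dots> \<le> whitney_norm K n h" by (simp add: whitney_norm_def)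
  also have "\<dots> \<le> ennreal \<epsilon>" using assms by simp
  finally show "cmod (h a y - taylor_jet n x h a y) \<le> \<epsilon> * dist x y ^ (n - mi_size a)"
    using assms(2) a x y by (intro whitney_qD) auto
qed

lemma whitney_bound_imp_norm:
  assumes "whitney_bound K n a h" "a \<ge> 0"
  shows "whitney_norm K n h \<le> ennreal (2 * a)"
proof -
  have "Sup {ennreal (cmod (h i x)) |i x. x \<in> K \<and> mi_size i \<le> n} \<le> ennreal a"
    using assms(1) by (intro Sup_least) (auto simp: whitney_bound_def intro: ennreal_leI)
  moreover have "(SUP t\<in>{0<..}. whitney_q K n t h) \<le> ennreal a"
    using assms(1) by (intro SUP_least whitney_qI) (auto simp: whitney_bound_def)
  ultimately have "whitney_norm K n h \<le> ennreal a + ennreal a"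
    unfolding whitney_norm_def by (rule add_mono)
  then show ?thesis using assms(2) by (simp add: ennreal_plus[symmetric])
qed

lemma whitney_norm_cong:
  assumes "\<And>a x. x \<in> K ==> f a x = g a x"
  shows "whitney_norm K n f = whitney_norm K n g"
proof -
  have "{ennreal (cmod (f a x)) |a x. x \<in> K \<and> mi_size a \<le> n} = {ennreal (cmod (g a x)) |a x. x \<in> K \<and> mi_size a \<le> n}"
    using assms by (metis (no_types, opaque_lifting))
  moreover have "whitney_q K n t f = whitney_q K n t g" for t
  proof -
    have "taylor_jet n x f a y = taylor_jet n x g a y" if "x \<in> K" for x a y
      by (rule taylor_jet_cong) (use assms that in auto)
    then show ?thesis unfolding whitney_q_eq using assms by (metis (no_types, opaque_lifting))
  qed
  ultimately show ?thesis by (simp add: whitney_norm_def)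
qed

lemma whitney_bound_cong:
  assumes "\<And>i x. x \<in> K ==> f i x = g i x" "whitney_bound K n a f"
  shows "whitney_bound K n a g"
proof -
  have "taylor_jet n x f i y = taylor_jet n x g i y" if "x \<in> K" for x i y
    by (rule taylor_jet_cong) (use assms that in auto)
  then show ?thesis using assms unfolding whitney_bound_def by simp
qed

lemma whitney_norm_triangle:
  fixes f g :: "'d::finite jet"
  shows "whitney_norm K n (\<lambda>a x. f a x + g a x) \<le> whitney_norm K n f + whitney_norm K n g"
proof -
  let ?S = "\<lambda>f :: 'd jet. Sup {ennreal (cmod (f a x)) |a x. x \<in> K \<and> mi_size a \<le> n}"
  let ?Q = "\<lambda>f. SUP t\<in>{0<..}. whitney_q K n t f"
  have S: "?S (\<lambda>a x. f a x + g a x) \<le> ?S f + ?S g"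
  proof (rule Sup_least, clarify)
    fix a :: "'d multi_index" and x assume "x \<in> K" "mi_size a \<le> n"
    then have "ennreal (cmod (f a x)) \<le> ?S f" "ennreal (cmod (g a x)) \<le> ?S g"
      by (auto intro!: Sup_upper)
    moreover have "ennreal (cmod (f a x + g a x)) \<le> ennreal (cmod (f a x)) + ennreal (cmod (g a x))"
      using ennreal_leI[OF norm_triangle_ineq[of "f a x" "g a x"]] by simp
    ultimately show "ennreal (cmod (f a x + g a x)) \<le> ?S f + ?S g" by (meson add_mono order_trans)
  qed
  have Q: "?Q (\<lambda>a x. f a x + g a x) \<le> ?Q f + ?Q g"
  proof (rule SUP_least)
    fix t :: real assume t: "t \<in> {0<..}"
    have "whitney_q K n t (\<lambda>a x. f a x + g a x) \<le> whitney_q K n t f + whitney_q K n t g"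
      unfolding whitney_q_eq[of K n t "\<lambda>a x. f a x + g a x"]
    proof (rule Sup_least, clarify)
      fix a :: "'d multi_index" and x y assume *: "mi_size a \<le> n" "x \<in> K" "y \<in> K" "0 < norm (x - y)" "norm (x - y) < t"
      let ?r = "\<lambda>f. cmod (f a y - taylor_jet n x f a y)" and ?d = "norm (x - y) ^ (n - mi_size a)"
      have "?r (\<lambda>a x. f a x + g a x) \<le> ?r f + ?r g"
        unfolding taylor_jet_add
        using norm_triangle_ineq[of "f a y - taylor_jet n x f a y" "g a y - taylor_jet n x g a y"] by (simp add: algebra_simps)
      then have "?r (\<lambda>a x. f a x + g a x) / ?d \<le> ?r f / ?d + ?r g / ?d"
        unfolding add_divide_distrib[symmetric] by (rule divide_right_mono) simp
      then have "ennreal (?r (\<lambda>a x. f a x + g a x) / ?d) \<le> ennreal (?r f / ?d + ?r g / ?d)"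
        by (rule ennreal_leI)
      also have "\<dots> = ennreal (?r f / ?d) + ennreal (?r g / ?d)" by (rule ennreal_plus) auto
      also have "\<dots> \<le> whitney_q K n t f + whitney_q K n t g"
        unfolding whitney_q_eq by (intro add_mono Sup_upper) (use * in blast)+
      finally show "ennreal (?r (\<lambda>a x. f a x + g a x) / ?d) \<le> whitney_q K n t f + whitney_q K n t g" .
    qed
    also have "\<dots> \<le> ?Q f + ?Q g" using t by (intro add_mono SUP_upper)
    finally show "whitney_q K n t (\<lambda>a x. f a x + g a x) \<le> ?Q f + ?Q g" .
  qed
  have "whitney_norm K n (\<lambda>a x. f a x + g a x) \<le> (?S f + ?S g) + (?Q f + ?Q g)"
    unfolding whitney_norm_def by (rule add_mono[OF S Q])
  then show ?thesis unfolding whitney_norm_def by (simp only: add_ac)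
qed

lemma jet_restrict_apply: "x \<in> F ==> jet_restrict F f a x = f a x"
  "x \<notin> F ==> jet_restrict F f a x = 0"
  by (simp_all add: jet_restrict_def)

lemma whitney_jets_remainder:
  fixes f :: "'d::finite jet"
  assumes f: "f \<in> whitney_jets F" and K: "compact K" "K \<subseteq> F" and c: "c > 0"
  obtains t where "t > 0" "\<And>a x y. mi_size a \<le> n ==> x \<in> K ==> y \<in> K ==> dist x y < t ==>
     cmod (f a y - taylor_jet n x f a y) \<le> c * dist x y ^ (n - mi_size a)"
proof -
  let ?h = "jet_restrict K f"
  have "((\<lambda>t. whitney_q K n t ?h) \<longlongrightarrow> 0) (at_right 0)"
    using f K by (simp add: whitney_jets_def whitney_jets_compact_def)
  then have "\<forall>\<^sub>F t in at_right 0. whitney_q K n t ?h < ennreal c"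
    using c by (intro order_tendstoD(2)) auto
  then obtain b where b: "b > 0" "\<And>t. 0 < t ==> t < b ==> whitney_q K n t ?h < ennreal c"
    unfolding eventually_at_right_field by auto
  have q: "whitney_q K n (b / 2) ?h \<le> ennreal c" using b(2)[of "b / 2"] b(1) by simp
  show ?thesis
  proof (rule that[of "b / 2"])
    fix a :: "'d multi_index" and x y assume *: "mi_size a \<le> n" "x \<in> K" "y \<in> K" "dist x y < b / 2"
    have "cmod (?h a y - taylor_jet n x ?h a y) \<le> c * dist x y ^ (n - mi_size a)"
      using * c by (intro whitney_qD[OF q]) auto
    moreover have "taylor_jet n x ?h a y = taylor_jet n x f a y"
      by (rule taylor_jet_cong) (use * in \<open>simp add: jet_restrict_apply\<close>)
    ultimately show "cmod (f a y - taylor_jet n x f a y) \<le> c * dist x y ^ (n - mi_size a)"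
      using * by (simp add: jet_restrict_apply)
  qed (use b in simp)
qed

lemma smooth_jet_bounded:
  assumes g: "smooth_on UNIV (g :: 'd::finite jet)" and K: "compact K"
  shows "\<exists>M\<ge>0. \<forall>x\<in>K. \<forall>a. mi_size a \<le> n --> cmod (g a x) \<le> M"
proof -
  have "\<exists>B\<ge>0. \<forall>x\<in>K. cmod (g a x) \<le> B" for a
  proof -
    have "bounded (g a ` K)"
      by (intro compact_imp_bounded compact_continuous_image smooth_on_continuous_on[OF smooth_on_subset[OF g]] K) auto
    then obtain B where B: "\<forall>z\<in>g a ` K. cmod z \<le> B" unfolding bounded_iff by blast
    then show ?thesis by (intro exI[of _ "max B 0"]) (auto simp: le_max_iff_disj)
  qed
  then obtain B where B: "\<And>a. B a \<ge> 0" "\<And>a x. x \<in> K ==> cmod (g a x) \<le> B a" by metis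
  have "cmod (g a x) \<le> (\<Sum>a | mi_size a \<le> n. B a)" if "mi_size a \<le> n" "x \<in> K" for a x
    using member_le_sum[of a "{a. mi_size a \<le> n}" B] that B(1) B(2)[of x a]
    by (auto simp: finite_mi_size_le intro: order_trans)
  then show ?thesis using B(1) by (intro exI[of _ "\<Sum>a | mi_size a \<le> n. B a"]) (auto intro: sum_nonneg)
qed

text \<open>Taylor's formula of one order more, on a ball around \<open>K\<close> since
  \<open>K\<close> itself need not be convex; the spare factor \<open>dist x y\<close> gives the
  bound \<open>C * t\<close>, which tends to 0.\<close>

lemma smooth_whitney_jets:
  assumes g: "smooth_on UNIV (g :: 'd::finite jet)"
  shows "jet_restrict F g \<in> whitney_jets F"
proof -
  have cont: "jet_restrict S g \<in> continuous_jets S" for S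
    unfolding continuous_jets_def
  proof (clarify, intro conjI allI impI)
    fix a
    have "continuous_on S (g a)" by (rule smooth_on_continuous_on[OF smooth_on_subset[OF g]]) simp
    then show "continuous_on S (jet_restrict S g a)"
      by (rule continuous_on_cong[THEN iffD1, rotated -1]) (auto simp: jet_restrict_apply)
  qed (simp add: jet_restrict_apply)
  have "jet_restrict K (jet_restrict F g) \<in> whitney_jets_compact K" if K: "compact K" "K \<subseteq> F" for K
  proof -
    have eq: "jet_restrict K (jet_restrict F g) = jet_restrict K g"
      using K by (auto simp: jet_restrict_def fun_eq_iff)
    have "((\<lambda>t. whitney_q K n t (jet_restrict K g)) \<longlongrightarrow> 0) (at_right 0)" for n
    proof -
      obtain R where "\<forall>x\<in>K. norm x \<le> R" using compact_imp_bounded[OF K(1)] unfolding bounded_iff by blast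
      then have R: "K \<subseteq> cball 0 R" by auto
      obtain M where M: "M \<ge> 0" "\<And>x a. x \<in> cball 0 R ==> mi_size a \<le> Suc n ==> cmod (g a x) \<le> M"
        using smooth_jet_bounded[OF g compact_cball, of 0 R "Suc n"] by blast
      define C where "C = M * real CARD('d) ^ Suc n"
      have "whitney_q K n t (jet_restrict K g) \<le> ennreal (C * t)" if t: "t > 0" for t
      proof (rule whitney_qI)
        fix a :: "'d multi_index" and x y assume *: "mi_size a \<le> n" "x \<in> K" "y \<in> K" "dist x y < t"
        have "taylor_jet n x (jet_restrict K g) a y = taylor_jet n x g a y"
          by (rule taylor_jet_cong) (use * in \<open>simp add: jet_restrict_apply\<close>)
        then have "cmod (jet_restrict K g a y - taylor_jet n x (jet_restrict K g) a y) = cmod (g a y - taylor_jet n x g a y)"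
          using * by (simp add: jet_restrict_apply)
        also have "\<dots> \<le> M * (real CARD('d) * norm (y - x)) ^ (Suc n - mi_size a)"
          using * R M(2) by (intro taylor_remainder[where S = "cball 0 R"] smooth_on_subset[OF g]) auto
        also have "\<dots> = M * (real CARD('d) ^ (Suc n - mi_size a) * (dist x y * dist x y ^ (n - mi_size a)))"
          using *(1) by (simp add: power_mult_distrib Suc_diff_le dist_norm norm_minus_commute)
        also have "\<dots> \<le> M * (real CARD('d) ^ Suc n * (t * dist x y ^ (n - mi_size a)))"
          using * M(1) t by (intro mult_left_mono mult_mono power_increasing mult_right_mono) auto
        also have "\<dots> = C * t * dist x y ^ (n - mi_size a)" by (simp add: C_def)
        finally show "cmod (jet_restrict K g a y - taylor_jet n x (jet_restrict K g) a y) \<le> C * t * dist x y ^ (n - mi_size a)" .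
      qed
      then have up: "\<forall>\<^sub>F t in at_right 0. whitney_q K n t (jet_restrict K g) \<le> ennreal (C * t)"
        by (intro eventually_at_rightI[of 0 1]) auto
      have "((\<lambda>t. ennreal (C * t)) \<longlongrightarrow> ennreal (C * 0)) (at_right 0)"
        by (intro tendsto_intros)
      then have lim: "((\<lambda>t. ennreal (C * t)) \<longlongrightarrow> 0) (at_right 0)" by simp
      show ?thesis
        by (rule tendsto_sandwich[OF _ up tendsto_const lim]) simp
    qed
    then show ?thesis using cont[of K] by (simp add: whitney_jets_compact_def eq)
  qed
  then show ?thesis using cont[of F] by (simp add: whitney_jets_def)
qed

text \<open>The Whitney condition of order \<open>Suc (mi_size a)\<close> says that the entry
  \<open>a\<close> differs from its Taylor polynomial at \<open>x\<close> by
  \<open>o(norm (y - x))\<close>, and the derivative of that polynomial at \<open>x\<close> consists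
  of the next entries.\<close>

lemma whitney_jets_smooth_interior:
  fixes f :: "'d::finite jet"
  assumes f: "f \<in> whitney_jets F"
  shows "smooth_on (interior F) f"
  unfolding smooth_on_def
proof (intro allI ballI)
  fix a :: "'d multi_index" and x :: "real ^ 'd" assume "x \<in> interior F"
  then obtain r where r: "r > 0" "cball x r \<subseteq> F" unfolding mem_interior_cball by blast
  define n where "n = Suc (mi_size a)"
  let ?T = "taylor_jet n x f"
  have T: "(?T a has_derivative (\<lambda>h. \<Sum>j\<in>UNIV. (h $ j) *\<^sub>R f (a + axis j (Suc 0)) x)) (at x)"
    using smooth_onD[OF smooth_on_taylor_jet, of x n x f a] by (simp add: taylor_jet_at n_def)
  have "((\<lambda>y. f a y - ?T a y) has_derivative (\<lambda>h. 0)) (at x)"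
    unfolding has_derivative_iff_norm
  proof (intro conjI bounded_linear_zero)
    show "((\<lambda>y. norm (f a y - ?T a y - (f a x - ?T a x) - 0) / norm (y - x)) \<longlongrightarrow> 0) (at x)"
    proof (rule tendstoI)
      fix e :: real assume e: "e > 0"
      obtain t where t: "t > 0" "\<And>b z y. mi_size b \<le> n ==> z \<in> cball x r ==> y \<in> cball x r ==> dist z y < t ==>
        cmod (f b y - taylor_jet n z f b y) \<le> e / 2 * dist z y ^ (n - mi_size b)"
        using whitney_jets_remainder[OF f compact_cball r(2) half_gt_zero[OF e], of n] by blast
      have "norm (f a y - ?T a y - (f a x - ?T a x) - 0) / norm (y - x) < e"
        if y: "y \<noteq> x" "dist y x < min t r" for y
      proof -
        have "cmod (f a y - ?T a y) \<le> e / 2 * dist x y ^ (n - mi_size a)"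
          using y r by (intro t(2)) (auto simp: n_def dist_commute)
        then have "cmod (f a y - ?T a y) \<le> e / 2 * norm (y - x)"
          by (simp add: n_def dist_norm norm_minus_commute)
        moreover have "norm (y - x) > 0" using y by simp
        ultimately have "cmod (f a y - ?T a y) / norm (y - x) \<le> e / 2" by (simp add: pos_divide_le_eq)
        moreover have "?T a x = f a x" by (simp add: taylor_jet_at n_def)
        then have "norm (f a y - ?T a y - (f a x - ?T a x) - 0) / norm (y - x) = cmod (f a y - ?T a y) / norm (y - x)"
          by simp
        ultimately show ?thesis using e by linarith
      qed
      then show "\<forall>\<^sub>F y in at x. dist (norm (f a y - ?T a y - (f a x - ?T a x) - 0) / norm (y - x)) 0 < e"
        unfolding eventually_at using t(1) r(1) by (intro exI[of _ "min t r"]) auto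
    qed
  qed
  from has_derivative_add[OF this T]
  show "(f a has_derivative (\<lambda>h. \<Sum>j\<in>UNIV. (h $ j) *\<^sub>R f (a + axis j (Suc 0)) x)) (at x)"
    by simp
qed

section \<open>Restriction of jets, and density in terms of finitely many Whitney bounds\<close>

lemma jet_op_restrict: "jet_op P (jet_restrict F f) = jet_restrict F (jet_op P f)"
  by (auto simp: jet_op_eq jet_restrict_def fun_eq_iff)

lemma jet_kernel_restrict:
  assumes "f \<in> jet_kernel P F2" "F1 \<subseteq> F2"
  shows "jet_restrict F1 f \<in> jet_kernel P F1"
proof -
  have f: "f \<in> whitney_jets F2" "jet_op P f = (\<lambda>a x. 0)" using assms(1) by (auto simp: jet_kernel_def)
  have "jet_restrict K (jet_restrict F1 f) = jet_restrict K f" if "K \<subseteq> F1" for K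
    using that by (auto simp: jet_restrict_def fun_eq_iff)
  moreover have "jet_restrict F1 f \<in> continuous_jets F1"
    unfolding continuous_jets_def
  proof (clarify, intro conjI allI impI)
    fix a
    have "continuous_on F1 (f a)"
      using f(1) assms(2) by (auto simp: whitney_jets_def continuous_jets_def intro: continuous_on_subset)
    then show "continuous_on F1 (jet_restrict F1 f a)"
      by (rule continuous_on_cong[THEN iffD1, rotated -1]) (auto simp: jet_restrict_apply)
  qed (simp add: jet_restrict_apply)
  ultimately have "jet_restrict F1 f \<in> whitney_jets F1"
    using f(1) assms(2) by (auto simp: whitney_jets_def)
  then show ?thesis unfolding jet_kernel_def mem_Collect_eq jet_op_restrict f(2) by (simp add: jet_restrict_def)
qed

lemma smooth_jet_kernel:
  assumes "smooth_on UNIV g" "\<And>x b. x \<in> F ==> jet_op P g b x = 0"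
  shows "jet_restrict F g \<in> jet_kernel P F"
  unfolding jet_kernel_def mem_Collect_eq jet_op_restrict
  using smooth_whitney_jets[OF assms(1)] assms(2) by (simp add: jet_restrict_def fun_eq_iff)

lemma whitney_norm_restrict_mono:
  assumes "K \<subseteq> K'"
  shows "whitney_norm K n (jet_restrict K h) \<le> whitney_norm K' n (jet_restrict K' h)"
proof -
  have "whitney_norm K n (jet_restrict K h) = whitney_norm K n (jet_restrict K' h)"
    by (rule whitney_norm_cong) (use assms in \<open>auto simp: jet_restrict_apply\<close>)
  also have "\<dots> \<le> whitney_norm K' n (jet_restrict K' h)"
    unfolding whitney_norm_def whitney_q_eq
    by (intro add_mono Sup_subset_mono SUP_mono') (use assms in blast)+
  finally show ?thesis .
qed

text \<open>Intersections of subbasic sets involve several compact sets and orders. Compact sets can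
  be united, but seminorms of different orders are not compared at this place, so all orders up to
  \<open>n0\<close> appear. Balls with other centres are recentred by the triangle
  inequality.\<close>

lemma whitney_topology_neighbourhood:
  assumes "openin (whitney_topology F) U" "f \<in> U"
  shows "\<exists>K n0 \<epsilon>. compact K \<and> K \<subseteq> F \<and> \<epsilon> > 0 \<and> (\<forall>g\<in>whitney_jets F.
     (\<forall>n\<le>n0. whitney_norm K n (jet_restrict K (g - f)) < ennreal \<epsilon>) --> g \<in> U)"
proof -
  let ?B = "{{g \<in> whitney_jets F. whitney_norm K n (jet_restrict K (g - f)) < ennreal \<epsilon>} | K n f \<epsilon>.
        compact K \<and> K \<subseteq> F \<and> f \<in> whitney_jets F \<and> 0 < \<epsilon>}"
  have "generate_topology_on ?B U"
    using assms(1) unfolding whitney_topology_def openin_topology_generated_by_iff .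
  then show ?thesis using assms(2)
  proof (induction arbitrary: f)
    case Empty
    then show ?case by simp
  next
    case (Int a b)
    obtain K1 n1 \<epsilon>1 where 1: "compact K1" "K1 \<subseteq> F" "\<epsilon>1 > 0" "\<forall>g\<in>whitney_jets F.
     (\<forall>n\<le>n1. whitney_norm K1 n (jet_restrict K1 (g - f)) < ennreal \<epsilon>1) --> g \<in> a"
      using Int.IH(1)[of f] Int.prems by blast
    obtain K2 n2 \<epsilon>2 where 2: "compact K2" "K2 \<subseteq> F" "\<epsilon>2 > 0" "\<forall>g\<in>whitney_jets F.
     (\<forall>n\<le>n2. whitney_norm K2 n (jet_restrict K2 (g - f)) < ennreal \<epsilon>2) --> g \<in> b"
      using Int.IH(2)[of f] Int.prems by blast
    have "g \<in> a \<inter> b" if g: "g \<in> whitney_jets F"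
      and *: "\<forall>n\<le>max n1 n2. whitney_norm (K1 \<union> K2) n (jet_restrict (K1 \<union> K2) (g - f)) < ennreal (min \<epsilon>1 \<epsilon>2)" for g
    proof -
      have le: "whitney_norm K n (jet_restrict K (g - f)) < ennreal \<epsilon>" if "K \<subseteq> K1 \<union> K2" "n \<le> max n1 n2" "min \<epsilon>1 \<epsilon>2 \<le> \<epsilon>" for K n \<epsilon>
        by (rule le_less_trans[OF whitney_norm_restrict_mono[OF that(1)] less_le_trans[OF *[rule_format, OF that(2)] ennreal_leI[OF that(3)]]])
      have "g \<in> a" using 1(4) g * le by (meson Un_upper1 max.cobounded1 min.cobounded1 order_trans)
      moreover have "g \<in> b" using 2(4) g * le by (meson Un_upper2 max.cobounded2 min.cobounded2 order_trans)
      ultimately show ?thesis by blast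
    qed
    moreover have "compact (K1 \<union> K2)" "K1 \<union> K2 \<subseteq> F" "min \<epsilon>1 \<epsilon>2 > 0" using 1 2 by auto
    ultimately show ?case by blast
  next
    case (UN K)
    then obtain a where a: "a \<in> K" "f \<in> a" by blast
    from UN.IH[OF a] obtain K' n0 \<epsilon> where "compact K'" "K' \<subseteq> F" "\<epsilon> > 0" "\<forall>g\<in>whitney_jets F.
      (\<forall>n\<le>n0. whitney_norm K' n (jet_restrict K' (g - f)) < ennreal \<epsilon>) --> g \<in> a" by blast
    then show ?case using a(1) by blast
  next
    case (Basis s)
    then obtain K n f0 \<epsilon> where s: "s = {g \<in> whitney_jets F. whitney_norm K n (jet_restrict K (g - f0)) < ennreal \<epsilon>}"
      and K: "compact K" "K \<subseteq> F" "\<epsilon> > 0" by blast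
    have "whitney_norm K n (jet_restrict K (f - f0)) < ennreal \<epsilon>" using Basis.prems s by simp
    then obtain a where a: "a \<ge> 0" "whitney_norm K n (jet_restrict K (f - f0)) = ennreal a" "a < \<epsilon>"
      by (cases "whitney_norm K n (jet_restrict K (f - f0))") (auto simp: ennreal_less_iff)
    have "g \<in> s" if g: "g \<in> whitney_jets F" "whitney_norm K n (jet_restrict K (g - f)) < ennreal (\<epsilon> - a)" for g
    proof -
      have "whitney_norm K n (jet_restrict K (g - f0)) \<le> whitney_norm K n (jet_restrict K (g - f)) + whitney_norm K n (jet_restrict K (f - f0))"
      proof -
        have "jet_restrict K (g - f0) = (\<lambda>i x. jet_restrict K (g - f) i x + jet_restrict K (f - f0) i x)"
          by (auto simp: jet_restrict_def fun_eq_iff)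
        then show ?thesis by (simp only: whitney_norm_triangle)
      qed
      also have "\<dots> < ennreal (\<epsilon> - a) + ennreal a"
      proof -
        have "ennreal a + whitney_norm K n (jet_restrict K (g - f)) < ennreal a + ennreal (\<epsilon> - a)"
          by (rule ennreal_add_left_cancel_less[THEN iffD2]) (rule conjI[OF _ g(2)], simp)
        then show ?thesis unfolding a(2) by (simp only: add.commute)
      qed
      also have "\<dots> = ennreal \<epsilon>" using a by (subst ennreal_plus[symmetric]) auto
      finally show ?thesis using g(1) s by simp
    qed
    moreover have "\<epsilon> - a > 0" using a by simp
    ultimately show ?case using K(1,2) by blast
  qed
qed

lemma whitney_topology_ball_open:
  assumes "compact K" "K \<subseteq> F" "f \<in> whitney_jets F" "0 < \<epsilon>"
  shows "openin (whitney_topology F) {g \<in> whitney_jets F. whitney_norm K n (jet_restrict K (g - f)) < ennreal \<epsilon>}"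
  unfolding whitney_topology_def openin_topology_generated_by_iff
  by (rule generate_topology_on.Basis) (use assms in blast)

lemma whitney_norm_zero: "whitney_norm K n (\<lambda>a x. 0) = 0"
proof -
  have "whitney_bound K n 0 (\<lambda>a x. 0)" by (simp add: whitney_bound_def taylor_jet_def)
  from whitney_bound_imp_norm[OF this] show ?thesis by simp
qed

lemma runge_pair_imp_approx:
  assumes "runge_pair P F1 F2" and f: "f \<in> jet_kernel P F1" and K: "compact K" "K \<subseteq> F1" and \<epsilon>: "\<epsilon> > 0"
  obtains g where "g \<in> jet_kernel P F2" "whitney_bound K n \<epsilon> (\<lambda>a x. g a x - f a x)"
proof -
  let ?U = "{g \<in> whitney_jets F1. whitney_norm K n (jet_restrict K (g - f)) < ennreal \<epsilon>}"
  have fw: "f \<in> whitney_jets F1" using f by (simp add: jet_kernel_def)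
  have cl: "f \<in> subtopology (whitney_topology F1) (jet_kernel P F1) closure_of (jet_restrict F1 ` jet_kernel P F2)"
    using assms(1) f by (simp add: runge_pair_def)
  have op: "openin (subtopology (whitney_topology F1) (jet_kernel P F1)) (?U \<inter> jet_kernel P F1)"
    using whitney_topology_ball_open[OF K fw \<epsilon>] by (auto simp: openin_subtopology)
  have mem: "f \<in> ?U \<inter> jet_kernel P F1"
  proof -
    have "jet_restrict K (f - f) = (\<lambda>a x. 0)" by (auto simp: jet_restrict_def fun_eq_iff)
    then show ?thesis using f fw \<epsilon> by (simp add: whitney_norm_zero)
  qed
  from cl[unfolded in_closure_of, THEN conjunct2, rule_format, OF conjI[OF mem op]]
  obtain h where h: "h \<in> jet_restrict F1 ` jet_kernel P F2" "h \<in> ?U" by blast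
  then obtain g where g: "g \<in> jet_kernel P F2" "h = jet_restrict F1 g" by blast
  have "whitney_bound K n \<epsilon> (jet_restrict K (h - f))" using h(2) \<epsilon> by (intro whitney_norm_imp_bound) auto
  then have "whitney_bound K n \<epsilon> (\<lambda>a x. g a x - f a x)"
    by (rule whitney_bound_cong[rotated]) (use K in \<open>auto simp: jet_restrict_def g(2)\<close>)
  with g(1) show ?thesis by (rule that)
qed

lemma runge_pairI:
  assumes "F1 \<subseteq> F2"
    and ap: "\<And>f K n0 \<epsilon>. f \<in> jet_kernel P F1 ==> compact K ==> K \<subseteq> F1 ==> \<epsilon> > 0 ==>
      \<exists>g\<in>jet_kernel P F2. \<forall>n\<le>n0. whitney_bound K n \<epsilon> (\<lambda>a x. g a x - f a x)"
  shows "runge_pair P F1 F2"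
proof -
  have "f \<in> subtopology (whitney_topology F1) (jet_kernel P F1) closure_of (jet_restrict F1 ` jet_kernel P F2)"
    if f: "f \<in> jet_kernel P F1" for f
    unfolding in_closure_of
  proof (intro conjI allI impI)
    have fw: "f \<in> whitney_jets F1" using f by (simp add: jet_kernel_def)
    \<comment> \<open>For the empty compact set the ball consists of all jets; this shows that
      \<open>f\<close> lies in the \<open>topspace\<close>.\<close>
    have "f \<in> {g \<in> whitney_jets F1. whitney_norm {} 0 (jet_restrict {} (g - f)) < ennreal 1}"
    proof -
      have "jet_restrict {} (f - f) = (\<lambda>a x. 0)" by (auto simp: jet_restrict_def fun_eq_iff)
      then show ?thesis using fw by (simp add: whitney_norm_zero)
    qed
    then have "f \<in> topspace (whitney_topology F1)"
      using whitney_topology_ball_open[of "{}" F1 f 1 0] fw openin_subset by (metis (no_types, lifting) bot_least compact_empty subsetD zero_less_one)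
    then show "f \<in> topspace (subtopology (whitney_topology F1) (jet_kernel P F1))" using f by simp
    fix T assume "f \<in> T \<and> openin (subtopology (whitney_topology F1) (jet_kernel P F1)) T"
    then obtain U where U: "openin (whitney_topology F1) U" "T = U \<inter> jet_kernel P F1" "f \<in> U"
      by (auto simp: openin_subtopology)
    obtain K n0 \<epsilon> where K: "compact K" "K \<subseteq> F1" "\<epsilon> > 0" "\<forall>g\<in>whitney_jets F1.
      (\<forall>n\<le>n0. whitney_norm K n (jet_restrict K (g - f)) < ennreal \<epsilon>) --> g \<in> U"
      using whitney_topology_neighbourhood[OF U(1,3)] by blast
    \<comment> \<open>\<open>\<epsilon> / 4\<close> because the passage from
      \<open>whitney_bound\<close> to the norm doubles the bound and the inequality must be
      strict.\<close>
    obtain g where g: "g \<in> jet_kernel P F2" "\<And>n. n \<le> n0 ==> whitney_bound K n (\<epsilon> / 4) (\<lambda>a x. g a x - f a x)"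
      using ap[OF f K(1,2), of "\<epsilon> / 4" n0] K(3) by auto
    let ?h = "jet_restrict F1 g"
    have hk: "?h \<in> jet_kernel P F1" by (rule jet_kernel_restrict[OF g(1) assms(1)])
    have "whitney_norm K n (jet_restrict K (?h - f)) < ennreal \<epsilon>" if "n \<le> n0" for n
    proof -
      have "whitney_bound K n (\<epsilon> / 4) (jet_restrict K (?h - f))"
        by (rule whitney_bound_cong[OF _ g(2)[OF that]]) (use K(2) in \<open>auto simp: jet_restrict_def\<close>)
      then have "whitney_norm K n (jet_restrict K (?h - f)) \<le> ennreal (2 * (\<epsilon> / 4))"
        by (rule whitney_bound_imp_norm) (use K(3) in simp)
      also have "\<dots> < ennreal \<epsilon>" using K(3) by (intro ennreal_lessI) auto
      finally show ?thesis .
    qed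
    then have "?h \<in> U" using K(4) hk by (auto simp: jet_kernel_def)
    then show "\<exists>y. y \<in> jet_restrict F1 ` jet_kernel P F2 \<and> y \<in> T" using g(1) hk U(2) by blast
  qed
  moreover have "subtopology (whitney_topology F1) (jet_kernel P F1) closure_of (jet_restrict F1 ` jet_kernel P F2) \<subseteq> jet_kernel P F1"
    using closure_of_subset_topspace[of "subtopology (whitney_topology F1) (jet_kernel P F1)"] by fastforce
  ultimately show ?thesis unfolding runge_pair_def by blast
qed

section \<open>Smoothing a Whitney jet at a given scale\<close>

definition taylor_close :: "nat => (real ^ 'd) set => real => real => ('d::finite) jet => bool" where
  "taylor_close N K A \<rho> f \<longleftrightarrow> (\<forall>x\<in>K. \<forall>y\<in>K. \<forall>a. mi_size a \<le> N --> dist x y \<le> \<rho> -->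
     cmod (f a y - taylor_jet N x f a y) \<le> A * dist x y ^ (N - mi_size a))"

lemma taylor_closeD:
  "taylor_close N K A \<rho> f ==> x \<in> K ==> y \<in> K ==> mi_size a \<le> N ==> dist x y \<le> \<rho> ==>
     cmod (f a y - taylor_jet N x f a y) \<le> A * dist x y ^ (N - mi_size a)"
  unfolding taylor_close_def by blast

text \<open>The difference of two Taylor polynomials of \<open>f\<close> is a polynomial whose jet
  at \<open>x'\<close> is the Whitney remainder of \<open>f\<close> there. Re-expanding it around
  \<open>x'\<close> turns remainder bounds into bounds at all nearby points.\<close>

lemma taylor_jet_recenter:
  fixes f :: "'d::finite jet"
  assumes f: "taylor_close N K A (q * \<delta>) f" and x: "x \<in> K" "x' \<in> K" and A: "A \<ge> 0" and \<delta>: "\<delta> > 0"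
    and q: "q \<ge> 1" "dist x x' \<le> q * \<delta>" "dist x' y \<le> q * \<delta>"
  shows "\<delta> ^ mi_size a * cmod (taylor_jet N x' f a y - taylor_jet N x f a y)
     \<le> real (card {\<gamma> :: 'd multi_index. mi_size \<gamma> \<le> N}) * (q ^ N * (A * (q * \<delta>) ^ N))"
proof -
  define p where "p = (\<lambda>a y. taylor_jet N x' f a y - taylor_jet N x f a y)"
  have "jet_bound \<delta> N {x'} p (A * (q * \<delta>) ^ N)"
    unfolding jet_bound_def
  proof (intro ballI allI impI)
    fix z and \<gamma> :: "'d multi_index" assume z: "z \<in> {x'}" and \<gamma>: "mi_size \<gamma> \<le> N"
    have "cmod (p \<gamma> z) = cmod (f \<gamma> x' - taylor_jet N x f \<gamma> x')"
      using z \<gamma> by (simp add: p_def taylor_jet_at)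
    also have "\<dots> \<le> A * dist x x' ^ (N - mi_size \<gamma>)" using f x \<gamma> q(2) by (rule taylor_closeD)
    also have "\<dots> \<le> A * (q * \<delta>) ^ (N - mi_size \<gamma>)" using A q(2) by (intro mult_left_mono power_mono) auto
    finally have "\<delta> ^ mi_size \<gamma> * cmod (p \<gamma> z) \<le> (q * \<delta>) ^ mi_size \<gamma> * (A * (q * \<delta>) ^ (N - mi_size \<gamma>))"
      using \<delta> q(1) A by (intro mult_mono power_mono) auto
    also have "\<dots> = A * ((q * \<delta>) ^ mi_size \<gamma> * (q * \<delta>) ^ (N - mi_size \<gamma>))" by (simp only: mult_ac)
    also have "\<dots> = A * (q * \<delta>) ^ N" using \<gamma> by (simp only: power_add[symmetric] le_add_diff_inverse)
    finally show "\<delta> ^ mi_size \<gamma> * cmod (p \<gamma> z) \<le> A * (q * \<delta>) ^ N" .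
  qed
  then have "\<delta> ^ mi_size a * cmod (taylor_jet N x' p a y)
     \<le> real (card {\<gamma> :: 'd multi_index. mi_size \<gamma> \<le> N}) * (q ^ N * (A * (q * \<delta>) ^ N))"
    using \<delta> q by (intro taylor_jet_bound) (auto simp: dist_norm norm_minus_commute)
  moreover have "taylor_jet N x' p a y = p a y"
    unfolding p_def by (rule taylor_jet_polynomial) (auto intro!: smooth_on_diff smooth_on_taylor_jet simp: taylor_jet_eq_0)
  ultimately show ?thesis by (simp add: p_def)
qed

lemma grid_fun_support:
  fixes x :: "real ^ 'd::finite"
  assumes "finite I" "\<delta> > 0" "\<kappa> \<in> I" "(\<Sum>\<kappa>\<in>I. norm (grid_pt \<delta> \<kappa> :: real ^ 'd)) + real CARD('d) * \<delta> < norm x"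
  shows "grid_fun \<delta> \<kappa> a x = 0"
proof (rule grid_fun_eq_0, rule notI)
  assume "\<kappa> \<in> grid_active \<delta> x"
  then have "norm (x - grid_pt \<delta> \<kappa>) \<le> real CARD('d) * \<delta>" using assms(2) by (rule grid_active_dist)
  moreover have "norm (grid_pt \<delta> \<kappa> :: real ^ 'd) \<le> (\<Sum>\<kappa>\<in>I. norm (grid_pt \<delta> \<kappa> :: real ^ 'd))"
    using assms by (intro member_le_sum) auto
  moreover have "norm x \<le> norm (x - grid_pt \<delta> \<kappa>) + norm (grid_pt \<delta> \<kappa> :: real ^ 'd)"
    using norm_triangle_ineq[of "x - grid_pt \<delta> \<kappa>" "grid_pt \<delta> \<kappa>"] by simp
  ultimately show False using assms(4) by linarith
qed

text \<open>All Taylor polynomials glued together near a point agree up to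
  \<open>A * \<delta> ^ N\<close> in the weighted sense, and a partition of unity of the same mesh
  preserves this. The comparison is with a Taylor polynomial because \<open>y\<close> may lie
  outside \<open>K\<close>. The number \<open>M\<close> of controlled derivatives is independent of
  \<open>N\<close>, and \<open>C\<close> precedes mesh, set and jet.\<close>

lemma whitney_smoothing:
  fixes c :: real
  assumes c: "c \<ge> 1"
  shows "\<exists>C\<ge>0. \<forall>\<delta>>0. \<forall>K A. \<forall>f :: 'd::finite jet. bounded K --> A \<ge> 0 -->
    taylor_close N K A (2 * (c + real CARD('d)) * \<delta>) f -->
    (\<exists>s. smooth_on UNIV s \<and> (\<exists>R. \<forall>i x. R < norm x --> s i x = 0) \<and>
      (\<forall>x\<in>K. \<forall>y i. dist x y \<le> c * \<delta> --> mi_size i \<le> M -->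
         \<delta> ^ mi_size i * cmod (s i y - taylor_jet N x f i y) \<le> C * (A * \<delta> ^ N)))"
proof -
  obtain B where B: "B \<ge> 1" "\<And>\<delta> \<kappa>. \<delta> > 0 ==> jet_bound \<delta> M UNIV (grid_fun \<delta> \<kappa> :: 'd jet) B"
    using grid_fun_bound by blast
  define d where "d = real CARD('d)"
  have d: "d \<ge> 0" by (simp add: d_def)
  \<comment> \<open>In units of \<open>\<delta>\<close>: a base point is within \<open>c + d\<close>
    of its grid point, the grid point within \<open>d\<close> of \<open>y\<close>, and
    \<open>y\<close> within \<open>c\<close> of \<open>x\<close>; the sum is
    \<open>2 * (c + d)\<close>.\<close>
  define q where "q = 2 * (c + d)"
  have q: "q \<ge> 1" using c d by (simp add: q_def)
  define p where "p = real (card {\<gamma> :: 'd multi_index. mi_size \<gamma> \<le> N})"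
  define C where "C = 3 ^ CARD('d) * (2 ^ M * (B * (p * (q ^ N * q ^ N))))"
  have "C \<ge> 0" using B q by (simp add: C_def p_def)
  moreover have "\<exists>s. smooth_on UNIV s \<and> (\<exists>R. \<forall>i x. R < norm x --> s i x = 0) \<and>
      (\<forall>x\<in>K. \<forall>y i. dist x y \<le> c * \<delta> --> mi_size i \<le> M -->
         \<delta> ^ mi_size i * cmod (s i y - taylor_jet N x f i y) \<le> C * (A * \<delta> ^ N))"
    if \<delta>: "\<delta> > 0" and K: "bounded K" and A: "A \<ge> 0" and f: "taylor_close N K A (q * \<delta>) f"
    for \<delta> K A and f :: "'d jet"
  proof -
    define Y where "Y = neighbourhood K (c * \<delta>)"
    obtain R0 where "\<forall>x\<in>K. norm x \<le> R0" using K unfolding bounded_iff by blast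
    then have "K \<subseteq> cball 0 R0" by auto
    then have "bounded Y"
      unfolding Y_def by (meson bounded_cball bounded_subset neighbourhood_subset_cball)
    define I where "I = (\<Union>y\<in>Y. grid_active \<delta> y)"
    have fin: "finite I" unfolding I_def by (rule grid_active_finite_Union) fact
    have "\<exists>x'\<in>K. dist x' (grid_pt \<delta> \<kappa>) \<le> (c + d) * \<delta>" if \<kappa>: "\<kappa> \<in> I" for \<kappa>
    proof -
      obtain y x' where y: "\<kappa> \<in> grid_active \<delta> y" "x' \<in> K" "dist x' y \<le> c * \<delta>"
        using \<kappa> by (auto simp: I_def Y_def neighbourhood_def)
      have "dist y (grid_pt \<delta> \<kappa>) \<le> d * \<delta>"
        using grid_active_dist[OF y(1) \<delta>] by (simp add: dist_norm d_def)
      then have "dist x' (grid_pt \<delta> \<kappa>) \<le> (c + d) * \<delta>"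
        using y(3) dist_triangle[of x' "grid_pt \<delta> \<kappa>" y] by (simp add: distrib_right)
      then show ?thesis using y(2) by blast
    qed
    then obtain pt where pt: "\<And>\<kappa>. \<kappa> \<in> I ==> pt \<kappa> \<in> K" "\<And>\<kappa>. \<kappa> \<in> I ==> dist (pt \<kappa>) (grid_pt \<delta> \<kappa>) \<le> (c + d) * \<delta>"
      by metis
    define s where "s = (\<lambda>i y. \<Sum>\<kappa>\<in>I. jet_mult (grid_fun \<delta> \<kappa>) (taylor_jet N (pt \<kappa>) f) i y)"
    have "smooth_on UNIV s"
      unfolding s_def by (intro smooth_on_sum smooth_on_mult smooth_on_grid_fun smooth_on_taylor_jet)
    moreover have "s i x = 0" if "(\<Sum>\<kappa>\<in>I. norm (grid_pt \<delta> \<kappa> :: real ^ 'd)) + real CARD('d) * \<delta> < norm x" for i x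
      unfolding s_def by (intro sum.neutral ballI jet_mult_zero_left grid_fun_support[OF fin \<delta> _ that])
    moreover have "\<delta> ^ mi_size i * cmod (s i y - taylor_jet N x f i y) \<le> C * (A * \<delta> ^ N)"
      if x: "x \<in> K" and y: "dist x y \<le> c * \<delta>" and i: "mi_size i \<le> M" for x y and i :: "'d multi_index"
    proof -
      let ?p = "\<lambda>\<kappa> i y. taylor_jet N (pt \<kappa>) f i y - taylor_jet N x f i y"
      let ?D = "p * (q ^ N * (A * (q * \<delta>) ^ N))"
      have sub: "grid_active \<delta> y \<subseteq> I" using x y by (auto simp: I_def Y_def neighbourhood_def)
      have "taylor_jet N x f i y = (\<Sum>\<kappa>\<in>I. jet_mult (grid_fun \<delta> \<kappa>) (taylor_jet N x f) i y)"
        unfolding jet_mult_sum_left[symmetric]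
        by (rule jet_mult_one_left[symmetric]) (rule grid_partition[OF \<delta> fin sub])
      then have "s i y - taylor_jet N x f i y = (\<Sum>\<kappa>\<in>I. jet_mult (grid_fun \<delta> \<kappa>) (?p \<kappa>) i y)"
        by (simp add: s_def jet_mult_diff_right sum_subtractf)
      also have "\<dots> = (\<Sum>\<kappa>\<in>grid_active \<delta> y. jet_mult (grid_fun \<delta> \<kappa>) (?p \<kappa>) i y)"
        by (rule sum.mono_neutral_right[OF fin sub]) (auto intro!: jet_mult_zero_left grid_fun_eq_0)
      finally have "\<delta> ^ mi_size i * cmod (s i y - taylor_jet N x f i y)
          \<le> (\<Sum>\<kappa>\<in>grid_active \<delta> y. \<delta> ^ mi_size i * cmod (jet_mult (grid_fun \<delta> \<kappa>) (?p \<kappa>) i y))"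
        unfolding sum_distrib_left[symmetric] using \<delta> by (intro mult_left_mono) (simp_all add: norm_sum)
      also have "\<dots> \<le> (\<Sum>\<kappa>\<in>grid_active \<delta> y. 2 ^ M * (B * ?D))"
      proof (rule sum_mono)
        fix \<kappa> assume \<kappa>: "\<kappa> \<in> grid_active \<delta> y"
        have pd: "dist (pt \<kappa>) (grid_pt \<delta> \<kappa>) \<le> (c + d) * \<delta>" "pt \<kappa> \<in> K" using pt \<kappa> sub by auto
        have "dist y (grid_pt \<delta> \<kappa>) \<le> d * \<delta>"
          using grid_active_dist[OF \<kappa> \<delta>] by (simp add: dist_norm d_def)
        then have a: "dist (pt \<kappa>) y \<le> (c + d) * \<delta> + d * \<delta>"
          using pd dist_triangle2[of "pt \<kappa>" y "grid_pt \<delta> \<kappa>"] by simp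
        moreover have "(c + d) * \<delta> + d * \<delta> + c * \<delta> = q * \<delta>" by (simp add: q_def algebra_simps)
        moreover have "c * \<delta> \<ge> 0" using c \<delta> by simp
        ultimately have b: "dist x (pt \<kappa>) \<le> q * \<delta>" "dist (pt \<kappa>) y \<le> q * \<delta>"
          using y dist_triangle2[of x "pt \<kappa>" y] by linarith+
        have "jet_bound \<delta> M {y} (?p \<kappa>) ?D"
          unfolding jet_bound_def using taylor_jet_recenter[OF f x pd(2) A \<delta> q b] by (simp add: p_def)
        moreover have "jet_bound \<delta> M {y} (grid_fun \<delta> \<kappa>) B" using B(2)[OF \<delta>] by (rule jet_bound_mono) auto
        ultimately have "jet_bound \<delta> M {y} (jet_mult (grid_fun \<delta> \<kappa>) (?p \<kappa>)) (2 ^ M * (B * ?D))"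
          using \<delta> B(1) by (intro jet_bound_mult) auto
        from jet_boundD[OF this _ i]
        show "\<delta> ^ mi_size i * cmod (jet_mult (grid_fun \<delta> \<kappa>) (?p \<kappa>) i y) \<le> 2 ^ M * (B * ?D)" by simp
      qed
      also have "\<dots> = real (card (grid_active \<delta> y)) * (2 ^ M * (B * ?D))" by simp
      also have "\<dots> \<le> real (3 ^ CARD('d)) * (2 ^ M * (B * ?D))"
      proof (rule mult_right_mono)
        show "real (card (grid_active \<delta> y)) \<le> real (3 ^ CARD('d))" using grid_active_card(2)[of \<delta> y] by (simp only: of_nat_le_iff)
        show "0 \<le> 2 ^ M * (B * ?D)" using B A q \<delta> by (simp add: p_def)
      qed
      also have "\<dots> = C * (A * \<delta> ^ N)" by (simp add: C_def power_mult_distrib mult_ac)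
      finally show ?thesis .
    qed
    ultimately show ?thesis by blast
  qed
  ultimately show ?thesis unfolding q_def d_def by blast
qed

text \<open>Sum the grid functions active at some point within \<open>c * \<delta>\<close> of
  \<open>K\<close>. Each of them reaches at most \<open>2 d \<delta>\<close> further, and at each
  point only boundedly many are active, so the constant depends on neither mesh nor set.\<close>

lemma scaled_cutoff:
  fixes c :: real
  assumes c: "c \<ge> 0"
  shows "\<exists>C\<ge>0. \<forall>\<delta>>0. \<forall>K. bounded K --> (\<exists>\<theta> :: 'd::finite jet. smooth_on UNIV \<theta> \<and>
     (\<forall>x\<in>K. \<forall>y b. dist x y \<le> c * \<delta> --> \<theta> b y = (if b = 0 then 1 else 0)) \<and>
     (\<forall>y. y \<notin> neighbourhood K ((c + 2 * real CARD('d)) * \<delta>) --> (\<forall>b. \<theta> b y = 0)) \<and>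
     jet_bound \<delta> M UNIV \<theta> C)"
proof -
  obtain B where B: "B \<ge> 1" "\<And>\<delta> \<kappa>. \<delta> > 0 ==> jet_bound \<delta> M UNIV (grid_fun \<delta> \<kappa> :: 'd jet) B"
    using grid_fun_bound by blast
  define C where "C = 3 ^ CARD('d) * B"
  have "C \<ge> 0" using B by (simp add: C_def)
  moreover have "\<exists>\<theta> :: 'd jet. smooth_on UNIV \<theta> \<and>
     (\<forall>x\<in>K. \<forall>y b. dist x y \<le> c * \<delta> --> \<theta> b y = (if b = 0 then 1 else 0)) \<and>
     (\<forall>y. y \<notin> neighbourhood K ((c + 2 * real CARD('d)) * \<delta>) --> (\<forall>b. \<theta> b y = 0)) \<and>
     jet_bound \<delta> M UNIV \<theta> C" if \<delta>: "\<delta> > 0" and K: "bounded K" for \<delta> K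
  proof -
    define Y where "Y = neighbourhood K (c * \<delta>)"
    obtain R0 where "\<forall>x\<in>K. norm x \<le> R0" using K unfolding bounded_iff by blast
    then have "K \<subseteq> cball 0 R0" by auto
    then have "bounded Y"
      unfolding Y_def by (meson bounded_cball bounded_subset neighbourhood_subset_cball)
    define I where "I = (\<Union>y\<in>Y. grid_active \<delta> y)"
    have fin: "finite I" unfolding I_def by (rule grid_active_finite_Union) fact
    define \<theta> where "\<theta> = (\<lambda>a y. \<Sum>\<kappa>\<in>I. grid_fun \<delta> \<kappa> a (y :: real ^ 'd))"
    have "smooth_on UNIV \<theta>"
      unfolding \<theta>_def by (intro smooth_on_sum smooth_on_grid_fun)
    moreover have "\<theta> b y = (if b = 0 then 1 else 0)" if "x \<in> K" "dist x y \<le> c * \<delta>" for x y b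
      unfolding \<theta>_def using that
      by (intro grid_partition[OF \<delta> fin]) (auto simp: I_def Y_def neighbourhood_def)
    moreover have "\<theta> b y = 0" if y: "y \<notin> neighbourhood K ((c + 2 * real CARD('d)) * \<delta>)" for y b
      unfolding \<theta>_def
    proof (intro sum.neutral ballI grid_fun_eq_0 notI)
      fix \<kappa> assume \<kappa>: "\<kappa> \<in> I" "\<kappa> \<in> grid_active \<delta> y"
      obtain y' x' where y': "\<kappa> \<in> grid_active \<delta> y'" "x' \<in> K" "dist x' y' \<le> c * \<delta>"
        using \<kappa>(1) by (auto simp: I_def Y_def neighbourhood_def)
      have "dist y (grid_pt \<delta> \<kappa>) \<le> real CARD('d) * \<delta>" "dist y' (grid_pt \<delta> \<kappa>) \<le> real CARD('d) * \<delta>"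
        using grid_active_dist[OF \<kappa>(2) \<delta>] grid_active_dist[OF y'(1) \<delta>] by (simp_all add: dist_norm)
      then have "dist y' y \<le> 2 * real CARD('d) * \<delta>"
        using dist_triangle2[of y' y "grid_pt \<delta> \<kappa>"] by simp
      then have "dist x' y \<le> (c + 2 * real CARD('d)) * \<delta>"
        using y'(3) dist_triangle[of x' y y'] by (simp add: distrib_right)
      then show False using y y'(2) by (auto simp: neighbourhood_def)
    qed
    moreover have "jet_bound \<delta> M UNIV \<theta> C"
      unfolding jet_bound_def
    proof (intro ballI allI impI)
      fix y and a :: "'d multi_index" assume a: "mi_size a \<le> M"
      have "\<theta> a y = (\<Sum>\<kappa>\<in>I \<inter> grid_active \<delta> y. grid_fun \<delta> \<kappa> a y)"
        unfolding \<theta>_def using fin by (intro sum.mono_neutral_right ballI grid_fun_eq_0) auto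
      then have "\<delta> ^ mi_size a * cmod (\<theta> a y) \<le> (\<Sum>\<kappa>\<in>I \<inter> grid_active \<delta> y. \<delta> ^ mi_size a * cmod (grid_fun \<delta> \<kappa> a y))"
        unfolding sum_distrib_left[symmetric] using \<delta> by (intro mult_left_mono) (simp_all add: norm_sum)
      also have "\<dots> \<le> (\<Sum>\<kappa>\<in>I \<inter> grid_active \<delta> y. B)"
        using jet_boundD[OF B(2)[OF \<delta>] UNIV_I a] by (intro sum_mono)
      also have "\<dots> = real (card (I \<inter> grid_active \<delta> y)) * B" by simp
      also have "\<dots> \<le> real (3 ^ CARD('d)) * B"
      proof (rule mult_right_mono)
        have "card (I \<inter> grid_active \<delta> y) \<le> card (grid_active \<delta> y)"
          by (intro card_mono grid_active_card) auto
        also have "\<dots> \<le> 3 ^ CARD('d)" by (rule grid_active_card)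
        finally show "real (card (I \<inter> grid_active \<delta> y)) \<le> real (3 ^ CARD('d))" by (simp only: of_nat_le_iff)
      qed (use B in simp)
      finally show "\<delta> ^ mi_size a * cmod (\<theta> a y) \<le> C" by (simp add: C_def)
    qed
    ultimately show ?thesis by blast
  qed
  ultimately show ?thesis by blast
qed


section \<open>Non-constant symbols\<close>

text \<open>If the principal part vanishes identically, so do all its derivatives, and the
  derivative of type \<open>\<gamma>\<close> at 0 is a nonzero multiple of the coefficient of
  \<open>\<gamma>\<close>. This supplies the direction \<open>\<eta>\<close> for the solution
  operator.\<close>

lemma principal_part_eq_0_imp:
  fixes P :: "'d::finite mpoly"
  assumes "\<forall>\<eta>. principal_part P \<eta> = 0"
  shows "P = 0"
proof (rule ccontr)
  assume "P \<noteq> 0"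
  let ?m = "mpoly_degree P"
  have "?m \<in> insert 0 (mi_size ` Poly_Mapping.keys P)"
    unfolding mpoly_degree_def by (rule Max_in) auto
  moreover have "\<exists>a. a \<in> Poly_Mapping.keys P"
    using \<open>P \<noteq> 0\<close> by (metis equals0I keys_eq_empty)
  ultimately obtain \<gamma> where \<gamma>: "\<gamma> \<in> Poly_Mapping.keys P" "mi_size \<gamma> = ?m"
    using mi_size_le_degree[of _ P] by fastforce
  let ?S = "{a \<in> Poly_Mapping.keys P. mi_size a = ?m}"
  define f where "f = (\<lambda>b x. \<Sum>a\<in>?S. (Poly_Mapping.lookup P a * of_real (mi_fact a)) * mono_jet a b x)"
  have fact: "mi_fact a \<noteq> 0" for a :: "'d multi_index" by (simp add: mi_fact_def)
  have mono0: "mono_jet a 0 v = of_real (mi_power v a / mi_fact a)" for a :: "'d multi_index" and v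
    by (simp add: mono_jet_def jet_tensor_def power_family_def mi_power_def mi_fact_def prod_dividef del: of_real_prod)
  have "f 0 x = principal_part P x" for x
    unfolding f_def principal_part_def by (intro sum.cong) (auto simp: mono0 fact)
  then have z: "f 0 x = 0" for x using assms by simp
  have "smooth_on UNIV f" unfolding f_def by (intro smooth_on_sum smooth_on_cmult smooth_on_mono_jet)
  then have "f \<gamma> 0 = 0"
    by (rule smooth_on_unique[where g = "\<lambda>a x. 0", OF _ smooth_on_zero open_UNIV]) (use z in auto)
  moreover have "f \<gamma> 0 = Poly_Mapping.lookup P \<gamma> * of_real (mi_fact \<gamma>)"
  proof -
    have "f \<gamma> 0 = (\<Sum>a\<in>?S. if a = \<gamma> then Poly_Mapping.lookup P a * of_real (mi_fact a) else 0)"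
      unfolding f_def by (intro sum.cong) (auto simp: mono_jet_at_0)
    then show ?thesis using \<gamma> by simp
  qed
  ultimately show False using \<gamma>(1) fact[of \<gamma>] by (simp add: in_keys_iff)
qed

text \<open>On the complex line through \<open>\<eta>\<close> the symbol is a polynomial in one
  variable with the principal part at \<open>\<eta>\<close> as its coefficient of order
  \<open>mpoly_degree P\<close>, hence not constant; it has a root by the fundamental theorem of
  algebra.\<close>

lemma exists_mpeval_zero:
  fixes P :: "'d::finite mpoly"
  assumes \<eta>: "principal_part P \<eta> \<noteq> 0" and P: "\<forall>c. P \<noteq> Poly_Mapping.single 0 c"
  shows "\<exists>\<zeta>. mpeval P \<zeta> = 0"
proof -
  let ?m = "mpoly_degree P"
  have m: "?m > 0"
  proof (rule ccontr)
    assume "\<not> ?m > 0"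
    then have "Poly_Mapping.keys P \<subseteq> {0}" using mi_size_le_degree[of _ P] by fastforce
    then have "P = Poly_Mapping.single 0 (Poly_Mapping.lookup P 0)"
      by (intro poly_mapping_eqI) (auto simp: lookup_single when_def in_keys_iff subset_iff)
    then show False using P by blast
  qed
  define p where "p = (\<Sum>a\<in>Poly_Mapping.keys P. monom (Poly_Mapping.lookup P a * of_real (mi_power \<eta> a)) (mi_size a))"
  have "coeff p ?m = (\<Sum>a\<in>Poly_Mapping.keys P. if mi_size a = ?m then Poly_Mapping.lookup P a * of_real (mi_power \<eta> a) else 0)"
    by (simp add: p_def coeff_sum)
  also have "\<dots> = principal_part P \<eta>"
    unfolding principal_part_def by (subst sum.inter_filter[symmetric]) auto
  finally have "coeff p ?m \<noteq> 0" using \<eta> by simp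
  then have "degree p \<noteq> 0" using m le_degree[of p ?m] by simp
  then have "\<not> constant (poly p)" by (simp add: constant_degree)
  then obtain z where z: "poly p z = 0" using fundamental_theorem_of_algebra by blast
  have "mpeval P (\<chi> j. z * of_real (\<eta> $ j)) = poly p z"
    unfolding mpeval_def p_def poly_sum poly_monom
  proof (rule sum.cong[OF refl])
    fix a
    have "(\<Prod>j\<in>UNIV. (z * of_real (\<eta> $ j)) ^ (a $ j)) = z ^ mi_size a * of_real (mi_power \<eta> a)"
      by (simp add: power_mult_distrib prod.distrib mi_size_prod_const mi_power_def)
    then show "Poly_Mapping.lookup P a * (\<Prod>j\<in>UNIV. (\<chi> j. z * of_real (\<eta> $ j)) $ j ^ (a $ j)) =
        Poly_Mapping.lookup P a * of_real (mi_power \<eta> a) * z ^ mi_size a" by simp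
  qed
  then show ?thesis using z by metis
qed

text \<open>
  The smoothings at the scales \<open>2\<^sup>-\<^sup>j\<close> are combined with nested cutoffs. Since \<open>w\<close> is controlled
  to one order more than the result, the corrections between consecutive scales form a geometric
  series, so that the bound does not depend on the finest scale \<open>2\<^sup>-\<^sup>J\<close>.
\<close>

lemma multiscale_extension:
  fixes c :: real
  assumes c: "c \<ge> 1"
  shows "\<exists>C\<ge>0. \<forall>K \<epsilon> J. \<forall>w :: 'd::finite jet. bounded K --> \<epsilon> \<ge> 0 --> whitney_bound K (Suc m) \<epsilon> w -->
    (\<exists>e. smooth_on UNIV e \<and> (\<forall>a y. mi_size a \<le> m --> cmod (e a y) \<le> C * \<epsilon>) \<and>
       (\<forall>x\<in>K. \<forall>y a. dist x y \<le> c * (1 / 2) ^ J --> mi_size a \<le> m -->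
          ((1 / 2) ^ J) ^ mi_size a * cmod (e a y - taylor_jet (Suc m) x w a y) \<le> C * (\<epsilon> * ((1 / 2) ^ J) ^ Suc m)))"
proof -
  define c' where "c' = c + 2 * real CARD('d)"
  have c': "c' \<ge> 1" "c \<le> c'" using c by (simp_all add: c'_def)
  from whitney_smoothing[where 'd = 'd, OF c'(1), of "Suc m" m]
  obtain C1 where C1: "C1 \<ge> 0" "\<forall>\<delta>>0. \<forall>K A. \<forall>f :: 'd jet. bounded K --> A \<ge> 0 -->
    taylor_close (Suc m) K A (2 * (c' + real CARD('d)) * \<delta>) f -->
    (\<exists>s. smooth_on UNIV s \<and> (\<exists>R. \<forall>a x. R < norm x --> s a x = 0) \<and>
      (\<forall>x\<in>K. \<forall>y a. dist x y \<le> c' * \<delta> --> mi_size a \<le> m -->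
         \<delta> ^ mi_size a * cmod (s a y - taylor_jet (Suc m) x f a y) \<le> C1 * (A * \<delta> ^ Suc m)))"
    by blast
  have "c \<ge> 0" using c by simp
  from scaled_cutoff[where 'd = 'd, OF this, of m, folded c'_def]
  obtain C2 where C2: "C2 \<ge> 0" "\<forall>\<delta>>0. \<forall>K. bounded K --> (\<exists>\<theta> :: 'd jet. smooth_on UNIV \<theta> \<and>
     (\<forall>x\<in>K. \<forall>y b. dist x y \<le> c * \<delta> --> \<theta> b y = (if b = 0 then 1 else 0)) \<and>
     (\<forall>y. y \<notin> neighbourhood K (c' * \<delta>) --> (\<forall>b. \<theta> b y = 0)) \<and> jet_bound \<delta> m UNIV \<theta> C2)"
    by - (elim exE conjE, rule that)
  define p where "p = real (card {\<gamma> :: 'd multi_index. mi_size \<gamma> \<le> Suc m})"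
  \<comment> \<open>\<open>E0\<close> belongs to the coarsest smoothing, which is close to a Taylor
    polynomial of size \<open>\<epsilon>\<close>. \<open>E1\<close> belongs to one correction: two
    consecutive smoothings are compared with the same Taylor polynomial, the coarser one at twice
    the scale, hence \<open>1 + 2 ^ Suc m\<close>.\<close>
  define E0 where "E0 = 2 ^ m * (C2 * (C1 + p * c' ^ Suc m))"
  define E1 where "E1 = 2 ^ m * (C2 * (C1 * (1 + 2 ^ Suc m)))"
  have E: "E0 \<ge> 0" "E1 \<ge> 0" using C1(1) C2(1) c' by (simp_all add: E0_def E1_def p_def)
  define C where "C = E0 + E1 + C1"
  have "C \<ge> 0" using E C1 by (simp add: C_def)
  moreover have "\<exists>e. smooth_on UNIV e \<and> (\<forall>a y. mi_size a \<le> m --> cmod (e a y) \<le> C * \<epsilon>) \<and>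
       (\<forall>x\<in>K. \<forall>y a. dist x y \<le> c * (1 / 2) ^ J --> mi_size a \<le> m -->
          ((1 / 2) ^ J) ^ mi_size a * cmod (e a y - taylor_jet (Suc m) x w a y) \<le> C * (\<epsilon> * ((1 / 2) ^ J) ^ Suc m))"
    if K: "bounded K" and \<epsilon>: "\<epsilon> \<ge> 0" and w: "whitney_bound K (Suc m) \<epsilon> w" for K \<epsilon> J and w :: "'d jet"
  proof -
    define \<delta> where "\<delta> = (\<lambda>j::nat. (1 / 2 :: real) ^ j)"
    have \<delta>: "\<delta> j > 0" "\<delta> j \<le> 1" "\<delta> j = 2 * \<delta> (Suc j)" for j
      by (simp_all add: \<delta>_def power_le_one)
    have \<delta>_mono: "\<delta> k \<le> \<delta> j" if "j \<le> k" for j k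
      using that by (simp add: \<delta>_def power_decreasing)
    let ?T = "\<lambda>x. taylor_jet (Suc m) x w"
    have tc: "taylor_close (Suc m) K \<epsilon> \<rho> w" for \<rho>
      using w by (simp add: whitney_bound_def taylor_close_def)
    have "\<forall>j. \<exists>s. smooth_on UNIV s \<and>
      (\<forall>x\<in>K. \<forall>y a. dist x y \<le> c' * \<delta> j --> mi_size a \<le> m -->
         \<delta> j ^ mi_size a * cmod (s a y - ?T x a y) \<le> C1 * (\<epsilon> * \<delta> j ^ Suc m))"
    proof
      fix j
      show "\<exists>s. smooth_on UNIV s \<and>
        (\<forall>x\<in>K. \<forall>y a. dist x y \<le> c' * \<delta> j --> mi_size a \<le> m -->
           \<delta> j ^ mi_size a * cmod (s a y - ?T x a y) \<le> C1 * (\<epsilon> * \<delta> j ^ Suc m))"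
        using C1(2)[rule_format, OF \<delta>(1)[of j] K \<epsilon> tc] by - (elim exE conjE, intro exI conjI)
    qed
    from choice[OF this] obtain s where s': "\<forall>j. smooth_on UNIV (s j) \<and>
      (\<forall>x\<in>K. \<forall>y a. dist x y \<le> c' * \<delta> j --> mi_size a \<le> m -->
         \<delta> j ^ mi_size a * cmod (s j a y - ?T x a y) \<le> C1 * (\<epsilon> * \<delta> j ^ Suc m))" ..
    note s = s'[rule_format, THEN conjunct1] and s_T = s'[rule_format, THEN conjunct2, rule_format]
    have "\<forall>j. \<exists>\<theta> :: 'd jet. smooth_on UNIV \<theta> \<and>
     (\<forall>x\<in>K. \<forall>y b. dist x y \<le> c * \<delta> j --> \<theta> b y = (if b = 0 then 1 else 0)) \<and>
     (\<forall>y. y \<notin> neighbourhood K (c' * \<delta> j) --> (\<forall>b. \<theta> b y = 0)) \<and> jet_bound (\<delta> j) m UNIV \<theta> C2"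
      by (rule allI) (rule C2(2)[rule_format, OF \<delta>(1) K])
    from choice[OF this] obtain \<theta> where \<theta>': "\<forall>j. smooth_on UNIV (\<theta> j :: 'd jet) \<and>
     (\<forall>x\<in>K. \<forall>y b. dist x y \<le> c * \<delta> j --> \<theta> j b y = (if b = 0 then 1 else 0)) \<and>
     (\<forall>y. y \<notin> neighbourhood K (c' * \<delta> j) --> (\<forall>b. \<theta> j b y = 0)) \<and> jet_bound (\<delta> j) m UNIV (\<theta> j) C2" ..
    note \<theta> = \<theta>'[rule_format, THEN conjunct1]
      and \<theta>_1 = \<theta>'[rule_format, THEN conjunct2, THEN conjunct1, rule_format]
      and \<theta>_0 = \<theta>'[rule_format, THEN conjunct2, THEN conjunct2, THEN conjunct1, rule_format]
      and \<theta>_b = \<theta>'[rule_format, THEN conjunct2, THEN conjunct2, THEN conjunct2]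
    define t where "t = (\<lambda>j. jet_mult (\<theta> (Suc j)) (\<lambda>a y. s (Suc j) a y - s j a y))"
    \<comment> \<open>Where all the cutoffs are 1, that is within \<open>c * \<delta> J\<close> of
      \<open>K\<close>, the sum telescopes to the finest smoothing \<open>s J\<close>.\<close>
    define e where "e = (\<lambda>a y. jet_mult (\<theta> 0) (s 0) a y + (\<Sum>j<J. t j a y))"
    have e: "smooth_on UNIV e"
      unfolding e_def t_def by (intro smooth_on_add smooth_on_sum smooth_on_mult smooth_on_diff s \<theta>)
    have b0: "cmod (jet_mult (\<theta> 0) (s 0) a y) \<le> E0 * \<epsilon>" if a: "mi_size a \<le> m" for a y
    proof (cases "y \<in> neighbourhood K (c' * \<delta> 0)")
      case True
      then obtain x where x: "x \<in> K" "dist x y \<le> c' * \<delta> 0" by (auto simp: neighbourhood_def)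
      have "jet_bound 1 (Suc m) {x} w \<epsilon>"
        using w x(1) by (simp add: jet_bound_def whitney_bound_def)
      then have T: "cmod (?T x b y) \<le> p * (c' ^ Suc m * \<epsilon>)" for b
        using taylor_jet_bound[of 1 c' y x "Suc m" w \<epsilon> b] c' x(2)
        by (simp add: p_def \<delta>_def dist_norm norm_minus_commute)
      have "jet_bound 1 m {y} (s 0) ((C1 + p * c' ^ Suc m) * \<epsilon>)"
        unfolding jet_bound_def
      proof (intro ballI allI impI)
        fix z and b :: "'d multi_index" assume z: "z \<in> {y}" and b: "mi_size b \<le> m"
        have "cmod (s 0 b y - ?T x b y) \<le> C1 * \<epsilon>" using s_T[OF x b] by (simp add: \<delta>_def)
        moreover have "cmod (s 0 b y) \<le> cmod (s 0 b y - ?T x b y) + cmod (?T x b y)"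
          using norm_triangle_ineq[of "s 0 b y - ?T x b y" "?T x b y"] by simp
        moreover have "(C1 + p * c' ^ Suc m) * \<epsilon> = C1 * \<epsilon> + p * (c' ^ Suc m * \<epsilon>)"
          by (simp only: distrib_right mult.assoc)
        ultimately have "cmod (s 0 b y) \<le> (C1 + p * c' ^ Suc m) * \<epsilon>" using T[of b] by linarith
        then show "1 ^ mi_size b * cmod (s 0 b z) \<le> (C1 + p * c' ^ Suc m) * \<epsilon>" using z by simp
      qed
      moreover have "jet_bound 1 m {y} (\<theta> 0) C2"
        using \<theta>_b[of 0] by (simp add: jet_bound_def \<delta>_def)
      ultimately have "jet_bound 1 m {y} (jet_mult (\<theta> 0) (s 0)) (2 ^ m * (C2 * ((C1 + p * c' ^ Suc m) * \<epsilon>)))"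
        using C2(1) by (intro jet_bound_mult) auto
      from jet_boundD[OF this _ a] show ?thesis by (simp add: E0_def mult.assoc)
    next
      case False
      then have "jet_mult (\<theta> 0) (s 0) a y = 0" by (intro jet_mult_zero_left \<theta>_0)
      then show ?thesis using E \<epsilon> by simp
    qed
    have bj: "cmod (t j a y) \<le> E1 * \<epsilon> * \<delta> (Suc j)" if a: "mi_size a \<le> m" for j a y
    proof (cases "y \<in> neighbourhood K (c' * \<delta> (Suc j))")
      case True
      then obtain x where x: "x \<in> K" "dist x y \<le> c' * \<delta> (Suc j)" by (auto simp: neighbourhood_def)
      have "c' * \<delta> (Suc j) \<le> c' * \<delta> j" using c' \<delta>_mono[of j "Suc j"] by (intro mult_left_mono) auto
      then have x': "dist x y \<le> c' * \<delta> j" using x(2) by linarith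
      let ?d = "\<delta> (Suc j)"
      have "jet_bound ?d m {y} (\<lambda>a y. s (Suc j) a y - s j a y) (C1 * (1 + 2 ^ Suc m) * (\<epsilon> * ?d ^ Suc m))"
        unfolding jet_bound_def
      proof (intro ballI allI impI)
        fix z and b :: "'d multi_index" assume z: "z \<in> {y}" and b: "mi_size b \<le> m"
        have 1: "?d ^ mi_size b * cmod (s (Suc j) b y - ?T x b y) \<le> C1 * (\<epsilon> * ?d ^ Suc m)" by (rule s_T[OF x b])
        have "?d ^ mi_size b * cmod (s j b y - ?T x b y) \<le> \<delta> j ^ mi_size b * cmod (s j b y - ?T x b y)"
          using \<delta>(1)[of "Suc j"] \<delta>_mono[of j "Suc j"] by (intro mult_right_mono power_mono) auto
        also have "\<dots> \<le> C1 * (\<epsilon> * \<delta> j ^ Suc m)" by (rule s_T[OF x(1) x' b])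
        also have "\<dots> = C1 * 2 ^ Suc m * (\<epsilon> * ?d ^ Suc m)"
          unfolding \<delta>(3)[of j] power_mult_distrib by (simp only: mult_ac)
        finally have 2: "?d ^ mi_size b * cmod (s j b y - ?T x b y) \<le> C1 * 2 ^ Suc m * (\<epsilon> * ?d ^ Suc m)" .
        have "cmod (s (Suc j) b y - s j b y) \<le> cmod (s (Suc j) b y - ?T x b y) + cmod (s j b y - ?T x b y)"
          using norm_triangle_ineq4[of "s (Suc j) b y - ?T x b y" "s j b y - ?T x b y"] by simp
        then have "?d ^ mi_size b * cmod (s (Suc j) b y - s j b y) \<le>
            ?d ^ mi_size b * (cmod (s (Suc j) b y - ?T x b y) + cmod (s j b y - ?T x b y))"
          using \<delta>(1)[of "Suc j"] by (intro mult_left_mono) auto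
        also have "\<dots> \<le> C1 * (\<epsilon> * ?d ^ Suc m) + C1 * 2 ^ Suc m * (\<epsilon> * ?d ^ Suc m)"
          unfolding distrib_left using 1 2 by (rule add_mono)
        also have "\<dots> = C1 * (1 + 2 ^ Suc m) * (\<epsilon> * ?d ^ Suc m)"
          by (simp only: distrib_left distrib_right mult_1_right)
        finally show "?d ^ mi_size b * cmod (s (Suc j) b z - s j b z) \<le> C1 * (1 + 2 ^ Suc m) * (\<epsilon> * ?d ^ Suc m)"
          using z by simp
      qed
      moreover have "jet_bound ?d m {y} (\<theta> (Suc j)) C2"
        using \<theta>_b[of "Suc j"] by (simp add: jet_bound_def)
      ultimately have "jet_bound ?d m {y} (t j) (2 ^ m * (C2 * (C1 * (1 + 2 ^ Suc m) * (\<epsilon> * ?d ^ Suc m))))"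
        unfolding t_def using C2(1) \<delta>(1)[of "Suc j"] by (intro jet_bound_mult) auto
      from jet_boundD[OF this _ a]
      have "?d ^ mi_size a * cmod (t j a y) \<le> 2 ^ m * (C2 * (C1 * (1 + 2 ^ Suc m) * (\<epsilon> * ?d ^ Suc m)))" by simp
      \<comment> \<open>The spare order of \<open>w\<close> is spent here: after the at most
        \<open>m\<close> derivatives have used their powers of the scale, one factor
        \<open>?d\<close> is left and makes the corrections summable.\<close>
      also have "\<dots> = E1 * \<epsilon> * ?d * ?d ^ m" by (simp only: E1_def power_Suc mult_ac)
      also have "\<dots> \<le> E1 * \<epsilon> * ?d * ?d ^ mi_size a"
      proof (rule mult_left_mono)
        show "?d ^ m \<le> ?d ^ mi_size a" using \<delta>(1,2)[of "Suc j"] a by (intro power_decreasing) auto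
        show "0 \<le> E1 * \<epsilon> * ?d" using \<delta>(1)[of "Suc j"] E \<epsilon> by (intro mult_nonneg_nonneg) auto
      qed
      finally have "?d ^ mi_size a * cmod (t j a y) \<le> ?d ^ mi_size a * (E1 * \<epsilon> * ?d)" by (simp only: mult_ac)
      then show ?thesis using \<delta>(1)[of "Suc j"] by (simp only: mult_le_cancel_left_pos zero_less_power)
    next
      case False
      then have "t j a y = 0" unfolding t_def by (intro jet_mult_zero_left \<theta>_0)
      moreover have "0 \<le> E1 * \<epsilon> * \<delta> (Suc j)" using E \<epsilon> \<delta>(1)[of "Suc j"] by simp
      ultimately show ?thesis by simp
    qed
    have "cmod (e a y) \<le> C * \<epsilon>" if a: "mi_size a \<le> m" for a y
    proof -
      have geo: "(\<Sum>j<J. \<delta> (Suc j)) = 1 - \<delta> J" by (induction J) (simp_all add: \<delta>_def)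
      have "cmod (e a y) \<le> E0 * \<epsilon> + (\<Sum>j<J. E1 * \<epsilon> * \<delta> (Suc j))"
        unfolding e_def by (intro norm_triangle_le add_mono b0 sum_norm_le bj a)
      also have "(\<Sum>j<J. E1 * \<epsilon> * \<delta> (Suc j)) = E1 * \<epsilon> * (1 - \<delta> J)"
        by (simp only: sum_distrib_left[symmetric] geo)
      also have "\<dots> \<le> E1 * \<epsilon> * 1" using E \<epsilon> \<delta>(1)[of J] by (intro mult_left_mono) auto
      finally have "cmod (e a y) \<le> E0 * \<epsilon> + E1 * \<epsilon>" by simp
      moreover have "C * \<epsilon> = E0 * \<epsilon> + E1 * \<epsilon> + C1 * \<epsilon>" by (simp add: C_def distrib_right)
      moreover have "C1 * \<epsilon> \<ge> 0" using C1 \<epsilon> by simp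
      ultimately show ?thesis by linarith
    qed
    moreover have "\<delta> J ^ mi_size a * cmod (e a y - ?T x a y) \<le> C * (\<epsilon> * \<delta> J ^ Suc m)"
      if x: "x \<in> K" "dist x y \<le> c * \<delta> J" and a: "mi_size a \<le> m" for x y a
    proof -
      have near: "dist x y \<le> c * \<delta> j" if "j \<le> J" for j
        using x(2) mult_left_mono[OF \<delta>_mono[OF that], of c] c by linarith
      have "t j a y = s (Suc j) a y - s j a y" if "j < J" for j
        unfolding t_def by (rule jet_mult_one_left) (rule \<theta>_1[OF x(1) near], use that in simp)
      moreover have "jet_mult (\<theta> 0) (s 0) a y = s 0 a y"
        by (rule jet_mult_one_left) (rule \<theta>_1[OF x(1) near], simp)
      ultimately have "e a y = s 0 a y + (\<Sum>j<J. s (Suc j) a y - s j a y)" unfolding e_def by simp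
      then have eq: "e a y = s J a y" by (simp add: sum_lessThan_telescope[of "\<lambda>j. s j a y" J])
      have "c * \<delta> J \<le> c' * \<delta> J" using c' \<delta>(1)[of J] by (intro mult_right_mono) auto
      then have "dist x y \<le> c' * \<delta> J" using x(2) by linarith
      then have "\<delta> J ^ mi_size a * cmod (e a y - ?T x a y) \<le> C1 * (\<epsilon> * \<delta> J ^ Suc m)"
        unfolding eq by (rule s_T[OF x(1) _ a])
      also have "\<dots> \<le> C * (\<epsilon> * \<delta> J ^ Suc m)"
        using E \<epsilon> \<delta>(1)[of J] by (intro mult_right_mono) (auto simp: C_def)
      finally show ?thesis .
    qed
    ultimately show ?thesis using e unfolding \<delta>_def by (intro exI[of _ e] conjI ballI allI impI)
  qed
  ultimately show ?thesis by (intro exI[of _ C] conjI allI impI)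
qed

section \<open>Necessity of the component condition\<close>

lemma jet_op_bound:
  assumes "\<And>a. mi_size a \<le> mpoly_degree P ==> cmod (f (b + a) x) \<le> A"
  shows "cmod (jet_op P f b x) \<le> (\<Sum>a | mi_size a \<le> mpoly_degree P. cmod (op_coeff P a)) * A"
  unfolding jet_op_eq_const_op const_op_def sum_distrib_right
  by (intro sum_norm_le) (simp add: norm_mult mult_left_mono assms)

text \<open>The bump is nonnegative and so small that the kernel, normalised at its centre
  \<open>a\<close>, has real part at least 1/2 on its support. The transform is then a nonzero
  multiple of an integral with positive real part.\<close>

lemma exists_bump:
  fixes S :: "(real ^ 'd::finite) set"
  assumes S: "open S" "S \<noteq> {}"
  obtains r \<phi> where "r > 0" "smooth_on UNIV \<phi>" "\<And>j x. x \<notin> S ==> \<phi> j x = 0"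
    "\<And>b x. b \<notin> S ==> dist b x \<le> r ==> \<phi> 0 x = 0" "fourier (\<phi> 0) \<zeta> \<noteq> 0"
proof -
  obtain a where a: "a \<in> S" using S by auto
  obtain r0 where r0: "r0 > 0" "ball a r0 \<subseteq> S" using S(1) a openE by blast
  have "continuous (at (0 :: real ^ 'd)) (\<lambda>v. exp (- \<i> * dotc \<zeta> v))"
    by (rule continuous_on_interior[where S = UNIV]) (auto intro!: continuous_intros)
  then obtain r1 where r1: "r1 > 0" "\<And>v :: real ^ 'd. dist v 0 < r1 ==> dist (exp (- \<i> * dotc \<zeta> v)) (exp (- \<i> * dotc \<zeta> 0)) < 1 / 2"
    unfolding continuous_at_eps_delta by (metis half_gt_zero_iff zero_less_one)
  have pos: "Re (exp (- \<i> * dotc \<zeta> v)) \<ge> 1 / 2" if "norm v < r1" for v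
  proof -
    have "cmod (exp (- \<i> * dotc \<zeta> v) - 1) < 1 / 2"
      using r1(2)[of v] that by (simp add: dist_norm dotc_def)
    then have "\<bar>Re (exp (- \<i> * dotc \<zeta> v) - 1)\<bar> < 1 / 2" using abs_Re_le_cmod order_le_less_trans by blast
    then show ?thesis by (auto simp: abs_if split: if_splits)
  qed
  \<comment> \<open>The factor 1/2 leaves a margin: the bump lives within \<open>r\<close> of
    \<open>a\<close>, and a point within \<open>r\<close> of the complement of \<open>S\<close> is
    at least \<open>r\<close> away from \<open>a\<close>.\<close>
  define r where "r = min r0 r1 / 2"
  have r: "r > 0" "2 * r \<le> r0" "r < r1" using r0 r1 by (auto simp: r_def min_def)
  define \<delta> where "\<delta> = r / real CARD('d) / 2"
  have \<delta>: "\<delta> > 0" "real CARD('d) * \<delta> < r" using r by (simp_all add: \<delta>_def)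
  let ?\<kappa> = "\<lambda>_::'d. 0::int"
  define \<phi> where "\<phi> = (\<lambda>l x. grid_fun \<delta> ?\<kappa> l (x + - a))"
  have smooth: "smooth_on UNIV \<phi>" unfolding \<phi>_def by (rule smooth_on_translate[OF smooth_on_grid_fun])
  have far: "\<phi> j x = 0" if "r \<le> dist a x" for j x
    unfolding \<phi>_def
  proof (rule grid_fun_eq_0, rule notI)
    assume "?\<kappa> \<in> grid_active \<delta> (x + - a)"
    from grid_active_dist[OF this \<delta>(1)] have "norm (x - a) \<le> real CARD('d) * \<delta>"
      by (simp add: grid_pt_def zero_vec_def[symmetric])
    then show False using that \<delta>(2) by (simp add: dist_norm norm_minus_commute)
  qed
  have ev: "\<exists>h::real. \<phi> 0 x = of_real h \<and> 0 \<le> h" for x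
    unfolding \<phi>_def grid_fun_def jet_tensor_def by (rule exI, rule conjI, rule refl) (auto intro!: prod_nonneg simp: hat_nonneg)
  then obtain h :: "real ^ 'd => real" where h: "\<And>x. \<phi> 0 x = of_real (h x)" "\<And>x. 0 \<le> h x" by metis
  have ha: "h a = 1"
    using h(1)[of a] by (simp add: \<phi>_def grid_fun_def jet_tensor_def hat_at_0 of_real_eq_iff[symmetric] del: of_real_eq_iff)
  define k where "k = (\<lambda>x. \<phi> 0 x * exp (- \<i> * dotc \<zeta> (x - a)))"
  have "cont_supp (norm a + r) (\<phi> 0)"
  proof (rule cont_supp_jet[OF smooth])
    fix l and x :: "real ^ 'd" assume "norm a + r < norm x"
    then show "\<phi> l x = 0" using norm_triangle_ineq2[of x a] by (intro far) (simp add: dist_norm norm_minus_commute)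
  qed
  then have cs: "cont_supp (norm a + r) k"
    unfolding k_def by (rule cont_supp_mult) (intro continuous_intros)
  then have intk: "integrable lborel k" by (rule cont_supp_integrable)
  have k0: "Re (k x) \<ge> 0" for x
  proof (cases "dist a x < r")
    case True
    then have "Re (exp (- \<i> * dotc \<zeta> (x - a))) \<ge> 1 / 2" using r by (intro pos) (simp add: dist_norm norm_minus_commute)
    then show ?thesis unfolding k_def h(1) Re_complex_of_real Re_complex_of_real using h(2)[of x] by simp
  next
    case False
    then show ?thesis by (simp add: k_def far)
  qed
  have "isCont k a" using cont_suppD(1)[OF cs, of UNIV] by (simp add: continuous_on_eq_continuous_at)
  then have "isCont (\<lambda>x. Re (k x)) a" by (rule isCont_Re)
  moreover have "Re (k a) = 1" by (simp add: k_def h(1) ha dotc_def)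
  ultimately obtain \<rho> where \<rho>: "\<rho> > 0" "\<And>x. dist x a < \<rho> ==> dist (Re (k x)) 1 < 1 / 2"
    unfolding continuous_at_eps_delta by (metis half_gt_zero_iff zero_less_one)
  have "(1 / 2) * measure lborel (ball a \<rho>) = (LINT x|lborel. (1 / 2) * indicator (ball a \<rho>) x)" by simp
  also have "\<dots> \<le> (LINT x|lborel. Re (k x))"
  proof (rule integral_mono)
    show "integrable lborel (\<lambda>x. (1 / 2) * (indicator (ball a \<rho>) x :: real))"
      using emeasure_bounded_finite[OF bounded_ball, of a \<rho>]
      by (intro Bochner_Integration.integrable_mult_right integrable_real_indicator) auto
    show "integrable lborel (\<lambda>x. Re (k x))" using intk by (rule integrable_Re)
    fix x
    show "(1 / 2) * indicator (ball a \<rho>) x \<le> Re (k x)"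
      using \<rho>(2)[of x] k0[of x] by (auto simp: indicator_def dist_commute dist_real_def abs_if split: if_splits)
  qed
  also have "\<dots> = Re (LINT x|lborel. k x)" by (rule integral_bounded_linear[OF bounded_linear_Re intk])
  finally have "(1 / 2) * measure lborel (ball a \<rho>) \<le> Re (LINT x|lborel. k x)" .
  moreover have "measure lborel (ball a \<rho>) > 0" using content_ball_pos[OF \<rho>(1), of a] by simp
  ultimately have "Re (LINT x|lborel. k x) > 0" by linarith
  then have nz: "(LINT x|lborel. k x) \<noteq> 0" by (metis less_irrefl zero_complex.sel(1))
  have "k = (\<lambda>x. \<phi> 0 x * exp (- \<i> * dotc \<zeta> x) * exp (\<i> * dotc \<zeta> a))"
    by (simp add: k_def fun_eq_iff dotc_diff mult.assoc exp_add[symmetric] algebra_simps)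
  then have "(LINT x|lborel. k x) = fourier (\<phi> 0) \<zeta> * exp (\<i> * dotc \<zeta> a)"
    by (simp add: fourier_def)
  then have "fourier (\<phi> 0) \<zeta> \<noteq> 0" using nz by auto
  moreover have "\<phi> j x = 0" if "x \<notin> S" for j x
  proof (rule far)
    have "x \<notin> ball a r0" using that r0 by auto
    then show "r \<le> dist a x" using r by simp
  qed
  moreover have "\<phi> 0 x = 0" if "b \<notin> S" "dist b x \<le> r" for b x
  proof (rule far)
    have "b \<notin> ball a r0" using that r0 by auto
    then show "r \<le> dist a x" using r that(2) dist_triangle3[of a b x] by (simp add: dist_commute)
  qed
  ultimately show ?thesis using that[OF r(1) smooth] by blast
qed


text \<open>Put \<open>z = (1 - \<theta>) (w - e)\<close> in \<open>S\<close> and 0 elsewhere. Near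
  the boundary \<open>w\<close> and \<open>e\<close> are close to the same Taylor polynomial, and
  the gain in \<open>\<delta>\<close> outweighs the derivatives of the cutoff; farther inside the
  operator applied to \<open>z\<close> gives \<open>- \<phi>\<close> up to its value on
  \<open>e\<close>, which is of size \<open>\<epsilon>\<close>. As \<open>L\<close> comes before
  \<open>w\<close> and \<open>r\<close>, it is independent of the zone in which the remainder of
  \<open>w\<close> is controlled.\<close>

lemma fourier_boundary_estimate:
  fixes P :: "'d::finite mpoly"
  assumes \<zeta>: "mpeval P \<zeta> = 0" and S: "open S" "S \<subseteq> cball 0 R"
  shows "\<exists>L\<ge>0. \<forall>w \<epsilon> r \<phi>. smooth_on S w --> (\<forall>x\<in>S. jet_op P w 0 x = - \<phi> x) -->
     0 < \<epsilon> --> \<epsilon> \<le> 1 --> r > 0 --> whitney_bound (frontier S) (Suc (mpoly_degree P)) \<epsilon> w -->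
     (\<forall>b\<in>frontier S. \<forall>x\<in>S. \<forall>a. mi_size a \<le> Suc (mpoly_degree P) --> dist b x < r -->
        cmod (w a x - taylor_jet (Suc (mpoly_degree P)) b w a x) \<le> dist b x ^ (Suc (mpoly_degree P) - mi_size a)) -->
     cont_supp R \<phi> --> (\<forall>x. x \<notin> S --> \<phi> x = 0) -->
     (\<forall>b x. b \<in> frontier S --> dist b x \<le> r --> \<phi> x = 0) --> cmod (fourier \<phi> \<zeta>) \<le> L * \<epsilon>"
proof -
  let ?m = "mpoly_degree P" and ?B = "frontier S"
  define c where "c = 1 + 2 * real CARD('d)"
  have c: "c \<ge> 1" by (simp add: c_def)
  have B: "bounded ?B" by (intro compact_imp_bounded compact_frontier_bounded bounded_subset[OF bounded_cball S(2)])
  obtain CE where CE: "CE \<ge> 0" and CE': "\<forall>K \<epsilon> J. \<forall>w :: 'd jet. bounded K --> \<epsilon> \<ge> 0 --> whitney_bound K (Suc ?m) \<epsilon> w -->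
    (\<exists>e. smooth_on UNIV e \<and> (\<forall>a y. mi_size a \<le> ?m --> cmod (e a y) \<le> CE * \<epsilon>) \<and>
       (\<forall>x\<in>K. \<forall>y a. dist x y \<le> c * (1 / 2) ^ J --> mi_size a \<le> ?m -->
          ((1 / 2) ^ J) ^ mi_size a * cmod (e a y - taylor_jet (Suc ?m) x w a y) \<le> CE * (\<epsilon> * ((1 / 2) ^ J) ^ Suc ?m)))"
    using multiscale_extension[where 'd = 'd, OF c, of ?m] by - (elim exE conjE, rule that)
  have "\<exists>C\<ge>0. \<forall>\<delta>>0. \<forall>K. bounded K --> (\<exists>\<theta> :: 'd jet. smooth_on UNIV \<theta> \<and>
     (\<forall>x\<in>K. \<forall>y j. dist x y \<le> 1 * \<delta> --> \<theta> j y = (if j = 0 then 1 else 0)) \<and>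
     (\<forall>y. y \<notin> neighbourhood K (c * \<delta>) --> (\<forall>j. \<theta> j y = 0)) \<and> jet_bound \<delta> ?m UNIV \<theta> C)"
    unfolding c_def by (rule scaled_cutoff) simp
  then obtain CK where CK: "CK \<ge> 0" and CK': "\<forall>\<delta>>0. \<forall>K. bounded K --> (\<exists>\<theta> :: 'd jet. smooth_on UNIV \<theta> \<and>
     (\<forall>x\<in>K. \<forall>y j. dist x y \<le> 1 * \<delta> --> \<theta> j y = (if j = 0 then 1 else 0)) \<and>
     (\<forall>y. y \<notin> neighbourhood K (c * \<delta>) --> (\<forall>j. \<theta> j y = 0)) \<and> jet_bound \<delta> ?m UNIV \<theta> CK)"
    by - (elim exE conjE, rule that)
  define \<Lambda> where "\<Lambda> = (\<Sum>a | mi_size (a :: 'd multi_index) \<le> ?m. cmod (op_coeff P a))"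
  have \<Lambda>: "\<Lambda> \<ge> 0" unfolding \<Lambda>_def by (intro sum_nonneg) auto
  define E where "E = 2 ^ ?m * ((1 + CK) * (c ^ Suc ?m + CE))"
  have E: "E \<ge> 0" using CK CE c by (simp add: E_def)
  have "continuous_on (cball 0 R) (\<lambda>x :: real ^ 'd. exp (- \<i> * dotc \<zeta> x))" by (intro continuous_intros)
  then have "bounded ((\<lambda>x :: real ^ 'd. exp (- \<i> * dotc \<zeta> x)) ` cball 0 R)"
    by (intro compact_imp_bounded compact_continuous_image compact_cball)
  then obtain X where X: "\<And>x. norm x \<le> R ==> cmod (exp (- \<i> * dotc \<zeta> x)) \<le> X"
    unfolding bounded_iff by (metis image_eqI mem_cball_0)
  define X' where "X' = max X 0"
  define V where "V = measure lborel (cball (0 :: real ^ 'd) R)"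
  have V: "V \<ge> 0" "X' \<ge> 0" by (simp_all add: V_def X'_def)
  define L where "L = \<Lambda> * (CE + E) * X' * V"
  have "L \<ge> 0" using \<Lambda> CE E V by (simp add: L_def)
  moreover have "cmod (fourier \<phi> \<zeta>) \<le> L * \<epsilon>"
    if w: "smooth_on S w" and Pw: "\<forall>x\<in>S. jet_op P w 0 x = - \<phi> x" and \<epsilon>: "0 < \<epsilon>" "\<epsilon> \<le> 1" and r: "r > 0"
      and wB: "whitney_bound ?B (Suc ?m) \<epsilon> w"
      and rem: "\<forall>b\<in>?B. \<forall>x\<in>S. \<forall>a. mi_size a \<le> Suc ?m --> dist b x < r -->
        cmod (w a x - taylor_jet (Suc ?m) b w a x) \<le> dist b x ^ (Suc ?m - mi_size a)"
      and \<phi>: "cont_supp R \<phi>" "\<forall>x. x \<notin> S --> \<phi> x = 0"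
      and \<phi>_B: "\<forall>b x. b \<in> ?B --> dist b x \<le> r --> \<phi> x = 0"
    for w \<epsilon> r \<phi>
  proof -
    \<comment> \<open>\<open>c * \<delta> < r\<close> keeps the cutoff zone inside the region where
      the remainder estimate for \<open>w\<close> holds and \<open>\<phi>\<close> vanishes. That
      estimate has the constant 1 and yields only a multiple of \<open>\<delta>\<close>, so
      \<open>\<delta> < \<epsilon>\<close> is required as well.\<close>
    have "min (r / c) \<epsilon> > 0" using r c \<epsilon> by simp
    then obtain J where J: "(1 / 2) ^ J < min (r / c) \<epsilon>"
      using real_arch_pow_inv[of "min (r / c) \<epsilon>" "1 / 2"] by auto
    define \<delta> where "\<delta> = (1 / 2 :: real) ^ J"
    have \<delta>: "\<delta> > 0" "\<delta> \<le> 1" "\<delta> < \<epsilon>" "c * \<delta> < r"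
      using J c by (simp_all add: \<delta>_def power_le_one pos_less_divide_eq mult.commute)
    obtain e where e: "smooth_on UNIV e" and e_b: "\<forall>a y. mi_size a \<le> ?m --> cmod (e a y) \<le> CE * \<epsilon>"
      and e_T: "\<forall>x\<in>?B. \<forall>y a. dist x y \<le> c * \<delta> --> mi_size a \<le> ?m -->
          \<delta> ^ mi_size a * cmod (e a y - taylor_jet (Suc ?m) x w a y) \<le> CE * (\<epsilon> * \<delta> ^ Suc ?m)"
      using CE'[rule_format, OF B less_imp_le[OF \<epsilon>(1)] wB, of J, folded \<delta>_def] by - (elim exE conjE, rule that)
    obtain \<theta> :: "'d jet" where \<theta>: "smooth_on UNIV \<theta>"
      and \<theta>_1: "\<forall>x\<in>?B. \<forall>y j. dist x y \<le> 1 * \<delta> --> \<theta> j y = (if j = 0 then 1 else 0)"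
      and \<theta>_0: "\<forall>y. y \<notin> neighbourhood ?B (c * \<delta>) --> (\<forall>j. \<theta> j y = 0)" and \<theta>_b: "jet_bound \<delta> ?m UNIV \<theta> CK"
      using CK'[rule_format, OF \<delta>(1) B] by - (elim exE conjE, rule that)
    define \<kappa> where "\<kappa> = (\<lambda>j y. jet_const 1 j y - \<theta> j (y :: real ^ 'd))"
    define v where "v = (\<lambda>a y. w a y - e a y)"
    define z where "z = (\<lambda>a y. if y \<in> S then jet_mult \<kappa> v a y else 0)"
    \<comment> \<open>On the open set \<open>W\<close> the function \<open>z\<close> vanishes, and
      together with \<open>S\<close> it covers the whole space; so extension by zero is smooth
      whatever the boundary looks like.\<close>
    define W where "W = - closure S \<union> (\<Union>b\<in>?B. ball b \<delta>)"
    have "smooth_on S (jet_mult \<kappa> v)"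
      unfolding \<kappa>_def v_def
      by (intro smooth_on_mult smooth_on_diff smooth_on_const w smooth_on_subset[OF e] smooth_on_subset[OF \<theta>]) auto
    then have zS: "smooth_on S z" by (rule smooth_on_cong_open) (simp_all add: S z_def)
    have "z a x = 0" if x: "x \<in> W" for a x
    proof (cases "x \<in> S")
      case True
      then obtain b where b: "b \<in> ?B" "dist b x < \<delta>" using x closure_subset[of S] by (auto simp: W_def)
      have "\<kappa> j x = 0" for j using \<theta>_1[rule_format, OF b(1), of x j] b(2) by (simp add: \<kappa>_def jet_const_def)
      then show ?thesis by (simp add: z_def jet_mult_zero_left)
    qed (simp add: z_def)
    moreover have "open W" unfolding W_def by (intro open_Un open_UN) (auto simp: open_closed)
    ultimately have zW: "smooth_on W z" by (rule_tac smooth_on_cong_open[OF smooth_on_zero])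
    have "x \<in> S \<union> W" for x
    proof (cases "x \<in> closure S")
      case True
      then have "x \<in> S \<or> x \<in> ?B" using S(1) by (auto simp: frontier_def interior_open)
      then show ?thesis using \<delta>(1) by (auto simp: W_def intro!: bexI[of _ x])
    qed (auto simp: W_def)
    then have "S \<union> W = UNIV" by blast
    then have z: "smooth_on UNIV z" using smooth_on_Un[OF zS zW] by simp
    have z_supp: "z a x = 0" if "R < norm x" for a x using that S(2) by (auto simp: z_def)
    have Pz0: "jet_op P z 0 x = 0" if "x \<notin> S" for x using that by (intro jet_op_zero) (simp add: z_def)
    \<comment> \<open>Since the transform of \<open>jet_op P z 0\<close> vanishes at
      \<open>\<zeta>\<close>, the transforms of \<open>\<phi>\<close> and of the small function
      \<open>\<psi>\<close> agree there.\<close>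
    define \<psi> where "\<psi> = (\<lambda>x. jet_op P z 0 x + \<phi> x)"
    have \<psi>: "cmod (\<psi> x) \<le> \<Lambda> * ((CE + E) * \<epsilon>)" for x
    proof -
      have t0: "CE * \<epsilon> \<le> (CE + E) * \<epsilon>" "E * \<delta> \<le> (CE + E) * \<epsilon>"
        using E CE \<epsilon> \<delta> mult_mono[of E "CE + E" \<delta> \<epsilon>] by (simp_all add: distrib_right)
      consider "x \<notin> S" | "x \<in> S" "x \<notin> neighbourhood ?B (c * \<delta>)" | b where "x \<in> S" "b \<in> ?B" "dist b x \<le> c * \<delta>"
        by (auto simp: neighbourhood_def)
      then show ?thesis
      proof cases
        case 1
        then show ?thesis using \<phi>(2) \<Lambda> CE E \<epsilon> by (simp add: \<psi>_def Pz0)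
      next
        case 2
        have "\<kappa> j x = (if j = 0 then 1 else 0)" for j using \<theta>_0 2(2) by (simp add: \<kappa>_def jet_const_def)
        then have "z j x = v j x" for j using 2(1) by (simp add: z_def jet_mult_one_left)
        then have "jet_op P z 0 x = jet_op P v 0 x" by (rule jet_op_cong)
        also have "\<dots> = - \<phi> x - jet_op P e 0 x" unfolding v_def jet_op_diff using Pw 2(1) by simp
        finally have "cmod (\<psi> x) = cmod (jet_op P e 0 x)" by (simp add: \<psi>_def)
        also have "\<dots> \<le> \<Lambda> * (CE * \<epsilon>)" unfolding \<Lambda>_def using e_b by (intro jet_op_bound) simp
        also have "\<dots> \<le> \<Lambda> * ((CE + E) * \<epsilon>)" using \<Lambda> t0(1) by (intro mult_left_mono)
        finally show ?thesis .
      next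
        case (3 b)
        let ?T = "taylor_jet (Suc ?m) b w"
        have br: "dist b x < r" using 3 \<delta> by simp
        have "jet_bound \<delta> ?m {x} v ((c ^ Suc ?m + CE) * \<delta> ^ Suc ?m)"
          unfolding jet_bound_def
        proof (intro ballI allI impI)
          fix y and a :: "'d multi_index" assume y: "y \<in> {x}" and a: "mi_size a \<le> ?m"
          have "cmod (w a x - ?T a x) \<le> dist b x ^ (Suc ?m - mi_size a)"
            using rem 3 br a by simp
          also have "\<dots> \<le> (c * \<delta>) ^ (Suc ?m - mi_size a)" using 3(3) by (intro power_mono) auto
          finally have "\<delta> ^ mi_size a * cmod (w a x - ?T a x) \<le> (c * \<delta>) ^ mi_size a * (c * \<delta>) ^ (Suc ?m - mi_size a)"
            using \<delta>(1) c by (intro mult_mono power_mono) auto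
          also have "\<dots> = (c * \<delta>) ^ Suc ?m" using a by (simp only: power_add[symmetric] le_add_diff_inverse le_SucI)
          finally have 1: "\<delta> ^ mi_size a * cmod (w a x - ?T a x) \<le> c ^ Suc ?m * \<delta> ^ Suc ?m"
            unfolding power_mult_distrib .
          have "\<delta> ^ mi_size a * cmod (e a x - ?T a x) \<le> CE * (\<epsilon> * \<delta> ^ Suc ?m)" using e_T 3 a by blast
          also have "\<dots> \<le> CE * (1 * \<delta> ^ Suc ?m)" using CE \<epsilon> \<delta>(1) by (intro mult_left_mono mult_right_mono) auto
          finally have 2: "\<delta> ^ mi_size a * cmod (e a x - ?T a x) \<le> CE * \<delta> ^ Suc ?m" by simp
          have "cmod (v a x) \<le> cmod (w a x - ?T a x) + cmod (e a x - ?T a x)"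
            using norm_triangle_ineq4[of "w a x - ?T a x" "e a x - ?T a x"] by (simp add: v_def)
          then have "\<delta> ^ mi_size a * cmod (v a x) \<le> \<delta> ^ mi_size a * (cmod (w a x - ?T a x) + cmod (e a x - ?T a x))"
            using \<delta>(1) by (intro mult_left_mono) auto
          also have "\<dots> \<le> c ^ Suc ?m * \<delta> ^ Suc ?m + CE * \<delta> ^ Suc ?m" unfolding distrib_left using 1 2 by (rule add_mono)
          finally show "\<delta> ^ mi_size a * cmod (v a y) \<le> (c ^ Suc ?m + CE) * \<delta> ^ Suc ?m"
            using y unfolding distrib_right singleton_iff by (simp only:)
        qed
        moreover have "jet_bound \<delta> ?m {x} \<kappa> (1 + CK)"
          unfolding jet_bound_def
        proof (intro ballI allI impI)
          fix y and a :: "'d multi_index" assume a: "mi_size a \<le> ?m"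
          have "cmod (\<kappa> a y) \<le> cmod (jet_const 1 a y) + cmod (\<theta> a y)" unfolding \<kappa>_def by (rule norm_triangle_ineq4)
          then have "\<delta> ^ mi_size a * cmod (\<kappa> a y) \<le> \<delta> ^ mi_size a * cmod (jet_const 1 a y) + \<delta> ^ mi_size a * cmod (\<theta> a y)"
            unfolding distrib_left[symmetric] using \<delta>(1) by (intro mult_left_mono) auto
          moreover have "\<delta> ^ mi_size a * cmod (jet_const 1 a y) \<le> 1" by (simp add: jet_const_def)
          moreover have "\<delta> ^ mi_size a * cmod (\<theta> a y) \<le> CK" by (rule jet_boundD[OF \<theta>_b UNIV_I a])
          ultimately show "\<delta> ^ mi_size a * cmod (\<kappa> a y) \<le> 1 + CK" by linarith
        qed
        ultimately have jb: "jet_bound \<delta> ?m {x} (jet_mult \<kappa> v) (2 ^ ?m * ((1 + CK) * ((c ^ Suc ?m + CE) * \<delta> ^ Suc ?m)))"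
          using \<delta>(1) CK by (intro jet_bound_mult) auto
        have "cmod (z a x) \<le> E * \<delta>" if a: "mi_size a \<le> ?m" for a
        proof -
          have "\<delta> ^ mi_size a * cmod (z a x) \<le> 2 ^ ?m * ((1 + CK) * ((c ^ Suc ?m + CE) * \<delta> ^ Suc ?m))"
            using jet_boundD[OF jb singletonI a] 3(1) by (simp add: z_def)
          also have "\<dots> = E * \<delta> * \<delta> ^ ?m" by (simp only: E_def power_Suc mult_ac)
          also have "\<dots> \<le> E * \<delta> * \<delta> ^ mi_size a"
          proof (rule mult_left_mono)
            show "\<delta> ^ ?m \<le> \<delta> ^ mi_size a" using \<delta>(1,2) a by (intro power_decreasing) auto
            show "0 \<le> E * \<delta>" using \<delta>(1) E by simp
          qed
          finally have "\<delta> ^ mi_size a * cmod (z a x) \<le> \<delta> ^ mi_size a * (E * \<delta>)" by (simp only: mult_ac)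
          then show ?thesis using \<delta>(1) by (simp only: mult_le_cancel_left_pos zero_less_power)
        qed
        then have "cmod (jet_op P z 0 x) \<le> \<Lambda> * (E * \<delta>)" unfolding \<Lambda>_def by (intro jet_op_bound) simp
        also have "\<dots> \<le> \<Lambda> * ((CE + E) * \<epsilon>)" using \<Lambda> t0(2) by (intro mult_left_mono)
        finally show ?thesis using \<phi>_B 3(2) br by (simp add: \<psi>_def)
      qed
    qed
    have Pz: "cont_supp R (jet_op P z 0)"
      by (rule cont_supp_jet[OF smooth_on_jet_op[OF z]]) (rule jet_op_zero, rule z_supp)
    have "fourier (jet_op P z 0) \<zeta> = mpeval P \<zeta> * fourier (z 0) \<zeta>"
      by (rule fourier_jet_op_0[OF z]) (rule z_supp)
    then have Fz: "fourier (jet_op P z 0) \<zeta> = 0" using \<zeta> by simp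
    have ce: "continuous_on UNIV (\<lambda>x :: real ^ 'd. exp (- \<i> * dotc \<zeta> x))" by (intro continuous_intros)
    have "fourier \<psi> \<zeta> = fourier (jet_op P z 0) \<zeta> + fourier \<phi> \<zeta>"
      unfolding fourier_def \<psi>_def distrib_right
      by (rule Bochner_Integration.integral_add)
         (rule cont_supp_integrable[OF cont_supp_mult[OF Pz ce]] cont_supp_integrable[OF cont_supp_mult[OF \<phi>(1) ce]])+
    then have eq: "fourier \<phi> \<zeta> = (LINT x|lborel. \<psi> x * exp (- \<i> * dotc \<zeta> x))" using Fz by (simp add: fourier_def)
    have "cont_supp R \<psi>" using Pz \<phi>(1) unfolding cont_supp_def \<psi>_def by (auto intro: continuous_on_add)
    have "cmod (fourier \<phi> \<zeta>) \<le> \<Lambda> * ((CE + E) * \<epsilon>) * X' * V"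
      unfolding eq V_def
    proof (rule cont_supp_integral_bound[OF cont_supp_mult[OF \<open>cont_supp R \<psi>\<close> ce]])
      fix x :: "real ^ 'd" assume "norm x \<le> R"
      then have "cmod (exp (- \<i> * dotc \<zeta> x)) \<le> X'" using X[of x] by (simp add: X'_def)
      then show "cmod (\<psi> x * exp (- \<i> * dotc \<zeta> x)) \<le> \<Lambda> * ((CE + E) * \<epsilon>) * X'"
        unfolding norm_mult using \<psi>[of x] V(2) \<Lambda> CE E \<epsilon> by (intro mult_mono) auto
    qed
    also have "\<dots> = L * \<epsilon>" by (simp only: L_def mult_ac)
    finally show ?thesis .
  qed
  ultimately show ?thesis by (intro exI[of _ L] conjI allI impI)
qed


text \<open>The test function \<open>\<phi>\<close> vanishes outside \<open>C\<close>, so the jet of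
  \<open>u\<close> on \<open>F1\<close> is a solution there. If it could be approximated from
  \<open>F2\<close>, the transform of \<open>\<phi>\<close> at a zero of the symbol would be smaller
  than itself.\<close>

theorem runge_pair_imp_no_bounded_component:
  fixes P :: "'d::finite mpoly"
  assumes F1: "closed F1" and F2: "closed F2" and sub: "F1 \<subseteq> F2"
    and P: "\<forall>c. P \<noteq> Poly_Mapping.single 0 c" and rp: "runge_pair P F1 F2"
  shows "\<not> (\<exists>C \<in> components (- F1). bounded C \<and> C \<subseteq> F2)"
proof
  assume "\<exists>C \<in> components (- F1). bounded C \<and> C \<subseteq> F2"
  then obtain C where C: "C \<in> components (- F1)" "bounded C" "C \<subseteq> F2" by blast
  let ?m = "mpoly_degree P"
  have "open C" using C(1) F1 by (meson open_Compl open_components)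
  have "C \<noteq> {}" using C(1) by (rule in_components_nonempty)
  have CF1: "x \<notin> C" if "x \<in> F1" for x using in_components_subset[OF C(1)] that by auto
  have fr: "frontier C \<subseteq> F1"
    using frontier_of_components_subset[OF C(1)] frontier_subset_closed[OF F1] frontier_complement[of F1] by auto
  have frC: "x \<notin> C" if "x \<in> frontier C" for x using that \<open>open C\<close> by (simp add: frontier_def interior_open)
  have cl: "closure C \<subseteq> F2" using C(3) F2 by (simp add: closure_minimal)
  have comp: "compact (closure C)" "compact (frontier C)"
    using C(2) by (simp_all add: compact_closure compact_frontier_bounded)
  obtain R where "\<forall>x\<in>C. norm x \<le> R" using C(2) unfolding bounded_iff by blast
  then have R: "C \<subseteq> cball 0 R" by auto
  have "P \<noteq> 0" using P by (metis single_zero)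
  then obtain \<eta> where \<eta>: "principal_part P \<eta> \<noteq> 0" using principal_part_eq_0_imp by blast
  obtain \<zeta> where \<zeta>: "mpeval P \<zeta> = 0" using exists_mpeval_zero[OF \<eta> P] by blast
  obtain r \<phi> where r: "r > 0" and \<phi>: "smooth_on UNIV \<phi>" "\<And>j x. x \<notin> C ==> \<phi> j x = 0"
    "\<And>b x. b \<notin> C ==> dist b x \<le> r ==> \<phi> 0 x = 0" and nz: "fourier (\<phi> 0) \<zeta> \<noteq> 0"
    using exists_bump[OF \<open>open C\<close> \<open>C \<noteq> {}\<close>, where \<zeta> = \<zeta>] by blast
  have \<phi>_supp: "\<phi> i x = 0" if "R < norm x" for i x using that R by (intro \<phi>(2)) auto
  from constant_coeff_solvable[OF \<eta>] obtain G :: "'d jet => 'd jet"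
    where "\<forall>w R. smooth_on UNIV w --> (\<forall>i x. R < norm x --> w i x = 0) --> smooth_on UNIV (G w) \<and> jet_op P (G w) = w"
    by - (elim exE conjE, rule that)
  then have "smooth_on UNIV (G \<phi>) \<and> jet_op P (G \<phi>) = \<phi>" using \<phi>(1) \<phi>_supp by blast
  then obtain u where u: "smooth_on UNIV u" "jet_op P u = \<phi>" by blast
  have f: "jet_restrict F1 u \<in> jet_kernel P F1"
    by (rule smooth_jet_kernel[OF u(1)]) (simp add: u(2) \<phi>(2) CF1)
  obtain L where L: "L \<ge> 0" and L': "\<forall>w \<epsilon> r \<phi>. smooth_on C w --> (\<forall>x\<in>C. jet_op P w 0 x = - \<phi> x) -->
     0 < \<epsilon> --> \<epsilon> \<le> 1 --> r > 0 --> whitney_bound (frontier C) (Suc ?m) \<epsilon> w -->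
     (\<forall>b\<in>frontier C. \<forall>x\<in>C. \<forall>i. mi_size i \<le> Suc ?m --> dist b x < r -->
        cmod (w i x - taylor_jet (Suc ?m) b w i x) \<le> dist b x ^ (Suc ?m - mi_size i)) -->
     cont_supp R \<phi> --> (\<forall>x. x \<notin> C --> \<phi> x = 0) -->
     (\<forall>b x. b \<in> frontier C --> dist b x \<le> r --> \<phi> x = 0) --> cmod (fourier \<phi> \<zeta>) \<le> L * \<epsilon>"
    using fourier_boundary_estimate[OF \<zeta> \<open>open C\<close> R] by - (elim exE conjE, rule that)
  define a where "a = cmod (fourier (\<phi> 0) \<zeta>)"
  have a: "a > 0" using nz by (simp add: a_def)
  \<comment> \<open>\<open>L\<close> is known before \<open>g\<close> is chosen, so the required
    precision can be fixed in advance; \<open>L * \<epsilon>\<close> is at most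
    \<open>a / 2\<close>.\<close>
  define \<epsilon> where "\<epsilon> = min 1 (a / (2 * (L + 1)))"
  have \<epsilon>: "0 < \<epsilon>" "\<epsilon> \<le> 1" "\<epsilon> \<le> a / (2 * (L + 1))" using a L by (auto simp: \<epsilon>_def)
  have "L * \<epsilon> \<le> (L + 1) * (a / (2 * (L + 1)))" using L \<epsilon> by (intro mult_mono) auto
  also have "\<dots> = a / 2" using L by (simp add: field_simps)
  finally have La: "L * \<epsilon> < a" using a by simp
  obtain g where g: "g \<in> jet_kernel P F2" "whitney_bound (frontier C) (Suc ?m) \<epsilon> (\<lambda>i x. g i x - jet_restrict F1 u i x)"
    using runge_pair_imp_approx[OF rp f comp(2) fr \<epsilon>(1)] .
  define w where "w = (\<lambda>i x. g i x - u i x)"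
  have wb: "whitney_bound (frontier C) (Suc ?m) \<epsilon> w"
    by (rule whitney_bound_cong[OF _ g(2)]) (use fr in \<open>auto simp: w_def jet_restrict_apply\<close>)
  have gW: "g \<in> whitney_jets F2" and gP: "jet_op P g = (\<lambda>i x. 0)" using g(1) by (auto simp: jet_kernel_def)
  \<comment> \<open>A jet on \<open>F2\<close> is smooth in the interior of \<open>F2\<close>, which
    contains the open set \<open>C\<close>; here the assumption that \<open>C\<close> lies in
    \<open>F2\<close> is used.\<close>
  have "smooth_on C g"
    by (rule smooth_on_subset[OF whitney_jets_smooth_interior[OF gW]]) (simp add: interior_maximal C(3) \<open>open C\<close>)
  then have w: "smooth_on C w" unfolding w_def by (intro smooth_on_diff smooth_on_subset[OF u(1)]) auto
  have Pw: "\<forall>x\<in>C. jet_op P w 0 x = - \<phi> 0 x" by (simp add: w_def jet_op_diff gP u(2))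
  \<comment> \<open>One half for the remainder of \<open>g\<close> and one half for that of
    \<open>u\<close> add up to the constant 1 in the boundary estimate. The radii depend on
    \<open>g\<close>.\<close>
  obtain t1 where t1: "t1 > 0" "\<And>i x y. mi_size i \<le> Suc ?m ==> x \<in> closure C ==> y \<in> closure C ==> dist x y < t1 ==>
     cmod (g i y - taylor_jet (Suc ?m) x g i y) \<le> (1 / 2) * dist x y ^ (Suc ?m - mi_size i)"
    by (rule whitney_jets_remainder[OF gW comp(1) cl, of "1 / 2" "Suc ?m"]) auto
  obtain t2 where t2: "t2 > 0" "\<And>i x y. mi_size i \<le> Suc ?m ==> x \<in> closure C ==> y \<in> closure C ==> dist x y < t2 ==>
     cmod (jet_restrict F2 u i y - taylor_jet (Suc ?m) x (jet_restrict F2 u) i y) \<le> (1 / 2) * dist x y ^ (Suc ?m - mi_size i)"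
    by (rule whitney_jets_remainder[OF smooth_whitney_jets[OF u(1)] comp(1) cl, of "1 / 2" "Suc ?m"]) auto
  define r' where "r' = min r (min t1 t2)"
  have r': "r' > 0" "r' \<le> r" "r' \<le> t1" "r' \<le> t2" using r t1(1) t2(1) by (auto simp: r'_def)
  have rem: "\<forall>b\<in>frontier C. \<forall>x\<in>C. \<forall>i. mi_size i \<le> Suc ?m --> dist b x < r' -->
        cmod (w i x - taylor_jet (Suc ?m) b w i x) \<le> dist b x ^ (Suc ?m - mi_size i)"
  proof (intro ballI allI impI)
    fix b x and i :: "'d multi_index"
    assume b: "b \<in> frontier C" and x: "x \<in> C" and i: "mi_size i \<le> Suc ?m" and d: "dist b x < r'"
    have bx: "b \<in> closure C" "x \<in> closure C" using b x closure_subset[of C] by (auto simp: frontier_def)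
    then have "b \<in> F2" "x \<in> F2" using cl by auto
    then have "taylor_jet (Suc ?m) b (jet_restrict F2 u) i x = taylor_jet (Suc ?m) b u i x" "jet_restrict F2 u i x = u i x"
      by (auto intro!: taylor_jet_cong simp: jet_restrict_apply)
    then have "cmod (u i x - taylor_jet (Suc ?m) b u i x) \<le> (1 / 2) * dist b x ^ (Suc ?m - mi_size i)"
      using t2(2)[OF i bx] d r' by simp
    moreover have "cmod (g i x - taylor_jet (Suc ?m) b g i x) \<le> (1 / 2) * dist b x ^ (Suc ?m - mi_size i)"
      using t1(2)[OF i bx] d r' by simp
    moreover have "w i x - taylor_jet (Suc ?m) b w i x =
        (g i x - taylor_jet (Suc ?m) b g i x) - (u i x - taylor_jet (Suc ?m) b u i x)"
      unfolding w_def taylor_jet_diff by simp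
    ultimately show "cmod (w i x - taylor_jet (Suc ?m) b w i x) \<le> dist b x ^ (Suc ?m - mi_size i)"
      using norm_triangle_ineq4[of "g i x - taylor_jet (Suc ?m) b g i x" "u i x - taylor_jet (Suc ?m) b u i x"]
      by (simp only:)
  qed
  have cs: "cont_supp R (\<phi> 0)" by (rule cont_supp_jet[OF \<phi>(1)]) (rule \<phi>_supp)
  have "cmod (fourier (\<phi> 0) \<zeta>) \<le> L * \<epsilon>"
  proof (rule L'[rule_format, OF w _ \<epsilon>(1,2) r'(1) wb _ cs])
    fix b x assume "b \<in> frontier C" "dist b x \<le> r'"
    then show "\<phi> 0 x = 0" using frC r'(2) by (intro \<phi>(3)[of b]) auto
  qed (use Pw rem \<phi>(2) in auto)
  then show False using La by (simp add: a_def)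
qed

section \<open>Sufficiency for elliptic operators\<close>

lemma whitney_bound_diff:
  fixes f g :: "'d::finite jet"
  assumes "whitney_bound K n a f" "whitney_bound K n b g"
  shows "whitney_bound K n (a + b) (\<lambda>i x. f i x - g i x)"
  unfolding whitney_bound_def
proof (intro conjI ballI allI impI)
  fix x and i :: "'d multi_index" assume x: "x \<in> K" and i: "mi_size i \<le> n"
  have "cmod (f i x) \<le> a" "cmod (g i x) \<le> b" using assms x i by (simp_all add: whitney_bound_def)
  then show "cmod (f i x - g i x) \<le> a + b" using norm_triangle_ineq4[of "f i x" "g i x"] by linarith
  fix y assume y: "y \<in> K"
  let ?f = "f i y - taylor_jet n x f i y" and ?g = "g i y - taylor_jet n x g i y"
  have 1: "cmod ?f \<le> a * dist x y ^ (n - mi_size i)" "cmod ?g \<le> b * dist x y ^ (n - mi_size i)"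
    using assms x y i by (simp_all add: whitney_bound_def)
  have eq: "f i y - g i y - taylor_jet n x (\<lambda>i x. f i x - g i x) i y = ?f - ?g"
    unfolding taylor_jet_diff by simp
  show "cmod (f i y - g i y - taylor_jet n x (\<lambda>i x. f i x - g i x) i y) \<le> (a + b) * dist x y ^ (n - mi_size i)"
    unfolding distrib_right eq using norm_triangle_ineq4[of ?f ?g] 1 by linarith
qed

lemma whitney_bound_mono: "whitney_bound K n a h ==> a \<le> b ==> whitney_bound K n b h"
  unfolding whitney_bound_def by (meson mult_right_mono order_trans zero_le_dist zero_le_power)

text \<open>Terms of order above \<open>n\<close> carry additional factors
  \<open>norm (y - x)\<close>, which are bounded by the diameter \<open>b\<close>.\<close>

lemma taylor_jet_order_diff:
  fixes h :: "'d::finite jet"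
  assumes "n \<le> N" and b: "b \<ge> 1" "norm (y - x) \<le> b" and h: "\<And>\<gamma>. mi_size \<gamma> \<le> N ==> cmod (h \<gamma> x) \<le> a"
    and i: "mi_size i \<le> n"
  shows "cmod (taylor_jet N x h i y - taylor_jet n x h i y)
    \<le> real (card {\<gamma> :: 'd multi_index. mi_size \<gamma> \<le> N}) * (a * b ^ N) * norm (y - x) ^ (n - mi_size i)"
proof -
  let ?S = "{\<gamma> :: 'd multi_index. mi_size \<gamma> \<le> N}" and ?r = "norm (y - x)"
  have a: "a \<ge> 0" using order_trans[OF norm_ge_zero h[of 0]] by simp
  have summand: "cmod (if mi_size \<gamma> \<le> n then 0 else h \<gamma> x * mono_jet \<gamma> i (y - x)) \<le> a * b ^ N * ?r ^ (n - mi_size i)"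
    if \<gamma>: "\<gamma> \<in> ?S" for \<gamma>
  proof (cases "mi_size \<gamma> \<le> n \<or> y = x")
    case True
    have "mono_jet \<gamma> i 0 = 0" if "\<not> mi_size \<gamma> \<le> n" using that i by (auto simp: mono_jet_at_0)
    then show ?thesis using True a b by auto
  next
    case False
    then have r: "?r > 0" and \<gamma>n: "n < mi_size \<gamma>" by auto
    have "?r ^ mi_size i * cmod (mono_jet \<gamma> i (y - x)) \<le> (1 * ?r) ^ mi_size \<gamma>"
      using r by (intro mono_jet_bound) auto
    also have "\<dots> = ?r ^ mi_size i * ?r ^ (mi_size \<gamma> - mi_size i)"
      using i \<gamma>n by (simp add: power_add[symmetric])
    finally have "cmod (mono_jet \<gamma> i (y - x)) \<le> ?r ^ (mi_size \<gamma> - mi_size i)"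
      using r by (simp only: mult_le_cancel_left_pos zero_less_power)
    also have "\<dots> = ?r ^ (mi_size \<gamma> - n) * ?r ^ (n - mi_size i)"
      using i \<gamma>n by (simp add: power_add[symmetric])
    also have "\<dots> \<le> b ^ N * ?r ^ (n - mi_size i)"
    proof (rule mult_right_mono)
      have "?r ^ (mi_size \<gamma> - n) \<le> b ^ (mi_size \<gamma> - n)" using b r by (intro power_mono) auto
      also have "\<dots> \<le> b ^ N" using b \<gamma> by (intro power_increasing) auto
      finally show "?r ^ (mi_size \<gamma> - n) \<le> b ^ N" .
    qed simp
    finally have "cmod (mono_jet \<gamma> i (y - x)) \<le> b ^ N * ?r ^ (n - mi_size i)" .
    moreover have "cmod (h \<gamma> x) \<le> a" using h \<gamma> by simp
    ultimately have "cmod (h \<gamma> x) * cmod (mono_jet \<gamma> i (y - x)) \<le> a * (b ^ N * ?r ^ (n - mi_size i))"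
      using a by (intro mult_mono) auto
    then show ?thesis using False by (simp add: norm_mult mult.assoc)
  qed
  have sub: "{\<gamma> :: 'd multi_index. mi_size \<gamma> \<le> n} \<subseteq> ?S" using \<open>n \<le> N\<close> by auto
  have "taylor_jet n x h i y = (\<Sum>\<gamma>\<in>?S. if mi_size \<gamma> \<le> n then h \<gamma> x * mono_jet \<gamma> i (y - x) else 0)"
    unfolding taylor_jet_def using sub by (intro sum.mono_neutral_cong_left finite_mi_size_le) auto
  then have "taylor_jet N x h i y - taylor_jet n x h i y = (\<Sum>\<gamma>\<in>?S. if mi_size \<gamma> \<le> n then 0 else h \<gamma> x * mono_jet \<gamma> i (y - x))"
    unfolding taylor_jet_def by (simp add: sum_subtractf[symmetric] if_distrib[of "\<lambda>t. _ - t"] cong: sum.cong if_cong)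
  also have "cmod \<dots> \<le> (\<Sum>\<gamma>\<in>?S. a * b ^ N * ?r ^ (n - mi_size i))" by (intro sum_norm_le summand)
  finally show ?thesis by (simp add: mult.assoc)
qed

text \<open>On a bounded set a higher seminorm controls the lower ones, at the cost of powers of the
  diameter. Approximation in the single order \<open>n\<close> therefore settles all orders below
  it.\<close>

lemma whitney_bound_lower:
  fixes h :: "'d::finite jet"
  assumes h: "whitney_bound K N a h" and "n \<le> N" and b: "b \<ge> 1" "\<And>x y. x \<in> K ==> y \<in> K ==> dist x y \<le> b" and a: "a \<ge> 0"
  shows "whitney_bound K n ((real (card {\<gamma> :: 'd multi_index. mi_size \<gamma> \<le> N}) + 1) * b ^ N * a) h"
  unfolding whitney_bound_def
proof (intro conjI ballI allI impI)
  let ?p = "real (card {\<gamma> :: 'd multi_index. mi_size \<gamma> \<le> N})"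
  fix x and i :: "'d multi_index" assume x: "x \<in> K" and i: "mi_size i \<le> n"
  have "1 * 1 \<le> (?p + 1) * b ^ N" using b by (intro mult_mono one_le_power) auto
  then have "1 * a \<le> (?p + 1) * b ^ N * a" using a by (intro mult_right_mono) auto
  moreover have "cmod (h i x) \<le> a" using h x i \<open>n \<le> N\<close> by (simp add: whitney_bound_def)
  ultimately show "cmod (h i x) \<le> (?p + 1) * b ^ N * a" by simp
  fix y assume y: "y \<in> K"
  have "cmod (h i y - taylor_jet N x h i y) \<le> a * dist x y ^ (N - mi_size i)"
    using h x y i \<open>n \<le> N\<close> by (simp add: whitney_bound_def)
  also have "\<dots> = a * (dist x y ^ (N - n) * dist x y ^ (n - mi_size i))"
    using i \<open>n \<le> N\<close> by (simp add: power_add[symmetric])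
  also have "\<dots> \<le> a * (b ^ N * dist x y ^ (n - mi_size i))"
  proof (intro mult_left_mono mult_right_mono a)
    have "dist x y ^ (N - n) \<le> b ^ (N - n)" using b x y by (intro power_mono) auto
    also have "\<dots> \<le> b ^ N" using b by (intro power_increasing) auto
    finally show "dist x y ^ (N - n) \<le> b ^ N" .
  qed simp
  finally have 1: "cmod (h i y - taylor_jet N x h i y) \<le> a * (b ^ N * dist x y ^ (n - mi_size i))" .
  have "norm (y - x) = dist x y" by (simp add: dist_norm norm_minus_commute)
  moreover have "cmod (taylor_jet N x h i y - taylor_jet n x h i y) \<le> ?p * (a * b ^ N) * norm (y - x) ^ (n - mi_size i)"
  proof (rule taylor_jet_order_diff[OF \<open>n \<le> N\<close> b(1) _ _ i])
    show "norm (y - x) \<le> b" using b(2)[OF x y] by (simp add: dist_norm norm_minus_commute)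
    show "cmod (h \<gamma> x) \<le> a" if "mi_size \<gamma> \<le> N" for \<gamma> using h x that by (simp add: whitney_bound_def)
  qed
  ultimately have 2: "cmod (taylor_jet N x h i y - taylor_jet n x h i y) \<le> ?p * (a * b ^ N) * dist x y ^ (n - mi_size i)" by simp
  have "cmod (h i y - taylor_jet n x h i y) \<le> cmod (h i y - taylor_jet N x h i y) + cmod (taylor_jet N x h i y - taylor_jet n x h i y)"
    using norm_triangle_ineq[of "h i y - taylor_jet N x h i y" "taylor_jet N x h i y - taylor_jet n x h i y"] by simp
  also have "\<dots> \<le> a * (b ^ N * dist x y ^ (n - mi_size i)) + ?p * (a * b ^ N) * dist x y ^ (n - mi_size i)"
    using 1 2 by (rule add_mono)
  also have "\<dots> = (?p + 1) * b ^ N * a * dist x y ^ (n - mi_size i)" by (simp add: algebra_simps)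
  finally show "cmod (h i y - taylor_jet n x h i y) \<le> (?p + 1) * b ^ N * a * dist x y ^ (n - mi_size i)" .
qed

text \<open>
  Two points at distance at most \<open>s\<close> are compared by Taylor's formula on a ball; for the others the
  powers of the distance are bounded below.
\<close>

lemma whitney_bound_near_far:
  fixes h :: "'d::finite jet"
  assumes s: "0 < s" "s \<le> 1" and b: "b \<ge> 1" "\<And>x y. x \<in> K ==> y \<in> K ==> dist x y \<le> b" and A: "A \<ge> 0" "A \<le> B"
    and small: "\<And>x a. x \<in> K ==> mi_size a \<le> n ==> cmod (h a x) \<le> A * s ^ n"
    and near: "\<And>x y a. x \<in> K ==> y \<in> K ==> mi_size a \<le> n ==> dist x y \<le> s ==>
       cmod (h a y - taylor_jet n x h a y) \<le> B * dist x y ^ (n - mi_size a)"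
  shows "whitney_bound K n (B + (1 + real (card {\<gamma> :: 'd multi_index. mi_size \<gamma> \<le> n}) * b ^ n) * A) h"
  unfolding whitney_bound_def
proof (intro conjI ballI allI impI)
  let ?p = "real (card {\<gamma> :: 'd multi_index. mi_size \<gamma> \<le> n})"
  fix x and a :: "'d multi_index" assume x: "x \<in> K" and a: "mi_size a \<le> n"
  have p: "?p * b ^ n * A \<ge> 0" using b A by simp
  have sn: "A * s ^ n \<le> A" using mult_left_mono[OF power_le_one[of s n], of A] s A by simp
  have tot: "(1 + ?p * b ^ n) * A = A + ?p * b ^ n * A" by (simp only: distrib_right mult_1)
  show "cmod (h a x) \<le> B + (1 + ?p * b ^ n) * A" using small[OF x a] sn p A tot by linarith
  fix y assume y: "y \<in> K"
  show "cmod (h a y - taylor_jet n x h a y) \<le> (B + (1 + ?p * b ^ n) * A) * dist x y ^ (n - mi_size a)"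
  proof (cases "dist x y \<le> s")
    case True
    have "B * dist x y ^ (n - mi_size a) \<le> (B + (1 + ?p * b ^ n) * A) * dist x y ^ (n - mi_size a)"
      using p A tot by (intro mult_right_mono) auto
    then show ?thesis using near[OF x y a True] by linarith
  next
    case False
    have "1 ^ mi_size a * cmod (taylor_jet n x h a y) \<le> ?p * (b ^ n * (A * s ^ n))"
    proof (rule taylor_jet_bound)
      show "norm (y - x) \<le> b * 1" using b(2)[OF x y] by (simp add: dist_norm norm_minus_commute)
    qed (use b small x in \<open>auto simp: jet_bound_def\<close>)
    then have "cmod (taylor_jet n x h a y) \<le> ?p * (b ^ n * (A * s ^ n))" by simp
    then have "cmod (h a y - taylor_jet n x h a y) \<le> A * s ^ n + ?p * (b ^ n * (A * s ^ n))"
      using small[OF y a] norm_triangle_ineq4[of "h a y" "taylor_jet n x h a y"] by linarith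
    also have "\<dots> = (1 + ?p * b ^ n) * A * s ^ n" by (simp add: algebra_simps)
    also have "\<dots> \<le> (1 + ?p * b ^ n) * A * dist x y ^ (n - mi_size a)"
    proof (rule mult_left_mono)
      have "s ^ n \<le> s ^ (n - mi_size a)" using s by (intro power_decreasing) auto
      also have "\<dots> \<le> dist x y ^ (n - mi_size a)" using False s by (intro power_mono) auto
      finally show "s ^ n \<le> dist x y ^ (n - mi_size a)" .
      show "0 \<le> (1 + ?p * b ^ n) * A" using p A tot by linarith
    qed
    also have "\<dots> \<le> (B + (1 + ?p * b ^ n) * A) * dist x y ^ (n - mi_size a)" using A by (intro mult_right_mono) auto
    finally show ?thesis .
  qed
qed

lemma taylor_remainder_whitney:
  fixes w :: "'d::finite jet"
  assumes w: "smooth_on UNIV w" and a: "mi_size a \<le> n"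
    and M: "\<And>b z. dist x z \<le> dist x y ==> mi_size b = Suc n ==> cmod (w b z) \<le> M"
  shows "cmod (w a y - taylor_jet n x w a y) \<le> M * real CARD('d) ^ Suc n * dist x y * dist x y ^ (n - mi_size a)"
proof -
  have "M \<ge> 0"
  proof -
    obtain j :: 'd where True by simp
    have "mi_size (axis j (Suc n)) = Suc n"
      unfolding mi_size_def axis_def by simp
    from M[OF _ this, of x] show ?thesis using norm_ge_zero order_trans by (metis dist_self zero_le_dist)
  qed
  have "cmod (w a y - taylor_jet n x w a y) \<le> M * (real CARD('d) * norm (y - x)) ^ (Suc n - mi_size a)"
    by (rule taylor_remainder[where S = "cball x (dist x y)", OF smooth_on_subset[OF w] convex_cball])
       (use a M in \<open>auto simp: dist_norm norm_minus_commute\<close>)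
  also have "\<dots> = M * (real CARD('d) ^ (Suc n - mi_size a) * (dist x y * dist x y ^ (n - mi_size a)))"
    using a by (simp add: power_mult_distrib dist_norm norm_minus_commute Suc_diff_le)
  also have "\<dots> \<le> M * (real CARD('d) ^ Suc n * (dist x y * dist x y ^ (n - mi_size a)))"
  proof (intro mult_left_mono mult_right_mono power_increasing \<open>M \<ge> 0\<close>)
    show "1 \<le> real CARD('d)" by (simp add: Suc_leI)
  qed auto
  finally show ?thesis by (simp only: mult_ac)
qed

text \<open>Converts uniform smallness near \<open>K\<close> into a Whitney bound. The factor
  \<open>s ^ n\<close> in the hypothesis pays for dividing by powers of distances larger than
  \<open>s\<close>; for closer points the ball between them lies in the neighbourhood, and
  derivatives of order \<open>Suc n\<close> control the remainder.\<close>

lemma smooth_whitney_bound: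
  fixes w :: "'d::finite jet"
  assumes w: "smooth_on UNIV w" and s: "0 < s" "s \<le> 1" and b: "b \<ge> 1" "\<And>x y. x \<in> K ==> y \<in> K ==> dist x y \<le> b"
    and A: "A \<ge> 0" and small: "\<And>x a. x \<in> neighbourhood K s ==> mi_size a \<le> Suc n ==> cmod (w a x) \<le> A * s ^ n"
  shows "whitney_bound K n ((real CARD('d) ^ Suc n + (1 + real (card {\<gamma> :: 'd multi_index. mi_size \<gamma> \<le> n}) * b ^ n)) * A) w"
proof -
  have K: "x \<in> neighbourhood K s" if "x \<in> K" for x using that s by (auto simp: neighbourhood_def intro!: bexI[of _ x])
  have d: "1 \<le> real CARD('d) ^ Suc n" by (intro one_le_power) (simp add: Suc_leI)
  have "whitney_bound K n (real CARD('d) ^ Suc n * A + (1 + real (card {\<gamma> :: 'd multi_index. mi_size \<gamma> \<le> n}) * b ^ n) * A) w"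
  proof (rule whitney_bound_near_far[OF s b A])
    show "A \<le> real CARD('d) ^ Suc n * A" using mult_right_mono[OF d A] by simp
    show "cmod (w a x) \<le> A * s ^ n" if "x \<in> K" "mi_size a \<le> n" for x a using small[OF K] that by simp
    fix x y and a :: "'d multi_index" assume x: "x \<in> K" and y: "y \<in> K" and a: "mi_size a \<le> n" and xy: "dist x y \<le> s"
    have "cmod (w j z) \<le> A" if z: "dist x z \<le> dist x y" and j: "mi_size j = Suc n" for j z
    proof -
      have "cmod (w j z) \<le> A * s ^ n" using z j x xy by (intro small) (auto simp: neighbourhood_def intro!: bexI[of _ x])
      also have "\<dots> \<le> A" using mult_left_mono[OF power_le_one[of s n], of A] s A by simp
      finally show ?thesis .
    qed
    then have "cmod (w a y - taylor_jet n x w a y) \<le> A * real CARD('d) ^ Suc n * dist x y * dist x y ^ (n - mi_size a)"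
      by (rule taylor_remainder_whitney[OF w a])
    also have "\<dots> \<le> A * real CARD('d) ^ Suc n * 1 * dist x y ^ (n - mi_size a)"
      using A xy s by (intro mult_right_mono mult_left_mono) auto
    finally show "cmod (w a y - taylor_jet n x w a y) \<le> real CARD('d) ^ Suc n * A * dist x y ^ (n - mi_size a)"
      by (simp only: mult_ac mult_1_right mult_1)
  qed
  then show ?thesis by (simp only: distrib_right)
qed

section \<open>Quality of the smoothing: its distance from the jet and the size of its
  source\<close>

lemma scaled_power_cancel:
  fixes \<delta> X C :: real
  assumes "\<delta> ^ k * X \<le> C * \<delta> ^ N" "k \<le> N" "\<delta> > 0"
  shows "X \<le> C * \<delta> ^ (N - k)"
proof -
  have "\<delta> ^ N = \<delta> ^ k * \<delta> ^ (N - k)" using assms(2) by (simp add: power_add[symmetric])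
  then have "C * \<delta> ^ N = \<delta> ^ k * (C * \<delta> ^ (N - k))" by (simp only: mult_ac)
  then have "\<delta> ^ k * X \<le> \<delta> ^ k * (C * \<delta> ^ (N - k))" using assms(1) by (simp only:)
  then show ?thesis using assms(3) by (simp only: mult_le_cancel_left_pos zero_less_power)
qed

text \<open>With \<open>2 * n + 1 \<le> N\<close> the entries of order at most \<open>n\<close>
  differ by at most a multiple of \<open>\<delta> ^ Suc n\<close>; for points farther apart than
  \<open>\<delta>\<close> this survives the division by distances and leaves a factor
  \<open>\<delta>\<close>. Closer points need the splitting below, since \<open>f\<close> is only a
  jet and Taylor's theorem does not apply to it.\<close>

lemma smoothing_whitney_bound:
  fixes f s :: "'d::finite jet"
  assumes N: "2 * n + 1 \<le> N" and \<delta>: "0 < \<delta>" "\<delta> \<le> 1" and c: "c \<ge> 1" and s: "smooth_on UNIV s" and C1: "C1 \<ge> 0"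
    and s_T: "\<And>x y a. x \<in> K ==> dist x y \<le> c * \<delta> ==> mi_size a \<le> N ==>
       \<delta> ^ mi_size a * cmod (s a y - taylor_jet N x f a y) \<le> C1 * \<delta> ^ N"
    and f: "\<And>x y a. x \<in> K ==> y \<in> K ==> mi_size a \<le> N ==> dist x y \<le> \<delta> ==>
       cmod (f a y - taylor_jet N x f a y) \<le> dist x y ^ (N - mi_size a)"
    and b: "b \<ge> 1" "\<And>x y. x \<in> K ==> y \<in> K ==> dist x y \<le> b"
  shows "whitney_bound K n ((C1 * real CARD('d) ^ Suc n + 1 + (1 + real (card {\<gamma> :: 'd multi_index. mi_size \<gamma> \<le> n}) * b ^ n) * C1) * \<delta>)
    (\<lambda>a x. s a x - f a x)"
proof -
  let ?h = "\<lambda>a x. s a x - f a x" and ?D = "real CARD('d) ^ Suc n"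
  have d: "1 \<le> ?D" by (intro one_le_power) (simp add: Suc_leI)
  have pw: "\<delta> ^ k \<le> \<delta>" if "1 \<le> k" for k using power_decreasing[OF that, of \<delta>] \<delta> by simp
  have s_T': "cmod (s a y - taylor_jet N x f a y) \<le> C1 * \<delta> ^ (N - mi_size a)"
    if "x \<in> K" "dist x y \<le> c * \<delta>" "mi_size a \<le> N" for x y a
    using s_T[OF that] that(3) \<delta>(1) by (rule scaled_power_cancel)
  have c\<delta>: "\<delta> \<le> c * \<delta>" using c \<delta> by simp
  have "whitney_bound K n ((C1 * ?D + 1) * \<delta> + (1 + real (card {\<gamma> :: 'd multi_index. mi_size \<gamma> \<le> n}) * b ^ n) * (C1 * \<delta>)) ?h"
  proof (rule whitney_bound_near_far[OF \<delta> b])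
    show "0 \<le> C1 * \<delta>" using C1 \<delta> by simp
    have "C1 * 1 \<le> C1 * ?D + 1" using mult_left_mono[OF d C1] by simp
    then show "C1 * \<delta> \<le> (C1 * ?D + 1) * \<delta>" using \<delta> by (intro mult_right_mono) auto
    show "cmod (?h a x) \<le> C1 * \<delta> * \<delta> ^ n" if "x \<in> K" "mi_size a \<le> n" for x a
    proof -
      have "0 \<le> c * \<delta>" using c \<delta> by simp
      then have "cmod (?h a x) \<le> C1 * \<delta> ^ (N - mi_size a)"
        using s_T'[of x x a] that N by (simp add: taylor_jet_at)
      also have "\<dots> \<le> C1 * \<delta> ^ (Suc n)" using C1 \<delta> that N by (intro mult_left_mono power_decreasing) auto
      finally show ?thesis by (simp add: mult.assoc)
    qed
    fix x y and a :: "'d multi_index" assume x: "x \<in> K" and y: "y \<in> K" and a: "mi_size a \<le> n" and xy: "dist x y \<le> \<delta>"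
    \<comment> \<open>The difference splits into \<open>?\<rho>\<close>, smooth and open to Taylor's
      theorem, and \<open>?q\<close>, whose jet at \<open>x\<close> vanishes up to order
      \<open>N\<close> and which is bounded by the Whitney condition of \<open>f\<close>.\<close>
    let ?\<rho> = "\<lambda>a y. s a y - taylor_jet N x f a y" and ?q = "\<lambda>a y. f a y - taylor_jet N x f a y"
    have "taylor_jet n x ?q a y = taylor_jet n x (\<lambda>a x. 0) a y"
      by (rule taylor_jet_cong) (use N in \<open>simp add: taylor_jet_at\<close>)
    also have "\<dots> = 0" by (simp add: taylor_jet_def)
    finally have q0: "taylor_jet n x ?q a y = 0" .
    have "taylor_jet n x ?h a y = taylor_jet n x (\<lambda>a y. ?\<rho> a y - ?q a y) a y" by (rule taylor_jet_cong) simp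
    also have "\<dots> = taylor_jet n x ?\<rho> a y" by (simp only: taylor_jet_diff[of n x ?\<rho> ?q] q0 diff_zero)
    finally have eq: "?h a y - taylor_jet n x ?h a y = (?\<rho> a y - taylor_jet n x ?\<rho> a y) - ?q a y" by simp
    have "cmod (?\<rho> a y - taylor_jet n x ?\<rho> a y) \<le> C1 * ?D * dist x y * dist x y ^ (n - mi_size a)"
    proof (rule taylor_remainder_whitney[OF smooth_on_diff[OF s smooth_on_taylor_jet] a])
      fix j :: "'d multi_index" and z assume "dist x z \<le> dist x y" and j: "mi_size j = Suc n"
      then have "cmod (?\<rho> j z) \<le> C1 * \<delta> ^ (N - mi_size j)" using x xy c\<delta> N by (intro s_T') auto
      also have "\<dots> \<le> C1 * 1" using C1 \<delta> by (intro mult_left_mono power_le_one) auto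
      finally show "cmod (?\<rho> j z) \<le> C1" by simp
    qed
    also have "\<dots> \<le> C1 * ?D * \<delta> * dist x y ^ (n - mi_size a)" using C1 xy by (intro mult_right_mono mult_left_mono) auto
    finally have 1: "cmod (?\<rho> a y - taylor_jet n x ?\<rho> a y) \<le> C1 * ?D * \<delta> * dist x y ^ (n - mi_size a)" .
    have "cmod (?q a y) \<le> dist x y ^ (N - mi_size a)" using x y a N xy by (intro f) auto
    also have "\<dots> = dist x y ^ (N - n) * dist x y ^ (n - mi_size a)" using a N by (simp add: power_add[symmetric])
    also have "\<dots> \<le> \<delta> * dist x y ^ (n - mi_size a)"
    proof (rule mult_right_mono)
      have "dist x y ^ (N - n) \<le> \<delta> ^ (N - n)" using xy by (intro power_mono) auto
      also have "\<dots> \<le> \<delta>" using N by (intro pw) auto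
      finally show "dist x y ^ (N - n) \<le> \<delta>" .
    qed simp
    finally have 2: "cmod (?q a y) \<le> \<delta> * dist x y ^ (n - mi_size a)" .
    have "cmod (?h a y - taylor_jet n x ?h a y) \<le> C1 * ?D * \<delta> * dist x y ^ (n - mi_size a) + \<delta> * dist x y ^ (n - mi_size a)"
      unfolding eq using norm_triangle_ineq4[of "?\<rho> a y - taylor_jet n x ?\<rho> a y" "?q a y"] 1 2 by linarith
    then show "cmod (?h a y - taylor_jet n x ?h a y) \<le> (C1 * ?D + 1) * \<delta> * dist x y ^ (n - mi_size a)"
      by (simp only: distrib_right mult_1)
  qed
  moreover have "(C1 * ?D + 1) * \<delta> + (1 + real (card {\<gamma> :: 'd multi_index. mi_size \<gamma> \<le> n}) * b ^ n) * (C1 * \<delta>) =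
     (C1 * ?D + 1 + (1 + real (card {\<gamma> :: 'd multi_index. mi_size \<gamma> \<le> n}) * b ^ n) * C1) * \<delta>"
    by (simp only: distrib_right mult.assoc)
  ultimately show ?thesis by simp
qed

text \<open>The operator applied to the Taylor polynomial of \<open>f\<close> at \<open>x\<close>
  vanishes at \<open>x\<close> to order \<open>k = N - m\<close>, because those entries coincide
  with entries of \<open>jet_op P f\<close> there. Hence it is small within
  \<open>c * \<delta>\<close>, and the smoothing differs from the polynomial by even less than is
  needed.\<close>

lemma smoothing_source_bound:
  fixes f s :: "'d::finite jet" and P :: "'d mpoly"
  assumes x: "\<And>b. jet_op P f b x = 0" and Bf: "\<And>\<gamma>. mi_size \<gamma> \<le> N ==> cmod (f \<gamma> x) \<le> Bf"
    and N: "N = mpoly_degree P + k" and \<delta>: "0 < \<delta>" "\<delta> \<le> 1" and c: "c \<ge> 1" "dist x y \<le> c * \<delta>" and C1: "C1 \<ge> 0"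
    and s_T: "\<And>a. mi_size a \<le> N ==> \<delta> ^ mi_size a * cmod (s a y - taylor_jet N x f a y) \<le> C1 * \<delta> ^ N"
    and b: "mi_size b \<le> k"
  shows "\<delta> ^ mi_size b * cmod (jet_op P s b y) \<le> (\<Sum>a | mi_size (a :: 'd multi_index) \<le> mpoly_degree P. cmod (op_coeff P a)) *
     (C1 + real (card {\<gamma> :: 'd multi_index. mi_size \<gamma> \<le> N}) * (c ^ N * Bf) * (real CARD('d) * c) ^ Suc k) * \<delta> ^ k"
proof -
  let ?m = "mpoly_degree P" and ?T = "taylor_jet N x f"
  define \<Lambda> where "\<Lambda> = (\<Sum>a | mi_size (a :: 'd multi_index) \<le> ?m. cmod (op_coeff P a))"
  have \<Lambda>: "\<Lambda> \<ge> 0" unfolding \<Lambda>_def by (intro sum_nonneg) auto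
  define M where "M = real (card {\<gamma> :: 'd multi_index. mi_size \<gamma> \<le> N}) * (c ^ N * Bf)"
  have "Bf \<ge> 0" using order_trans[OF norm_ge_zero Bf[of 0]] by simp
  then have M: "M \<ge> 0" using c by (simp add: M_def)
  have dc: "1 \<le> real CARD('d) * c" using c mult_mono[of 1 "real CARD('d)" 1 c] by (simp add: Suc_leI)
  have split: "\<delta> ^ k = \<delta> ^ mi_size b * \<delta> ^ (k - mi_size b)" using b by (simp add: power_add[symmetric])
  have "cmod (jet_op P (\<lambda>a y. s a y - ?T a y) b y) \<le> \<Lambda> * (C1 * \<delta> ^ (k - mi_size b))"
    unfolding \<Lambda>_def
  proof (rule jet_op_bound)
    fix a :: "'d multi_index" assume a: "mi_size a \<le> ?m"
    have "cmod (s (b + a) y - ?T (b + a) y) \<le> C1 * \<delta> ^ (N - mi_size (b + a))"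
      using s_T[of "b + a"] a b N \<delta>(1) by (intro scaled_power_cancel) (auto simp: mi_size_add)
    also have "\<dots> \<le> C1 * \<delta> ^ (k - mi_size b)"
      using C1 \<delta> a b N by (intro mult_left_mono power_decreasing) (auto simp: mi_size_add)
    finally show "cmod (s (b + a) y - ?T (b + a) y) \<le> C1 * \<delta> ^ (k - mi_size b)" .
  qed
  then have "\<delta> ^ mi_size b * cmod (jet_op P (\<lambda>a y. s a y - ?T a y) b y) \<le> \<delta> ^ mi_size b * (\<Lambda> * (C1 * \<delta> ^ (k - mi_size b)))"
    using \<delta> by (intro mult_left_mono) auto
  also have "\<dots> = \<Lambda> * C1 * \<delta> ^ k" unfolding split by (simp only: mult_ac)
  finally have 1: "\<delta> ^ mi_size b * cmod (jet_op P (\<lambda>a y. s a y - ?T a y) b y) \<le> \<Lambda> * C1 * \<delta> ^ k" .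
  have "cmod (jet_op P ?T b y) \<le> \<Lambda> * M * (real CARD('d) * norm (y - x)) ^ (Suc k - mi_size b)"
  proof (rule taylor_vanish[where S = "cball x c"])
    show "smooth_on (cball x c) (jet_op P ?T)" by (intro smooth_on_jet_op smooth_on_subset[OF smooth_on_taylor_jet]) auto
    have "c * \<delta> \<le> c" using c \<delta> by simp
    then show "y \<in> cball x c" unfolding mem_cball using c(2) by linarith
    show "x \<in> cball x c" "convex (cball x c)" using c by auto
    show "mi_size b \<le> Suc k" using b by simp
    fix \<gamma> :: "'d multi_index"
    show "jet_op P ?T \<gamma> x = 0" if \<gamma>: "mi_size \<gamma> \<le> k"
    proof -
      have "jet_op P ?T \<gamma> x = jet_op P f \<gamma> x"
        unfolding jet_op_eq_const_op const_op_def using \<gamma> N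
        by (intro sum.cong refl) (auto simp: taylor_jet_at mi_size_add)
      then show ?thesis using x by simp
    qed
    fix z assume z: "z \<in> cball x c"
    show "cmod (jet_op P ?T \<gamma> z) \<le> \<Lambda> * M"
      unfolding \<Lambda>_def
    proof (rule jet_op_bound)
      fix a :: "'d multi_index"
      have "1 ^ mi_size (\<gamma> + a) * cmod (?T (\<gamma> + a) z) \<le> M"
        unfolding M_def by (rule taylor_jet_bound) (use c z Bf in \<open>auto simp: jet_bound_def dist_norm norm_minus_commute\<close>)
      then show "cmod (?T (\<gamma> + a) z) \<le> M" by simp
    qed
  qed
  also have "\<dots> \<le> \<Lambda> * M * (real CARD('d) * c * \<delta>) ^ (Suc k - mi_size b)"
    using c(2) \<Lambda> M by (intro mult_left_mono power_mono) (auto simp: dist_norm norm_minus_commute mult.assoc)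
  also have "\<dots> \<le> \<Lambda> * M * ((real CARD('d) * c) ^ Suc k * \<delta> ^ (k - mi_size b))"
    unfolding power_mult_distrib[of "real CARD('d) * c" \<delta>]
  proof (intro mult_left_mono mult_mono)
    show "(real CARD('d) * c) ^ (Suc k - mi_size b) \<le> (real CARD('d) * c) ^ Suc k" using dc by (intro power_increasing) auto
    show "\<delta> ^ (Suc k - mi_size b) \<le> \<delta> ^ (k - mi_size b)" using \<delta> by (intro power_decreasing) auto
  qed (use \<Lambda> M \<delta> dc in auto)
  finally have "\<delta> ^ mi_size b * cmod (jet_op P ?T b y) \<le> \<delta> ^ mi_size b * (\<Lambda> * M * ((real CARD('d) * c) ^ Suc k * \<delta> ^ (k - mi_size b)))"
    using \<delta> by (intro mult_left_mono) auto
  also have "\<dots> = \<Lambda> * (M * (real CARD('d) * c) ^ Suc k) * \<delta> ^ k" unfolding split by (simp only: mult_ac)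
  finally have 2: "\<delta> ^ mi_size b * cmod (jet_op P ?T b y) \<le> \<Lambda> * (M * (real CARD('d) * c) ^ Suc k) * \<delta> ^ k" .
  have "cmod (jet_op P s b y) \<le> cmod (jet_op P (\<lambda>a y. s a y - ?T a y) b y) + cmod (jet_op P ?T b y)"
    using norm_triangle_ineq[of "jet_op P s b y - jet_op P ?T b y" "jet_op P ?T b y"] by (simp add: jet_op_diff)
  then have "\<delta> ^ mi_size b * cmod (jet_op P s b y) \<le>
     \<delta> ^ mi_size b * (cmod (jet_op P (\<lambda>a y. s a y - ?T a y) b y) + cmod (jet_op P ?T b y))"
    using \<delta> by (intro mult_left_mono) auto
  also have "\<dots> \<le> \<Lambda> * C1 * \<delta> ^ k + \<Lambda> * (M * (real CARD('d) * c) ^ Suc k) * \<delta> ^ k"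
    unfolding distrib_left using 1 2 by (rule add_mono)
  also have "\<dots> = \<Lambda> * (C1 + M * (real CARD('d) * c) ^ Suc k) * \<delta> ^ k" by (simp only: distrib_left distrib_right)
  finally show ?thesis by (simp only: \<Lambda>_def M_def)
qed


lemma continuous_jets_bounded:
  fixes f :: "'d::finite jet"
  assumes f: "f \<in> continuous_jets F" and K: "compact K" "K \<subseteq> F"
  shows "\<exists>M\<ge>0. \<forall>x\<in>K. \<forall>a. mi_size a \<le> n --> cmod (f a x) \<le> M"
proof -
  have "\<exists>b. \<forall>x\<in>K. cmod (f a x) \<le> b" for a
  proof -
    have "continuous_on K (f a)" using f K(2) by (auto simp: continuous_jets_def intro: continuous_on_subset)
    then have "bounded (f a ` K)" using K(1) by (intro compact_imp_bounded compact_continuous_image)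
    then show ?thesis unfolding bounded_iff by auto
  qed
  then obtain b where b: "\<And>a x. x \<in> K ==> cmod (f a x) \<le> b a" by metis
  define M where "M = (\<Sum>a | mi_size (a :: 'd multi_index) \<le> n. \<bar>b a\<bar>)"
  have "cmod (f a x) \<le> M" if "x \<in> K" "mi_size a \<le> n" for x a
  proof -
    have "\<bar>b a\<bar> \<le> M" unfolding M_def using that by (intro member_le_sum finite_mi_size_le) auto
    then show ?thesis using b[OF that(1), of a] by linarith
  qed
  moreover have "M \<ge> 0" unfolding M_def by (intro sum_nonneg) auto
  ultimately show ?thesis by blast
qed

text \<open>By \<open>runge_pairI\<close> one compact set and finitely many orders are treated at a
  time, so a smoothing of finite order suffices for a jet with infinitely many entries.\<close>

theorem elliptic_runge_pair:
  fixes P :: "'d::finite mpoly"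
  assumes ell: "elliptic P" and F1: "closed F1" and F2: "closed F2" and sub: "F1 \<subseteq> F2"
    and cond: "\<not> (\<exists>C \<in> components (- F1). bounded C \<and> C \<subseteq> F2)"
  shows "runge_pair P F1 F2"
proof (rule runge_pairI[OF sub])
  fix f K n and \<epsilon> :: real assume f: "f \<in> jet_kernel P F1" and K: "compact K" "K \<subseteq> F1" and \<epsilon>: "\<epsilon> > 0"
  have fW: "f \<in> whitney_jets F1" and fC: "f \<in> continuous_jets F1" and fP: "jet_op P f j x = 0" for j x
    using f by (simp_all add: jet_kernel_def whitney_jets_def)
  let ?d = "real CARD('d)"
  have "axis undefined 1 \<noteq> (0 :: real ^ 'd)" by (simp add: axis_eq_0_iff)
  then obtain \<eta> where \<eta>: "principal_part P \<eta> \<noteq> 0" using ell unfolding elliptic_def by blast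
  \<comment> \<open>Derivatives of the source that have to be small: \<open>Suc n\<close> for a
    Whitney bound of order \<open>n\<close> of the correction, and two per variable lost by the
    solution operator.\<close>
  define M1 where "M1 = Suc n + 2 * CARD('d)"
  \<comment> \<open>After division by \<open>\<delta> ^ M1\<close> at least one factor
    \<open>\<delta>\<close> is left, and \<open>N\<close> is at least \<open>2 * n + 1\<close> as
    \<open>smoothing_whitney_bound\<close> demands.\<close>
  define k where "k = M1 + (2 * n + 1)"
  define N where "N = mpoly_degree P + k"
  obtain R0 where R0: "\<forall>x\<in>K. norm x \<le> R0" using compact_imp_bounded[OF K(1)] unfolding bounded_iff by blast
  define R where "R = max R0 0"
  have R: "R \<ge> 0" "K \<subseteq> cball 0 R" using R0 by (auto simp: R_def le_max_iff_disj)
  \<comment> \<open>The source is removed only near this compact part of \<open>F1\<close>. Sources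
    near other points of \<open>F1\<close> have norm at least \<open>R + 4\<close> wherever they
    meet \<open>F1\<close> and can be sent to infinity.\<close>
  define K1 where "K1 = F1 \<inter> cball 0 (R + 5)"
  have K1: "compact K1" "K1 \<subseteq> F1" "K1 \<subseteq> cball 0 (R + 5)" unfolding K1_def using F1 by (auto intro: closed_Int_compact)
  have KK1: "K \<subseteq> K1" using K R by (fastforce simp: K1_def)
  have bK1: "bounded K1" using K1(1) by (rule compact_imp_bounded)
  define b where "b = 2 * R + 1"
  have b: "b \<ge> 1" "\<And>x y. x \<in> K ==> y \<in> K ==> dist x y \<le> b"
  proof -
    fix x y assume "x \<in> K" "y \<in> K"
    then have "norm x \<le> R" "norm y \<le> R" using R(2) by auto
    then show "dist x y \<le> b" using norm_triangle_ineq4[of x y] by (simp add: b_def dist_norm)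
  qed (use R in \<open>simp add: b_def\<close>)
  define c where "c = 1 + 2 * ?d"
  have c: "c \<ge> 1" by (simp add: c_def)
  obtain CS where CS: "CS \<ge> 0" and CS': "\<forall>\<delta>>0. \<forall>K A. \<forall>f :: 'd jet. bounded K --> A \<ge> 0 -->
    taylor_close N K A (2 * (c + ?d) * \<delta>) f -->
    (\<exists>s. smooth_on UNIV s \<and> (\<exists>R. \<forall>a x. R < norm x --> s a x = 0) \<and>
      (\<forall>x\<in>K. \<forall>y a. dist x y \<le> c * \<delta> --> mi_size a \<le> N -->
         \<delta> ^ mi_size a * cmod (s a y - taylor_jet N x f a y) \<le> CS * (A * \<delta> ^ N)))"
    using whitney_smoothing[where 'd = 'd, OF c, of N N] by - (elim exE conjE, rule that)
  have "\<exists>C\<ge>0. \<forall>\<delta>>0. \<forall>K. bounded K --> (\<exists>\<theta> :: 'd jet. smooth_on UNIV \<theta> \<and>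
     (\<forall>x\<in>K. \<forall>y j. dist x y \<le> 1 * \<delta> --> \<theta> j y = (if j = 0 then 1 else 0)) \<and>
     (\<forall>y. y \<notin> neighbourhood K (c * \<delta>) --> (\<forall>j. \<theta> j y = 0)) \<and> jet_bound \<delta> M1 UNIV \<theta> C)"
    unfolding c_def by (rule scaled_cutoff) simp
  then obtain CX where CX: "CX \<ge> 0" and CX': "\<forall>\<delta>>0. \<forall>K. bounded K --> (\<exists>\<theta> :: 'd jet. smooth_on UNIV \<theta> \<and>
     (\<forall>x\<in>K. \<forall>y j. dist x y \<le> 1 * \<delta> --> \<theta> j y = (if j = 0 then 1 else 0)) \<and>
     (\<forall>y. y \<notin> neighbourhood K (c * \<delta>) --> (\<forall>j. \<theta> j y = 0)) \<and> jet_bound \<delta> M1 UNIV \<theta> CX)"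
    by - (elim exE conjE, rule that)
  define R' where "R' = R + 5 + c"
  obtain G :: "'d jet => 'd jet" where
    G1: "\<forall>w R. smooth_on UNIV w --> (\<forall>a x. R < norm x --> w a x = 0) --> smooth_on UNIV (G w) \<and> jet_op P (G w) = w" and
    G2: "\<forall>R. \<exists>C\<ge>0. \<forall>w B j. smooth_on UNIV w --> (\<forall>a x. R < norm x --> w a x = 0) -->
       (\<forall>a x. mi_size a \<le> 2 * CARD('d) --> cmod (w (j + a) x) \<le> B) -->
       (\<forall>x. norm x \<le> R --> cmod (G w j x) \<le> C * B)"
    using constant_coeff_solvable[OF \<eta>] by - (elim exE conjE, rule that)
  obtain CG where CG: "CG \<ge> 0" and CG': "\<forall>w B j. smooth_on UNIV w --> (\<forall>a x. R' < norm x --> w a x = 0) -->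
       (\<forall>a x. mi_size a \<le> 2 * CARD('d) --> cmod (w (j + a) x) \<le> B) -->
       (\<forall>x. norm x \<le> R' --> cmod (G w j x) \<le> CG * B)"
    using G2[rule_format, of R'] by - (elim exE conjE, rule that)
  obtain Bf where Bf: "Bf \<ge> 0" "\<And>x a. x \<in> K1 ==> mi_size a \<le> N ==> cmod (f a x) \<le> Bf"
    using continuous_jets_bounded[OF fC K1(1,2), of N] by blast
  define D where "D = (\<Sum>a | mi_size (a :: 'd multi_index) \<le> mpoly_degree P. cmod (op_coeff P a)) *
     (CS + real (card {\<gamma> :: 'd multi_index. mi_size \<gamma> \<le> N}) * (c ^ N * Bf) * (?d * c) ^ Suc k)"
  have D: "D \<ge> 0" unfolding D_def using CS Bf c by (intro mult_nonneg_nonneg add_nonneg_nonneg sum_nonneg) auto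
  define C3 where "C3 = 2 ^ M1 * (CX * D)"
  have C3: "C3 \<ge> 0" using CX D by (simp add: C3_def)
  define p where "p = real (card {\<gamma> :: 'd multi_index. mi_size \<gamma> \<le> n})"
  \<comment> \<open>\<open>Q1\<close>, \<open>Q2\<close> and \<open>Q3\<close> are the constants of
    \<open>smoothing_whitney_bound\<close>, \<open>smooth_whitney_bound\<close> and
    \<open>whitney_bound_lower\<close>.\<close>
  define Q1 where "Q1 = CS * ?d ^ Suc n + 1 + (1 + p * b ^ n) * CS"
  define Q2 where "Q2 = ?d ^ Suc n + (1 + p * b ^ n)"
  define Q3 where "Q3 = (p + 1) * b ^ n"
  have pb: "p * b ^ n \<ge> 0" "b ^ n > 0" using b by (simp_all add: p_def)
  have Q: "Q1 \<ge> 0" "Q2 > 0" "Q3 > 0"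
    using CS pb by (auto simp: Q1_def Q2_def Q3_def p_def intro!: add_nonneg_nonneg mult_nonneg_nonneg add_nonneg_pos add_pos_nonneg mult_pos_pos)
  \<comment> \<open>Smoothing and correction together contribute at most \<open>\<tau>\<close>,
    moving the sources contributes another \<open>\<tau>\<close>, and the passage to lower orders
    multiplies by \<open>Q3\<close>.\<close>
  define \<tau> where "\<tau> = \<epsilon> / (2 * Q3)"
  have \<tau>: "\<tau> > 0" using \<epsilon> Q by (simp add: \<tau>_def)
  obtain t where t: "t > 0" "\<And>a x y. mi_size a \<le> N ==> x \<in> K1 ==> y \<in> K1 ==> dist x y < t ==>
     cmod (f a y - taylor_jet N x f a y) \<le> 1 * dist x y ^ (N - mi_size a)"
    by (rule whitney_jets_remainder[OF fW K1(1,2), of 1 N]) auto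
  define E where "E = Q1 + Q2 * (CG * C3)"
  have E: "E \<ge> 0" using Q CG C3 by (simp add: E_def)
  define q where "q = 2 * (c + ?d)"
  have q: "q \<ge> 1" using c by (simp add: q_def)
  define \<delta> where "\<delta> = min 1 (min (t / (2 * q)) (\<tau> / (E + 1)))"
  have \<delta>: "\<delta> > 0" "\<delta> \<le> 1" using t(1) q \<tau> E by (simp_all add: \<delta>_def)
  have "\<delta> \<le> t / (2 * q)" "\<delta> \<le> \<tau> / (E + 1)" by (simp_all add: \<delta>_def)
  then have "q * \<delta> \<le> t / 2" and "(E + 1) * \<delta> \<le> \<tau>" using q E by (simp_all add: field_simps)
  then have \<delta>t: "q * \<delta> < t" and \<delta>E: "E * \<delta> \<le> \<tau>" using t(1) \<delta>(1) by (simp_all add: distrib_right)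
  have "1 * \<delta> \<le> q * \<delta>" using q \<delta> by (intro mult_right_mono) auto
  then have \<delta>t': "\<delta> < t" using \<delta>t by simp
  have tc: "taylor_close N K1 1 (2 * (c + ?d) * \<delta>) f"
    unfolding taylor_close_def q_def[symmetric] using t(2) \<delta>t by simp
  obtain s Rs where s: "smooth_on UNIV s" and s_supp: "\<forall>a x. Rs < norm x --> s a x = 0"
    and s_T': "\<forall>x\<in>K1. \<forall>y a. dist x y \<le> c * \<delta> --> mi_size a \<le> N -->
         \<delta> ^ mi_size a * cmod (s a y - taylor_jet N x f a y) \<le> CS * (1 * \<delta> ^ N)"
    using CS'[rule_format, OF \<delta>(1) bK1 zero_le_one tc] by - (elim exE conjE, rule that)
  have s_T: "\<delta> ^ mi_size a * cmod (s a y - taylor_jet N x f a y) \<le> CS * \<delta> ^ N"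
    if "x \<in> K1" "dist x y \<le> c * \<delta>" "mi_size a \<le> N" for x y a using s_T' that by simp
  obtain \<theta> :: "'d jet" where \<theta>: "smooth_on UNIV \<theta>"
    and \<theta>_1: "\<forall>x\<in>K1. \<forall>y j. dist x y \<le> 1 * \<delta> --> \<theta> j y = (if j = 0 then 1 else 0)"
    and \<theta>_0: "\<forall>y. y \<notin> neighbourhood K1 (c * \<delta>) --> (\<forall>j. \<theta> j y = 0)" and \<theta>_b: "jet_bound \<delta> M1 UNIV \<theta> CX"
    using CX'[rule_format, OF \<delta>(1) bK1] by - (elim exE conjE, rule that)
  define \<phi> where "\<phi> = jet_op P s"
  have \<phi>: "smooth_on UNIV \<phi>" unfolding \<phi>_def by (rule smooth_on_jet_op[OF s])
  define \<psi> where "\<psi> = jet_mult \<theta> \<phi>"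
  have \<psi>: "smooth_on UNIV \<psi>" unfolding \<psi>_def by (rule smooth_on_mult[OF \<theta> \<phi>])
  have \<psi>_bound: "cmod (\<psi> a y) \<le> C3 * \<delta>" if a: "mi_size a \<le> M1" for a y
  proof (cases "y \<in> neighbourhood K1 (c * \<delta>)")
    case True
    then obtain x where x: "x \<in> K1" "dist x y \<le> c * \<delta>" by (auto simp: neighbourhood_def)
    have "jet_bound \<delta> M1 {y} \<phi> (D * \<delta> ^ k)"
      unfolding jet_bound_def
    proof (intro ballI allI impI)
      fix z and j :: "'d multi_index" assume z: "z \<in> {y}" and j: "mi_size j \<le> M1"
      have "mi_size j \<le> k" using j by (simp add: k_def)
      from smoothing_source_bound[where s = s, OF fP Bf(2)[OF x(1)] N_def \<delta> c x(2) CS s_T[OF x] this]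
      show "\<delta> ^ mi_size j * cmod (\<phi> j z) \<le> D * \<delta> ^ k" using z by (simp add: \<phi>_def D_def)
    qed
    moreover have "jet_bound \<delta> M1 {y} \<theta> CX" using \<theta>_b by (simp add: jet_bound_def)
    ultimately have jb: "jet_bound \<delta> M1 {y} \<psi> (2 ^ M1 * (CX * (D * \<delta> ^ k)))"
      unfolding \<psi>_def using \<delta>(1) CX by (intro jet_bound_mult) auto
    have "\<delta> ^ mi_size a * cmod (\<psi> a y) \<le> 2 ^ M1 * (CX * (D * \<delta> ^ k))" by (rule jet_boundD[OF jb singletonI a])
    also have "\<dots> = C3 * \<delta> ^ k" by (simp only: C3_def mult_ac)
    finally have "cmod (\<psi> a y) \<le> C3 * \<delta> ^ (k - mi_size a)"
      using a \<delta>(1) by (intro scaled_power_cancel) (simp_all add: k_def)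
    also have "\<dots> \<le> C3 * \<delta> ^ 1" using C3 \<delta> a by (intro mult_left_mono power_decreasing) (simp_all add: k_def)
    finally show ?thesis by simp
  next
    case False
    then have "\<psi> a y = 0" unfolding \<psi>_def using \<theta>_0 by (intro jet_mult_zero_left) simp
    then show ?thesis using C3 \<delta> by simp
  qed
  have \<psi>_supp: "\<psi> a x = 0" if "R' < norm x" for a x
  proof -
    have "c * \<delta> \<le> c" using c \<delta> by simp
    then have "neighbourhood K1 (c * \<delta>) \<subseteq> cball 0 R'"
      using neighbourhood_subset_cball[OF K1(3), of "c * \<delta>"] unfolding R'_def by (meson add_left_mono order_trans subset_cball)
    then have "x \<notin> neighbourhood K1 (c * \<delta>)" using that by auto
    then show ?thesis unfolding \<psi>_def using \<theta>_0 by (intro jet_mult_zero_left) simp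
  qed
  have "smooth_on UNIV (G \<psi>) \<and> jet_op P (G \<psi>) = \<psi>" using G1 \<psi> \<psi>_supp by blast
  then have u: "smooth_on UNIV (G \<psi>)" and Pu: "jet_op P (G \<psi>) = \<psi>" by simp_all
  have uK: "whitney_bound K n (Q2 * (CG * (C3 * \<delta>))) (G \<psi>)"
    unfolding Q2_def p_def
  proof (rule smooth_whitney_bound[OF u zero_less_one order_refl b])
    show "0 \<le> CG * (C3 * \<delta>)" using CG C3 \<delta> by simp
    fix x and a :: "'d multi_index" assume x: "x \<in> neighbourhood K 1" and a: "mi_size a \<le> Suc n"
    have "norm x \<le> R'" using neighbourhood_subset_cball[OF R(2), of 1] x c by (force simp: R'_def)
    moreover have "\<forall>j x. mi_size j \<le> 2 * CARD('d) --> cmod (\<psi> (a + j) x) \<le> C3 * \<delta>"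
      using a by (intro allI impI \<psi>_bound) (simp add: mi_size_add M1_def)
    ultimately have "cmod (G \<psi> a x) \<le> CG * (C3 * \<delta>)" using CG' \<psi> \<psi>_supp by blast
    then show "cmod (G \<psi> a x) \<le> CG * (C3 * \<delta>) * 1 ^ n" by simp
  qed
  have sK: "whitney_bound K n (Q1 * \<delta>) (\<lambda>a x. s a x - f a x)"
    unfolding Q1_def p_def
  proof (rule smoothing_whitney_bound[OF _ \<delta> c s CS _ _ b])
    show "2 * n + 1 \<le> N" by (simp add: N_def k_def)
    show "\<delta> ^ mi_size a * cmod (s a y - taylor_jet N x f a y) \<le> CS * \<delta> ^ N"
      if "x \<in> K" "dist x y \<le> c * \<delta>" "mi_size a \<le> N" for x y a using that KK1 by (intro s_T) auto
    show "cmod (f a y - taylor_jet N x f a y) \<le> dist x y ^ (N - mi_size a)"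
      if "x \<in> K" "y \<in> K" "mi_size a \<le> N" "dist x y \<le> \<delta>" for x y a
      using t(2)[of a x y] that KK1 \<delta>t' by auto
  qed
  define v where "v = (\<lambda>a x. s a x - G \<psi> a x)"
  have v: "smooth_on UNIV v" unfolding v_def by (rule smooth_on_diff[OF s u])
  \<comment> \<open>The source of \<open>v\<close> is \<open>\<phi> - \<psi>\<close>. It vanishes
    within \<open>\<delta>\<close> of \<open>K1\<close>, where the cutoff is 1, and outside the ball
    that contains the support of \<open>s\<close>.\<close>
  define Z where "Z = cball 0 Rs - (\<Union>x\<in>K1. ball x \<delta>)"
  have "compact Z" unfolding Z_def by (intro compact_diff compact_cball open_UN) auto
  have Zfar: "y \<notin> F1 \<or> R + 4 \<le> norm y" if "y \<in> Z" for y
  proof (rule ccontr)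
    assume "\<not> (y \<notin> F1 \<or> R + 4 \<le> norm y)"
    then have "y \<in> K1" by (simp add: K1_def)
    then show False using that \<delta>(1) by (auto simp: Z_def)
  qed
  have "source_in P Z v"
    unfolding source_in_def
  proof (intro conjI allI impI v)
    fix x j assume x: "x \<notin> Z"
    have Pv: "jet_op P v j x = \<phi> j x - \<psi> j x" unfolding v_def jet_op_diff Pu \<phi>_def ..
    show "jet_op P v j x = 0"
    proof (cases "Rs < norm x")
      case True
      then have "\<phi> \<gamma> x = 0" for \<gamma> unfolding \<phi>_def using s_supp by (intro jet_op_zero) simp
      then show ?thesis unfolding Pv \<psi>_def by (simp add: jet_mult_zero_right)
    next
      case False
      then obtain y where y: "y \<in> K1" "dist y x \<le> 1 * \<delta>" using x by (auto simp: Z_def)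
      have "\<psi> j x = \<phi> j x" unfolding \<psi>_def using \<theta>_1 y by (intro jet_mult_one_left) blast
      then show ?thesis unfolding Pv by simp
    qed
  qed
  then obtain s0 where s0: "s0 > 0" "approximable P F2 (neighbourhood K s0) v"
    using approximable_off_F1[OF ell F1 F2 cond K(2) R(2,1) \<open>compact Z\<close> Zfar _ \<eta>] by blast
  define r where "r = min s0 1"
  have r: "0 < r" "r \<le> 1" using s0(1) by (simp_all add: r_def)
  have "approximable P F2 (neighbourhood K r) v"
    using s0(2) by (rule approximable_mono) (simp add: neighbourhood_mono r_def)
  \<comment> \<open>The neighbourhood in which \<open>v\<close> can be approximated may be very
    thin; the precision contains the factor \<open>r ^ n\<close> that
    \<open>smooth_whitney_bound\<close> asks for.\<close>
  moreover have A: "\<tau> / Q2 * r ^ n > 0" using \<tau> Q r by simp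
  ultimately obtain g where g: "smooth_on UNIV g" "\<forall>x\<in>F2. \<forall>j. jet_op P g j x = 0"
    "close_on (Suc n) (neighbourhood K r) (\<tau> / Q2 * r ^ n) v g"
    unfolding approximable_def by blast
  have gK: "whitney_bound K n (Q2 * (\<tau> / Q2)) (\<lambda>a x. v a x - g a x)"
    unfolding Q2_def p_def
  proof (rule smooth_whitney_bound[OF smooth_on_diff[OF v g(1)] r b])
    show "0 \<le> \<tau> / (?d ^ Suc n + (1 + real (card {\<gamma> :: 'd multi_index. mi_size \<gamma> \<le> n}) * b ^ n))"
      using \<tau> Q(2) by (simp add: Q2_def p_def)
    show "cmod (v a x - g a x) \<le> \<tau> / (?d ^ Suc n + (1 + real (card {\<gamma> :: 'd multi_index. mi_size \<gamma> \<le> n}) * b ^ n)) * r ^ n"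
      if "x \<in> neighbourhood K r" "mi_size a \<le> Suc n" for x a
      using g(3) that unfolding close_on_def Q2_def p_def by (simp add: less_imp_le)
  qed
  let ?g = "jet_restrict F2 g"
  \<comment> \<open>The error of \<open>g\<close> is that of the smoothing, minus the correction
    \<open>G \<psi>\<close>, minus the change made by moving the sources of
    \<open>v\<close>.\<close>
  have "whitney_bound K n ((Q1 * \<delta> + Q2 * (CG * (C3 * \<delta>))) + Q2 * (\<tau> / Q2))
      (\<lambda>a x. (s a x - f a x - G \<psi> a x) - (v a x - g a x))"
    by (intro whitney_bound_diff sK uK gK)
  then have "whitney_bound K n ((Q1 * \<delta> + Q2 * (CG * (C3 * \<delta>))) + Q2 * (\<tau> / Q2)) (\<lambda>a x. ?g a x - f a x)"
    by (rule whitney_bound_cong[rotated]) (use K sub in \<open>auto simp: v_def jet_restrict_apply\<close>)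
  moreover have "(Q1 * \<delta> + Q2 * (CG * (C3 * \<delta>))) + Q2 * (\<tau> / Q2) \<le> 2 * \<tau>"
    using \<delta>E Q by (simp add: E_def algebra_simps)
  ultimately have fin: "whitney_bound K n (2 * \<tau>) (\<lambda>a x. ?g a x - f a x)" by (rule whitney_bound_mono)
  have bN: "?g \<in> jet_kernel P F2" using g by (intro smooth_jet_kernel) auto
  have "whitney_bound K n' \<epsilon> (\<lambda>a x. ?g a x - f a x)" if "n' \<le> n" for n'
  proof -
    have "whitney_bound K n' ((p + 1) * b ^ n * (2 * \<tau>)) (\<lambda>a x. ?g a x - f a x)"
      unfolding p_def by (rule whitney_bound_lower[OF fin that b]) (use \<tau> in auto)
    moreover have "(p + 1) * b ^ n * (2 * \<tau>) = \<epsilon>" using Q(3) by (simp add: \<tau>_def Q3_def[symmetric])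
    ultimately show ?thesis by simp
  qed
  then show "\<exists>g\<in>jet_kernel P F2. \<forall>n'\<le>n. whitney_bound K n' \<epsilon> (\<lambda>a x. g a x - f a x)"
    using bN by blast
qed

theorem theoremA:
  fixes F1 F2 :: "(real ^ 'd) set" and P :: "'d mpoly"
  assumes "closed F1" and "closed F2" and "F1 \<subseteq> F2"
    and "\<forall>c. P \<noteq> Poly_Mapping.single 0 c"
  shows "(runge_pair P F1 F2 \<longrightarrow> \<not> (\<exists>C \<in> components (- F1). bounded C \<and> C \<subseteq> F2)) \<and>
         (elliptic P \<longrightarrow> \<not> (\<exists>C \<in> components (- F1). bounded C \<and> C \<subseteq> F2) \<longrightarrow> runge_pair P F1 F2)"
proof (intro conjI impI)
  assume "runge_pair P F1 F2"
  then show "\<not> (\<exists>C \<in> components (- F1). bounded C \<and> C \<subseteq> F2)"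
    by (rule runge_pair_imp_no_bounded_component[OF assms])
next
  assume "elliptic P" "\<not> (\<exists>C \<in> components (- F1). bounded C \<and> C \<subseteq> F2)"
  then show "runge_pair P F1 F2"
    by (intro elliptic_runge_pair assms(1-3))
qed

end
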